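(* Let $n\ge1$ and let $\lambda=(\lambda_1,\dots,\lambda_k)$ be a composition of a positive integer $l$ (all $\lambda_i$ positive integers, $\sum_i\lambda_i=l$). Then there is an isomorphism of $gl_{n+1}(\mathbb C)$-crystals $$[\mathscr C_\lambda]\cong B(\lambda_1\epsilon_1)\otimes\cdots\otimes B(\lambda_k\epsilon_1),$$ where $[\mathscr C_\lambda]$ is the set of isomorphism classes of irreducible finite-dimensional modules over $\mathbb CP_{\lambda_1}\otimes\cdots\otimes\mathbb CP_{\lambda_k}$ with the maps $(wt,\tilde e_{i,\lambda},\tilde f_{i,\lambda},\varepsilon_{i,\lambda},\varphi_{i,\lambda})_{1\le i\le n}$, and $B(\lambda_j\epsilon_1)$ is the crystal basis of the irreducible polynomial $U_q(gl_{n+1})$-module of highest weight $\lambda_j\epsilon_1$.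
   Context: Algebra. Fix $n\ge1$. In the ring $\mathbb Z_2^n$ (componentwise operations) let $u_i$ be the element with $i$-th component $1$ and other components $0$. For $m\ge1$, $P_m$ is the set of $m\times m$ matrices over $\mathbb Z_2^n$ with entries in $\{0,u_1,\dots,u_n\}$ such that (a) each row and each column has at most one nonzero entry; (b) for no $1\le i\le n$ is there a $2\times2$ submatrix $\begin{pmatrix}0 & u_i \\ u_i & 0\end{pmatrix}$. $P_m$ is a semigroup under matrix multiplication; $\mathbb CP_m$ is its semigroup algebra over $\mathbb C$. For $d_1\in P_{m_1},d_2\in P_{m_2}$, $d_1\otimes d_2\in P_{m_1+m_2}$ is the block diagonal matrix with blocks $d_1,d_2$; this extends bilinearly to an embedding $\mathbb CP_{m_1}\otimes\mathbb CP_{m_2}\to\mathbb CP_{m_1+m_2}$. Let $I_i=(u_i)$ ($1\le i\le n$) and $I_0=(0)$ in $P_1$, $e_1=\sum_{i=1}^nI_i-(n-1)I_0$; the identity of $\mathbb CP_m$ is $e_m=e_1^{\otimes m}$. For $d\in P_m$, $size(d)$ is the number of nonzero entries; $d'\subseteq d$ means $d'$ is obtained from $d$ by replacing some nonzero entries by $0$; $x_d=\sum_{d'\subseteq d}(-1)^{size(d)-size(d')}d'$. The $x_d$ form a basis of $\mathbb CP_m$. For $1\le k\le n$, $\beta_k(d)$ is the set of $j$ such that column $j$ of $d$ contains $u_k$, and $\beta_0(d)$ is the set of indices of zero columns; $\beta(d)=(\beta_0(d),\dots,\beta_n(d))$. Let $X_m$ be the set of $(n+1)$-tuples $T=(T_0,\dots,T_n)$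 of pairwise disjoint, possibly empty, sets with union $\{1,\dots,m\}$. For $T\in X_m$, $W^m_T=\mathrm{span}_{\mathbb C}\{x_d: d\in P_m,\ \beta(d)=T\}$, a left $\mathbb CP_m$-module. Modules are left and unital. It is known that $\mathbb CP_m$ is semisimple, the $W^m_T$ are irreducible and exhaust the irreducibles up to isomorphism, and $W^m_T\cong W^m_{T'}$ iff $|T_i|=|T'_i|$ for all $0\le i\le n$. $W^m_{m_0,\dots,m_n}$ denotes $W^m_T$ for the $T$ consisting of consecutive intervals of sizes $m_0,\dots,m_n$ (in this order), where $\sum m_i=m$. Functors. $\mathscr C_m$ is the category of finite-dimensional $\mathbb CP_m$-modules. For $m\ge2$ let $\psi_{i,m}:\mathbb CP_{m-1}\to\mathbb CP_m$ be the (non-unital) algebra embedding $x\mapsto x\otimes(I_i-I_0)$ for $1\le i\le n$, and $x\mapsto x\otimes I_0$ for $i=0$. Then $Res_{i,m}:\mathscr C_m\to\mathscr C_{m-1}$ is $Res_{i,m}(M)=\psi_{i,m}(e_{m-1})M$ with $x\in\mathbb CP_{m-1}$ acting as $\psi_{i,m}(x)$, and $Ind_{i,m}:\mathscr C_{m-1}\to\mathscr C_m$ is $Ind_{i,m}(M)=\mathbb CP_m\otimes_{\mathbb CP_{m-1}}M$, where $\mathbb CP_{m-1}$ acts on $\mathbb CP_m$ on the right through $\psi_{i,m}$. For $1\le i\le n$, $m\ge1$: $\tilde{\mathscr E}_{i,m}=Res_{i,m+1}\circ Ind_{i-1,m+1}$, $\tilde{\mathscr F}_{i,m}=Res_{i-1,m+1}\circ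 Ind_{i,m+1}$. Put $wt([W^m_{m_0,\dots,m_n}])=\sum_{j=0}^nm_j\epsilon_{j+1}$. The crystal $[\mathscr C_\lambda]$. For $\lambda=(\lambda_1,\dots,\lambda_k)$ with positive integer parts, $\mathbb CP_\lambda=\mathbb CP_{\lambda_1}\otimes\cdots\otimes\mathbb CP_{\lambda_k}$, and $[\mathscr C_\lambda]$ is the set of isomorphism classes of irreducible finite-dimensional $\mathbb CP_\lambda$-modules; its elements are $[M]=[W^{\lambda_1}_{\lambda_{10},\dots,\lambda_{1n}}\otimes\cdots\otimes W^{\lambda_k}_{\lambda_{k0},\dots,\lambda_{kn}}]$ with $\lambda_{ij}\in\mathbb N$, $\sum_{j=0}^n\lambda_{ij}=\lambda_i$. For $1\le i\le n$ assign to $[M]$ the sequence of signs which is the concatenation, for $j=1,\dots,k$, of the $j$-th component consisting of $\lambda_{ji}$ signs $-$ followed by $\lambda_{j,i-1}$ signs $+$. Repeatedly delete adjacent pairs $(+,-)$ until a sequence of the form $(-,\dots,-,+,\dots,+)$ remains. If the rightmost remaining $-$ comes from the $s$-th component, $\tilde e_{i,\lambda}([M])$ is the class obtained by applying $\tilde{\mathscr E}_{i,\lambda_s}$ to the $s$-th tensor factor; if the leftmost remaining $+$ comes from the $t$-th component, $\tilde f_{i,\lambda}([M])$ is the class obtained by applying $\tilde{\mathscr F}_{i,\lambda_t}$ to the $t$-th tensor factor; if no $-$ (resp. no $+$) remains, $\tilde e_{i,\lambda}([M])=0$ (resp. $\tilde f_{i,\lambda}([M])=0$). Also $wt([M])=\sum_jwt([W^{\lambda_j}_{\lambda_{j0},\dots,\lambda_{jn}}])$,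 $\varepsilon_{i,\lambda}([M])=\max\{j\ge0:\tilde e_{i,\lambda}^j([M])\ne0\}$, $\varphi_{i,\lambda}([M])=\max\{j\ge0:\tilde f_{i,\lambda}^j([M])\neq0\}$. Crystals. $\mathfrak h$ is the diagonal Cartan subalgebra of $gl_{n+1}(\mathbb C)$, $\epsilon_i(E_{jj})=\delta_{ij}$, $P=\bigoplus_{i=1}^{n+1}\mathbb Z\epsilon_i$. A $gl_{n+1}(\mathbb C)$-crystal is a set $B$ with maps $wt:B\to P$, $\varepsilon_i,\varphi_i:B\to\mathbb Z\cup\{-\infty\}$, $\tilde e_i,\tilde f_i:B\to B\cup\{0\}$ ($1\le i\le n$) such that: (a) $\varphi_i(b)=\varepsilon_i(b)+wt(b)(E_{ii}-E_{i+1,i+1})$; (b) $wt(\tilde e_ib)=wt(b)+\epsilon_i-\epsilon_{i+1}$ if $\tilde e_ib\in B$, and $wt(\tilde f_ib)=wt(b)-\epsilon_i+\epsilon_{i+1}$ if $\tilde f_ib\in B$; (c) for $b_1,b_2\in B$, $\tilde f_ib_2=b_1$ iff $\tilde e_ib_1=b_2$; (d) if $\varepsilon_i(b)=-\infty$ then $\tilde e_ib=\tilde f_ib=0$. An isomorphism of crystals is a bijection commuting with all these maps (with $0\mapsto0$). Tensor product: $B_1\otimes B_2=\{b_1\otimes b_2\}$ with $\tilde e_i(b_1\otimes b_2)=\tilde e_ib_1\otimes b_2$ if $\varphi_i(b_1)\ge\varepsilon_i(b_2)$ and $b_1\otimes\tilde e_ib_2$ otherwise; $\tilde f_i(b_1\otimes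 b_2)=\tilde f_ib_1\otimes b_2$ if $\varphi_i(b_1)>\varepsilon_i(b_2)$ and $b_1\otimes\tilde f_ib_2$ otherwise; $wt(b_1\otimes b_2)=wt(b_1)+wt(b_2)$; $\varepsilon_i(b_1\otimes b_2)=\max\{\varepsilon_i(b_1),\varepsilon_i(b_2)-wt(b_1)(E_{ii}-E_{i+1,i+1})\}$; $\varphi_i(b_1\otimes b_2)=\max\{\varphi_i(b_2),\varphi_i(b_1)+wt(b_2)(E_{ii}-E_{i+1,i+1})\}$ (and $b\otimes0=0\otimes b=0$). $B(\epsilon_1)$ is the set of boxes filled with $j\in\{0,1,\dots,n\}$, with $wt(j)=\epsilon_{j+1}$, $\varepsilon_i(j)=\delta_{i,j}$, $\varphi_i(j)=\delta_{i,j+1}$, $\tilde f_i(i-1)=i$, $\tilde e_i(i)=i-1$, all other values of $\tilde e_i,\tilde f_i$ being $0$. $B(m\epsilon_1)$ is realized on semistandard Young tableaux consisting of one row of $m$ boxes (weakly increasing entries in $\{0,\dots,n\}$), its crystal structure being induced from $B(\epsilon_1)^{\otimes m}$ by sending a tableau to the tensor product of its boxes read from right to left. *)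

theory Defs
  imports
    "Jordan_Normal_Form.VS_Connect"
    "HOL-Library.Function_Algebras"
    "HOL-Library.Set_Algebras"
    "HOL-Library.Extended"
    "HOL-Library.Z2"
begin

section \<open>Free vector spaces, modules and tensor products\<close>

subsection \<open>Free complex vector spaces\<close>

text \<open>Formal linear combinations of elements of a set are finitely supported complex functions;
  sums of functions are pointwise.\<close>

definition fscale :: "complex \<Rightarrow> ('x \<Rightarrow> complex) \<Rightarrow> 'x \<Rightarrow> complex" where
  "fscale c f = (\<lambda>x. c * f x)"

definition delta :: "'x \<Rightarrow> 'x \<Rightarrow> complex" where
  "delta x = (\<lambda>y. if y = x then 1 else 0)"

definition free_space :: "'x set \<Rightarrow> ('x \<Rightarrow> complex) set" where
  "free_space S = {f. finite {x. f x \<noteq> 0} \<and> {x. f x \<noteq> 0} \<subseteq> S}"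

abbreviation fspan :: "('x \<Rightarrow> complex) set \<Rightarrow> ('x \<Rightarrow> complex) set" where
  "fspan \<equiv> Modules.module.span fscale"

definition lin_ext :: "('x \<Rightarrow> 'y) \<Rightarrow> ('x \<Rightarrow> complex) \<Rightarrow> 'y \<Rightarrow> complex" where
  "lin_ext F f = (\<Sum>x | f x \<noteq> 0. fscale (f x) (delta (F x)))"

definition bilin_ext ::
  "('x \<Rightarrow> 'y \<Rightarrow> 'z) \<Rightarrow> ('x \<Rightarrow> complex) \<Rightarrow> ('y \<Rightarrow> complex) \<Rightarrow> 'z \<Rightarrow> complex" where
  "bilin_ext F f g =
    (\<Sum>x | f x \<noteq> 0. \<Sum>y | g y \<noteq> 0. fscale (f x * g y) (delta (F x y)))"

subsection \<open>Modules over a complex algebra\<close>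

text \<open>A complex algebra is a record of type \<^typ>\<open>(complex, 'a) module\<close>, all of whose
  fields are used. For modules over an algebra the ring fields \<open>mult\<close> and \<open>one\<close>
  carry no meaning.\<close>

record ('a, 'v) alg_module = "(complex, 'v) module" +
  act :: "'a \<Rightarrow> 'v \<Rightarrow> 'v"

locale left_module = vectorspace "class_ring :: complex ring" M
  for A :: "(complex, 'a) module" and M :: "('a, 'v) alg_module" +
  assumes act_closed: "a \<in> carrier A \<Longrightarrow> v \<in> carrier M \<Longrightarrow> act M a v \<in> carrier M"
    and act_add_left: "a \<in> carrier A \<Longrightarrow> b \<in> carrier A \<Longrightarrow> v \<in> carrier M \<Longrightarrow>
      act M (a \<oplus>\<^bsub>A\<^esub> b) v = act M a v \<oplus>\<^bsub>M\<^esub> act M b v"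
    and act_add_right: "a \<in> carrier A \<Longrightarrow> v \<in> carrier M \<Longrightarrow> w \<in> carrier M \<Longrightarrow>
      act M a (v \<oplus>\<^bsub>M\<^esub> w) = act M a v \<oplus>\<^bsub>M\<^esub> act M a w"
    and act_smult_left: "a \<in> carrier A \<Longrightarrow> v \<in> carrier M \<Longrightarrow>
      act M (c \<odot>\<^bsub>A\<^esub> a) v = c \<odot>\<^bsub>M\<^esub> act M a v"
    and act_smult_right: "a \<in> carrier A \<Longrightarrow> v \<in> carrier M \<Longrightarrow>
      act M a (c \<odot>\<^bsub>M\<^esub> v) = c \<odot>\<^bsub>M\<^esub> act M a v"
    and act_mult: "a \<in> carrier A \<Longrightarrow> b \<in> carrier A \<Longrightarrow> v \<in> carrier M \<Longrightarrow>
      act M (a \<otimes>\<^bsub>A\<^esub> b) v = act M a (act M b v)"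
    and act_one: "v \<in> carrier M \<Longrightarrow> act M \<one>\<^bsub>A\<^esub> v = v"

definition fin_dim_module :: "(complex, 'a) module \<Rightarrow> ('a, 'v) alg_module \<Rightarrow> bool" where
  "fin_dim_module A M \<longleftrightarrow>
    left_module A M \<and> vectorspace.fin_dim (class_ring :: complex ring) M"

definition irreducible_module :: "(complex, 'a) module \<Rightarrow> ('a, 'v) alg_module \<Rightarrow> bool" where
  "irreducible_module A M \<longleftrightarrow> left_module A M \<and> carrier M \<noteq> {\<zero>\<^bsub>M\<^esub>} \<and>
    (\<forall>N. VectorSpace.subspace (class_ring :: complex ring) N M \<and>
         (\<forall>a\<in>carrier A. \<forall>v\<in>N. act M a v \<in> N) \<longrightarrow> N = {\<zero>\<^bsub>M\<^esub>} \<or> N = carrier M)"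

definition module_isomorphic ::
  "(complex, 'a) module \<Rightarrow> ('a, 'v) alg_module \<Rightarrow> ('a, 'w) alg_module \<Rightarrow> bool" where
  "module_isomorphic A M N \<longleftrightarrow> (\<exists>h. bij_betw h (carrier M) (carrier N) \<and>
    (\<forall>v\<in>carrier M. \<forall>w\<in>carrier M. h (v \<oplus>\<^bsub>M\<^esub> w) = h v \<oplus>\<^bsub>N\<^esub> h w) \<and>
    (\<forall>c. \<forall>v\<in>carrier M. h (c \<odot>\<^bsub>M\<^esub> v) = c \<odot>\<^bsub>N\<^esub> h v) \<and>
    (\<forall>a\<in>carrier A. \<forall>v\<in>carrier M. h (act M a v) = act N a (h v)))"

text \<open>Isomorphism classes are formed inside the modules whose carrier is an arbitrary set of
  functions \<^typ>\<open>nat \<Rightarrow> complex\<close>. Every finite-dimensional module has an isomorphic copy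
  there, since the type contains a copy of \<open>\<complex>\<^sup>d\<close> for each \<open>d\<close>.\<close>

definition iso_class ::
  "(complex, 'a) module \<Rightarrow> ('a, 'v) alg_module \<Rightarrow> ('a, nat \<Rightarrow> complex) alg_module set" where
  "iso_class A M = {N. left_module A N \<and> module_isomorphic A M N}"

definition std_copy ::
  "(complex, 'a) module \<Rightarrow> ('a, 'v) alg_module \<Rightarrow> ('a, nat \<Rightarrow> complex) alg_module" where
  "std_copy A M = (SOME N. N \<in> iso_class A M)"

definition irr_classes ::
  "(complex, 'a) module \<Rightarrow> ('a, nat \<Rightarrow> complex) alg_module set set" where
  "irr_classes A = {iso_class A M | M :: ('a, nat \<Rightarrow> complex) alg_module.
     fin_dim_module A M \<and> irreducible_module A M}"

subsection \<open>Quotients and tensor products\<close>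

text \<open>In a quotient by a subspace \<open>R\<close> the elements are the cosets \<open>f +o R\<close>; the sum of
  two cosets is their elementwise sum.\<close>

definition quotient_space ::
  "('x \<Rightarrow> complex) set \<Rightarrow> ('x \<Rightarrow> complex) set \<Rightarrow> (complex, ('x \<Rightarrow> complex) set) module" where
  "quotient_space V R = \<lparr>carrier = (\<lambda>f. f +o R) ` V, mult = undefined, one = undefined,
     zero = R, add = (+), smult = (\<lambda>c X. fscale c ` X + R)\<rparr>"

definition multilinear_rels :: "(complex, 'v, 'm) module_scheme list \<Rightarrow> ('v list \<Rightarrow> complex) set" where
  "multilinear_rels Vs = fspan
    ({delta (vs[j := v \<oplus>\<^bsub>Vs ! j\<^esub> w]) - delta (vs[j := v]) - delta (vs[j := w]) | vs j v w.
        vs \<in> listset (map carrier Vs) \<and> j < length Vs \<and>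
        v \<in> carrier (Vs ! j) \<and> w \<in> carrier (Vs ! j)} \<union>
     {delta (vs[j := c \<odot>\<^bsub>Vs ! j\<^esub> v]) - fscale c (delta (vs[j := v])) | vs j c v.
        vs \<in> listset (map carrier Vs) \<and> j < length Vs \<and> v \<in> carrier (Vs ! j)})"

text \<open>The pure tensor \<open>v\<^sub>1 \<otimes> \<dots> \<otimes> v\<^sub>k\<close> is the coset of \<open>delta [v\<^sub>1, \<dots>, v\<^sub>k]\<close>.\<close>

definition tensor_space ::
  "(complex, 'v, 'm) module_scheme list \<Rightarrow> (complex, ('v list \<Rightarrow> complex) set) module" where
  "tensor_space Vs =
     quotient_space (free_space (listset (map carrier Vs))) (multilinear_rels Vs)"

text \<open>On cosets, bilinear maps are given by the union over all representatives of the cosets of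
  the values, which all agree when the map is well defined.\<close>

definition tensor_algebra ::
  "(complex, 'a) module list \<Rightarrow> (complex, ('a list \<Rightarrow> complex) set) module" where
  "tensor_algebra As = (tensor_space As)
     \<lparr>mult := (\<lambda>X Y. \<Union>f\<in>X. \<Union>g\<in>Y.
        bilin_ext (\<lambda>as bs. map (\<lambda>j. as ! j \<otimes>\<^bsub>As ! j\<^esub> bs ! j) [0..<length As]) f g
          +o multilinear_rels As),
      one := delta (map one As) +o multilinear_rels As\<rparr>"

definition outer_tensor ::
  "('a, 'v) alg_module list \<Rightarrow>
   (('a list \<Rightarrow> complex) set, ('v list \<Rightarrow> complex) set) alg_module" where
  "outer_tensor Ms = module.extend (tensor_space Ms) (alg_module.fields
     (\<lambda>X Y. \<Union>f\<in>X. \<Union>g\<in>Y.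
        bilin_ext (\<lambda>as vs. map (\<lambda>j. act (Ms ! j) (as ! j) (vs ! j)) [0..<length Ms]) f g
          +o multilinear_rels Ms))"

text \<open>Induction \<open>A \<otimes>\<^sub>B M\<close> and restriction \<open>\<psi>(1) M\<close> along a
  (not necessarily unital) homomorphism \<open>\<psi>\<close> from \<open>B\<close> to \<open>A\<close>.\<close>

definition balanced_rels ::
  "(complex, 'a) module \<Rightarrow> (complex, 'b) module \<Rightarrow> ('b \<Rightarrow> 'a) \<Rightarrow> ('b, 'v) alg_module \<Rightarrow>
   ('a \<times> 'v \<Rightarrow> complex) set" where
  "balanced_rels A B \<psi> M = fspan
    ({delta (a \<oplus>\<^bsub>A\<^esub> a', v) - delta (a, v) - delta (a', v) | a a' v.
        a \<in> carrier A \<and> a' \<in> carrier A \<and> v \<in> carrier M} \<union>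
     {delta (a, v \<oplus>\<^bsub>M\<^esub> v') - delta (a, v) - delta (a, v') | a v v'.
        a \<in> carrier A \<and> v \<in> carrier M \<and> v' \<in> carrier M} \<union>
     {delta (c \<odot>\<^bsub>A\<^esub> a, v) - fscale c (delta (a, v)) | c a v.
        a \<in> carrier A \<and> v \<in> carrier M} \<union>
     {delta (a, c \<odot>\<^bsub>M\<^esub> v) - fscale c (delta (a, v)) | c a v.
        a \<in> carrier A \<and> v \<in> carrier M} \<union>
     {delta (a \<otimes>\<^bsub>A\<^esub> \<psi> b, v) - delta (a, act M b v) | a b v.
        a \<in> carrier A \<and> b \<in> carrier B \<and> v \<in> carrier M})"

definition induced_module ::
  "(complex, 'a) module \<Rightarrow> (complex, 'b) module \<Rightarrow> ('b \<Rightarrow> 'a) \<Rightarrow> ('b, 'v) alg_module \<Rightarrow>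
   ('a, ('a \<times> 'v \<Rightarrow> complex) set) alg_module" where
  "induced_module A B \<psi> M = module.extend
     (quotient_space (free_space (carrier A \<times> carrier M)) (balanced_rels A B \<psi> M))
     (alg_module.fields
       (\<lambda>a X. lin_ext (\<lambda>(b, v). (a \<otimes>\<^bsub>A\<^esub> b, v)) ` X + balanced_rels A B \<psi> M))"

definition restricted_module ::
  "(complex, 'b) module \<Rightarrow> ('b \<Rightarrow> 'a) \<Rightarrow> ('a, 'v) alg_module \<Rightarrow> ('b, 'v) alg_module" where
  "restricted_module B \<psi> M = \<lparr>carrier = act M (\<psi> \<one>\<^bsub>B\<^esub>) ` carrier M,
     mult = undefined, one = undefined, zero = zero M, add = add M, smult = smult M,
     act = (\<lambda>b. act M (\<psi> b))\<rparr>"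

section \<open>The algebras \<open>\<complex>P\<^sub>m\<close>\<close>

text \<open>Elements of \<open>\<int>\<^sub>2\<^sup>n\<close> are functions \<open>nat \<Rightarrow> bit\<close> vanishing outside \<open>{1..n}\<close>, with pointwise
  operations. Rows and columns of matrices are numbered from 0.\<close>

type_synonym pmat = "(nat \<Rightarrow> bit) mat"
type_synonym pvec = "pmat \<Rightarrow> complex"

definition uel :: "nat \<Rightarrow> nat \<Rightarrow> bit" where
  "uel i = (\<lambda>j. if j = i then 1 else 0)"

definition Pset :: "nat \<Rightarrow> nat \<Rightarrow> pmat set" where
  "Pset n m = {d \<in> carrier_mat m m.
     (\<forall>r<m. \<forall>c<m. d $$ (r, c) \<in> insert 0 (uel ` {1..n})) \<and>
     (\<forall>r<m. \<forall>c<m. \<forall>c'<m. d $$ (r, c) \<noteq> 0 \<and> d $$ (r, c') \<noteq> 0 \<longrightarrow> c = c') \<and>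
     (\<forall>c<m. \<forall>r<m. \<forall>r'<m. d $$ (r, c) \<noteq> 0 \<and> d $$ (r', c) \<noteq> 0 \<longrightarrow> r = r') \<and>
     \<not> (\<exists>i\<in>{1..n}. \<exists>r r' c c'. r < r' \<and> r' < m \<and> c < c' \<and> c' < m \<and>
          d $$ (r, c) = 0 \<and> d $$ (r, c') = uel i \<and>
          d $$ (r', c) = uel i \<and> d $$ (r', c') = 0)}"

definition block_diag :: "pmat \<Rightarrow> pmat \<Rightarrow> pmat" where
  "block_diag d1 d2 =
     four_block_mat d1 (0\<^sub>m (dim_row d1) (dim_col d2)) (0\<^sub>m (dim_row d2) (dim_col d1)) d2"

abbreviation ptensor :: "pvec \<Rightarrow> pvec \<Rightarrow> pvec" where
  "ptensor \<equiv> bilin_ext block_diag"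

definition Iel :: "nat \<Rightarrow> pvec" where
  "Iel i = delta (mat 1 1 (\<lambda>_. if i = 0 then 0 else uel i))"

definition e1 :: "nat \<Rightarrow> pvec" where
  "e1 n = (\<Sum>i\<in>{1..n}. Iel i) - fscale (of_nat n - 1) (Iel 0)"

text \<open>The \<open>m\<close>-th tensor power of \<open>e1\<close>, for \<open>m \<ge> 1\<close>.\<close>

definition eCP :: "nat \<Rightarrow> nat \<Rightarrow> pvec" where
  "eCP n m = ((\<lambda>x. ptensor x (e1 n)) ^^ (m - 1)) (e1 n)"

definition CP :: "nat \<Rightarrow> nat \<Rightarrow> (complex, pvec) module" where
  "CP n m = \<lparr>carrier = free_space (Pset n m), mult = bilin_ext (*), one = eCP n m,
     zero = 0, add = (+), smult = fscale\<rparr>"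

definition msize :: "pmat \<Rightarrow> nat" where
  "msize d = card {(r, c). r < dim_row d \<and> c < dim_col d \<and> d $$ (r, c) \<noteq> 0}"

definition sub_mat :: "pmat \<Rightarrow> pmat \<Rightarrow> bool" where
  "sub_mat d' d \<longleftrightarrow> dim_row d' = dim_row d \<and> dim_col d' = dim_col d \<and>
     (\<forall>r<dim_row d. \<forall>c<dim_col d. d' $$ (r, c) = 0 \<or> d' $$ (r, c) = d $$ (r, c))"

definition xvec :: "pmat \<Rightarrow> pvec" where
  "xvec d = (\<Sum>d' | sub_mat d' d. fscale ((- 1) ^ (msize d - msize d')) (delta d'))"

definition beta :: "nat \<Rightarrow> pmat \<Rightarrow> nat set list" where
  "beta n d = map (\<lambda>k. {c. c < dim_col d \<and>
     (if k = 0 then \<forall>r<dim_row d. d $$ (r, c) = 0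
      else \<exists>r<dim_row d. d $$ (r, c) = uel k)}) [0..<n + 1]"

definition WT :: "nat \<Rightarrow> nat \<Rightarrow> nat set list \<Rightarrow> (pvec, pvec) alg_module" where
  "WT n m T = \<lparr>carrier = fspan {xvec d | d. d \<in> Pset n m \<and> beta n d = T},
     mult = undefined, one = undefined, zero = 0, add = (+), smult = fscale,
     act = bilin_ext (*)\<rparr>"

definition intervals :: "nat list \<Rightarrow> nat set list" where
  "intervals ms = map (\<lambda>k. {sum_list (take k ms)..<sum_list (take (Suc k) ms)}) [0..<length ms]"

definition Wmod :: "nat \<Rightarrow> nat list \<Rightarrow> (pvec, pvec) alg_module" where
  "Wmod n ms = WT n (sum_list ms) (intervals ms)"

subsection \<open>The functors\<close>

definition psi :: "nat \<Rightarrow> pvec \<Rightarrow> pvec" where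
  "psi i x = ptensor x (if i = 0 then Iel 0 else Iel i - Iel 0)"

definition Res :: "nat \<Rightarrow> nat \<Rightarrow> nat \<Rightarrow> (pvec, 'v) alg_module \<Rightarrow> (pvec, 'v) alg_module" where
  "Res n i m = restricted_module (CP n (m - 1)) (psi i)"

definition Ind :: "nat \<Rightarrow> nat \<Rightarrow> nat \<Rightarrow> (pvec, 'v) alg_module \<Rightarrow>
    (pvec, (pvec \<times> 'v \<Rightarrow> complex) set) alg_module" where
  "Ind n i m = induced_module (CP n m) (CP n (m - 1)) (psi i)"

definition Efun :: "nat \<Rightarrow> nat \<Rightarrow> nat \<Rightarrow> (pvec, 'v) alg_module \<Rightarrow>
    (pvec, (pvec \<times> 'v \<Rightarrow> complex) set) alg_module" where
  "Efun n i m = Res n i (m + 1) \<circ> Ind n (i - 1) (m + 1)"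

definition Ffun :: "nat \<Rightarrow> nat \<Rightarrow> nat \<Rightarrow> (pvec, 'v) alg_module \<Rightarrow>
    (pvec, (pvec \<times> 'v \<Rightarrow> complex) set) alg_module" where
  "Ffun n i m = Res n (i - 1) (m + 1) \<circ> Ind n i (m + 1)"

section \<open>Crystals\<close>

text \<open>A weight \<open>\<mu>\<close> in the lattice spanned by \<open>\<epsilon>\<^sub>1, \<dots>, \<epsilon>\<^sub>n\<^sub>+\<^sub>1\<close> is given by its values
  \<open>\<mu> j\<close> on the diagonal matrix units \<open>E\<^sub>j\<^sub>j\<close>. The additional element 0 of a crystal is
  \<^const>\<open>None\<close>.\<close>

type_synonym weight = "nat \<Rightarrow> int"

definition weight_lattice :: "nat \<Rightarrow> weight set" where
  "weight_lattice n = {\<mu>. \<forall>j. j \<notin> {1..n + 1} \<longrightarrow> \<mu> j = 0}"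

definition epsilon :: "nat \<Rightarrow> weight" where
  "epsilon i = (\<lambda>j. if j = i then 1 else 0)"

definition coroot_val :: "nat \<Rightarrow> weight \<Rightarrow> int" where
  "coroot_val i \<mu> = \<mu> i - \<mu> (i + 1)"

record 'b crystal =
  elts :: "'b set"
  wt :: "'b \<Rightarrow> weight"
  eps :: "nat \<Rightarrow> 'b \<Rightarrow> int extended"
  phi :: "nat \<Rightarrow> 'b \<Rightarrow> int extended"
  ecr :: "nat \<Rightarrow> 'b \<Rightarrow> 'b option"
  fcr :: "nat \<Rightarrow> 'b \<Rightarrow> 'b option"

locale gl_crystal =
  fixes n :: nat and B :: "'b crystal"
  assumes wt_lattice: "b \<in> elts B \<Longrightarrow> wt B b \<in> weight_lattice n"
    and eps_range: "i \<in> {1..n} \<Longrightarrow> b \<in> elts B \<Longrightarrow> eps B i b \<noteq> Pinf"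
    and phi_range: "i \<in> {1..n} \<Longrightarrow> b \<in> elts B \<Longrightarrow> phi B i b \<noteq> Pinf"
    and e_range: "i \<in> {1..n} \<Longrightarrow> b \<in> elts B \<Longrightarrow> set_option (ecr B i b) \<subseteq> elts B"
    and f_range: "i \<in> {1..n} \<Longrightarrow> b \<in> elts B \<Longrightarrow> set_option (fcr B i b) \<subseteq> elts B"
    and phi_eq: "i \<in> {1..n} \<Longrightarrow> b \<in> elts B \<Longrightarrow>
      phi B i b = eps B i b + Fin (coroot_val i (wt B b))"
    and wt_e: "i \<in> {1..n} \<Longrightarrow> b \<in> elts B \<Longrightarrow> ecr B i b = Some b' \<Longrightarrow>
      wt B b' = wt B b + epsilon i - epsilon (i + 1)"
    and wt_f: "i \<in> {1..n} \<Longrightarrow> b \<in> elts B \<Longrightarrow> fcr B i b = Some b' \<Longrightarrow>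
      wt B b' = wt B b - epsilon i + epsilon (i + 1)"
    and f_iff_e: "i \<in> {1..n} \<Longrightarrow> b1 \<in> elts B \<Longrightarrow> b2 \<in> elts B \<Longrightarrow>
      fcr B i b2 = Some b1 \<longleftrightarrow> ecr B i b1 = Some b2"
    and eps_Minf: "i \<in> {1..n} \<Longrightarrow> b \<in> elts B \<Longrightarrow> eps B i b = Minf \<Longrightarrow>
      ecr B i b = None \<and> fcr B i b = None"

definition crystal_iso :: "nat \<Rightarrow> 'b crystal \<Rightarrow> 'c crystal \<Rightarrow> ('b \<Rightarrow> 'c) \<Rightarrow> bool" where
  "crystal_iso n B C h \<longleftrightarrow> bij_betw h (elts B) (elts C) \<and>
    (\<forall>b\<in>elts B. wt C (h b) = wt B b \<and>
      (\<forall>i\<in>{1..n}. eps C i (h b) = eps B i b \<and> phi C i (h b) = phi B i b \<and>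
         ecr C i (h b) = map_option h (ecr B i b) \<and>
         fcr C i (h b) = map_option h (fcr B i b)))"

definition crystal_isomorphic :: "nat \<Rightarrow> 'b crystal \<Rightarrow> 'c crystal \<Rightarrow> bool" where
  "crystal_isomorphic n B C \<longleftrightarrow>
     gl_crystal n B \<and> gl_crystal n C \<and> (\<exists>h. crystal_iso n B C h)"

definition crystal_tensor :: "'b crystal \<Rightarrow> 'c crystal \<Rightarrow> ('b \<times> 'c) crystal" where
  "crystal_tensor B C = \<lparr>elts = elts B \<times> elts C,
     wt = (\<lambda>(b, c). wt B b + wt C c),
     eps = (\<lambda>i (b, c). max (eps B i b) (eps C i c - Fin (coroot_val i (wt B b)))),
     phi = (\<lambda>i (b, c). max (phi C i c) (phi B i b + Fin (coroot_val i (wt C c)))),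
     ecr = (\<lambda>i (b, c). if phi B i b \<ge> eps C i c then map_option (\<lambda>b'. (b', c)) (ecr B i b)
                       else map_option (\<lambda>c'. (b, c')) (ecr C i c)),
     fcr = (\<lambda>i (b, c). if phi B i b > eps C i c then map_option (\<lambda>b'. (b', c)) (fcr B i b)
                       else map_option (\<lambda>c'. (b, c')) (fcr C i c))\<rparr>"

text \<open>The structure induced on a set \<open>S\<close> by an injective map \<open>g\<close> from \<open>S\<close> into a crystal.\<close>

definition induced_crystal :: "'s set \<Rightarrow> ('s \<Rightarrow> 'b) \<Rightarrow> 'b crystal \<Rightarrow> 's crystal" where
  "induced_crystal S g B = \<lparr>elts = S, wt = wt B \<circ> g,
     eps = (\<lambda>i. eps B i \<circ> g), phi = (\<lambda>i. phi B i \<circ> g),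
     ecr = (\<lambda>i s. map_option (the_inv_into S g) (ecr B i (g s))),
     fcr = (\<lambda>i s. map_option (the_inv_into S g) (fcr B i (g s)))\<rparr>"

text \<open>Iterated tensor products \<open>B\<^sub>1 \<otimes> (B\<^sub>2 \<otimes> \<dots>)\<close> of at least one factor, with
  \<open>b\<^sub>1 \<otimes> \<dots> \<otimes> b\<^sub>k\<close> written as the list \<open>[b\<^sub>1, \<dots>, b\<^sub>k]\<close>. The tensor product of
  crystals is associative.\<close>

fun crystal_tensor_list :: "'b crystal list \<Rightarrow> 'b list crystal" where
  "crystal_tensor_list [] = undefined"
| "crystal_tensor_list [B] = induced_crystal {[b] | b. b \<in> elts B} hd B"
| "crystal_tensor_list (B # C # Bs) =
     induced_crystal {b # bs | b bs. b \<in> elts B \<and> bs \<in> elts (crystal_tensor_list (C # Bs))}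
       (\<lambda>bs. (hd bs, tl bs)) (crystal_tensor B (crystal_tensor_list (C # Bs)))"

definition box_crystal :: "nat \<Rightarrow> nat crystal" where
  "box_crystal n = \<lparr>elts = {0..n}, wt = (\<lambda>j. epsilon (j + 1)),
     eps = (\<lambda>i j. Fin (if i = j then 1 else 0)),
     phi = (\<lambda>i j. Fin (if i = j + 1 then 1 else 0)),
     ecr = (\<lambda>i j. if j = i then Some (i - 1) else None),
     fcr = (\<lambda>i j. if j = i - 1 then Some i else None)\<rparr>"

text \<open>\<open>B(m\<epsilon>\<^sub>1)\<close>, on one-row semistandard tableaux, read from right to left.\<close>

definition row_crystal :: "nat \<Rightarrow> nat \<Rightarrow> nat list crystal" where
  "row_crystal n m = induced_crystal {t. length t = m \<and> sorted t \<and> set t \<subseteq> {0..n}} rev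
     (crystal_tensor_list (replicate m (box_crystal n)))"

section \<open>The crystal on isomorphism classes of irreducible modules\<close>

text \<open>Indices into compositions are numbered from 0.\<close>

definition CP_comp :: "nat \<Rightarrow> nat list \<Rightarrow> (complex, (pvec list \<Rightarrow> complex) set) module" where
  "CP_comp n lam = tensor_algebra (map (CP n) lam)"

type_synonym mod_class =
  "((pvec list \<Rightarrow> complex) set, nat \<Rightarrow> complex) alg_module set"

text \<open>The array \<open>(\<lambda>\<^sub>j\<^sub>i)\<close> with \<open>[M] = [W\<^sub>1 \<otimes> \<dots> \<otimes> W\<^sub>k]\<close>,
  where \<open>W\<^sub>j\<close> is the module with parameters \<open>\<lambda>\<^sub>j\<^sub>0, \<dots>, \<lambda>\<^sub>j\<^sub>n\<close>.\<close>

definition params :: "nat \<Rightarrow> nat list \<Rightarrow> mod_class \<Rightarrow> nat list list" where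
  "params n lam X = (THE L. length L = length lam \<and>
     (\<forall>j<length lam. length (L ! j) = n + 1 \<and> sum_list (L ! j) = lam ! j) \<and>
     X = iso_class (CP_comp n lam) (outer_tensor (map (Wmod n) L)))"

datatype sign = Minus | Plus

definition sign_seq :: "nat \<Rightarrow> nat list list \<Rightarrow> (sign \<times> nat) list" where
  "sign_seq i L = concat (map (\<lambda>j. replicate (L ! j ! i) (Minus, j) @
     replicate (L ! j ! (i - 1)) (Plus, j)) [0..<length L])"

inductive delete_pair :: "(sign \<times> nat) list \<Rightarrow> (sign \<times> nat) list \<Rightarrow> bool" where
  "delete_pair (xs @ [(Plus, a), (Minus, b)] @ ys) (xs @ ys)"

definition reduced_seq :: "(sign \<times> nat) list \<Rightarrow> (sign \<times> nat) list" where
  "reduced_seq s = (THE r. delete_pair\<^sup>*\<^sup>* s r \<and>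
     (\<exists>xs ys. r = xs @ ys \<and> (\<forall>x\<in>set xs. fst x = Minus) \<and> (\<forall>y\<in>set ys. fst y = Plus)))"

text \<open>The class obtained from \<open>[W\<^sub>1 \<otimes> \<dots> \<otimes> W\<^sub>k]\<close> by replacing the factor \<open>s\<close> by \<open>N\<close>. The
  factors are first replaced by isomorphic copies whose vectors have a common type.\<close>

definition replace_factor ::
  "nat \<Rightarrow> nat list \<Rightarrow> nat list list \<Rightarrow> nat \<Rightarrow> (pvec, 'v) alg_module \<Rightarrow> mod_class" where
  "replace_factor n lam L s N = iso_class (CP_comp n lam) (outer_tensor
     ((map2 (\<lambda>m ms. std_copy (CP n m) (Wmod n ms)) lam L)[s := std_copy (CP n (lam ! s)) N]))"

definition e_class :: "nat \<Rightarrow> nat list \<Rightarrow> nat \<Rightarrow> mod_class \<Rightarrow> mod_class option" where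
  "e_class n lam i X =
    (let L = params n lam X;
         ms = filter (\<lambda>x. fst x = Minus) (reduced_seq (sign_seq i L))
     in if ms = [] then None
        else let s = snd (last ms)
             in Some (replace_factor n lam L s (Efun n i (lam ! s) (Wmod n (L ! s)))))"

definition f_class :: "nat \<Rightarrow> nat list \<Rightarrow> nat \<Rightarrow> mod_class \<Rightarrow> mod_class option" where
  "f_class n lam i X =
    (let L = params n lam X;
         ps = filter (\<lambda>x. fst x = Plus) (reduced_seq (sign_seq i L))
     in if ps = [] then None
        else let t = snd (hd ps)
             in Some (replace_factor n lam L t (Ffun n i (lam ! t) (Wmod n (L ! t)))))"

definition max_iter :: "('b \<Rightarrow> 'b option) \<Rightarrow> 'b \<Rightarrow> int extended" where
  "max_iter h b = Fin (int (Max {j. ((\<lambda>x. Option.bind x h) ^^ j) (Some b) \<noteq> None}))"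

definition class_crystal :: "nat \<Rightarrow> nat list \<Rightarrow> mod_class crystal" where
  "class_crystal n lam = \<lparr>elts = irr_classes (CP_comp n lam),
     wt = (\<lambda>X. \<Sum>j<length lam. \<Sum>i\<le>n. (\<lambda>p. int (params n lam X ! j ! i) * epsilon (i + 1) p)),
     eps = (\<lambda>i. max_iter (e_class n lam i)),
     phi = (\<lambda>i. max_iter (f_class n lam i)),
     ecr = e_class n lam,
     fcr = f_class n lam\<rparr>"

end

theory Submission
  imports Defs
begin

text \<open>A matrix \<open>d \<in> P\<^sub>m\<close> acts as a partial map on \<open>X\<^sub>m\<close> by moving the colour \<open>k\<close> of column \<open>c\<close> to row \<open>r\<close>
  whenever its entry at \<open>(r, c)\<close> is \<open>u\<^sub>k\<close>. In the resulting matrix representation of \<open>\<complex>P\<^sub>m\<close> the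
  elements \<open>x\<^sub>d\<close> become matrix units, and since condition (b) forbids crossings within a colour, there
  is exactly one \<open>d\<close> for each pair of tuples with equal colour multiplicities. So \<open>\<complex>P\<^sub>m\<close> is a product
  of full matrix algebras, one for each \<open>(m\<^sub>0, \<dots>, m\<^sub>n)\<close>, and tensor products of such algebras are of the
  same kind. A module over them is irreducible of a given type iff it is generated by a vector fixed by
  a minimal idempotent of that type. As \<open>\<psi>\<^sub>i\<close> maps matrix units to matrix units by appending a
  column of colour \<open>i\<close>, the functors \<open>Ind\<^sub>i\<close> and \<open>Res\<^sub>i\<close> raise and lower \<open>m\<^sub>i\<close> by one. Hence \<open>e\<^sub>i\<close> and \<open>f\<^sub>i\<close>
  turn an entry \<open>i\<close> of a row tableau into \<open>i - 1\<close> and vice versa, and the signature rule agrees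
  with the iterated tensor product rule for crystals.\<close>

section \<open>Modules over complex algebras\<close>

text \<open>The modules involved are quotients, corners and spans over unrelated vector types, and
  the class operators act on arbitrarily chosen representatives. Such a module is therefore never
  computed; only a minimal idempotent fixing a generator is tracked. This datum
  (\<open>of_type\<close>) is invariant under isomorphism and determines the class. Induction along
  \<open>psi p\<close> turns type \<open>s\<close> into \<open>s @ [p]\<close>, and restriction
  along \<open>psi q\<close> removes a final \<open>q\<close>; in between, a tuple of the same shape
  that ends in \<open>q\<close> is chosen. It exists because the multiplicity of \<open>q\<close> is
  positive, which the signature rule guarantees for the factor it selects. Generators of tensor
  products and of induced modules could vanish in the quotients that define them; explicit
  functionals that vanish on the relations exclude this.\<close>

lemma vectorspace_complexI:
  fixes V :: "(complex, 'v, 'm) module_scheme"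
  assumes "\<zero>\<^bsub>V\<^esub> \<in> carrier V"
    and "\<And>v w. v \<in> carrier V \<Longrightarrow> w \<in> carrier V \<Longrightarrow> v \<oplus>\<^bsub>V\<^esub> w \<in> carrier V"
    and "\<And>c v. v \<in> carrier V \<Longrightarrow> c \<odot>\<^bsub>V\<^esub> v \<in> carrier V"
    and "\<And>v w. v \<in> carrier V \<Longrightarrow> w \<in> carrier V \<Longrightarrow> v \<oplus>\<^bsub>V\<^esub> w = w \<oplus>\<^bsub>V\<^esub> v"
    and "\<And>u v w. u \<in> carrier V \<Longrightarrow> v \<in> carrier V \<Longrightarrow> w \<in> carrier V \<Longrightarrow>
      (u \<oplus>\<^bsub>V\<^esub> v) \<oplus>\<^bsub>V\<^esub> w = u \<oplus>\<^bsub>V\<^esub> (v \<oplus>\<^bsub>V\<^esub> w)"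
    and "\<And>v. v \<in> carrier V \<Longrightarrow> v \<oplus>\<^bsub>V\<^esub> \<zero>\<^bsub>V\<^esub> = v"
    and "\<And>v. v \<in> carrier V \<Longrightarrow> v \<oplus>\<^bsub>V\<^esub> ((- 1) \<odot>\<^bsub>V\<^esub> v) = \<zero>\<^bsub>V\<^esub>"
    and "\<And>c d v. v \<in> carrier V \<Longrightarrow> (c * d) \<odot>\<^bsub>V\<^esub> v = c \<odot>\<^bsub>V\<^esub> (d \<odot>\<^bsub>V\<^esub> v)"
    and "\<And>v. v \<in> carrier V \<Longrightarrow> 1 \<odot>\<^bsub>V\<^esub> v = v"
    and "\<And>c d v. v \<in> carrier V \<Longrightarrow> (c + d) \<odot>\<^bsub>V\<^esub> v = (c \<odot>\<^bsub>V\<^esub> v) \<oplus>\<^bsub>V\<^esub> (d \<odot>\<^bsub>V\<^esub> v)"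
    and "\<And>c v w. v \<in> carrier V \<Longrightarrow> w \<in> carrier V \<Longrightarrow>
      c \<odot>\<^bsub>V\<^esub> (v \<oplus>\<^bsub>V\<^esub> w) = (c \<odot>\<^bsub>V\<^esub> v) \<oplus>\<^bsub>V\<^esub> (c \<odot>\<^bsub>V\<^esub> w)"
  shows "vectorspace (class_ring :: complex ring) V"
proof (rule vs_criteria)
  show "field (class_ring :: complex ring)"
    by (rule class_field.field_axioms)
  show "\<forall>v\<in>carrier V. \<exists>neg_v\<in>carrier V. v \<oplus>\<^bsub>V\<^esub> neg_v = \<zero>\<^bsub>V\<^esub>"
    using assms(3,7) by blast
qed (use assms in auto)

context left_module
begin

lemma smult_closed': "v \<in> carrier M \<Longrightarrow> c \<odot>\<^bsub>M\<^esub> v \<in> carrier M"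
  by (rule smult_closed) auto

lemma smult_assoc': "v \<in> carrier M \<Longrightarrow> c \<odot>\<^bsub>M\<^esub> (d \<odot>\<^bsub>M\<^esub> v) = (c * d) \<odot>\<^bsub>M\<^esub> v"
  using smult_assoc1[of c d v] by simp

lemma smult_one': "v \<in> carrier M \<Longrightarrow> 1 \<odot>\<^bsub>M\<^esub> v = v"
  using smult_one[of v] by simp

lemma smult_zero': "v \<in> carrier M \<Longrightarrow> 0 \<odot>\<^bsub>M\<^esub> v = \<zero>\<^bsub>M\<^esub>"
  using lmult_0[of v] by simp

lemma smult_r_zero': "c \<odot>\<^bsub>M\<^esub> \<zero>\<^bsub>M\<^esub> = \<zero>\<^bsub>M\<^esub>"
  using rmult_0[of c] by simp

lemma smult_add_left': "v \<in> carrier M \<Longrightarrow> (c + d) \<odot>\<^bsub>M\<^esub> v = c \<odot>\<^bsub>M\<^esub> v \<oplus>\<^bsub>M\<^esub> d \<odot>\<^bsub>M\<^esub> v"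
  using smult_l_distr[of c d v] by simp

lemma smult_add_right': "v \<in> carrier M \<Longrightarrow> w \<in> carrier M \<Longrightarrow>
  c \<odot>\<^bsub>M\<^esub> (v \<oplus>\<^bsub>M\<^esub> w) = c \<odot>\<^bsub>M\<^esub> v \<oplus>\<^bsub>M\<^esub> c \<odot>\<^bsub>M\<^esub> w"
  using smult_r_distr[of c v w] by simp

lemma add_minus_one': "v \<in> carrier M \<Longrightarrow> v \<oplus>\<^bsub>M\<^esub> (- 1) \<odot>\<^bsub>M\<^esub> v = \<zero>\<^bsub>M\<^esub>"
  using smult_add_left'[of v 1 "- 1"] by (simp add: smult_one' smult_zero')

lemma smult_eq_iff':
  assumes "w \<in> carrier M" "w \<noteq> \<zero>\<^bsub>M\<^esub>"
  shows "c \<odot>\<^bsub>M\<^esub> w = d \<odot>\<^bsub>M\<^esub> w \<longleftrightarrow> c = d"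
proof
  assume eq: "c \<odot>\<^bsub>M\<^esub> w = d \<odot>\<^bsub>M\<^esub> w"
  have 0: "(c - d) \<odot>\<^bsub>M\<^esub> w = \<zero>\<^bsub>M\<^esub>"
  proof -
    have "(c - d) \<odot>\<^bsub>M\<^esub> w = c \<odot>\<^bsub>M\<^esub> w \<oplus>\<^bsub>M\<^esub> (- d) \<odot>\<^bsub>M\<^esub> w"
      using smult_add_left'[OF assms(1), of c "- d"] by simp
    also have "\<dots> = (d - d) \<odot>\<^bsub>M\<^esub> w"
      using smult_add_left'[OF assms(1), of d "- d"] eq by simp
    finally show ?thesis using assms by (simp add: smult_zero')
  qed
  show "c = d"
  proof (rule ccontr)
    assume "c \<noteq> d"
    then have "w = inverse (c - d) \<odot>\<^bsub>M\<^esub> ((c - d) \<odot>\<^bsub>M\<^esub> w)"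
      using assms by (simp add: smult_assoc' smult_one')
    then show False using 0 assms by (simp add: smult_r_zero')
  qed
qed simp

lemma act_zero': "a \<in> carrier A \<Longrightarrow> act M a \<zero>\<^bsub>M\<^esub> = \<zero>\<^bsub>M\<^esub>"
  using act_smult_right[of a "\<zero>\<^bsub>M\<^esub>" 0] by (simp add: smult_zero' act_closed)

end

lemma left_moduleI:
  fixes M :: "('a, 'v) alg_module"
  assumes "vectorspace (class_ring :: complex ring) M"
    and "\<And>a v. a \<in> carrier A \<Longrightarrow> v \<in> carrier M \<Longrightarrow> act M a v \<in> carrier M"
    and "\<And>a b v. a \<in> carrier A \<Longrightarrow> b \<in> carrier A \<Longrightarrow> v \<in> carrier M \<Longrightarrow>
      act M (a \<oplus>\<^bsub>A\<^esub> b) v = act M a v \<oplus>\<^bsub>M\<^esub> act M b v"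
    and "\<And>a v w. a \<in> carrier A \<Longrightarrow> v \<in> carrier M \<Longrightarrow> w \<in> carrier M \<Longrightarrow>
      act M a (v \<oplus>\<^bsub>M\<^esub> w) = act M a v \<oplus>\<^bsub>M\<^esub> act M a w"
    and "\<And>a v c. a \<in> carrier A \<Longrightarrow> v \<in> carrier M \<Longrightarrow>
      act M (c \<odot>\<^bsub>A\<^esub> a) v = c \<odot>\<^bsub>M\<^esub> act M a v"
    and "\<And>a v c. a \<in> carrier A \<Longrightarrow> v \<in> carrier M \<Longrightarrow>
      act M a (c \<odot>\<^bsub>M\<^esub> v) = c \<odot>\<^bsub>M\<^esub> act M a v"
    and "\<And>a b v. a \<in> carrier A \<Longrightarrow> b \<in> carrier A \<Longrightarrow> v \<in> carrier M \<Longrightarrow>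
      act M (a \<otimes>\<^bsub>A\<^esub> b) v = act M a (act M b v)"
    and "\<And>v. v \<in> carrier M \<Longrightarrow> act M \<one>\<^bsub>A\<^esub> v = v"
  shows "left_module A M"
  by (intro left_module.intro left_module_axioms.intro) (use assms in auto)

lemma module_isomorphicI:
  assumes "bij_betw h (carrier M) (carrier N)"
    and "\<And>v w. v \<in> carrier M \<Longrightarrow> w \<in> carrier M \<Longrightarrow> h (v \<oplus>\<^bsub>M\<^esub> w) = h v \<oplus>\<^bsub>N\<^esub> h w"
    and "\<And>c v. v \<in> carrier M \<Longrightarrow> h (c \<odot>\<^bsub>M\<^esub> v) = c \<odot>\<^bsub>N\<^esub> h v"
    and "\<And>a v. a \<in> carrier A \<Longrightarrow> v \<in> carrier M \<Longrightarrow> h (act M a v) = act N a (h v)"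
  shows "module_isomorphic A M N"
  unfolding module_isomorphic_def using assms by blast

text \<open>Isomorphism classes only contain modules with vectors of type
  \<open>nat \<Rightarrow> complex\<close>; transporting the structure along an injection of the
  carrier produces representatives there.\<close>

lemma left_module_copy:
  fixes M :: "('a, 'v) alg_module" and g :: "'v \<Rightarrow> 'w"
  assumes "left_module A M" and inj: "inj_on g (carrier M)"
  shows "\<exists>N :: ('a, 'w) alg_module. left_module A N \<and> module_isomorphic A M N"
proof -
  interpret left_module A M by fact
  define k where "k = the_inv_into (carrier M) g"
  define N :: "('a, 'w) alg_module" where
    "N = \<lparr>carrier = g ` carrier M, mult = undefined, one = undefined, zero = g \<zero>\<^bsub>M\<^esub>,
      add = (\<lambda>x y. g (k x \<oplus>\<^bsub>M\<^esub> k y)), smult = (\<lambda>c x. g (c \<odot>\<^bsub>M\<^esub> k x)),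
      act = (\<lambda>a x. g (act M a (k x)))\<rparr>"
  have kg: "k (g v) = v" if "v \<in> carrier M" for v
    using that inj by (simp add: k_def the_inv_into_f_f)
  have "vectorspace (class_ring :: complex ring) N"
    by (rule vectorspace_complexI)
      (auto simp: N_def kg smult_closed' a_ac smult_assoc' smult_one' smult_add_left'
         smult_add_right' add_minus_one')
  then have "left_module A N"
    by (rule left_moduleI)
      (auto simp: N_def kg act_closed act_add_left act_add_right act_smult_left act_smult_right
         act_mult act_one smult_closed')
  moreover have "module_isomorphic A M N"
    by (rule module_isomorphicI[where h = g])
      (auto simp: N_def kg inj_on_imp_bij_betw[OF inj])
  ultimately show ?thesis by blast
qed

section \<open>Products of matrix algebras\<close>

text \<open>The map \<open>coef\<close> identifies \<open>A\<close> with the algebra of \<open>X \<times> X\<close>-matrices that are block diagonal for the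
  partition of \<open>X\<close> into the fibres of \<open>sh\<close>, hence with a product of full matrix algebras, one for
  each value of \<open>sh\<close>.\<close>

locale block_algebra =
  fixes A :: "(complex, 'a) module" and X :: "'s set" and sh :: "'s \<Rightarrow> 'c"
    and coef :: "'a \<Rightarrow> 's \<Rightarrow> 's \<Rightarrow> complex"
  assumes finite_X: "finite X" and X_ne: "X \<noteq> {}"
    and add_closed: "a \<in> carrier A \<Longrightarrow> b \<in> carrier A \<Longrightarrow> a \<oplus>\<^bsub>A\<^esub> b \<in> carrier A"
    and mult_closed: "a \<in> carrier A \<Longrightarrow> b \<in> carrier A \<Longrightarrow> a \<otimes>\<^bsub>A\<^esub> b \<in> carrier A"
    and smult_closed: "a \<in> carrier A \<Longrightarrow> c \<odot>\<^bsub>A\<^esub> a \<in> carrier A"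
    and one_closed: "\<one>\<^bsub>A\<^esub> \<in> carrier A"
    and coef_add: "a \<in> carrier A \<Longrightarrow> b \<in> carrier A \<Longrightarrow> t \<in> X \<Longrightarrow> s \<in> X \<Longrightarrow>
      coef (a \<oplus>\<^bsub>A\<^esub> b) t s = coef a t s + coef b t s"
    and coef_smult: "a \<in> carrier A \<Longrightarrow> t \<in> X \<Longrightarrow> s \<in> X \<Longrightarrow>
      coef (c \<odot>\<^bsub>A\<^esub> a) t s = c * coef a t s"
    and coef_mult: "a \<in> carrier A \<Longrightarrow> b \<in> carrier A \<Longrightarrow> t \<in> X \<Longrightarrow> s \<in> X \<Longrightarrow>
      coef (a \<otimes>\<^bsub>A\<^esub> b) t s = (\<Sum>u\<in>X. coef a t u * coef b u s)"
    and coef_one: "t \<in> X \<Longrightarrow> s \<in> X \<Longrightarrow> coef \<one>\<^bsub>A\<^esub> t s = of_bool (t = s)"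
    and coef_inj: "a \<in> carrier A \<Longrightarrow> b \<in> carrier A \<Longrightarrow>
      (\<And>t s. t \<in> X \<Longrightarrow> s \<in> X \<Longrightarrow> coef a t s = coef b t s) \<Longrightarrow> a = b"
    and coef_sh: "a \<in> carrier A \<Longrightarrow> t \<in> X \<Longrightarrow> s \<in> X \<Longrightarrow> sh t \<noteq> sh s \<Longrightarrow> coef a t s = 0"
    and unit_ex: "t \<in> X \<Longrightarrow> s \<in> X \<Longrightarrow> sh t = sh s \<Longrightarrow>
      \<exists>a\<in>carrier A. \<forall>t'\<in>X. \<forall>s'\<in>X. coef a t' s' = of_bool (t' = t \<and> s' = s)"
begin

text \<open>Determined uniquely by \<open>coef_inj\<close> for \<open>t\<close>, \<open>s\<close> in
  one fibre of \<open>sh\<close>. For elements of \<open>X\<close> in different fibres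
  \<open>coef_sh\<close> excludes such a matrix and the choice is arbitrary.\<close>

definition E :: "'s \<Rightarrow> 's \<Rightarrow> 'a" where
  "E t s = (SOME a. a \<in> carrier A \<and> (\<forall>t'\<in>X. \<forall>s'\<in>X. coef a t' s' = of_bool (t' = t \<and> s' = s)))"

lemma E_props:
  assumes "t \<in> X" "s \<in> X" "sh t = sh s"
  shows "E t s \<in> carrier A"
    and "t' \<in> X \<Longrightarrow> s' \<in> X \<Longrightarrow> coef (E t s) t' s' = of_bool (t' = t \<and> s' = s)"
proof -
  have "E t s \<in> carrier A \<and> (\<forall>t'\<in>X. \<forall>s'\<in>X. coef (E t s) t' s' = of_bool (t' = t \<and> s' = s))"
    unfolding E_def by (rule someI_ex) (use unit_ex[OF assms] in blast)
  then show "E t s \<in> carrier A"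
    and "t' \<in> X \<Longrightarrow> s' \<in> X \<Longrightarrow> coef (E t s) t' s' = of_bool (t' = t \<and> s' = s)" by auto
qed

lemmas closed = add_closed mult_closed smult_closed one_closed E_props(1)
lemmas coefs = coef_add coef_smult coef_mult coef_one E_props(2)

lemma sum_of_bool_left:
  fixes f :: "'s \<Rightarrow> complex"
  shows "t \<in> X \<Longrightarrow> (\<Sum>u\<in>X. of_bool (u = t \<and> P) * f u) = of_bool P * f t"
    and "t \<in> X \<Longrightarrow> (\<Sum>u\<in>X. of_bool (P \<and> u = t) * f u) = of_bool P * f t"
    and "t \<in> X \<Longrightarrow> (\<Sum>u\<in>X. f u * of_bool (u = t \<and> P)) = f t * of_bool P"
    and "t \<in> X \<Longrightarrow> (\<Sum>u\<in>X. f u * of_bool (P \<and> u = t)) = f t * of_bool P"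
    and "t \<in> X \<Longrightarrow> (\<Sum>u\<in>X. f u * of_bool (u = t)) = f t"
    and "t \<in> X \<Longrightarrow> (\<Sum>u\<in>X. f u * of_bool (t = u)) = f t"
    and "t \<in> X \<Longrightarrow> (\<Sum>u\<in>X. of_bool (t = u) * f u) = f t"
    and "t \<in> X \<Longrightarrow> (\<Sum>u\<in>X. of_bool (u = t) * f u) = f t"
  using finite_X by (auto simp: of_bool_def if_distrib if_distribR sum.delta sum.delta' cong: if_cong)

text \<open>The locale assumes no ring laws: faithfulness of \<open>coef\<close> transfers them from
  matrices, here by exchanging two finite sums.\<close>

lemma mult_assoc:
  assumes "a \<in> carrier A" "b \<in> carrier A" "c \<in> carrier A"
  shows "(a \<otimes>\<^bsub>A\<^esub> b) \<otimes>\<^bsub>A\<^esub> c = a \<otimes>\<^bsub>A\<^esub> (b \<otimes>\<^bsub>A\<^esub> c)"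
proof (rule coef_inj)
  fix t s assume ts: "t \<in> X" "s \<in> X"
  have "(\<Sum>u\<in>X. (\<Sum>v\<in>X. coef a t v * coef b v u) * coef c u s) =
      (\<Sum>u\<in>X. \<Sum>v\<in>X. coef a t v * coef b v u * coef c u s)"
    by (simp add: sum_distrib_right)
  also have "\<dots> = (\<Sum>v\<in>X. \<Sum>u\<in>X. coef a t v * coef b v u * coef c u s)"
    by (rule sum.swap)
  also have "\<dots> = (\<Sum>v\<in>X. coef a t v * (\<Sum>u\<in>X. coef b v u * coef c u s))"
    by (simp add: sum_distrib_left mult.assoc)
  finally show "coef ((a \<otimes>\<^bsub>A\<^esub> b) \<otimes>\<^bsub>A\<^esub> c) t s = coef (a \<otimes>\<^bsub>A\<^esub> (b \<otimes>\<^bsub>A\<^esub> c)) t s"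
    using ts assms by (simp add: coefs closed)
qed (use assms in \<open>auto simp: closed\<close>)

lemma algebra_laws:
  assumes "a \<in> carrier A" "b \<in> carrier A" "c \<in> carrier A"
  shows "(a \<oplus>\<^bsub>A\<^esub> b) \<otimes>\<^bsub>A\<^esub> c = (a \<otimes>\<^bsub>A\<^esub> c) \<oplus>\<^bsub>A\<^esub> (b \<otimes>\<^bsub>A\<^esub> c)"
    and "c \<otimes>\<^bsub>A\<^esub> (a \<oplus>\<^bsub>A\<^esub> b) = (c \<otimes>\<^bsub>A\<^esub> a) \<oplus>\<^bsub>A\<^esub> (c \<otimes>\<^bsub>A\<^esub> b)"
    and "(k \<odot>\<^bsub>A\<^esub> a) \<otimes>\<^bsub>A\<^esub> b = k \<odot>\<^bsub>A\<^esub> (a \<otimes>\<^bsub>A\<^esub> b)"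
    and "a \<otimes>\<^bsub>A\<^esub> (k \<odot>\<^bsub>A\<^esub> b) = k \<odot>\<^bsub>A\<^esub> (a \<otimes>\<^bsub>A\<^esub> b)"
    and "\<one>\<^bsub>A\<^esub> \<otimes>\<^bsub>A\<^esub> a = a"
    and "a \<otimes>\<^bsub>A\<^esub> \<one>\<^bsub>A\<^esub> = a"
  using assms
  by - (rule coef_inj; auto simp: coefs closed algebra_simps sum.distrib sum_distrib_left
      sum_of_bool_left)+

text \<open>The matrix identity e_pt a e_ss = a_ts e_ps. Sandwiching between matrix units isolates
  one entry, and this is how coefficients are read off from vectors of a module.\<close>

lemma E_mult_E:
  assumes "a \<in> carrier A" "p \<in> X" "t \<in> X" "s \<in> X" "sh p = sh t" "sh p = sh s"
  shows "(E p t \<otimes>\<^bsub>A\<^esub> a) \<otimes>\<^bsub>A\<^esub> E s s = coef a t s \<odot>\<^bsub>A\<^esub> E p s"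
  using assms by (intro coef_inj) (auto simp: coefs closed sum_of_bool_left)

text \<open>Matrix units span the algebra. The set \<open>S\<close> of positions that may be nonzero
  is emptied one position at a time by subtracting a multiple of a matrix unit; positions between
  different fibres vanish by \<open>coef_sh\<close>.\<close>

lemma block_induct [consumes 1, case_names E add smult]:
  assumes a: "a \<in> carrier A"
    and E: "\<And>t s. t \<in> X \<Longrightarrow> s \<in> X \<Longrightarrow> sh t = sh s \<Longrightarrow> P (E t s)"
    and add: "\<And>a b. a \<in> carrier A \<Longrightarrow> b \<in> carrier A \<Longrightarrow> P a \<Longrightarrow> P b \<Longrightarrow> P (a \<oplus>\<^bsub>A\<^esub> b)"
    and smult: "\<And>c a. a \<in> carrier A \<Longrightarrow> P a \<Longrightarrow> P (c \<odot>\<^bsub>A\<^esub> a)"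
  shows "P a"
proof -
  have "\<forall>a\<in>carrier A. (\<forall>t\<in>X. \<forall>s\<in>X. (t, s) \<notin> S \<longrightarrow> coef a t s = 0) \<longrightarrow> P a"
    if "finite S" "S \<subseteq> X \<times> X" for S
    using that
  proof (induction S rule: finite_induct)
    case empty
    obtain x where x: "x \<in> X" using X_ne by auto
    show ?case
    proof (intro ballI impI)
      fix a assume "a \<in> carrier A" and 0: "\<forall>t\<in>X. \<forall>s\<in>X. (t, s) \<notin> {} \<longrightarrow> coef a t s = 0"
      \<comment> \<open>The zero matrix is written as a scalar multiple of a matrix unit, so that
        the rule for scalars covers it; nonemptiness of \<open>X\<close> supplies the unit.\<close>
      then have "a = 0 \<odot>\<^bsub>A\<^esub> E x x"
        by (intro coef_inj) (auto simp: coefs closed x)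
      then show "P a" using smult[OF E_props(1)[OF x x] E[OF x x]] by simp
    qed
  next
    case (insert p S)
    obtain t0 s0 where p: "p = (t0, s0)" "t0 \<in> X" "s0 \<in> X" using insert.prems by auto
    show ?case
    proof (intro ballI impI)
      fix a assume a: "a \<in> carrier A"
        and 0: "\<forall>t\<in>X. \<forall>s\<in>X. (t, s) \<notin> insert p S \<longrightarrow> coef a t s = 0"
      show "P a"
      proof (cases "sh t0 = sh s0")
        case True
        define b where "b = a \<oplus>\<^bsub>A\<^esub> ((- coef a t0 s0) \<odot>\<^bsub>A\<^esub> E t0 s0)"
        have b: "b \<in> carrier A" using a p True by (simp add: b_def closed)
        have "coef b t s = 0" if "t \<in> X" "s \<in> X" "(t, s) \<notin> S" for t s
          using that 0 a p True by (auto simp: b_def coefs closed)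
        then have Pb: "P b" using insert b by auto
        have "a = b \<oplus>\<^bsub>A\<^esub> (coef a t0 s0 \<odot>\<^bsub>A\<^esub> E t0 s0)"
          using a b p True by (intro coef_inj) (auto simp: coefs closed b_def)
        then show "P a"
          using add[OF b _ Pb smult[OF E_props(1) E]] p True by (metis smult_closed E_props(1))
      next
        case False
        then have "\<forall>t\<in>X. \<forall>s\<in>X. (t, s) \<notin> S \<longrightarrow> coef a t s = 0"
          using 0 p a coef_sh by (metis insert_iff old.prod.inject)
        then show "P a" using insert a by auto
      qed
    qed
  qed
  from this[of "X \<times> X"] show ?thesis using a finite_X by auto
qed

text \<open>The irreducible module belonging to the block of \<open>s\<close> is generated by a vector fixed by the
  minimal idempotent \<open>E s s\<close>.\<close>

definition of_type :: "'s \<Rightarrow> ('a, 'v) alg_module \<Rightarrow> bool" where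
  "of_type s M \<longleftrightarrow> left_module A M \<and> (\<exists>w\<in>carrier M. w \<noteq> \<zero>\<^bsub>M\<^esub> \<and> act M (E s s) w = w \<and>
     carrier M = (\<lambda>a. act M a w) ` carrier A)"

section \<open>Modules generated by a vector fixed by a minimal idempotent\<close>

lemma act_E_act:
  fixes M :: "('a, 'v) alg_module"
  assumes "left_module A M" "w \<in> carrier M" "act M (E s s) w = w"
    "s \<in> X" "t \<in> X" "p \<in> X" "sh p = sh t" "sh p = sh s" "a \<in> carrier A"
  shows "act M (E p t) (act M a w) = coef a t s \<odot>\<^bsub>M\<^esub> act M (E p s) w"
proof -
  interpret M: left_module A M by fact
  have "act M (E p t) (act M a w) = act M ((E p t \<otimes>\<^bsub>A\<^esub> a) \<otimes>\<^bsub>A\<^esub> E s s) w"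
    using assms by (simp add: M.act_mult closed)
  then show ?thesis using assms by (simp add: E_mult_E M.act_smult_left closed)
qed

text \<open>The module is a copy of the left ideal \<open>A E s s\<close>: on a vector fixed by
  \<open>E s s\<close> only column \<open>s\<close> of \<open>a\<close> is visible, and conversely
  \<open>E s t\<close> applied to \<open>a w\<close> returns the entry at \<open>(t, s)\<close> as a
  multiple of \<open>w\<close>.\<close>

lemma act_eq_iff:
  fixes M :: "('a, 'v) alg_module"
  assumes M: "left_module A M" and w: "w \<in> carrier M" "w \<noteq> \<zero>\<^bsub>M\<^esub>" "act M (E s s) w = w"
    and s: "s \<in> X" and ab: "a \<in> carrier A" "b \<in> carrier A"
  shows "act M a w = act M b w \<longleftrightarrow> (\<forall>t\<in>X. coef a t s = coef b t s)"
proof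
  interpret M: left_module A M by fact
  assume eq: "act M a w = act M b w"
  show "\<forall>t\<in>X. coef a t s = coef b t s"
  proof
    fix t assume t: "t \<in> X"
    show "coef a t s = coef b t s"
    proof (cases "sh t = sh s")
      case True
      then have "coef a t s \<odot>\<^bsub>M\<^esub> w = coef b t s \<odot>\<^bsub>M\<^esub> w"
        using act_E_act[OF M w(1,3) s t s _ _ ab(1)] act_E_act[OF M w(1,3) s t s _ _ ab(2)] w eq
        by auto
      then show ?thesis using w M.smult_eq_iff' by blast
    qed (use coef_sh ab t s in auto)
  qed
next
  interpret M: left_module A M by fact
  assume eq: "\<forall>t\<in>X. coef a t s = coef b t s"
  have "a \<otimes>\<^bsub>A\<^esub> E s s = b \<otimes>\<^bsub>A\<^esub> E s s"
    using eq ab s by (intro coef_inj) (auto simp: coefs closed sum_of_bool_left)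
  moreover have "act M c w = act M (c \<otimes>\<^bsub>A\<^esub> E s s) w" if "c \<in> carrier A" for c
    using w s that by (simp add: M.act_mult closed)
  ultimately show "act M a w = act M b w" using ab by simp
qed

text \<open>Sending \<open>a w\<close> to \<open>a x\<close> is well defined and injective, because
  by \<open>act_eq_iff\<close> equality of such vectors depends only on column \<open>s\<close> of
  \<open>a\<close>, in both modules.\<close>

lemma of_type_isomorphic:
  fixes M :: "('a, 'v) alg_module" and N :: "('a, 'w) alg_module"
  assumes "of_type s M" "of_type s N" "s \<in> X"
  shows "module_isomorphic A M N"
proof -
  obtain w where M: "left_module A M" and w: "w \<in> carrier M" "w \<noteq> \<zero>\<^bsub>M\<^esub>" "act M (E s s) w = w"
    and cM: "carrier M = (\<lambda>a. act M a w) ` carrier A"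
    using assms unfolding of_type_def by blast
  obtain x where N: "left_module A N" and x: "x \<in> carrier N" "x \<noteq> \<zero>\<^bsub>N\<^esub>" "act N (E s s) x = x"
    and cN: "carrier N = (\<lambda>a. act N a x) ` carrier A"
    using assms unfolding of_type_def by blast
  interpret M: left_module A M by fact
  interpret N: left_module A N by fact
  define h where "h v = act N (SOME a. a \<in> carrier A \<and> v = act M a w) x" for v
  have h: "h (act M a w) = act N a x" if "a \<in> carrier A" for a
  proof -
    define b where "b = (SOME b. b \<in> carrier A \<and> act M a w = act M b w)"
    have b: "b \<in> carrier A \<and> act M a w = act M b w"
      unfolding b_def by (rule someI[of _ a]) (use that in auto)
    then have "act N a x = act N b x"
      using act_eq_iff[OF M w \<open>s \<in> X\<close>] act_eq_iff[OF N x \<open>s \<in> X\<close>] that by blast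
    then show ?thesis by (simp add: h_def b_def)
  qed
  show ?thesis
  proof (rule module_isomorphicI[where h = h])
    show "bij_betw h (carrier M) (carrier N)"
      using act_eq_iff[OF M w \<open>s \<in> X\<close>] act_eq_iff[OF N x \<open>s \<in> X\<close>]
      by (auto simp: bij_betw_def inj_on_def cM cN h image_iff)
  next
    fix v v' assume "v \<in> carrier M" "v' \<in> carrier M"
    then show "h (v \<oplus>\<^bsub>M\<^esub> v') = h v \<oplus>\<^bsub>N\<^esub> h v'"
      using w x by (auto simp: cM h M.act_add_left[symmetric] N.act_add_left[symmetric] closed)
  next
    fix c v assume "v \<in> carrier M"
    then show "h (c \<odot>\<^bsub>M\<^esub> v) = c \<odot>\<^bsub>N\<^esub> h v"
      using w x by (auto simp: cM h M.act_smult_left[symmetric] N.act_smult_left[symmetric] closed)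
  next
    fix a v assume "v \<in> carrier M" "a \<in> carrier A"
    then show "h (act M a v) = act N a (h v)"
      using w x by (auto simp: cM h M.act_mult[symmetric] N.act_mult[symmetric] closed)
  qed
qed

lemma of_type_transport:
  fixes M :: "('a, 'v) alg_module" and N :: "('a, 'w) alg_module"
  assumes "of_type s M" "s \<in> X" "left_module A N" "module_isomorphic A M N"
  shows "of_type s N"
proof -
  obtain w where M: "left_module A M" and w: "w \<in> carrier M" "w \<noteq> \<zero>\<^bsub>M\<^esub>" "act M (E s s) w = w"
    and cM: "carrier M = (\<lambda>a. act M a w) ` carrier A"
    using assms unfolding of_type_def by blast
  interpret M: left_module A M by fact
  interpret N: left_module A N by fact
  obtain h where bij: "bij_betw h (carrier M) (carrier N)"
    and sm: "\<And>c v. v \<in> carrier M \<Longrightarrow> h (c \<odot>\<^bsub>M\<^esub> v) = c \<odot>\<^bsub>N\<^esub> h v"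
    and ac: "\<And>a v. a \<in> carrier A \<Longrightarrow> v \<in> carrier M \<Longrightarrow> h (act M a v) = act N a (h v)"
    using assms(4) unfolding module_isomorphic_def by blast
  have hN: "h v \<in> carrier N" if "v \<in> carrier M" for v
    using bij that by (auto simp: bij_betw_def)
  have h0: "h \<zero>\<^bsub>M\<^esub> = \<zero>\<^bsub>N\<^esub>"
    using sm[of "\<zero>\<^bsub>M\<^esub>" 0] hN by (simp add: M.smult_zero' N.smult_zero')
  show ?thesis unfolding of_type_def
  proof (intro conjI bexI[of _ "h w"])
    show "h w \<noteq> \<zero>\<^bsub>N\<^esub>"
      using w h0 bij M.zero_closed by (metis bij_betw_def inj_on_contraD)
    show "act N (E s s) (h w) = h w"
      using w assms(2) by (simp add: ac[symmetric] closed)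
    have "carrier N = h ` carrier M" using bij by (auto simp: bij_betw_def)
    also have "\<dots> = (\<lambda>a. act N a (h w)) ` carrier A"
      unfolding cM image_image using w by (intro image_cong) (auto simp: ac)
    finally show "carrier N = (\<lambda>a. act N a (h w)) ` carrier A" .
  qed (use w hN assms in auto)
qed

text \<open>\<open>E t s\<close> carries the generator to one fixed by \<open>E t t\<close>, and
  \<open>E s t\<close> carries it back. This free choice of a representative in a fibre of
  \<open>sh\<close> is what allows a restriction along a colour other than the one used for
  induction.\<close>

lemma of_type_sh:
  assumes "of_type s M" "s \<in> X" "t \<in> X" "sh s = sh t"
  shows "of_type t M"
proof -
  obtain w where M: "left_module A M" and w: "w \<in> carrier M" "w \<noteq> \<zero>\<^bsub>M\<^esub>" "act M (E s s) w = w"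
    and cM: "carrier M = (\<lambda>a. act M a w) ` carrier A"
    using assms unfolding of_type_def by blast
  interpret M: left_module A M by fact
  define x where "x = act M (E t s) w"
  have x: "x \<in> carrier M" using assms w by (simp add: x_def M.act_closed closed)
  have wx: "act M (E s t) x = w"
    using act_E_act[OF M w(1,3), of t s "E t s"] assms w
    by (simp add: x_def closed coefs M.smult_one')
  have "act M (E t t) x = x"
    unfolding x_def
    by (subst act_E_act[OF M w(1,3)]) (use assms w x in \<open>auto simp: x_def closed coefs M.smult_one'\<close>)
  moreover have "x \<noteq> \<zero>\<^bsub>M\<^esub>"
    using wx w assms M.act_zero' by (metis E_props(1))
  moreover have "carrier M = (\<lambda>a. act M a x) ` carrier A"
  proof
    show "carrier M \<subseteq> (\<lambda>a. act M a x) ` carrier A"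
    proof
      fix v assume "v \<in> carrier M"
      then obtain a where "a \<in> carrier A" "v = act M a (act M (E s t) x)"
        unfolding wx using cM by auto
      then have "v = act M (a \<otimes>\<^bsub>A\<^esub> E s t) x" "a \<otimes>\<^bsub>A\<^esub> E s t \<in> carrier A"
        using x assms by (auto simp: M.act_mult closed)
      then show "v \<in> (\<lambda>a. act M a x) ` carrier A" by blast
    qed
  qed (use x M.act_closed in auto)
  ultimately show ?thesis unfolding of_type_def using M x by blast
qed

text \<open>Between different blocks \<open>E t t a E s s\<close> is the zero matrix, so a vector
  fixed by \<open>E t t\<close> in a module generated by one fixed by \<open>E s s\<close> would
  vanish.\<close>

lemma of_type_unique:
  fixes M :: "('a, 'v) alg_module"
  assumes "of_type s M" "of_type t M" "s \<in> X" "t \<in> X"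
  shows "sh s = sh t"
proof (rule ccontr)
  assume ne: "sh s \<noteq> sh t"
  obtain w where M: "left_module A M" and w: "w \<in> carrier M" "w \<noteq> \<zero>\<^bsub>M\<^esub>" "act M (E s s) w = w"
    and cM: "carrier M = (\<lambda>a. act M a w) ` carrier A"
    using assms unfolding of_type_def by blast
  obtain x where x: "x \<in> carrier M" "x \<noteq> \<zero>\<^bsub>M\<^esub>" "act M (E t t) x = x"
    using assms unfolding of_type_def by blast
  interpret M: left_module A M by fact
  obtain a where a: "a \<in> carrier A" "x = act M a (act M (E s s) w)" using x cM w by auto
  have "x = act M ((E t t \<otimes>\<^bsub>A\<^esub> a) \<otimes>\<^bsub>A\<^esub> E s s) w"
    using x a w assms by (simp add: M.act_mult closed)
  also have "(E t t \<otimes>\<^bsub>A\<^esub> a) \<otimes>\<^bsub>A\<^esub> E s s = 0 \<odot>\<^bsub>A\<^esub> E s s"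
    using assms a ne coef_sh[OF a(1), of t s]
    by (intro coef_inj) (auto simp: coefs closed sum_of_bool_left)
  also have "act M (0 \<odot>\<^bsub>A\<^esub> E s s) w = \<zero>\<^bsub>M\<^esub>"
    using w assms by (simp add: M.act_smult_left M.smult_zero' closed)
  finally show False using x by simp
qed

text \<open>A nonzero \<open>v = a w\<close> has a nonzero entry at some \<open>(t, s)\<close>; the
  matching multiple of \<open>E s t\<close> recovers \<open>w\<close> from \<open>v\<close>.\<close>

lemma of_type_submodule:
  fixes M :: "('a, 'v) alg_module"
  assumes "of_type s M" "s \<in> X" "v \<in> carrier M" "v \<noteq> \<zero>\<^bsub>M\<^esub>"
  shows "carrier M = (\<lambda>a. act M a v) ` carrier A"
proof -
  obtain w where M: "left_module A M" and w: "w \<in> carrier M" "w \<noteq> \<zero>\<^bsub>M\<^esub>" "act M (E s s) w = w"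
    and cM: "carrier M = (\<lambda>a. act M a w) ` carrier A"
    using assms unfolding of_type_def by blast
  interpret M: left_module A M by fact
  obtain a where a: "a \<in> carrier A" "v = act M a w" using assms cM by auto
  obtain x where x: "x \<in> X" using X_ne by auto
  have "0 \<odot>\<^bsub>A\<^esub> a \<in> carrier A" "act M (0 \<odot>\<^bsub>A\<^esub> a) w = \<zero>\<^bsub>M\<^esub>"
    using a w by (auto simp: closed M.act_smult_left M.smult_zero' M.act_closed)
  then have "\<not> (\<forall>t\<in>X. coef a t s = coef (0 \<odot>\<^bsub>A\<^esub> a) t s)"
    using act_eq_iff[OF M w \<open>s \<in> X\<close> a(1)] a assms by metis
  then obtain t where t: "t \<in> X" "coef a t s \<noteq> 0" using a assms by (auto simp: coefs)
  then have st: "sh t = sh s" using coef_sh a assms by blast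
  define b where "b = inverse (coef a t s) \<odot>\<^bsub>A\<^esub> E s t"
  have b: "b \<in> carrier A" using t assms st by (simp add: b_def closed)
  have bv: "act M b v = w"
    using act_E_act[OF M w(1,3) assms(2) t(1) assms(2) _ _ a(1)] t st assms a w
    by (simp add: b_def M.act_smult_left closed M.smult_assoc' M.smult_one')
  show ?thesis
  proof
    show "carrier M \<subseteq> (\<lambda>a. act M a v) ` carrier A"
    proof
      fix u assume "u \<in> carrier M"
      then obtain c where "c \<in> carrier A" "u = act M c (act M b v)" unfolding bv using cM by auto
      then have "c \<otimes>\<^bsub>A\<^esub> b \<in> carrier A" "u = act M (c \<otimes>\<^bsub>A\<^esub> b) v"
        using assms b by (auto simp: M.act_mult closed)
      then show "u \<in> (\<lambda>a. act M a v) ` carrier A" by blast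
    qed
  qed (use assms M.act_closed in auto)
qed

lemma of_type_irreducible:
  assumes "of_type s M" "s \<in> X"
  shows "irreducible_module A M"
  unfolding irreducible_module_def
proof (intro conjI allI impI)
  show M: "left_module A M" using assms by (simp add: of_type_def)
  interpret M: left_module A M by fact
  show "carrier M \<noteq> {\<zero>\<^bsub>M\<^esub>}" using assms unfolding of_type_def by blast
  fix N assume N: "VectorSpace.subspace class_ring N M \<and> (\<forall>a\<in>carrier A. \<forall>v\<in>N. act M a v \<in> N)"
  then have sub: "N \<subseteq> carrier M" "\<zero>\<^bsub>M\<^esub> \<in> N"
    by (auto simp: VectorSpace.subspace_def LinearCombinations.submodule_def)
  show "N = {\<zero>\<^bsub>M\<^esub>} \<or> N = carrier M"
  proof (cases "N \<subseteq> {\<zero>\<^bsub>M\<^esub>}")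
    case False
    then obtain v where "v \<in> N" "v \<noteq> \<zero>\<^bsub>M\<^esub>" by blast
    then have "carrier M = (\<lambda>a. act M a v) ` carrier A"
      using of_type_submodule[OF assms, of v] sub by blast
    then have "carrier M \<subseteq> N" using N \<open>v \<in> N\<close> by auto
    then show ?thesis using sub by blast
  qed (use sub in auto)
qed

lemma of_type_fin_dim:
  assumes "of_type s M" "s \<in> X"
  shows "fin_dim_module A M"
proof -
  obtain w where M: "left_module A M" and w: "w \<in> carrier M" "w \<noteq> \<zero>\<^bsub>M\<^esub>" "act M (E s s) w = w"
    and cM: "carrier M = (\<lambda>a. act M a w) ` carrier A"
    using assms unfolding of_type_def by blast
  interpret M: left_module A M by fact
  define S where "S = (\<lambda>(t, u). act M (E t u) w) ` {(t, u) \<in> X \<times> X. sh t = sh u}"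
  have fin: "finite S" unfolding S_def by (rule finite_imageI, rule finite_subset[of _ "X \<times> X"]) (auto simp: finite_X)
  have S: "S \<subseteq> carrier M" unfolding S_def using w by (auto intro!: M.act_closed closed)
  have sub: "LinearCombinations.submodule class_ring (M.span S) M"
    using M.span_is_submodule[OF S] .
  have "act M a w \<in> M.span S" if "a \<in> carrier A" for a
    using that
  proof (induction rule: block_induct)
    case (E t s)
    then have "act M (E t s) w \<in> S" by (auto simp: S_def)
    then show ?case using M.in_own_span[OF S] by blast
  next
    case (add a b)
    then show ?case using sub w
      by (auto simp: M.act_add_left LinearCombinations.submodule_def)
  next
    case (smult c a)
    then show ?case using sub w
      by (auto simp: M.act_smult_left LinearCombinations.submodule_def)
  qed
  then have "M.span S = carrier M" using sub cM
    by (auto simp: LinearCombinations.submodule_def)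
  then show ?thesis unfolding fin_dim_module_def M.fin_dim_def using M fin S by blast
qed

text \<open>If every \<open>E s s\<close> killed a nonzero vector \<open>v\<close>, so would every
  \<open>E t s = E t s E s s\<close>, hence the identity. A surviving \<open>E s s v\<close> is
  fixed by \<open>E s s\<close> and generates a nonzero submodule.\<close>

lemma irreducible_of_type:
  fixes M :: "('a, 'v) alg_module"
  assumes "irreducible_module A M"
  shows "\<exists>s\<in>X. of_type s M"
proof -
  have M: "left_module A M" and ne: "carrier M \<noteq> {\<zero>\<^bsub>M\<^esub>}"
    and irr: "\<And>N. VectorSpace.subspace class_ring N M \<Longrightarrow> \<forall>a\<in>carrier A. \<forall>v\<in>N. act M a v \<in> N \<Longrightarrow>
      N = {\<zero>\<^bsub>M\<^esub>} \<or> N = carrier M"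
    using assms unfolding irreducible_module_def by auto
  interpret M: left_module A M by fact
  obtain v where v: "v \<in> carrier M" "v \<noteq> \<zero>\<^bsub>M\<^esub>" using ne M.zero_closed by blast
  have "\<exists>s\<in>X. act M (E s s) v \<noteq> \<zero>\<^bsub>M\<^esub>"
  proof (rule ccontr)
    assume "\<not> ?thesis"
    then have 0: "act M (E s s) v = \<zero>\<^bsub>M\<^esub>" if "s \<in> X" for s using that by blast
    have "act M a v = \<zero>\<^bsub>M\<^esub>" if "a \<in> carrier A" for a
      using that
    proof (induction rule: block_induct)
      case (E t s)
      then have "E t s = E t s \<otimes>\<^bsub>A\<^esub> E s s"
        by (intro coef_inj) (auto simp: coefs closed sum_of_bool_left)
      then have "act M (E t s) v = act M (E t s) (act M (E s s) v)"
        using E v by (metis M.act_mult E_props(1))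
      then show ?case using E 0 by (simp add: M.act_zero' closed)
    next
      case (add a b)
      then show ?case using v by (simp add: M.act_add_left)
    next
      case (smult c a)
      then show ?case using v by (simp add: M.act_smult_left M.smult_r_zero')
    qed
    from this[OF one_closed] show False using v M.act_one by simp
  qed
  then obtain s where s: "s \<in> X" and nz: "act M (E s s) v \<noteq> \<zero>\<^bsub>M\<^esub>" by blast
  define w where "w = act M (E s s) v"
  have w: "w \<in> carrier M" "w \<noteq> \<zero>\<^bsub>M\<^esub>" using nz v s by (auto simp: w_def M.act_closed closed)
  have EE: "E s s \<otimes>\<^bsub>A\<^esub> E s s = E s s"
    using s by (intro coef_inj) (auto simp: coefs closed sum_of_bool_left)
  have ww: "act M (E s s) w = w"
    unfolding w_def using v s by (simp add: M.act_mult[symmetric] closed EE)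
  define N where "N = (\<lambda>a. act M a w) ` carrier A"
  have "VectorSpace.subspace class_ring N M"
    unfolding VectorSpace.subspace_def
  proof (intro conjI M.vectorspace_axioms LinearCombinations.submodule.intro M.module_axioms)
    show "N \<subseteq> carrier M" using w by (auto simp: N_def M.act_closed)
    show "\<zero>\<^bsub>M\<^esub> \<in> N"
      unfolding N_def using w M.act_smult_left[OF one_closed w(1), of 0]
      by (intro image_eqI[of _ _ "0 \<odot>\<^bsub>A\<^esub> \<one>\<^bsub>A\<^esub>"]) (auto simp: closed M.act_one M.smult_zero')
    fix x y assume "x \<in> N" "y \<in> N"
    then show "x \<oplus>\<^bsub>M\<^esub> y \<in> N"
      unfolding N_def using w by (auto simp: M.act_add_left[symmetric] closed)
  next
    fix c x assume "x \<in> N"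
    then show "c \<odot>\<^bsub>M\<^esub> x \<in> N"
      unfolding N_def using w by (auto simp: M.act_smult_left[symmetric] closed)
  qed
  moreover have "\<forall>a\<in>carrier A. \<forall>v\<in>N. act M a v \<in> N"
    unfolding N_def using w by (auto simp: M.act_mult[symmetric] closed)
  moreover have "w \<in> N" unfolding N_def using ww s closed by (intro image_eqI[of _ _ "E s s"]) auto
  ultimately have "N = carrier M" using irr w by blast
  then show ?thesis unfolding of_type_def N_def using M w ww s by blast
qed

text \<open>The coordinates in column \<open>s\<close> separate vectors by
  \<open>act_eq_iff\<close>; an enumeration of the finite set \<open>X\<close> turns them into
  functions on the natural numbers.\<close>

lemma of_type_copy:
  fixes M :: "('a, 'v) alg_module"
  assumes "of_type s M" "s \<in> X"
  shows "\<exists>N :: ('a, nat \<Rightarrow> complex) alg_module. of_type s N"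
proof -
  obtain w where M: "left_module A M" and w: "w \<in> carrier M" "w \<noteq> \<zero>\<^bsub>M\<^esub>" "act M (E s s) w = w"
    and cM: "carrier M = (\<lambda>a. act M a w) ` carrier A"
    using assms unfolding of_type_def by blast
  obtain e :: "nat \<Rightarrow> 's" and k where e: "X = e ` {i. i < k}"
    using finite_imp_nat_seg_image_inj_on[OF finite_X] by metis
  define r where "r v = (SOME a. a \<in> carrier A \<and> v = act M a w)" for v
  have r: "r v \<in> carrier A \<and> v = act M (r v) w" if "v \<in> carrier M" for v
    unfolding r_def by (rule someI_ex) (use that cM in auto)
  define g :: "'v \<Rightarrow> nat \<Rightarrow> complex" where "g v = (\<lambda>i. coef (r v) (e i) s)" for v
  have "inj_on g (carrier M)"
  proof (rule inj_onI)
    fix v v' assume v: "v \<in> carrier M" "v' \<in> carrier M" and "g v = g v'"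
    then have "\<forall>t\<in>X. coef (r v) t s = coef (r v') t s" by (auto simp: e g_def fun_eq_iff)
    then show "v = v'" using act_eq_iff[OF M w assms(2)] r v by metis
  qed
  from left_module_copy[OF M this] show ?thesis using of_type_transport[OF assms] by blast
qed

text \<open>Reduces questions about isomorphism classes to questions about types: the type is
  invariant under isomorphism (\<open>of_type_transport\<close>) and complete
  (\<open>of_type_isomorphic\<close>).\<close>

lemma iso_class_of_type:
  assumes "of_type s M" "s \<in> X"
  shows "iso_class A M = {N. of_type s N}"
proof -
  have "left_module A N" if "of_type s N" for N :: "('a, nat \<Rightarrow> complex) alg_module"
    using that by (simp add: of_type_def)
  then show ?thesis
    unfolding iso_class_def using of_type_transport[OF assms] of_type_isomorphic[OF assms(1) _ assms(2)]
    by blast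
qed

lemma std_copy_of_type:
  assumes "of_type s M" "s \<in> X"
  shows "of_type s (std_copy A M)"
  unfolding std_copy_def iso_class_of_type[OF assms]
  using someI_ex[OF of_type_copy[OF assms]] by simp

lemma E_eqI:
  assumes "t \<in> X" "s \<in> X" "sh t = sh s" "a \<in> carrier A"
    and "\<And>t' s'. t' \<in> X \<Longrightarrow> s' \<in> X \<Longrightarrow> coef a t' s' = of_bool (t' = t \<and> s' = s)"
  shows "a = E t s"
  using assms by (intro coef_inj) (auto simp: coefs closed)

text \<open>The functional \<open>\<phi> t\<close> reads off the coordinate at the basis vector \<open>E t s w\<close>.\<close>

lemma of_type_coordinates:
  fixes M :: "('a, 'v) alg_module"
  assumes "of_type s M" "s \<in> X"
  obtains w \<phi> where "w \<in> carrier M" "w \<noteq> \<zero>\<^bsub>M\<^esub>" "act M (E s s) w = w"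
    "carrier M = (\<lambda>a. act M a w) ` carrier A"
    "\<And>t a. t \<in> X \<Longrightarrow> a \<in> carrier A \<Longrightarrow> \<phi> t (act M a w) = coef a t s"
    "\<And>t u v. t \<in> X \<Longrightarrow> u \<in> carrier M \<Longrightarrow> v \<in> carrier M \<Longrightarrow> \<phi> t (u \<oplus>\<^bsub>M\<^esub> v) = \<phi> t u + \<phi> t v"
    "\<And>t c v. t \<in> X \<Longrightarrow> v \<in> carrier M \<Longrightarrow> \<phi> t (c \<odot>\<^bsub>M\<^esub> v) = c * \<phi> t v"
proof -
  obtain w where M: "left_module A M" and w: "w \<in> carrier M" "w \<noteq> \<zero>\<^bsub>M\<^esub>" "act M (E s s) w = w"
    and cM: "carrier M = (\<lambda>a. act M a w) ` carrier A"
    using assms unfolding of_type_def by blast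
  interpret M: left_module A M by fact
  define \<phi> where "\<phi> t v = coef (SOME a. a \<in> carrier A \<and> v = act M a w) t s" for t v
  have \<phi>: "\<phi> t (act M a w) = coef a t s" if "t \<in> X" "a \<in> carrier A" for t a
  proof -
    define b where "b = (SOME b. b \<in> carrier A \<and> act M a w = act M b w)"
    have "b \<in> carrier A \<and> act M a w = act M b w"
      unfolding b_def by (rule someI[of _ a]) (use that in auto)
    then have "coef a t s = coef b t s"
      using act_eq_iff[OF M w assms(2)] that by blast
    then show ?thesis by (simp add: \<phi>_def b_def)
  qed
  show ?thesis
  proof (rule that[OF w cM \<phi>])
    fix t u v assume t: "t \<in> X" and "u \<in> carrier M" "v \<in> carrier M"
    then show "\<phi> t (u \<oplus>\<^bsub>M\<^esub> v) = \<phi> t u + \<phi> t v"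
      using w by (auto simp: cM M.act_add_left[symmetric] \<phi> closed coefs assms(2))
  next
    fix t c v assume t: "t \<in> X" and "v \<in> carrier M"
    then show "\<phi> t (c \<odot>\<^bsub>M\<^esub> v) = c * \<phi> t v"
      using w by (auto simp: cM M.act_smult_left[symmetric] \<phi> closed coefs assms(2))
  qed
qed

end

section \<open>Finitely supported functions and quotient spaces\<close>

text \<open>The locale is interpreted in function spaces and in the complex numbers, so that linear
  maps and linear functionals on free spaces share one theory; \<open>lsum h\<close> is the linear
  extension of a map \<open>h\<close> of basis elements.\<close>

locale complex_space = vector_space scale
  for scale :: "complex \<Rightarrow> 'b::ab_group_add \<Rightarrow> 'b"
begin

definition lsum :: "('x \<Rightarrow> 'b) \<Rightarrow> ('x \<Rightarrow> complex) \<Rightarrow> 'b" where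
  "lsum h f = (\<Sum>x | f x \<noteq> 0. scale (f x) (h x))"

lemma lsum_superset:
  assumes "finite S" "{x. f x \<noteq> 0} \<subseteq> S"
  shows "lsum h f = (\<Sum>x\<in>S. scale (f x) (h x))"
  unfolding lsum_def by (rule sum.mono_neutral_left) (use assms in auto)

lemma lsum_zero [simp]: "lsum h 0 = 0"
  by (simp add: lsum_def)

lemma lsum_cong: "(\<And>x. f x \<noteq> 0 \<Longrightarrow> h x = h' x) \<Longrightarrow> lsum h f = lsum h' f"
  unfolding lsum_def by (rule sum.cong) auto

lemma lsum_plus:
  assumes "finite {x. f x \<noteq> 0}" "finite {x. g x \<noteq> 0}"
  shows "lsum h (f + g) = lsum h f + lsum h g"
proof -
  let ?S = "{x. f x \<noteq> 0} \<union> {x. g x \<noteq> 0}"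
  have S: "finite ?S" using assms by simp
  have "{x. (f + g) x \<noteq> 0} \<subseteq> ?S" by auto
  then have "lsum h (f + g) = (\<Sum>x\<in>?S. scale ((f + g) x) (h x))" by (rule lsum_superset[OF S])
  also have "\<dots> = (\<Sum>x\<in>?S. scale (f x) (h x)) + (\<Sum>x\<in>?S. scale (g x) (h x))"
    by (simp add: scale_left_distrib sum.distrib)
  finally show ?thesis using lsum_superset[OF S, of f h] lsum_superset[OF S, of g h] by auto
qed

lemma lsum_sum:
  assumes "\<And>i. i \<in> I \<Longrightarrow> finite {x. f i x \<noteq> 0}"
  shows "lsum h (\<Sum>i\<in>I. f i) = (\<Sum>i\<in>I. lsum h (f i))"
proof (cases "finite I")
  case True
  then have "lsum h (\<Sum>i\<in>I. f i) = (\<Sum>i\<in>I. lsum h (f i)) \<and> finite {x. (\<Sum>i\<in>I. f i) x \<noteq> 0}"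
    using assms
  proof (induction I rule: finite_induct)
    case (insert i I)
    then have fin: "finite {x. f i x \<noteq> 0}" "finite {x. (\<Sum>i\<in>I. f i) x \<noteq> 0}" by auto
    have "{x. (f i + (\<Sum>i\<in>I. f i)) x \<noteq> 0} \<subseteq> {x. f i x \<noteq> 0} \<union> {x. (\<Sum>i\<in>I. f i) x \<noteq> 0}" by auto
    then have "finite {x. (f i + (\<Sum>i\<in>I. f i)) x \<noteq> 0}" using fin by (meson finite_UnI finite_subset)
    moreover have eq: "(\<Sum>i\<in>insert i I. f i) = f i + (\<Sum>i\<in>I. f i)"
      by (rule sum.insert[OF insert(1,2)])
    moreover have "lsum h (\<Sum>i\<in>I. f i) = (\<Sum>i\<in>I. lsum h (f i))" using insert by blast
    ultimately show ?case
      unfolding eq lsum_plus[OF fin] by (simp only: sum.insert[OF insert(1,2)] simp_thms)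
  qed simp
  then show ?thesis by simp
qed simp

lemma lsum_add_fun: "lsum (\<lambda>x. h x + h' x) f = lsum h f + lsum h' f"
  by (simp add: lsum_def scale_right_distrib sum.distrib)

lemma lsum_scale_fun: "lsum (\<lambda>x. scale c (h x)) f = scale c (lsum h f)"
  by (simp add: lsum_def scale_sum_right mult.commute)

lemma lsum_sum_fun: "lsum (\<lambda>x. \<Sum>i\<in>I. h i x) f = (\<Sum>i\<in>I. lsum (h i) f)"
  unfolding lsum_def by (simp add: scale_sum_right sum.swap[of _ _ I])

lemma lsum_in_subspace:
  assumes "subspace V" "\<And>x. f x \<noteq> 0 \<Longrightarrow> h x \<in> V"
  shows "lsum h f \<in> V"
  unfolding lsum_def using assms by (intro subspace_sum subspace_scale) auto

lemma lsum_diff_fun: "lsum (\<lambda>x. h x - h' x) f = lsum h f - lsum h' f"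
  by (simp add: lsum_def scale_right_diff_distrib sum_subtractf)

end

interpretation fs: complex_space "fscale :: complex \<Rightarrow> ('x \<Rightarrow> complex) \<Rightarrow> _"
  by unfold_locales (auto simp: fscale_def fun_eq_iff algebra_simps)

interpretation cs: complex_space "(*) :: complex \<Rightarrow> complex \<Rightarrow> complex"
  by unfold_locales (auto simp: algebra_simps)

declare cs.scale_scale [simp del]

lemma delta_apply: "delta x y = (if y = x then 1 else 0)"
  by (simp add: delta_def)

lemma supp_delta [simp]: "{y. delta x y \<noteq> 0} = {x}"
  by (auto simp: delta_def)

lemma fs_lsum_delta [simp]: "fs.lsum h (delta x) = h x"
  and cs_lsum_delta [simp]: "cs.lsum k (delta x) = k x"
  by (simp_all add: fs.lsum_def cs.lsum_def, simp_all add: delta_def)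

lemma fscale_apply: "fscale c f x = c * f x"
  by (simp add: fscale_def)

lemma supp_fscale_subset: "{x. fscale c f x \<noteq> 0} \<subseteq> {x. f x \<noteq> 0}"
  by (auto simp: fscale_def)

lemma fs_lsum_fscale: "fs.lsum h (fscale c f) = fscale c (fs.lsum h f)"
proof (cases "c = 0")
  case False
  then have supp: "{x. fscale c f x \<noteq> 0} = {x. f x \<noteq> 0}" by (auto simp: fscale_apply)
  show ?thesis
    by (simp only: fs.lsum_def supp) (simp only: fscale_apply fs.scale_sum_right fs.scale_scale)
next
  case True
  then have "fscale c f = 0" by (simp add: fscale_def fun_eq_iff)
  then show ?thesis using True by simp
qed

lemma cs_lsum_fscale: "cs.lsum h (fscale c f) = c * cs.lsum h f"
proof (cases "c = 0")
  case False
  then have supp: "{x. fscale c f x \<noteq> 0} = {x. f x \<noteq> 0}" by (auto simp: fscale_apply)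
  show ?thesis
    by (simp only: cs.lsum_def supp) (simp only: fscale_apply sum_distrib_left mult.assoc)
next
  case True
  then have "fscale c f = 0" by (simp add: fscale_def fun_eq_iff)
  then show ?thesis using True by simp
qed

lemma free_spaceD: "f \<in> free_space S \<Longrightarrow> finite {x. f x \<noteq> 0}"
  "f \<in> free_space S \<Longrightarrow> f x \<noteq> 0 \<Longrightarrow> x \<in> S"
  by (auto simp: free_space_def)

lemma delta_free [simp]: "delta x \<in> free_space S \<longleftrightarrow> x \<in> S"
  by (simp add: free_space_def)

lemma free_space_subspace: "fs.subspace (free_space S)"
proof (rule fs.subspaceI)
  show "0 \<in> free_space S" by (simp add: free_space_def)
next
  fix f g :: "'a \<Rightarrow> complex" assume f: "f \<in> free_space S" "g \<in> free_space S"
  have "{x. (f + g) x \<noteq> 0} \<subseteq> {x. f x \<noteq> 0} \<union> {x. g x \<noteq> 0}" by auto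
  then show "f + g \<in> free_space S"
    using f unfolding free_space_def by (auto intro: finite_subset)
next
  fix c and f :: "'a \<Rightarrow> complex" assume f: "f \<in> free_space S"
  then show "fscale c f \<in> free_space S"
    using supp_fscale_subset[of c f] unfolding free_space_def by (auto intro: finite_subset)
qed

lemmas free_closed = fs.subspace_add[OF free_space_subspace] fs.subspace_diff[OF free_space_subspace]
  fs.subspace_scale[OF free_space_subspace] fs.subspace_0[OF free_space_subspace]
  fs.subspace_sum[OF free_space_subspace] fs.lsum_in_subspace[OF free_space_subspace]

lemma fs_lsum_add:
  "f \<in> free_space S \<Longrightarrow> g \<in> free_space S \<Longrightarrow> fs.lsum h (f + g) = fs.lsum h f + fs.lsum h g"
  by (intro fs.lsum_plus) (auto dest: free_spaceD)

lemma cs_lsum_add: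
  "f \<in> free_space S \<Longrightarrow> g \<in> free_space S \<Longrightarrow> cs.lsum h (f + g) = cs.lsum h f + cs.lsum h g"
  by (intro cs.lsum_plus) (auto dest: free_spaceD)

lemma fscale_minus_one: "fscale (- 1) f = - f"
  by (simp add: fscale_def fun_eq_iff)

lemma fs_lsum_diff:
  assumes "f \<in> free_space S" "g \<in> free_space S"
  shows "fs.lsum h (f - g) = fs.lsum h f - fs.lsum h g"
  using fs_lsum_add[OF assms(1) free_closed(3)[OF assms(2)], of h "- 1"] fs_lsum_fscale[of h "- 1" g]
  by (simp add: fscale_minus_one)

lemma cs_lsum_diff:
  assumes "f \<in> free_space S" "g \<in> free_space S"
  shows "cs.lsum h (f - g) = cs.lsum h f - cs.lsum h g"
  using cs_lsum_add[OF assms(1) free_closed(3)[OF assms(2)], of h "- 1"] cs_lsum_fscale[of h "- 1" g]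
  by (simp add: fscale_minus_one)

lemma sum_fun_apply: "(\<Sum>i\<in>I. f i) x = (\<Sum>i\<in>I. f i x)"
  by (induction I rule: infinite_finite_induct) auto

lemma lsum_delta_self:
  assumes "finite {x. f x \<noteq> 0}"
  shows "fs.lsum delta f = f"
proof
  fix y
  have "fs.lsum delta f y = (\<Sum>x | f x \<noteq> 0. f x * delta x y)"
    by (simp add: fs.lsum_def sum_fun_apply fscale_def)
  also have "\<dots> = f y"
    using assms by (simp add: delta_apply if_distrib[of "\<lambda>z. _ * z"] sum.delta' cong: if_cong)
  finally show "fs.lsum delta f y = f y" .
qed

lemma free_induct [consumes 1, case_names zero delta add scale]:
  assumes f: "f \<in> free_space S" and "P 0" "\<And>x. x \<in> S \<Longrightarrow> P (delta x)"
    and add: "\<And>f g. f \<in> free_space S \<Longrightarrow> g \<in> free_space S \<Longrightarrow> P f \<Longrightarrow> P g \<Longrightarrow> P (f + g)"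
    and "\<And>c f. f \<in> free_space S \<Longrightarrow> P f \<Longrightarrow> P (fscale c f)"
  shows "P f"
proof -
  have "P (\<Sum>x\<in>T. fscale (f x) (delta x)) \<and> (\<Sum>x\<in>T. fscale (f x) (delta x)) \<in> free_space S"
    if "finite T" "T \<subseteq> S" for T
    using that by (induction T rule: finite_induct) (auto simp: assms free_closed)
  then have "P (fs.lsum delta f)"
    unfolding fs.lsum_def using f by (auto simp: free_space_def)
  then show ?thesis using lsum_delta_self free_spaceD(1)[OF f] by metis
qed

lemma lsum_lsum:
  assumes "\<And>x. f x \<noteq> 0 \<Longrightarrow> finite {y. h x y \<noteq> 0}"
  shows "fs.lsum k (fs.lsum h f) = fs.lsum (\<lambda>x. fs.lsum k (h x)) f"
    and "cs.lsum l (fs.lsum h f) = cs.lsum (\<lambda>x. cs.lsum l (h x)) f"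
proof -
  have fin: "finite {y. fscale (f x) (h x) y \<noteq> 0}" if "x \<in> {x. f x \<noteq> 0}" for x
    using assms[of x] that finite_subset[OF supp_fscale_subset] by blast
  have "fs.lsum k (\<Sum>x | f x \<noteq> 0. fscale (f x) (h x)) =
      (\<Sum>x | f x \<noteq> 0. fs.lsum k (fscale (f x) (h x)))"
    by (rule fs.lsum_sum) (rule fin)
  also have "\<dots> = (\<Sum>x | f x \<noteq> 0. fscale (f x) (fs.lsum k (h x)))"
    by (simp only: fs_lsum_fscale)
  finally show "fs.lsum k (fs.lsum h f) = fs.lsum (\<lambda>x. fs.lsum k (h x)) f"
    by (simp only: fs.lsum_def[of h f] fs.lsum_def[of "\<lambda>x. fs.lsum k (h x)" f])
  have "cs.lsum l (\<Sum>x | f x \<noteq> 0. fscale (f x) (h x)) =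
      (\<Sum>x | f x \<noteq> 0. cs.lsum l (fscale (f x) (h x)))"
    by (rule cs.lsum_sum) (rule fin)
  also have "\<dots> = (\<Sum>x | f x \<noteq> 0. f x * cs.lsum l (h x))"
    by (simp only: cs_lsum_fscale)
  finally show "cs.lsum l (fs.lsum h f) = cs.lsum (\<lambda>x. cs.lsum l (h x)) f"
    by (simp only: fs.lsum_def[of h f] cs.lsum_def[of "\<lambda>x. cs.lsum l (h x)" f])
qed

lemma lin_ext_eq: "lin_ext F = fs.lsum (\<lambda>x. delta (F x))"
  by (simp add: lin_ext_def fs.lsum_def fun_eq_iff)

lemma bilin_ext_eq: "bilin_ext F f g = fs.lsum (\<lambda>x. fs.lsum (\<lambda>y. delta (F x y)) g) f"
  by (simp add: bilin_ext_def fs.lsum_def fs.scale_sum_right)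

text \<open>Together with \<open>bilin_ext_eq\<close>, either argument can be made the outer one, so
  linearity of \<open>lsum\<close> yields linearity in both.\<close>

lemma bilin_ext_flip: "bilin_ext F f g = fs.lsum (\<lambda>y. fs.lsum (\<lambda>x. delta (F x y)) f) g"
proof -
  have "bilin_ext F f g = (\<Sum>y | g y \<noteq> 0. \<Sum>x | f x \<noteq> 0. fscale (f x * g y) (delta (F x y)))"
    unfolding bilin_ext_def by (rule sum.swap)
  then show ?thesis
    by (simp add: fs.lsum_def fs.scale_sum_right mult.commute)
qed

lemma finite_supp_lsum:
  assumes "finite {x. f x \<noteq> 0}" "\<And>x. f x \<noteq> 0 \<Longrightarrow> finite {y. h x y \<noteq> 0}"
  shows "finite {y. fs.lsum h f y \<noteq> 0}"
proof -
  have "h x \<in> free_space UNIV" if "f x \<noteq> 0" for x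
    using assms(2)[OF that] by (simp add: free_space_def)
  then have "fs.lsum h f \<in> free_space UNIV" by (rule free_closed)
  then show ?thesis by (rule free_spaceD)
qed

lemma bilin_ext_delta [simp]: "bilin_ext F (delta x) (delta y) = delta (F x y)"
  by (simp add: bilin_ext_eq)

lemma bilin_ext_left:
  assumes "f \<in> free_space S" "g \<in> free_space S"
  shows "bilin_ext F (f + g) h = bilin_ext F f h + bilin_ext F g h"
    and "bilin_ext F (f - g) h = bilin_ext F f h - bilin_ext F g h"
  by (simp_all only: bilin_ext_eq fs_lsum_add[OF assms] fs_lsum_diff[OF assms])

lemma bilin_ext_right:
  assumes "f \<in> free_space S" "g \<in> free_space S"
  shows "bilin_ext F h (f + g) = bilin_ext F h f + bilin_ext F h g"
    and "bilin_ext F h (f - g) = bilin_ext F h f - bilin_ext F h g"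
  by (simp_all only: bilin_ext_flip fs_lsum_add[OF assms] fs_lsum_diff[OF assms])

lemma bilin_ext_fscale:
  "bilin_ext F (fscale c f) g = fscale c (bilin_ext F f g)"
  "bilin_ext F f (fscale c g) = fscale c (bilin_ext F f g)"
proof -
  show "bilin_ext F (fscale c f) g = fscale c (bilin_ext F f g)"
    by (simp only: bilin_ext_eq fs_lsum_fscale)
  show "bilin_ext F f (fscale c g) = fscale c (bilin_ext F f g)"
    by (simp only: bilin_ext_flip fs_lsum_fscale)
qed

lemma bilin_ext_free:
  assumes "f \<in> free_space S" "g \<in> free_space T" "\<And>x y. x \<in> S \<Longrightarrow> y \<in> T \<Longrightarrow> F x y \<in> U"
  shows "bilin_ext F f g \<in> free_space U"
  unfolding bilin_ext_eq using assms by (intro free_closed(6)) (auto dest: free_spaceD)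

lemma cs_lsum_bilin_ext:
  assumes "g \<in> free_space T"
  shows "cs.lsum k (bilin_ext F f g) = cs.lsum (\<lambda>x. cs.lsum (\<lambda>y. k (F x y)) g) f"
  using assms unfolding bilin_ext_eq
  by (subst lsum_lsum, force intro!: finite_supp_lsum dest: free_spaceD)
    (simp add: lsum_lsum)

text \<open>Four different operations are allowed because the application is the module law, where a
  product of algebra elements acts on a vector.\<close>

lemma bilin_ext_assoc:
  assumes "f \<in> free_space S" "g \<in> free_space T" "h \<in> free_space U"
    and "\<And>x y z. x \<in> S \<Longrightarrow> y \<in> T \<Longrightarrow> z \<in> U \<Longrightarrow> F (G x y) z = H x (K y z)"
  shows "bilin_ext F (bilin_ext G f g) h = bilin_ext H f (bilin_ext K g h)"
proof -
  have "bilin_ext F (bilin_ext G f g) h =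
      fs.lsum (\<lambda>x. fs.lsum (\<lambda>y. fs.lsum (\<lambda>z. delta (F (G x y) z)) h) g) f"
    using assms(2) unfolding bilin_ext_eq
    by (subst lsum_lsum, force intro!: finite_supp_lsum dest: free_spaceD)
      (simp add: lsum_lsum)
  also have "\<dots> = fs.lsum (\<lambda>x. fs.lsum (\<lambda>y. fs.lsum (\<lambda>z. delta (H x (K y z))) h) g) f"
    by (intro fs.lsum_cong arg_cong[of _ _ delta] assms(4))
      (erule free_spaceD(2)[OF assms(1)] free_spaceD(2)[OF assms(2)] free_spaceD(2)[OF assms(3)])+
  also have "\<dots> = bilin_ext H f (bilin_ext K g h)"
    using assms(3) unfolding bilin_ext_eq
    by (subst lsum_lsum, force intro!: finite_supp_lsum dest: free_spaceD)
      (simp add: lsum_lsum)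
  finally show ?thesis .
qed

section \<open>Cosets and quotient spaces\<close>

lemma coset_eq_iff:
  assumes "fs.subspace R"
  shows "f +o R = g +o R \<longleftrightarrow> f - g \<in> R"
proof
  assume "f +o R = g +o R"
  moreover have "f \<in> f +o R" using fs.subspace_0[OF assms] by (auto simp: elt_set_plus_def intro: bexI[of _ 0])
  ultimately obtain r where "r \<in> R" "f = g + r" by (auto simp: elt_set_plus_def)
  then show "f - g \<in> R" by simp
next
  assume d: "f - g \<in> R"
  show "f +o R = g +o R"
  proof (intro equalityI subsetI)
    fix x assume "x \<in> f +o R"
    then obtain r where "r \<in> R" "x = g + ((f - g) + r)" by (auto simp: elt_set_plus_def)
    then show "x \<in> g +o R" using fs.subspace_add[OF assms d] unfolding elt_set_plus_def by blast
  next
    fix x assume "x \<in> g +o R"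
    then obtain r where "r \<in> R" "x = f + (r - (f - g))" by (auto simp: elt_set_plus_def)
    then show "x \<in> f +o R" using fs.subspace_diff[OF assms _ d] unfolding elt_set_plus_def by blast
  qed
qed

lemma coset_eqI: "fs.subspace R \<Longrightarrow> f - g \<in> R \<Longrightarrow> f +o R = g +o R"
  by (simp add: coset_eq_iff)

lemma zero_coset: "0 +o R = (R :: ('x \<Rightarrow> complex) set)"
  by (auto simp: elt_set_plus_def)

lemma coset_plus:
  assumes "fs.subspace R"
  shows "(f +o R) + (g +o R) = (f + g) +o R"
proof -
  have "R + R = R"
    using fs.subspace_add[OF assms] fs.subspace_0[OF assms] by (force simp: set_plus_def)
  then show ?thesis by (simp add: set_plus_rearrange)
qed

lemma coset_plus_zero:
  assumes "fs.subspace R"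
  shows "(f +o R) + R = f +o R"
  using coset_plus[OF assms, of f 0] by (simp add: zero_coset)

text \<open>Scalar multiplication and actions on a quotient are defined by adding the relation space
  to the image of a coset. This fills the image up to a full coset, also when \<open>L\<close>
  shrinks it, as for the scalar 0.\<close>

lemma linear_image_coset:
  assumes "fs.subspace R" "fs.subspace R'" "\<And>r. r \<in> R \<Longrightarrow> L (f + r) - L f \<in> R'"
  shows "L ` (f +o R) + R' = L f +o R'"
proof (intro equalityI subsetI)
  fix x assume "x \<in> L ` (f +o R) + R'"
  then obtain r r' where r: "r \<in> R" "r' \<in> R'" "x = L (f + r) + r'"
    by (auto simp: set_plus_def elt_set_plus_def)
  then have "(L (f + r) - L f) + r' \<in> R'" using assms fs.subspace_add by blast
  moreover have "x = L f + ((L (f + r) - L f) + r')" using r by simp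
  ultimately show "x \<in> L f +o R'" unfolding elt_set_plus_def by blast
next
  fix x assume "x \<in> L f +o R'"
  then show "x \<in> L ` (f +o R) + R'"
    using fs.subspace_0[OF assms(1)] by (force simp: set_plus_def elt_set_plus_def)
qed

lemma coset_scale:
  assumes "fs.subspace R"
  shows "fscale c ` (f +o R) + R = fscale c f +o R"
  by (rule linear_image_coset[OF assms assms])
    (use fs.subspace_scale[OF assms] in \<open>simp add: fs.scale_right_distrib\<close>)

lemma quotient_space_simps:
  "carrier (quotient_space V R) = (\<lambda>f. f +o R) ` V"
  "zero (quotient_space V R) = R"
  "add (quotient_space V R) = (+)"
  "smult (quotient_space V R) c X = fscale c ` X + R"
  by (simp_all add: quotient_space_def)

text \<open>Stated for any record with these fields, so that it also serves quotient modules, which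
  carry an action in addition.\<close>

lemma quotient_vectorspace:
  fixes Q :: "(complex, ('x \<Rightarrow> complex) set, 'm) module_scheme"
  assumes V: "fs.subspace V" and R: "fs.subspace R"
    and Q: "carrier Q = (\<lambda>f. f +o R) ` V" "zero Q = R" "add Q = (+)"
      "\<And>c X. smult Q c X = fscale c ` X + R"
  shows "vectorspace (class_ring :: complex ring) Q"
proof (rule vectorspace_complexI)
  have smult: "c \<odot>\<^bsub>Q\<^esub> (f +o R) = fscale c f +o R" for c f
    by (simp only: Q(4) coset_scale[OF R])
  note Q' = Q(1-3) smult coset_plus[OF R] coset_plus_zero[OF R]
  show "\<zero>\<^bsub>Q\<^esub> \<in> carrier Q"
    unfolding Q(1,2) using fs.subspace_0[OF V] zero_coset[of R] by blast
  show "v \<oplus>\<^bsub>Q\<^esub> ((- 1) \<odot>\<^bsub>Q\<^esub> v) = \<zero>\<^bsub>Q\<^esub>" if "v \<in> carrier Q" for v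
    using that by (auto simp: Q' fscale_minus_one zero_coset)

  fix c d :: complex and u v w
  assume "v \<in> carrier Q"
  then show "c \<odot>\<^bsub>Q\<^esub> v \<in> carrier Q" "v \<oplus>\<^bsub>Q\<^esub> \<zero>\<^bsub>Q\<^esub> = v" "1 \<odot>\<^bsub>Q\<^esub> v = v"
    "(c * d) \<odot>\<^bsub>Q\<^esub> v = c \<odot>\<^bsub>Q\<^esub> (d \<odot>\<^bsub>Q\<^esub> v)"
    "(c + d) \<odot>\<^bsub>Q\<^esub> v = (c \<odot>\<^bsub>Q\<^esub> v) \<oplus>\<^bsub>Q\<^esub> (d \<odot>\<^bsub>Q\<^esub> v)"
    by (auto simp: Q' fs.scale_left_distrib fs.subspace_scale[OF V])
  assume "w \<in> carrier Q"
  then show "v \<oplus>\<^bsub>Q\<^esub> w \<in> carrier Q" "v \<oplus>\<^bsub>Q\<^esub> w = w \<oplus>\<^bsub>Q\<^esub> v"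
    "c \<odot>\<^bsub>Q\<^esub> (v \<oplus>\<^bsub>Q\<^esub> w) = (c \<odot>\<^bsub>Q\<^esub> v) \<oplus>\<^bsub>Q\<^esub> (c \<odot>\<^bsub>Q\<^esub> w)"
    using \<open>v \<in> carrier Q\<close>
    by (auto simp: Q' fs.scale_right_distrib fs.subspace_add[OF V] add.commute)
  assume "u \<in> carrier Q"
  then show "(u \<oplus>\<^bsub>Q\<^esub> v) \<oplus>\<^bsub>Q\<^esub> w = u \<oplus>\<^bsub>Q\<^esub> (v \<oplus>\<^bsub>Q\<^esub> w)"
    by (simp add: Q(3) add.assoc)
qed

section \<open>Multilinear maps on tensor products\<close>

lemma in_listset_iff:
  "xs \<in> listset Xs \<longleftrightarrow> length xs = length Xs \<and> (\<forall>j<length Xs. xs ! j \<in> Xs ! j)"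
proof (induction Xs arbitrary: xs)
  case (Cons X Xs)
  show ?case
  proof (cases xs)
    case (Cons y ys)
    have "(\<forall>j<Suc (length Xs). (y # ys) ! j \<in> (X # Xs) ! j) \<longleftrightarrow>
        y \<in> X \<and> (\<forall>j<length Xs. ys ! j \<in> Xs ! j)"
      by (auto simp: less_Suc_eq_0_disj)
    then show ?thesis using Cons.IH[of ys] Cons by (auto simp: set_Cons_def)
  qed (auto simp: set_Cons_def)
qed simp

lemma finite_listset: "(\<And>j. j < length Xs \<Longrightarrow> finite (Xs ! j)) \<Longrightarrow> finite (listset Xs)"
proof (induction Xs)
  case (Cons X Xs)
  have "finite X" "finite (listset Xs)" using Cons.prems[of 0] Cons.prems[of "Suc _"] Cons.IH by auto
  moreover have "listset (X # Xs) = (\<lambda>(x, xs). x # xs) ` (X \<times> listset Xs)"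
    by (auto simp: set_Cons_def)
  ultimately show ?case by simp
qed simp

text \<open>Distributivity of products over sums, indexed by tuples. It is the reason why Kronecker
  products of matrices multiply slot by slot.\<close>

lemma sum_prod_listset:
  fixes F :: "nat \<Rightarrow> 's \<Rightarrow> complex"
  shows "(\<Sum>us\<in>listset Xs. \<Prod>j<length Xs. F j (us ! j)) = (\<Prod>j<length Xs. \<Sum>u\<in>Xs ! j. F j u)"
proof (induction Xs arbitrary: F)
  case (Cons X Xs)
  have eq: "listset (X # Xs) = (\<lambda>(x, xs). x # xs) ` (X \<times> listset Xs)"
    by (auto simp: set_Cons_def)
  have "(\<Sum>us\<in>listset (X # Xs). \<Prod>j<length (X # Xs). F j (us ! j)) =
      (\<Sum>(x, xs)\<in>X \<times> listset Xs. F 0 x * (\<Prod>j<length Xs. F (Suc j) (xs ! j)))"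
    unfolding eq by (subst sum.reindex)
      (auto simp: inj_on_def prod.lessThan_Suc_shift case_prod_unfold simp del: prod.lessThan_Suc)
  also have "\<dots> = (\<Sum>x\<in>X. F 0 x) * (\<Sum>xs\<in>listset Xs. \<Prod>j<length Xs. F (Suc j) (xs ! j))"
    by (simp add: sum_product sum.cartesian_product)
  also have "\<dots> = (\<Prod>j<length (X # Xs). \<Sum>u\<in>(X # Xs) ! j. F j u)"
    using Cons.IH[of "\<lambda>j. F (Suc j)"] by (simp add: prod.lessThan_Suc_shift del: prod.lessThan_Suc)
  finally show ?case .
qed simp

text \<open>Isolating the factor of slot \<open>j\<close> shows that a product of functionals is
  linear in that slot.\<close>

lemma prod_list_update:
  fixes F :: "nat \<Rightarrow> 'v \<Rightarrow> complex"
  assumes "j < k" "length vs = k"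
  shows "(\<Prod>i<k. F i (vs[j := v] ! i)) = F j v * (\<Prod>i\<in>{..<k} - {j}. F i (vs ! i))"
proof -
  have "(\<Prod>i<k. F i (vs[j := v] ! i)) = F j (vs[j := v] ! j) * (\<Prod>i\<in>{..<k} - {j}. F i (vs[j := v] ! i))"
    using assms by (intro prod.remove) auto
  also have "(\<Prod>i\<in>{..<k} - {j}. F i (vs[j := v] ! i)) = (\<Prod>i\<in>{..<k} - {j}. F i (vs ! i))"
    by (rule prod.cong) auto
  finally show ?thesis using assms by simp
qed

lemma multilinear_rels_subspace: "fs.subspace (multilinear_rels Vs)"
  unfolding multilinear_rels_def by (rule fs.subspace_span)

text \<open>Closure is all that is assumed, so that the same facts serve lists of algebras and lists
  of modules.\<close>

locale slot_spaces =
  fixes Vs :: "(complex, 'v, 'm) module_scheme list"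
  assumes slot_add: "j < length Vs \<Longrightarrow> v \<in> carrier (Vs ! j) \<Longrightarrow> w \<in> carrier (Vs ! j) \<Longrightarrow>
      v \<oplus>\<^bsub>Vs ! j\<^esub> w \<in> carrier (Vs ! j)"
    and slot_smult: "j < length Vs \<Longrightarrow> v \<in> carrier (Vs ! j) \<Longrightarrow> c \<odot>\<^bsub>Vs ! j\<^esub> v \<in> carrier (Vs ! j)"
begin

abbreviation "car \<equiv> listset (map carrier Vs)"
abbreviation "rels \<equiv> multilinear_rels Vs"

lemma car_iff: "vs \<in> car \<longleftrightarrow> length vs = length Vs \<and> (\<forall>j<length Vs. vs ! j \<in> carrier (Vs ! j))"
  by (auto simp: in_listset_iff)

lemma car_update: "vs \<in> car \<Longrightarrow> j < length Vs \<Longrightarrow> v \<in> carrier (Vs ! j) \<Longrightarrow> vs[j := v] \<in> car"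
  by (auto simp: car_iff nth_list_update)

lemma rels_add:
  assumes "vs \<in> car" "j < length Vs" "v \<in> carrier (Vs ! j)" "w \<in> carrier (Vs ! j)"
  shows "delta (vs[j := v \<oplus>\<^bsub>Vs ! j\<^esub> w]) - delta (vs[j := v]) - delta (vs[j := w]) \<in> rels"
  unfolding multilinear_rels_def by (rule fs.span_base) (use assms in blast)

lemma rels_smult:
  assumes "vs \<in> car" "j < length Vs" "v \<in> carrier (Vs ! j)"
  shows "delta (vs[j := c \<odot>\<^bsub>Vs ! j\<^esub> v]) - fscale c (delta (vs[j := v])) \<in> rels"
  unfolding multilinear_rels_def by (rule fs.span_base) (use assms in blast)

lemma rels_minimal:
  assumes "fs.subspace K"
    and "\<And>vs j v w. vs \<in> car \<Longrightarrow> j < length Vs \<Longrightarrow> v \<in> carrier (Vs ! j) \<Longrightarrow> w \<in> carrier (Vs ! j) \<Longrightarrow>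
      delta (vs[j := v \<oplus>\<^bsub>Vs ! j\<^esub> w]) - delta (vs[j := v]) - delta (vs[j := w]) \<in> K"
    and "\<And>vs j c v. vs \<in> car \<Longrightarrow> j < length Vs \<Longrightarrow> v \<in> carrier (Vs ! j) \<Longrightarrow>
      delta (vs[j := c \<odot>\<^bsub>Vs ! j\<^esub> v]) - fscale c (delta (vs[j := v])) \<in> K"
  shows "rels \<subseteq> K"
  unfolding multilinear_rels_def by (rule fs.span_minimal[OF _ assms(1)]) (use assms(2,3) in blast)

lemma rels_free: "rels \<subseteq> free_space car"
  by (rule rels_minimal[OF free_space_subspace])
    (intro free_closed; simp add: car_update slot_add slot_smult)+

text \<open>Universal property of the tensor product in relative form, multilinearity being required
  only modulo \<open>R\<close>. The preimage of \<open>R\<close> is a subspace that contains the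
  generating relations.\<close>

lemma lsum_rels:
  assumes "fs.subspace R" "r \<in> rels"
    and add: "\<And>vs j v w. vs \<in> car \<Longrightarrow> j < length Vs \<Longrightarrow> v \<in> carrier (Vs ! j) \<Longrightarrow> w \<in> carrier (Vs ! j) \<Longrightarrow>
      h (vs[j := v \<oplus>\<^bsub>Vs ! j\<^esub> w]) - h (vs[j := v]) - h (vs[j := w]) \<in> R"
    and smult: "\<And>vs j c v. vs \<in> car \<Longrightarrow> j < length Vs \<Longrightarrow> v \<in> carrier (Vs ! j) \<Longrightarrow>
      h (vs[j := c \<odot>\<^bsub>Vs ! j\<^esub> v]) - fscale c (h (vs[j := v])) \<in> R"
  shows "fs.lsum h r \<in> R"
proof -
  let ?K = "{f \<in> free_space car. fs.lsum h f \<in> R}"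
  have K: "fs.subspace ?K"
    by (rule fs.subspaceI)
      (auto simp: free_closed fs_lsum_add[of _ car] fs_lsum_fscale fs.subspace_0[OF assms(1)]
        fs.subspace_add[OF assms(1)] fs.subspace_scale[OF assms(1)])
  have d: "delta (vs[j := v]) \<in> free_space car" if "vs \<in> car" "j < length Vs" "v \<in> carrier (Vs ! j)" for vs j v
    using that by (simp add: car_update)
  have "rels \<subseteq> ?K"
  proof (rule rels_minimal[OF K])
    fix vs j v w assume a: "vs \<in> car" "j < length Vs" "v \<in> carrier (Vs ! j)" "w \<in> carrier (Vs ! j)"
    note dA = d[OF a(1,2) slot_add[OF a(2-4)]] and dB = d[OF a(1-3)] and dC = d[OF a(1,2,4)]
    show "delta (vs[j := v \<oplus>\<^bsub>Vs ! j\<^esub> w]) - delta (vs[j := v]) - delta (vs[j := w]) \<in> ?K"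
      using free_closed(2)[OF free_closed(2)[OF dA dB] dC] add[OF a]
      unfolding mem_Collect_eq fs_lsum_diff[OF free_closed(2)[OF dA dB] dC] fs_lsum_diff[OF dA dB] fs_lsum_delta
      by blast
  next
    fix vs j c v assume a: "vs \<in> car" "j < length Vs" "v \<in> carrier (Vs ! j)"
    note dA = d[OF a(1,2) slot_smult[OF a(2,3)]] and dB = free_closed(3)[OF d[OF a(1-3)]]
    show "delta (vs[j := c \<odot>\<^bsub>Vs ! j\<^esub> v]) - fscale c (delta (vs[j := v])) \<in> ?K"
      using free_closed(2)[OF dA dB] smult[OF a]
      unfolding mem_Collect_eq fs_lsum_diff[OF dA dB] fs_lsum_fscale fs_lsum_delta by blast
  qed
  then show ?thesis using assms(2) by blast
qed

text \<open>One linear functional per slot gives a multilinear function, hence a functional on the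
  tensor product. Such functionals define the matrix coefficients of tensors and show that certain
  pure tensors are nonzero.\<close>

lemma functional_rels:
  assumes "r \<in> rels"
    and add: "\<And>j v w. j < length Vs \<Longrightarrow> v \<in> carrier (Vs ! j) \<Longrightarrow> w \<in> carrier (Vs ! j) \<Longrightarrow>
      F j (v \<oplus>\<^bsub>Vs ! j\<^esub> w) = F j v + F j w"
    and smult: "\<And>j c v. j < length Vs \<Longrightarrow> v \<in> carrier (Vs ! j) \<Longrightarrow> F j (c \<odot>\<^bsub>Vs ! j\<^esub> v) = c * F j v"
  shows "cs.lsum (\<lambda>vs. \<Prod>j<length Vs. F j (vs ! j)) r = 0"
proof -
  let ?h = "\<lambda>vs. \<Prod>j<length Vs. F j (vs ! j)"
  let ?K = "{f \<in> free_space car. cs.lsum ?h f = 0}"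
  have K: "fs.subspace ?K"
    by (rule fs.subspaceI) (auto simp: free_closed cs_lsum_add[of _ car] cs_lsum_fscale)
  have d: "delta (vs[j := v]) \<in> free_space car" if "vs \<in> car" "j < length Vs" "v \<in> carrier (Vs ! j)" for vs j v
    using that by (simp add: car_update)
  have "rels \<subseteq> ?K"
  proof (rule rels_minimal[OF K])
    fix vs j v w assume a: "vs \<in> car" "j < length Vs" "v \<in> carrier (Vs ! j)" "w \<in> carrier (Vs ! j)"
    have l: "length vs = length Vs" using a by (simp add: car_iff)
    note dA = d[OF a(1,2) slot_add[OF a(2-4)]] and dB = d[OF a(1-3)] and dC = d[OF a(1,2,4)]
    show "delta (vs[j := v \<oplus>\<^bsub>Vs ! j\<^esub> w]) - delta (vs[j := v]) - delta (vs[j := w]) \<in> ?K"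
      using free_closed(2)[OF free_closed(2)[OF dA dB] dC]
      unfolding mem_Collect_eq cs_lsum_diff[OF free_closed(2)[OF dA dB] dC] cs_lsum_diff[OF dA dB] cs_lsum_delta
      by (simp add: prod_list_update[OF a(2) l] add[OF a(2-4)] algebra_simps)
  next
    fix vs j c v assume a: "vs \<in> car" "j < length Vs" "v \<in> carrier (Vs ! j)"
    have l: "length vs = length Vs" using a by (simp add: car_iff)
    note dA = d[OF a(1,2) slot_smult[OF a(2,3)]] and dB = free_closed(3)[OF d[OF a(1-3)]]
    show "delta (vs[j := c \<odot>\<^bsub>Vs ! j\<^esub> v]) - fscale c (delta (vs[j := v])) \<in> ?K"
      using free_closed(2)[OF dA dB]
      unfolding mem_Collect_eq cs_lsum_diff[OF dA dB] cs_lsum_fscale cs_lsum_delta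
      by (simp add: prod_list_update[OF a(2) l] smult[OF a(2,3)])
  qed
  then show ?thesis using assms(1) by blast
qed

end

text \<open>Treats the multiplication of a list of algebras (\<open>Us = Vs\<close>) and the action
  on a list of modules in one setting.\<close>

locale slot_bilinear = V: slot_spaces Vs + U: slot_spaces Us
  for Vs :: "(complex, 'v, 'm) module_scheme list" and Us :: "(complex, 'u, 'k) module_scheme list" +
  fixes b :: "nat \<Rightarrow> 'v \<Rightarrow> 'u \<Rightarrow> 'u"
  assumes len: "length Us = length Vs"
    and b_closed: "j < length Vs \<Longrightarrow> v \<in> carrier (Vs ! j) \<Longrightarrow> u \<in> carrier (Us ! j) \<Longrightarrow> b j v u \<in> carrier (Us ! j)"
    and b_add_left: "j < length Vs \<Longrightarrow> v \<in> carrier (Vs ! j) \<Longrightarrow> v' \<in> carrier (Vs ! j) \<Longrightarrow> u \<in> carrier (Us ! j) \<Longrightarrow>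
      b j (v \<oplus>\<^bsub>Vs ! j\<^esub> v') u = b j v u \<oplus>\<^bsub>Us ! j\<^esub> b j v' u"
    and b_add_right: "j < length Vs \<Longrightarrow> v \<in> carrier (Vs ! j) \<Longrightarrow> u \<in> carrier (Us ! j) \<Longrightarrow> u' \<in> carrier (Us ! j) \<Longrightarrow>
      b j v (u \<oplus>\<^bsub>Us ! j\<^esub> u') = b j v u \<oplus>\<^bsub>Us ! j\<^esub> b j v u'"
    and b_smult_left: "j < length Vs \<Longrightarrow> v \<in> carrier (Vs ! j) \<Longrightarrow> u \<in> carrier (Us ! j) \<Longrightarrow>
      b j (c \<odot>\<^bsub>Vs ! j\<^esub> v) u = c \<odot>\<^bsub>Us ! j\<^esub> b j v u"
    and b_smult_right: "j < length Vs \<Longrightarrow> v \<in> carrier (Vs ! j) \<Longrightarrow> u \<in> carrier (Us ! j) \<Longrightarrow>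
      b j v (c \<odot>\<^bsub>Us ! j\<^esub> u) = c \<odot>\<^bsub>Us ! j\<^esub> b j v u"
begin

definition F :: "'v list \<Rightarrow> 'u list \<Rightarrow> 'u list" where
  "F vs us = map (\<lambda>j. b j (vs ! j) (us ! j)) [0..<length Vs]"

lemma F_car: "vs \<in> V.car \<Longrightarrow> us \<in> U.car \<Longrightarrow> F vs us \<in> U.car"
  by (auto simp: F_def V.car_iff U.car_iff len b_closed)

lemma F_nth: "j < length Vs \<Longrightarrow> F vs us ! j = b j (vs ! j) (us ! j)"
  by (simp add: F_def)

lemma F_update_left:
  assumes "j < length Vs" "length vs = length Vs"
  shows "F (vs[j := v]) us = (F vs us)[j := b j v (us ! j)]"
  by (rule nth_equalityI) (use assms in \<open>auto simp: F_def nth_list_update\<close>)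

lemma F_update_right:
  assumes "j < length Vs" "length us = length Vs"
  shows "F vs (us[j := u]) = (F vs us)[j := b j (vs ! j) u]"
  by (rule nth_equalityI) (use assms in \<open>auto simp: F_def nth_list_update\<close>)

lemma bilin_rels_left:
  assumes "r \<in> V.rels" "g \<in> free_space U.car"
  shows "bilin_ext F r g \<in> U.rels"
  unfolding bilin_ext_flip
proof (rule fs.lsum_in_subspace[OF multilinear_rels_subspace])
  fix us assume "g us \<noteq> 0"
  then have us: "us \<in> U.car" using assms(2) by (auto dest: free_spaceD)
  then have us': "length us = length Vs" "\<And>j. j < length Vs \<Longrightarrow> us ! j \<in> carrier (Us ! j)"
    by (auto simp: U.car_iff len)
  show "fs.lsum (\<lambda>vs. delta (F vs us)) r \<in> U.rels"
  proof (rule V.lsum_rels[OF multilinear_rels_subspace assms(1)])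
    fix vs j v w assume a: "vs \<in> V.car" "j < length Vs" "v \<in> carrier (Vs ! j)" "w \<in> carrier (Vs ! j)"
    have l: "length vs = length Vs" using a by (simp add: V.car_iff)
    show "delta (F (vs[j := v \<oplus>\<^bsub>Vs ! j\<^esub> w]) us) - delta (F (vs[j := v]) us) - delta (F (vs[j := w]) us) \<in> U.rels"
      using U.rels_add[OF F_car[OF a(1) us], of j "b j v (us ! j)" "b j w (us ! j)"] a us'
      by (simp add: F_update_left[OF a(2) l] b_add_left b_closed len)
  next
    fix vs j c v assume a: "vs \<in> V.car" "j < length Vs" "v \<in> carrier (Vs ! j)"
    have l: "length vs = length Vs" using a by (simp add: V.car_iff)
    show "delta (F (vs[j := c \<odot>\<^bsub>Vs ! j\<^esub> v]) us) - fscale c (delta (F (vs[j := v]) us)) \<in> U.rels"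
      using U.rels_smult[OF F_car[OF a(1) us], of j "b j v (us ! j)" c] a us'
      by (simp add: F_update_left[OF a(2) l] b_smult_left b_closed len)
  qed
qed

lemma bilin_rels_right:
  assumes "f \<in> free_space V.car" "r \<in> U.rels"
  shows "bilin_ext F f r \<in> U.rels"
  unfolding bilin_ext_eq
proof (rule fs.lsum_in_subspace[OF multilinear_rels_subspace])
  fix vs assume "f vs \<noteq> 0"
  then have vs: "vs \<in> V.car" using assms(1) by (auto dest: free_spaceD)
  then have vs': "\<And>j. j < length Vs \<Longrightarrow> vs ! j \<in> carrier (Vs ! j)"
    by (auto simp: V.car_iff)
  show "fs.lsum (\<lambda>us. delta (F vs us)) r \<in> U.rels"
  proof (rule U.lsum_rels[OF multilinear_rels_subspace assms(2)])
    fix us j u w assume a: "us \<in> U.car" "j < length Us" "u \<in> carrier (Us ! j)" "w \<in> carrier (Us ! j)"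
    have l: "length us = length Vs" and j: "j < length Vs" using a by (simp_all add: U.car_iff len)
    show "delta (F vs (us[j := u \<oplus>\<^bsub>Us ! j\<^esub> w])) - delta (F vs (us[j := u])) - delta (F vs (us[j := w])) \<in> U.rels"
      using U.rels_add[OF F_car[OF vs a(1)], of j "b j (vs ! j) u" "b j (vs ! j) w"] a vs' j
      by (simp add: F_update_right[OF j l] b_add_right b_closed)
  next
    fix us j c u assume a: "us \<in> U.car" "j < length Us" "u \<in> carrier (Us ! j)"
    have l: "length us = length Vs" and j: "j < length Vs" using a by (simp_all add: U.car_iff len)
    show "delta (F vs (us[j := c \<odot>\<^bsub>Us ! j\<^esub> u])) - fscale c (delta (F vs (us[j := u]))) \<in> U.rels"
      using U.rels_smult[OF F_car[OF vs a(1)], of j "b j (vs ! j) u" c] a vs' j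
      by (simp add: F_update_right[OF j l] b_smult_right b_closed)
  qed
qed

text \<open>Other representatives \<open>f + r\<close> and \<open>g + s\<close> change the value by
  two terms, each with a relation as one argument, and such terms are relations. Hence the union
  over all representatives is a single coset.\<close>

lemma bilin_coset:
  assumes f: "f \<in> free_space V.car" and g: "g \<in> free_space U.car"
  shows "(\<Union>f'\<in>f +o V.rels. \<Union>g'\<in>g +o U.rels. bilin_ext F f' g' +o U.rels) = bilin_ext F f g +o U.rels"
proof -
  have "bilin_ext F f' g' +o U.rels = bilin_ext F f g +o U.rels"
    if fg: "f' \<in> f +o V.rels" "g' \<in> g +o U.rels" for f' g'
  proof (rule coset_eqI[OF multilinear_rels_subspace])
    obtain r s where r: "r \<in> V.rels" "f' = f + r" and s: "s \<in> U.rels" "g' = g + s"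
      using fg unfolding elt_set_plus_def by blast
    have rf: "r \<in> free_space V.car" and sf: "s \<in> free_space U.car"
      using r s V.rels_free U.rels_free by auto
    have "bilin_ext F f' g' - bilin_ext F f g = bilin_ext F r g' + bilin_ext F f s"
      using bilin_ext_left(1)[OF f rf, of F g'] bilin_ext_right(1)[OF g sf, of F f]
      by (simp add: r s)
    moreover have "g' \<in> free_space U.car" using s sf g free_closed by simp
    ultimately show "bilin_ext F f' g' - bilin_ext F f g \<in> U.rels"
      using bilin_rels_left[OF r(1)] bilin_rels_right[OF f s(1)]
        fs.subspace_add[OF multilinear_rels_subspace] by metis
  qed
  moreover have "f \<in> f +o V.rels" "g \<in> g +o U.rels"
    using fs.subspace_0[OF multilinear_rels_subspace] by (auto simp: elt_set_plus_def intro!: bexI[of _ 0])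
  ultimately show ?thesis by blast
qed

end

section \<open>Tensor products of matrix algebras and of their modules\<close>

text \<open>The maps \<open>sh\<close> and \<open>coef\<close> are common to all factors, as they
  are for the algebras \<open>CP n m\<close> with varying \<open>m\<close>; only the index sets
  differ.\<close>

locale block_algebras =
  fixes As :: "(complex, 'a) module list" and Xs :: "'s set list" and sh :: "'s \<Rightarrow> 'c"
    and coef :: "'a \<Rightarrow> 's \<Rightarrow> 's \<Rightarrow> complex"
  assumes length_Xs: "length Xs = length As"
    and block: "j < length As \<Longrightarrow> block_algebra (As ! j) (Xs ! j) sh coef"
begin

sublocale slot_spaces As
  by unfold_locales
    (simp_all add: block_algebra.add_closed[OF block] block_algebra.smult_closed[OF block])

sublocale mul: slot_bilinear As As "\<lambda>j. mult (As ! j)"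
  by unfold_locales
    (simp_all add: block_algebra.mult_closed[OF block] block_algebra.algebra_laws[OF block])

abbreviation "T \<equiv> tensor_algebra As"
abbreviation "XX \<equiv> listset Xs"

lemma XX_iff: "ss \<in> XX \<longleftrightarrow> length ss = length As \<and> (\<forall>j<length As. ss ! j \<in> Xs ! j)"
  by (simp add: in_listset_iff length_Xs)

text \<open>Entries of the Kronecker product of the matrices in the slots. They are extended
  linearly in \<open>coefF\<close> and pass to cosets in \<open>coefT\<close> through a
  representative.\<close>

definition coef0 :: "'s list \<Rightarrow> 's list \<Rightarrow> 'a list \<Rightarrow> complex" where
  "coef0 ts ss as = (\<Prod>j<length As. coef (as ! j) (ts ! j) (ss ! j))"

definition coefF :: "'s list \<Rightarrow> 's list \<Rightarrow> ('a list \<Rightarrow> complex) \<Rightarrow> complex" where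
  "coefF ts ss = cs.lsum (coef0 ts ss)"

definition coefT :: "('a list \<Rightarrow> complex) set \<Rightarrow> 's list \<Rightarrow> 's list \<Rightarrow> complex" where
  "coefT Y ts ss = coefF ts ss (SOME f. f \<in> Y)"

lemma coefF_linear:
  assumes "f \<in> free_space car" "g \<in> free_space car"
  shows "coefF ts ss (f + g) = coefF ts ss f + coefF ts ss g"
    and "coefF ts ss (f - g) = coefF ts ss f - coefF ts ss g"
    and "coefF ts ss (fscale c h) = c * coefF ts ss h"
    and "coefF ts ss (delta as) = coef0 ts ss as"
  by (simp_all only: coefF_def cs_lsum_add[OF assms] cs_lsum_diff[OF assms] cs_lsum_fscale cs_lsum_delta)

lemma coefF_rels:
  assumes "r \<in> rels" "ts \<in> XX" "ss \<in> XX"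
  shows "coefF ts ss r = 0"
  unfolding coefF_def coef0_def
  by (rule functional_rels[OF assms(1)])
    (use assms XX_iff in \<open>auto simp: block_algebra.coef_add[OF block] block_algebra.coef_smult[OF block]\<close>)

lemma coefT_coset:
  assumes "f \<in> free_space car" "ts \<in> XX" "ss \<in> XX"
  shows "coefT (f +o rels) ts ss = coefF ts ss f"
proof -
  define g where "g = (SOME g. g \<in> f +o rels)"
  have "f \<in> f +o rels" using fs.subspace_0[OF multilinear_rels_subspace]
    by (auto simp: elt_set_plus_def intro!: bexI[of _ 0])
  then have "g \<in> f +o rels" unfolding g_def by (rule someI[of "\<lambda>g. g \<in> f +o rels"])
  then obtain r where r: "r \<in> rels" "g = f + r" unfolding elt_set_plus_def by blast
  then have "coefF ts ss g = coefF ts ss f"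
    using coefF_linear(1)[OF assms(1)] rels_free coefF_rels[OF r(1) assms(2,3)] by auto
  then show ?thesis by (simp add: coefT_def g_def)
qed

lemma T_simps:
  "carrier T = (\<lambda>f. f +o rels) ` free_space car"
  "zero T = rels" "add T = (+)" "smult T c Y = fscale c ` Y + rels"
  "one T = delta (map one As) +o rels"
  by (simp_all add: tensor_algebra_def tensor_space_def quotient_space_def)

lemma T_ops:
  assumes "f \<in> free_space car" "g \<in> free_space car"
  shows "(f +o rels) \<oplus>\<^bsub>T\<^esub> (g +o rels) = (f + g) +o rels"
    and "c \<odot>\<^bsub>T\<^esub> (f +o rels) = fscale c f +o rels"
    and "(f +o rels) \<otimes>\<^bsub>T\<^esub> (g +o rels) = bilin_ext mul.F f g +o rels"
proof -
  show "(f +o rels) \<oplus>\<^bsub>T\<^esub> (g +o rels) = (f + g) +o rels"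
    by (simp only: T_simps coset_plus[OF multilinear_rels_subspace])
  show "c \<odot>\<^bsub>T\<^esub> (f +o rels) = fscale c f +o rels"
    by (simp only: T_simps coset_scale[OF multilinear_rels_subspace])
  have "(f +o rels) \<otimes>\<^bsub>T\<^esub> (g +o rels) =
      (\<Union>f'\<in>f +o rels. \<Union>g'\<in>g +o rels. bilin_ext mul.F f' g' +o rels)"
    by (simp add: tensor_algebra_def mul.F_def[abs_def])
  then show "(f +o rels) \<otimes>\<^bsub>T\<^esub> (g +o rels) = bilin_ext mul.F f g +o rels"
    using mul.bilin_coset[OF assms] by simp
qed

lemma mulF_free: "f \<in> free_space car \<Longrightarrow> g \<in> free_space car \<Longrightarrow> bilin_ext mul.F f g \<in> free_space car"
  by (rule bilin_ext_free) (auto simp: mul.F_car)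

lemma one_car: "map one As \<in> car"
  using block_algebra.one_closed[OF block] by (auto simp: car_iff)

definition EE :: "'s list \<Rightarrow> 's list \<Rightarrow> 'a list" where
  "EE ts ss = map (\<lambda>j. block_algebra.E (As ! j) (Xs ! j) coef (ts ! j) (ss ! j)) [0..<length As]"

lemma EE_car:
  assumes "ts \<in> XX" "ss \<in> XX" "map sh ts = map sh ss"
  shows "EE ts ss \<in> car"
proof -
  have "sh (ts ! j) = sh (ss ! j)" if "j < length As" for j
    using assms that by (metis XX_iff nth_map)
  then show ?thesis
    using assms unfolding car_iff XX_iff by (auto simp: EE_def block_algebra.E_props(1)[OF block])
qed

lemma coef0_EE:
  assumes "ts \<in> XX" "ss \<in> XX" "map sh ts = map sh ss" "ts' \<in> XX" "ss' \<in> XX"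
  shows "coef0 ts' ss' (EE ts ss) = of_bool (ts' = ts \<and> ss' = ss)"
proof -
  have sh: "sh (ts ! j) = sh (ss ! j)" if "j < length As" for j
    using assms that by (metis XX_iff nth_map)
  have "coef0 ts' ss' (EE ts ss) = (\<Prod>j<length As. of_bool (ts' ! j = ts ! j \<and> ss' ! j = ss ! j))"
    unfolding coef0_def
    by (rule prod.cong) (use assms sh XX_iff in \<open>auto simp: EE_def block_algebra.E_props(2)[OF block]\<close>)
  also have "\<dots> = of_bool (ts' = ts \<and> ss' = ss)"
    using assms unfolding XX_iff by (auto simp: list_eq_iff_nth_eq)
  finally show ?thesis .
qed

lemma coef0_sh:
  assumes "as \<in> car" "ts \<in> XX" "ss \<in> XX" "map sh ts \<noteq> map sh ss"
  shows "coef0 ts ss as = 0"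
proof -
  obtain j where "j < length As" "sh (ts ! j) \<noteq> sh (ss ! j)"
    using assms unfolding XX_iff by (auto simp: list_eq_iff_nth_eq)
  then show ?thesis using assms unfolding coef0_def XX_iff car_iff
    by (intro prod_zero bexI[of _ j]) (auto intro: block_algebra.coef_sh[OF block])
qed

text \<open>Rewrites \<open>f\<close> in tensors of matrix units. That \<open>f\<close> agrees with
  its expansion modulo relations means that a coset is determined by its coefficients, which is the
  injectivity required of \<open>coefT\<close>.\<close>

definition expansion :: "('a list \<Rightarrow> complex) \<Rightarrow> 'a list \<Rightarrow> complex" where
  "expansion f = (\<Sum>(ts, ss)\<in>{(ts, ss) \<in> XX \<times> XX. map sh ts = map sh ss}.
     fscale (coefF ts ss f) (delta (EE ts ss)))"

lemma finite_XX: "finite XX"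
  by (rule finite_listset) (simp add: length_Xs block_algebra.finite_X[OF block])

text \<open>Multilinearity modulo \<open>rels\<close> lets \<open>block_induct\<close> treat one
  slot while the others stay fixed, until all slots contain matrix units; there the expansion is the
  tensor itself.\<close>

lemma expansion_delta:
  assumes as: "as \<in> car"
  shows "delta as - expansion (delta as) \<in> rels"
proof -
  let ?U = "{f \<in> free_space car. f - expansion f \<in> rels}"
  note R = multilinear_rels_subspace[of As]
  have plus: "expansion (f + g) = expansion f + expansion g"
    if "f \<in> free_space car" "g \<in> free_space car" for f g
    unfolding expansion_def coefF_linear(1)[OF that] fs.scale_left_distrib case_prod_unfold sum.distrib ..
  have scale: "expansion (fscale c f) = fscale c (expansion f)"
    if "f \<in> free_space car" for c f
    unfolding expansion_def coefF_linear(3)[OF that that] fs.scale_sum_right case_prod_unfold fs.scale_scale ..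
  have U: "fs.subspace ?U"
  proof (rule fs.subspaceI)
    show "0 \<in> ?U" using scale[OF free_closed(4), of 0] by (simp add: free_closed fs.subspace_0[OF R])
  next
    fix f g assume a: "f \<in> ?U" "g \<in> ?U"
    have "(f - expansion f) + (g - expansion g) \<in> rels"
      using a fs.subspace_add[OF R] by blast
    moreover have "(f + g) - expansion (f + g) = (f - expansion f) + (g - expansion g)"
      using plus a by simp
    ultimately show "f + g \<in> ?U" using a by (simp only: mem_Collect_eq free_closed simp_thms)
  next
    fix c f assume a: "f \<in> ?U"
    have "fscale c (f - expansion f) \<in> rels" using a fs.subspace_scale[OF R] by blast
    then show "fscale c f \<in> ?U"
      using a scale[of f c] by (simp add: free_closed fs.scale_right_diff_distrib)
  qed
  \<comment> \<open>On relations all coefficients vanish, so their expansion is 0. Thus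
    \<open>?U\<close> is a subspace containing \<open>rels\<close>, and membership may be tested
    modulo relations.\<close>
  have RU: "rels \<subseteq> ?U"
  proof
    fix r assume r: "r \<in> rels"
    have "expansion r = 0" unfolding expansion_def
      by (rule sum.neutral) (auto simp: coefF_rels[OF r])
    then show "r \<in> ?U" using r rels_free by auto
  qed
  \<comment> \<open>Slots from \<open>k\<close> on are assumed to be matrix units. The induction on
    \<open>k\<close> frees one more slot in each step, and \<open>k = length As\<close> leaves no
    assumption.\<close>
  have "delta as \<in> ?U"
    if "as \<in> car" "\<And>j. k \<le> j \<Longrightarrow> j < length As \<Longrightarrow>
      \<exists>t\<in>Xs ! j. \<exists>s\<in>Xs ! j. sh t = sh s \<and> as ! j = block_algebra.E (As ! j) (Xs ! j) coef t s" for k as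
    using that
  proof (induction k arbitrary: as)
    case 0
    then have "\<forall>j. \<exists>t s. j < length As \<longrightarrow> t \<in> Xs ! j \<and> s \<in> Xs ! j \<and> sh t = sh s \<and>
        as ! j = block_algebra.E (As ! j) (Xs ! j) coef t s" by blast
    then obtain t s where ts: "\<And>j. j < length As \<Longrightarrow> t j \<in> Xs ! j \<and> s j \<in> Xs ! j \<and> sh (t j) = sh (s j) \<and>
        as ! j = block_algebra.E (As ! j) (Xs ! j) coef (t j) (s j)" by metis
    define tl sl where "tl = map t [0..<length As]" and "sl = map s [0..<length As]"
    have X: "tl \<in> XX" "sl \<in> XX" "map sh tl = map sh sl"
      using ts by (auto simp: tl_def sl_def XX_iff)
    have as: "as = EE tl sl"
      using 0(1) ts by (intro nth_equalityI) (auto simp: EE_def tl_def sl_def car_iff)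
    have "expansion (delta as) =
        (\<Sum>p\<in>{(ts, ss) \<in> XX \<times> XX. map sh ts = map sh ss}. if p = (tl, sl) then delta (EE tl sl) else 0)"
      unfolding expansion_def as
      by (rule sum.cong) (use X in \<open>auto simp: coefF_linear(4)[OF free_closed(4) free_closed(4)] coef0_EE\<close>)
    also have "\<dots> = delta as"
    proof -
      have "finite {(ts, ss) \<in> XX \<times> XX. map sh ts = map sh ss}"
        by (rule finite_subset[of _ "XX \<times> XX"]) (auto simp: finite_XX)
      then show ?thesis using X by (simp add: sum.delta as)
    qed
    finally show ?case using 0(1) fs.subspace_0[OF R]
      by (simp only: diff_self mem_Collect_eq delta_free simp_thms)
  next
    case (Suc k)
    show ?case
    proof (cases "k < length As")
      case k: True
      interpret B: block_algebra "As ! k" "Xs ! k" sh coef by (rule block[OF k])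
      have upd: "delta (as[k := a]) \<in> ?U" if "a \<in> carrier (As ! k)" for a
        using that
      proof (induction rule: B.block_induct)
        case (E t s)
        show ?case
        proof (rule Suc.IH)
          show "as[k := B.E t s] \<in> car" using Suc.prems(1) k E by (simp add: car_update B.E_props)
        next
          fix j assume "k \<le> j" "j < length As"
          then show "\<exists>t'\<in>Xs ! j. \<exists>s'\<in>Xs ! j. sh t' = sh s' \<and>
              as[k := B.E t s] ! j = block_algebra.E (As ! j) (Xs ! j) coef t' s'"
            using Suc.prems E k by (cases "j = k") (auto simp: car_iff)
        qed
      next
        case (add a b)
        have "delta (as[k := a \<oplus>\<^bsub>As ! k\<^esub> b]) - delta (as[k := a]) - delta (as[k := b]) \<in> ?U"
          using rels_add[OF Suc.prems(1) k add(1,2)] RU by blast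
        from fs.subspace_add[OF U fs.subspace_add[OF U this add(4)] add(3)]
        show ?case by (simp only: diff_add_cancel)
      next
        case (smult c a)
        have "delta (as[k := c \<odot>\<^bsub>As ! k\<^esub> a]) - fscale c (delta (as[k := a])) \<in> ?U"
          using rels_smult[OF Suc.prems(1) k smult(1)] RU by blast
        from fs.subspace_add[OF U this fs.subspace_scale[OF U smult(2), of c]]
        show ?case by (simp only: diff_add_cancel)
      qed
      have "as ! k \<in> carrier (As ! k)" using Suc.prems(1) k by (simp add: car_iff)
      from upd[OF this] show ?thesis by (simp only: list_update_id)
    next
      case False
      then show ?thesis using Suc by simp
    qed
  qed
  from this[OF as, of "length As"] show ?thesis by simp
qed

lemma expansion_free:
  assumes "f \<in> free_space car"
  shows "f - expansion f \<in> rels"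
  using assms
proof (induction rule: free_induct)
  case zero
  have "expansion 0 = 0" unfolding expansion_def coefF_def by (simp add: case_prod_unfold)
  then show ?case using fs.subspace_0[OF multilinear_rels_subspace] by (simp only: diff_self)
next
  case (delta x)
  then show ?case by (rule expansion_delta)
next
  case (add f g)
  have "expansion (f + g) = expansion f + expansion g"
    unfolding expansion_def coefF_linear(1)[OF add(1,2)] fs.scale_left_distrib case_prod_unfold sum.distrib ..
  then have "(f + g) - expansion (f + g) = (f - expansion f) + (g - expansion g)" by simp
  then show ?case using fs.subspace_add[OF multilinear_rels_subspace add(3,4)] by (simp only:)
next
  case (scale c f)
  have "expansion (fscale c f) = fscale c (expansion f)"
    unfolding expansion_def coefF_linear(3)[OF scale(1) scale(1)] fs.scale_sum_right case_prod_unfold fs.scale_scale ..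
  then have "fscale c f - expansion (fscale c f) = fscale c (f - expansion f)"
    by (simp only: fs.scale_right_diff_distrib)
  then show ?case using fs.subspace_scale[OF multilinear_rels_subspace scale(2), of c]
    by (simp only:)
qed

lemma coefF_mult:
  assumes f: "f \<in> free_space car" and g: "g \<in> free_space car" and X: "ts \<in> XX" "ss \<in> XX"
  shows "coefF ts ss (bilin_ext mul.F f g) = (\<Sum>us\<in>XX. coefF ts us f * coefF us ss g)"
proof -
  have "coefF ts ss (bilin_ext mul.F f g) =
      cs.lsum (\<lambda>as. cs.lsum (\<lambda>bs. coef0 ts ss (mul.F as bs)) g) f"
    unfolding coefF_def by (rule cs_lsum_bilin_ext[OF g])
  also have "\<dots> = cs.lsum (\<lambda>as. cs.lsum (\<lambda>bs. \<Sum>us\<in>XX. coef0 ts us as * coef0 us ss bs) g) f"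
  proof (intro cs.lsum_cong)
    fix as bs assume "f as \<noteq> 0" "g bs \<noteq> 0"
    then have ab: "as \<in> car" "bs \<in> car" using f g by (auto dest: free_spaceD)
    have "coef0 ts ss (mul.F as bs) =
        (\<Prod>j<length Xs. \<Sum>u\<in>Xs ! j. coef (as ! j) (ts ! j) u * coef (bs ! j) u (ss ! j))"
      unfolding coef0_def length_Xs
      by (rule prod.cong)
        (use ab X in \<open>auto simp: mul.F_nth block_algebra.coef_mult[OF block] car_iff XX_iff\<close>)
    also have "\<dots> = (\<Sum>us\<in>XX. coef0 ts us as * coef0 us ss bs)"
      unfolding sum_prod_listset[symmetric] coef0_def by (simp add: prod.distrib length_Xs)
    finally show "coef0 ts ss (mul.F as bs) = (\<Sum>us\<in>XX. coef0 ts us as * coef0 us ss bs)" .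
  qed
  also have "\<dots> = (\<Sum>us\<in>XX. coefF ts us f * coefF us ss g)"
    unfolding cs.lsum_sum_fun coefF_def cs.lsum_scale_fun
  proof (rule sum.cong)
    fix us
    show "cs.lsum (\<lambda>as. coef0 ts us as * cs.lsum (coef0 us ss) g) f =
        cs.lsum (coef0 ts us) f * cs.lsum (coef0 us ss) g"
      using cs.lsum_scale_fun[of "cs.lsum (coef0 us ss) g" "coef0 ts us" f] by (simp add: mult.commute)
  qed simp
  finally show ?thesis .
qed

sublocale T: block_algebra T XX "map sh" coefT
proof
  note simps = T_simps(1) T_simps(5) T_ops coefT_coset coefF_linear
  show "finite XX" by (rule finite_XX)
  have "\<forall>j. \<exists>x. j < length As \<longrightarrow> x \<in> Xs ! j" using block_algebra.X_ne[OF block] by blast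
  then obtain x where "\<forall>j<length As. x j \<in> Xs ! j" by metis
  then have "map x [0..<length As] \<in> XX" by (simp add: XX_iff)
  then show "XX \<noteq> {}" by blast
next
  fix a b assume "a \<in> carrier T" "b \<in> carrier T"
  then obtain f g where ab: "a = f +o rels" "b = g +o rels"
    and fg: "f \<in> free_space car" "g \<in> free_space car" by (auto simp: T_simps)
  show "a \<oplus>\<^bsub>T\<^esub> b \<in> carrier T"
    unfolding ab T_ops(1)[OF fg] T_simps(1) using fg free_closed(1) by blast
  show "a \<otimes>\<^bsub>T\<^esub> b \<in> carrier T"
    unfolding ab T_ops(3)[OF fg] T_simps(1) using mulF_free fg by blast
  fix ts ss assume X: "ts \<in> XX" "ss \<in> XX"
  show "coefT (a \<oplus>\<^bsub>T\<^esub> b) ts ss = coefT a ts ss + coefT b ts ss"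
    unfolding ab T_ops(1)[OF fg] coefT_coset[OF fg(1) X] coefT_coset[OF fg(2) X]
      coefT_coset[OF free_closed(1)[OF fg] X] by (rule coefF_linear(1)[OF fg])
  show "coefT (a \<otimes>\<^bsub>T\<^esub> b) ts ss = (\<Sum>us\<in>XX. coefT a ts us * coefT b us ss)"
    unfolding ab T_ops(3)[OF fg] coefT_coset[OF mulF_free[OF fg] X] coefF_mult[OF fg X]
    by (rule sum.cong) (simp_all add: coefT_coset fg X)
next
  fix a b assume "a \<in> carrier T" "b \<in> carrier T"
    and eq: "\<And>ts ss. ts \<in> XX \<Longrightarrow> ss \<in> XX \<Longrightarrow> coefT a ts ss = coefT b ts ss"
  then obtain f g where ab: "a = f +o rels" "b = g +o rels"
    and fg: "f \<in> free_space car" "g \<in> free_space car" by (auto simp: T_simps)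
  have "expansion f = expansion g"
    unfolding expansion_def
    by (rule sum.cong) (use eq ab coefT_coset fg in auto)
  then have "f - g = (f - expansion f) - (g - expansion g)" by simp
  also have "\<dots> \<in> rels"
    using expansion_free fg fs.subspace_diff[OF multilinear_rels_subspace] by blast
  finally show "a = b" unfolding ab by (rule coset_eqI[OF multilinear_rels_subspace])
next
  fix a c assume "a \<in> carrier T"
  then obtain f where a: "a = f +o rels" and f: "f \<in> free_space car" by (auto simp: T_simps)
  show "c \<odot>\<^bsub>T\<^esub> a \<in> carrier T"
    unfolding a T_ops(2)[OF f f] T_simps(1) using f free_closed(3) by blast
  fix ts ss assume X: "ts \<in> XX" "ss \<in> XX"
  show "coefT (c \<odot>\<^bsub>T\<^esub> a) ts ss = c * coefT a ts ss"
    unfolding a T_ops(2)[OF f f] coefT_coset[OF f X] coefT_coset[OF free_closed(3)[OF f] X]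
    by (rule coefF_linear(3)[OF f f])
  assume "map sh ts \<noteq> map sh ss"
  then show "coefT a ts ss = 0"
    unfolding a coefT_coset[OF f X] coefF_def cs.lsum_def using f X
    by (intro sum.neutral) (auto simp: coef0_sh dest: free_spaceD)
next
  show "\<one>\<^bsub>T\<^esub> \<in> carrier T" using one_car by (simp add: T_simps)
  fix ts ss assume X: "ts \<in> XX" "ss \<in> XX"
  have "coefT \<one>\<^bsub>T\<^esub> ts ss = coef0 ts ss (map one As)"
    unfolding T_simps using one_car X by (simp add: coefT_coset coefF_def)
  also have "\<dots> = (\<Prod>j<length As. of_bool (ts ! j = ss ! j))"
    unfolding coef0_def
    by (rule prod.cong) (use X in \<open>auto simp: block_algebra.coef_one[OF block] XX_iff\<close>)
  also have "\<dots> = of_bool (ts = ss)" using X unfolding XX_iff by (auto simp: list_eq_iff_nth_eq)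
  finally show "coefT \<one>\<^bsub>T\<^esub> ts ss = of_bool (ts = ss)" .
next
  fix ts ss assume X: "ts \<in> XX" "ss \<in> XX" "map sh ts = map sh ss"
  have "delta (EE ts ss) \<in> free_space car" using EE_car[OF X] by simp
  then show "\<exists>a\<in>carrier T. \<forall>ts'\<in>XX. \<forall>ss'\<in>XX. coefT a ts' ss' = of_bool (ts' = ts \<and> ss' = ss)"
    unfolding T_simps
    by (intro bexI[of _ "delta (EE ts ss) +o rels"])
      (auto simp: coefT_coset coefF_def coef0_EE[OF X])
qed

lemma E_tensor:
  assumes X: "ts \<in> XX" "ss \<in> XX" "map sh ts = map sh ss"
  shows "T.E ts ss = delta (EE ts ss) +o rels"
  by (rule T.E_eqI[OF X, symmetric])
    (use EE_car[OF X] in \<open>auto simp: T_simps coefT_coset coefF_def coef0_EE[OF X]\<close>)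

section \<open>Outer tensor products of modules\<close>

lemma outer_tensor_simps:
  fixes Ms :: "('a, 'v) alg_module list"
  defines "R \<equiv> multilinear_rels Ms"
  shows "carrier (outer_tensor Ms) = (\<lambda>f. f +o R) ` free_space (listset (map carrier Ms))"
    "zero (outer_tensor Ms) = R" "add (outer_tensor Ms) = (+)"
    "smult (outer_tensor Ms) c Z = fscale c ` Z + R"
    "act (outer_tensor Ms) Y Z = (\<Union>f\<in>Y. \<Union>g\<in>Z.
        bilin_ext (\<lambda>as vs. map (\<lambda>j. act (Ms ! j) (as ! j) (vs ! j)) [0..<length Ms]) f g +o R)"
  by (simp_all add: outer_tensor_def module.extend_def alg_module.fields_def tensor_space_def
      quotient_space_def R_def)

text \<open>The tensor of the generators is fixed by the tensor of the idempotents and reaches every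
  pure tensor by acting slot by slot. It is nonzero because the product of the coordinate
  functionals takes the value 1 on it and vanishes on relations.\<close>

lemma outer_tensor_of_type:
  fixes Ms :: "('a, 'v) alg_module list"
  assumes len: "length Ms = length As" and ss: "ss \<in> XX"
    and ty: "\<And>j. j < length As \<Longrightarrow> block_algebra.of_type (As ! j) (Xs ! j) coef (ss ! j) (Ms ! j)"
  shows "T.of_type ss (outer_tensor Ms)"
proof -
  have lm: "left_module (As ! j) (Ms ! j)" if "j < length As" for j
    using ty[OF that] block_algebra.of_type_def[OF block[OF that]] by blast
  have ssj: "ss ! j \<in> Xs ! j" if "j < length As" for j using ss that XX_iff by blast
  interpret M: slot_spaces Ms
  proof
    fix j v w c assume "j < length Ms"
    then interpret left_module "As ! j" "Ms ! j" using lm len by simp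
    assume v: "v \<in> carrier (Ms ! j)"
    show "c \<odot>\<^bsub>Ms ! j\<^esub> v \<in> carrier (Ms ! j)" using v by (rule smult_closed')
    assume "w \<in> carrier (Ms ! j)"
    then show "v \<oplus>\<^bsub>Ms ! j\<^esub> w \<in> carrier (Ms ! j)" using v by simp
  qed
  interpret a: slot_bilinear As Ms "\<lambda>j. act (Ms ! j)"
    by unfold_locales
      (simp_all add: len left_module.act_closed[OF lm] left_module.act_add_left[OF lm]
        left_module.act_add_right[OF lm] left_module.act_smult_left[OF lm]
        left_module.act_smult_right[OF lm])
  let ?N = "outer_tensor Ms"
  note N = outer_tensor_simps[of Ms] and R = multilinear_rels_subspace[of Ms]
  have aF: "(\<lambda>as vs. map (\<lambda>j. act (Ms ! j) (as ! j) (vs ! j)) [0..<length Ms]) = a.F"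
    by (simp add: a.F_def fun_eq_iff len)
  have act: "act ?N (f +o rels) (g +o M.rels) = bilin_ext a.F f g +o M.rels"
    if "f \<in> free_space car" "g \<in> free_space M.car" for f g
    unfolding N aF by (rule a.bilin_coset[OF that])
  have aF_free: "bilin_ext a.F f g \<in> free_space M.car"
    if "f \<in> free_space car" "g \<in> free_space M.car" for f g
    using that by (rule bilin_ext_free) (rule a.F_car)
  have plus: "(f +o M.rels) \<oplus>\<^bsub>?N\<^esub> (g +o M.rels) = (f + g) +o M.rels" for f g
    by (simp only: N coset_plus[OF R])
  have smult: "c \<odot>\<^bsub>?N\<^esub> (f +o M.rels) = fscale c f +o M.rels" for f c
    by (simp only: N coset_scale[OF R])
  have vs: "vectorspace (class_ring :: complex ring) ?N"
    by (rule quotient_vectorspace[OF free_space_subspace R N(1-4)])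
  have lmN: "left_module T ?N"
  proof (rule left_moduleI[OF vs])
    fix a v assume "a \<in> carrier T" "v \<in> carrier ?N"
    then obtain f g where av: "a = f +o rels" "v = g +o M.rels"
      and fg: "f \<in> free_space car" "g \<in> free_space M.car" by (auto simp: T_simps N)
    show "act ?N a v \<in> carrier ?N"
      unfolding av act[OF fg] N(1) using aF_free[OF fg] by blast
    fix c
    show "act ?N (c \<odot>\<^bsub>T\<^esub> a) v = c \<odot>\<^bsub>?N\<^esub> act ?N a v"
      unfolding av T_ops(2)[OF fg(1) fg(1)] act[OF fg] act[OF free_closed(3)[OF fg(1)] fg(2)]
        smult bilin_ext_fscale ..
    show "act ?N a (c \<odot>\<^bsub>?N\<^esub> v) = c \<odot>\<^bsub>?N\<^esub> act ?N a v"
      unfolding av smult act[OF fg] act[OF fg(1) free_closed(3)[OF fg(2)]] bilin_ext_fscale ..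
  next
    fix a b v assume "a \<in> carrier T" "b \<in> carrier T" "v \<in> carrier ?N"
    then obtain f f' g where av: "a = f +o rels" "b = f' +o rels" "v = g +o M.rels"
      and fg: "f \<in> free_space car" "f' \<in> free_space car" "g \<in> free_space M.car"
      by (auto simp: T_simps N)
    show "act ?N (a \<oplus>\<^bsub>T\<^esub> b) v = act ?N a v \<oplus>\<^bsub>?N\<^esub> act ?N b v"
      unfolding av T_ops(1)[OF fg(1,2)] act[OF fg(1,3)] act[OF fg(2,3)]
        act[OF free_closed(1)[OF fg(1,2)] fg(3)] plus bilin_ext_left(1)[OF fg(1,2)] ..
    have "bilin_ext a.F (bilin_ext mul.F f f') g = bilin_ext a.F f (bilin_ext a.F f' g)"
    proof (rule bilin_ext_assoc[OF fg])
      fix as bs vs assume v: "as \<in> car" "bs \<in> car" "vs \<in> M.car"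
      show "a.F (mul.F as bs) vs = a.F as (a.F bs vs)"
        by (rule nth_equalityI)
          (use v in \<open>auto simp: a.F_def mul.F_def car_iff M.car_iff len left_module.act_mult[OF lm]\<close>)
    qed
    then show "act ?N (a \<otimes>\<^bsub>T\<^esub> b) v = act ?N a (act ?N b v)"
      unfolding av T_ops(3)[OF fg(1,2)] act[OF fg(2,3)] act[OF fg(1) aF_free[OF fg(2,3)]]
        act[OF mulF_free[OF fg(1,2)] fg(3)] by simp
  next
    fix a v w assume "a \<in> carrier T" "v \<in> carrier ?N" "w \<in> carrier ?N"
    then obtain f g h where av: "a = f +o rels" "v = g +o M.rels" "w = h +o M.rels"
      and fg: "f \<in> free_space car" "g \<in> free_space M.car" "h \<in> free_space M.car"
      by (auto simp: T_simps N)
    show "act ?N a (v \<oplus>\<^bsub>?N\<^esub> w) = act ?N a v \<oplus>\<^bsub>?N\<^esub> act ?N a w"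
      unfolding av plus act[OF fg(1,2)] act[OF fg(1,3)] act[OF fg(1) free_closed(1)[OF fg(2,3)]]
        bilin_ext_right(1)[OF fg(2,3)] ..
  next
    fix v assume "v \<in> carrier ?N"
    then obtain g where v: "v = g +o M.rels" and g: "g \<in> free_space M.car" by (auto simp: N)
    have "bilin_ext a.F (delta (map one As)) g = fs.lsum (\<lambda>vs. delta (a.F (map one As) vs)) g"
      by (simp add: bilin_ext_eq)
    also have "\<dots> = fs.lsum delta g"
    proof (intro fs.lsum_cong arg_cong[of _ _ delta])
      fix vs assume "g vs \<noteq> 0"
      then have "vs \<in> M.car" using g by (auto dest: free_spaceD)
      then show "a.F (map one As) vs = vs"
        by (intro nth_equalityI) (auto simp: a.F_def M.car_iff len left_module.act_one[OF lm])
    qed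
    also have "\<dots> = g" by (rule lsum_delta_self) (rule free_spaceD[OF g])
    finally show "act ?N \<one>\<^bsub>T\<^esub> v = v"
      unfolding v T_simps using act[of "delta (map one As)" g] one_car g by simp
  qed
  \<comment> \<open>A generator and a functional with value 1 on it are bundled into one predicate,
    so that compatible choices can be made for all slots at once.\<close>
  define Q where "Q j w \<phi> \<longleftrightarrow> w \<in> carrier (Ms ! j) \<and> act (Ms ! j) (block_algebra.E (As ! j) (Xs ! j) coef (ss ! j) (ss ! j)) w = w \<and>
      carrier (Ms ! j) = (\<lambda>a. act (Ms ! j) a w) ` carrier (As ! j) \<and> \<phi> w = (1 :: complex) \<and>
      (\<forall>u\<in>carrier (Ms ! j). \<forall>v\<in>carrier (Ms ! j). \<phi> (u \<oplus>\<^bsub>Ms ! j\<^esub> v) = \<phi> u + \<phi> v) \<and>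
      (\<forall>c. \<forall>v\<in>carrier (Ms ! j). \<phi> (c \<odot>\<^bsub>Ms ! j\<^esub> v) = c * \<phi> v)"
    for j w \<phi>
  have "\<exists>w \<phi>. Q j w \<phi>" if j: "j < length As" for j
  proof -
    interpret B: block_algebra "As ! j" "Xs ! j" sh coef by (rule block[OF j])
    obtain w \<phi> where w: "w \<in> carrier (Ms ! j)" "w \<noteq> \<zero>\<^bsub>Ms ! j\<^esub>" "act (Ms ! j) (B.E (ss ! j) (ss ! j)) w = w"
      "carrier (Ms ! j) = (\<lambda>a. act (Ms ! j) a w) ` carrier (As ! j)"
      and \<phi>: "\<And>t a. t \<in> Xs ! j \<Longrightarrow> a \<in> carrier (As ! j) \<Longrightarrow> \<phi> t (act (Ms ! j) a w) = coef a t (ss ! j)"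
      and lin: "\<And>t u v. t \<in> Xs ! j \<Longrightarrow> u \<in> carrier (Ms ! j) \<Longrightarrow> v \<in> carrier (Ms ! j) \<Longrightarrow>
          \<phi> t (u \<oplus>\<^bsub>Ms ! j\<^esub> v) = \<phi> t u + \<phi> t v"
        "\<And>t c v. t \<in> Xs ! j \<Longrightarrow> v \<in> carrier (Ms ! j) \<Longrightarrow> \<phi> t (c \<odot>\<^bsub>Ms ! j\<^esub> v) = c * \<phi> t v"
      by (rule B.of_type_coordinates[OF ty[OF j] ssj[OF j]]) (rule that)
    have "\<phi> (ss ! j) w = 1"
      using \<phi>[OF ssj[OF j] B.E_props(1)[OF ssj[OF j] ssj[OF j]]] ssj[OF j]
      by (simp add: w(3) B.E_props(2))
    then show ?thesis unfolding Q_def using w lin ssj[OF j]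
      by (intro exI[of _ w] exI[of _ "\<phi> (ss ! j)"]) simp
  qed
  note exQ = this
  define w where "w j = (SOME w. \<exists>\<phi>. Q j w \<phi>)" for j
  define \<phi> where "\<phi> j = (SOME \<phi>. Q j (w j) \<phi>)" for j
  have Q: "Q j (w j) (\<phi> j)" if "j < length As" for j
    using someI_ex[of "\<lambda>w. \<exists>\<phi>. Q j w \<phi>", OF exQ[OF that]] someI_ex[of "Q j (w j)"]
    unfolding w_def \<phi>_def by blast
  have w: "w j \<in> carrier (Ms ! j)"
    and ww: "act (Ms ! j) (block_algebra.E (As ! j) (Xs ! j) coef (ss ! j) (ss ! j)) (w j) = w j"
    and gen: "carrier (Ms ! j) = (\<lambda>a. act (Ms ! j) a (w j)) ` carrier (As ! j)"
    and \<phi>: "\<phi> j (w j) = 1"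
      "\<And>u v. u \<in> carrier (Ms ! j) \<Longrightarrow> v \<in> carrier (Ms ! j) \<Longrightarrow>
        \<phi> j (u \<oplus>\<^bsub>Ms ! j\<^esub> v) = \<phi> j u + \<phi> j v"
      "\<And>c v. v \<in> carrier (Ms ! j) \<Longrightarrow> \<phi> j (c \<odot>\<^bsub>Ms ! j\<^esub> v) = c * \<phi> j v"
    if "j < length As" for j
    using Q[OF that] unfolding Q_def by blast+
  define ws where "ws = map w [0..<length As]"
  have ws: "ws \<in> M.car" using w by (auto simp: ws_def M.car_iff len)
  let ?w = "delta ws +o M.rels"
  have w_in: "?w \<in> carrier ?N" unfolding N(1) using ws by (intro imageI) simp
  have "?w \<noteq> \<zero>\<^bsub>?N\<^esub>"
  proof
    assume "?w = \<zero>\<^bsub>?N\<^esub>"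
    then have "delta ws +o M.rels = 0 +o M.rels" by (simp only: N zero_coset)
    then have "delta ws - 0 \<in> M.rels" by (simp only: coset_eq_iff[OF R])
    then have "delta ws \<in> M.rels" by (simp only: diff_zero)
    then have "cs.lsum (\<lambda>vs. \<Prod>j<length Ms. \<phi> j (vs ! j)) (delta ws) = 0"
      by (rule M.functional_rels) (simp_all add: \<phi> len)
    then show False using \<phi> by (simp add: ws_def len)
  qed
  moreover have "act ?N (T.E ss ss) ?w = ?w"
  proof -
    have "a.F (EE ss ss) ws = ws"
      by (rule nth_equalityI) (auto simp: a.F_def EE_def ws_def ww)
    then show ?thesis
      using EE_car[OF ss ss refl] ws by (simp add: E_tensor[OF ss ss refl] act)
  qed
  moreover have "carrier ?N = (\<lambda>a. act ?N a ?w) ` carrier T"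
  proof
    interpret N: left_module T ?N by (rule lmN)
    show "(\<lambda>a. act ?N a ?w) ` carrier T \<subseteq> carrier ?N" using w_in N.act_closed by auto
    have "g +o M.rels \<in> (\<lambda>a. act ?N a ?w) ` carrier T" if "g \<in> free_space M.car" for g
      using that
    proof (induction rule: free_induct)
      case zero
      have "act ?N (0 \<odot>\<^bsub>T\<^esub> \<one>\<^bsub>T\<^esub>) ?w = \<zero>\<^bsub>?N\<^esub>"
        using w_in by (simp add: N.act_smult_left T.closed N.smult_zero' N.act_one)
      also have "\<dots> = 0 +o M.rels" by (simp only: N zero_coset)
      finally show ?case by (metis T.closed(3,4) image_eqI)
    next
      case (delta vs)
      have "\<forall>j. \<exists>a. j < length As \<longrightarrow> a \<in> carrier (As ! j) \<and> vs ! j = act (Ms ! j) a (w j)"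
        using delta gen by (auto simp: M.car_iff len)
      then obtain a where a: "\<And>j. j < length As \<Longrightarrow> a j \<in> carrier (As ! j) \<and> vs ! j = act (Ms ! j) (a j) (w j)"
        by metis
      have as: "map a [0..<length As] \<in> car" using a by (auto simp: car_iff)
      have "a.F (map a [0..<length As]) ws = vs"
        by (rule nth_equalityI) (use delta a in \<open>auto simp: a.F_def ws_def M.car_iff len\<close>)
      then have "delta vs +o M.rels = act ?N (delta (map a [0..<length As]) +o rels) ?w"
        using as ws by (simp add: act)
      moreover have "delta (map a [0..<length As]) +o rels \<in> carrier T"
        unfolding T_simps using as by (intro imageI) simp
      ultimately show ?case by blast
    next
      case (add f g)
      then obtain a b where "a \<in> carrier T" "f +o M.rels = act ?N a ?w"
        "b \<in> carrier T" "g +o M.rels = act ?N b ?w" by blast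
      then have "(f + g) +o M.rels = act ?N (a \<oplus>\<^bsub>T\<^esub> b) ?w" "a \<oplus>\<^bsub>T\<^esub> b \<in> carrier T"
        using w_in by (simp_all add: N.act_add_left plus[symmetric] T.closed)
      then show ?case by blast
    next
      case (scale c f)
      then obtain a where "a \<in> carrier T" "f +o M.rels = act ?N a ?w" by blast
      then have "fscale c f +o M.rels = act ?N (c \<odot>\<^bsub>T\<^esub> a) ?w" "c \<odot>\<^bsub>T\<^esub> a \<in> carrier T"
        using w_in by (simp_all add: N.act_smult_left smult[symmetric] T.closed)
      then show ?case by blast
    qed
    then show "carrier ?N \<subseteq> (\<lambda>a. act ?N a ?w) ` carrier T" by (auto simp: outer_tensor_simps)
  qed
  ultimately show ?thesis unfolding T.of_type_def using lmN w_in by blast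
qed

end

section \<open>Induction and restriction between matrix algebras\<close>

text \<open>The embedding \<open>\<psi>\<close> extends a \<open>Y \<times> Y\<close>-matrix by zero to an \<open>X \<times> X\<close>-matrix.\<close>

locale block_embedding = A: block_algebra A X sha coefa + B: block_algebra B Y shb coefb
  for A :: "(complex, 'a) module" and X :: "'s set" and sha :: "'s \<Rightarrow> 'c"
    and coefa :: "'a \<Rightarrow> 's \<Rightarrow> 's \<Rightarrow> complex"
    and B :: "(complex, 'b) module" and Y :: "'t set" and shb :: "'t \<Rightarrow> 'd"
    and coefb :: "'b \<Rightarrow> 't \<Rightarrow> 't \<Rightarrow> complex" +
  fixes \<psi> :: "'b \<Rightarrow> 'a" and \<iota> :: "'t \<Rightarrow> 's"
  assumes \<iota>_X: "y \<in> Y \<Longrightarrow> \<iota> y \<in> X" and \<iota>_inj: "inj_on \<iota> Y"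
    and \<iota>_sh: "y \<in> Y \<Longrightarrow> z \<in> Y \<Longrightarrow> sha (\<iota> y) = sha (\<iota> z) \<longleftrightarrow> shb y = shb z"
    and \<psi>_closed: "b \<in> carrier B \<Longrightarrow> \<psi> b \<in> carrier A"
    and coef_\<psi>: "b \<in> carrier B \<Longrightarrow> y \<in> Y \<Longrightarrow> z \<in> Y \<Longrightarrow> coefa (\<psi> b) (\<iota> y) (\<iota> z) = coefb b y z"
    and coef_\<psi>_out: "b \<in> carrier B \<Longrightarrow> x \<in> X \<Longrightarrow> x' \<in> X \<Longrightarrow> x \<notin> \<iota> ` Y \<or> x' \<notin> \<iota> ` Y \<Longrightarrow>
      coefa (\<psi> b) x x' = 0"
begin

lemma sum_\<psi>:
  assumes "\<And>x. x \<in> X \<Longrightarrow> x \<notin> \<iota> ` Y \<Longrightarrow> g x = (0 :: complex)"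
  shows "(\<Sum>x\<in>X. g x) = (\<Sum>y\<in>Y. g (\<iota> y))"
proof -
  have "(\<Sum>x\<in>X. g x) = (\<Sum>x\<in>\<iota> ` Y. g x)"
    by (rule sum.mono_neutral_right) (use assms \<iota>_X A.finite_X in auto)
  then show ?thesis by (simp add: sum.reindex[OF \<iota>_inj])
qed

lemma coef_\<psi>_mult:
  assumes "a \<in> carrier A" "b \<in> carrier B" "x \<in> X" "y \<in> Y"
  shows "coefa (a \<otimes>\<^bsub>A\<^esub> \<psi> b) x (\<iota> y) = (\<Sum>z\<in>Y. coefa a x (\<iota> z) * coefb b z y)"
    and "coefa (\<psi> b \<otimes>\<^bsub>A\<^esub> a) (\<iota> y) x = (\<Sum>z\<in>Y. coefb b y z * coefa a (\<iota> z) x)"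
  using assms \<iota>_X
  by (simp_all add: A.coef_mult \<psi>_closed sum_\<psi> coef_\<psi>_out coef_\<psi>)

lemma \<psi>_mult:
  assumes "b \<in> carrier B" "c \<in> carrier B"
  shows "\<psi> (b \<otimes>\<^bsub>B\<^esub> c) = \<psi> b \<otimes>\<^bsub>A\<^esub> \<psi> c"
proof (rule A.coef_inj)
  fix x x' assume x: "x \<in> X" "x' \<in> X"
  show "coefa (\<psi> (b \<otimes>\<^bsub>B\<^esub> c)) x x' = coefa (\<psi> b \<otimes>\<^bsub>A\<^esub> \<psi> c) x x'"
  proof (cases "x \<in> \<iota> ` Y \<and> x' \<in> \<iota> ` Y")
    case True
    then obtain y y' where y: "y \<in> Y" "y' \<in> Y" "x = \<iota> y" "x' = \<iota> y'" by blast
    then show ?thesis using assms x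
      by (simp add: coef_\<psi> coef_\<psi>_mult(1) \<psi>_closed B.closed B.coef_mult)
  next
    case False
    then have "coefa (\<psi> b) x u * coefa (\<psi> c) u x' = 0" if "u \<in> X" for u
      using assms x that coef_\<psi>_out by auto
    then show ?thesis using False assms x by (simp add: A.coef_mult \<psi>_closed coef_\<psi>_out B.closed)
  qed
qed (use assms in \<open>simp_all add: \<psi>_closed A.closed B.closed\<close>)

lemma \<psi>_linear:
  assumes "b \<in> carrier B" "c \<in> carrier B"
  shows "\<psi> (b \<oplus>\<^bsub>B\<^esub> c) = \<psi> b \<oplus>\<^bsub>A\<^esub> \<psi> c" and "\<psi> (k \<odot>\<^bsub>B\<^esub> b) = k \<odot>\<^bsub>A\<^esub> \<psi> b"
proof -
  have "coefa (\<psi> (b \<oplus>\<^bsub>B\<^esub> c)) x x' = coefa (\<psi> b \<oplus>\<^bsub>A\<^esub> \<psi> c) x x' \<and>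
      coefa (\<psi> (k \<odot>\<^bsub>B\<^esub> b)) x x' = coefa (k \<odot>\<^bsub>A\<^esub> \<psi> b) x x'" if x: "x \<in> X" "x' \<in> X" for x x'
  proof (cases "x \<in> \<iota> ` Y \<and> x' \<in> \<iota> ` Y")
    case True
    then obtain y y' where y: "y \<in> Y" "y' \<in> Y" "x = \<iota> y" "x' = \<iota> y'" by blast
    then show ?thesis using assms x by (simp add: coef_\<psi> \<psi>_closed B.closed A.coefs B.coefs)
  next
    case False
    then show ?thesis using assms x by (simp add: coef_\<psi>_out \<psi>_closed B.closed A.coefs)
  qed
  then show "\<psi> (b \<oplus>\<^bsub>B\<^esub> c) = \<psi> b \<oplus>\<^bsub>A\<^esub> \<psi> c" "\<psi> (k \<odot>\<^bsub>B\<^esub> b) = k \<odot>\<^bsub>A\<^esub> \<psi> b"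
    using assms by (auto intro!: A.coef_inj simp: \<psi>_closed A.closed B.closed)
qed

lemma \<psi>_E:
  assumes "y \<in> Y" "z \<in> Y" "shb y = shb z"
  shows "\<psi> (B.E y z) = A.E (\<iota> y) (\<iota> z)"
proof (rule A.E_eqI)
  fix x x' assume x: "x \<in> X" "x' \<in> X"
  show "coefa (\<psi> (B.E y z)) x x' = of_bool (x = \<iota> y \<and> x' = \<iota> z)"
  proof (cases "x \<in> \<iota> ` Y \<and> x' \<in> \<iota> ` Y")
    case True
    then obtain u v where "u \<in> Y" "v \<in> Y" "x = \<iota> u" "x' = \<iota> v" by blast
    then show ?thesis using assms \<iota>_inj by (auto simp: coef_\<psi> B.closed B.coefs inj_on_eq_iff)
  next
    case False
    then show ?thesis using assms x by (auto simp: coef_\<psi>_out B.closed)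
  qed
qed (use assms in \<open>auto simp: \<iota>_X \<iota>_sh \<psi>_closed B.closed\<close>)

text \<open>Restriction keeps the part of \<open>N\<close> supported on the image of
  \<open>\<iota>\<close>. The generator lies in it because \<open>\<psi> (B.E s s)\<close> is the
  idempotent that fixes it, and every vector of that part is already reached from it by elements of
  \<open>B\<close>.\<close>

lemma restricted_of_type:
  fixes N :: "('a, 'v) alg_module"
  assumes "A.of_type (\<iota> s) N" and s: "s \<in> Y"
  shows "B.of_type s (restricted_module B \<psi> N)"
proof -
  obtain w where N: "left_module A N" and w: "w \<in> carrier N" "w \<noteq> \<zero>\<^bsub>N\<^esub>" "act N (A.E (\<iota> s) (\<iota> s)) w = w"
    and cN: "carrier N = (\<lambda>a. act N a w) ` carrier A"
    using assms unfolding A.of_type_def by blast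
  interpret N: left_module A N by fact
  let ?M = "restricted_module B \<psi> N" and ?e = "\<psi> \<one>\<^bsub>B\<^esub>"
  have e: "?e \<in> carrier A" by (simp add: \<psi>_closed B.closed)
  have eb: "?e \<otimes>\<^bsub>A\<^esub> \<psi> b = \<psi> b" "\<psi> b \<otimes>\<^bsub>A\<^esub> ?e = \<psi> b" if "b \<in> carrier B" for b
    using that by (simp_all add: \<psi>_mult[symmetric] B.closed B.algebra_laws)
  have ev: "act N ?e (act N (\<psi> b) v) = act N (\<psi> b) v" "act N (\<psi> b) (act N ?e v) = act N (\<psi> b) v"
    if "b \<in> carrier B" "v \<in> carrier N" for b v
    using that by (simp_all add: N.act_mult[symmetric] \<psi>_closed e eb)
  have M: "carrier ?M = act N ?e ` carrier N" "zero ?M = zero N" "add ?M = add N" "smult ?M = smult N"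
    "act ?M b = act N (\<psi> b)" for b
    by (simp_all add: restricted_module_def)
  have sub: "v \<in> carrier N" "act N ?e v = v" if "v \<in> carrier ?M" for v
    using that ev(1)[OF B.one_closed] by (auto simp: M N.act_closed e)
  have ev_in: "v \<in> carrier ?M" if "v \<in> carrier N" "act N ?e v = v" for v
    using that by (metis M(1) image_eqI)
  have vs: "vectorspace (class_ring :: complex ring) ?M"
  proof (rule vectorspace_complexI)
    fix u v w c assume u: "v \<in> carrier ?M"
    show "c \<odot>\<^bsub>?M\<^esub> v \<in> carrier ?M"
      using sub[OF u] by (intro ev_in) (simp_all add: M N.smult_closed' N.act_smult_right e)
    assume "w \<in> carrier ?M"
    then show "v \<oplus>\<^bsub>?M\<^esub> w \<in> carrier ?M"
      using sub[OF u] sub[of w] by (intro ev_in) (simp_all add: M N.act_add_right e)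
  next
    show "\<zero>\<^bsub>?M\<^esub> \<in> carrier ?M" by (intro ev_in) (simp_all add: M N.act_zero' e)
  qed (auto dest!: sub(1) simp: M(2-5) N.a_ac N.add_minus_one' N.smult_assoc' N.smult_one'
      N.smult_add_left' N.smult_add_right')
  have lm: "left_module B ?M"
  proof (rule left_moduleI[OF vs])
    fix b v assume b: "b \<in> carrier B" and "v \<in> carrier ?M"
    then have v: "v \<in> carrier N" using sub(1) by blast
    show "act ?M b v \<in> carrier ?M"
      unfolding M(5) by (rule ev_in[OF N.act_closed[OF \<psi>_closed[OF b] v] ev(1)[OF b v]])
  next
    fix v assume "v \<in> carrier ?M"
    then show "act ?M \<one>\<^bsub>B\<^esub> v = v" unfolding M(5) by (rule sub(2))
  qed (auto dest!: sub(1) simp: M(2-5) \<psi>_linear \<psi>_mult N.act_add_left N.act_add_right N.act_smult_left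
      N.act_smult_right N.act_mult \<psi>_closed)
  have ww: "act N (\<psi> (B.E s s)) w = w" using w s by (simp add: \<psi>_E)
  have wM: "w \<in> carrier ?M" using ev(1)[OF B.E_props(1)[OF s s refl] w(1)] ww w by (intro ev_in) simp_all
  have "carrier ?M \<subseteq> (\<lambda>b. act N (\<psi> b) w) ` carrier B"
  proof
    fix v assume v: "v \<in> carrier ?M"
    then obtain a where a: "a \<in> carrier A" "v = act N a w" using sub(1) cN by auto
    \<comment> \<open>The part of column \<open>\<iota> s\<close> of \<open>a\<close> in rows from
      the image of \<open>\<iota>\<close> is realised by an element of \<open>B\<close>. Matrix
      units outside that column or those rows contribute nothing.\<close>
    have "\<exists>b\<in>carrier B. \<forall>y\<in>Y. coefb b y s = coefa a (\<iota> y) (\<iota> s)"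
      using a(1)
    proof (induction rule: A.block_induct)
      case (E t u)
      show ?case
      proof (cases "t \<in> \<iota> ` Y \<and> u = \<iota> s")
        case True
        then obtain z where "z \<in> Y" "t = \<iota> z" by blast
        then show ?thesis
          using True E s \<iota>_inj by (intro bexI[of _ "B.E z s"])
            (auto simp: B.coefs A.coefs B.closed \<iota>_sh \<iota>_X inj_on_eq_iff)
      next
        case False
        then show ?thesis
          using E s by (intro bexI[of _ "0 \<odot>\<^bsub>B\<^esub> \<one>\<^bsub>B\<^esub>"]) (auto simp: B.coefs A.coefs B.closed \<iota>_X)
      qed
    next
      case (add a a')
      then obtain b b' where "b \<in> carrier B" "\<forall>y\<in>Y. coefb b y s = coefa a (\<iota> y) (\<iota> s)"
        "b' \<in> carrier B" "\<forall>y\<in>Y. coefb b' y s = coefa a' (\<iota> y) (\<iota> s)" by blast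
      then show ?case using add s
        by (intro bexI[of _ "b \<oplus>\<^bsub>B\<^esub> b'"]) (auto simp: B.coefs A.coefs B.closed \<iota>_X)
    next
      case (smult c a)
      then obtain b where "b \<in> carrier B" "\<forall>y\<in>Y. coefb b y s = coefa a (\<iota> y) (\<iota> s)" by blast
      then show ?case using smult s
        by (intro bexI[of _ "c \<odot>\<^bsub>B\<^esub> b"]) (auto simp: B.coefs A.coefs B.closed \<iota>_X)
    qed
    then obtain b where b: "b \<in> carrier B" "\<forall>y\<in>Y. coefb b y s = coefa a (\<iota> y) (\<iota> s)" by blast
    \<comment> \<open>As \<open>v\<close> is fixed by \<open>?e\<close>, this factor may be
      inserted; it clears the rows outside the image of \<open>\<iota>\<close>, where
      \<open>\<psi> b\<close> vanishes as well.\<close>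
    have "v = act N (?e \<otimes>\<^bsub>A\<^esub> a) w" using sub(2)[OF v] a w e by (simp add: N.act_mult)
    also have "\<dots> = act N (\<psi> b) w"
    proof (subst A.act_eq_iff[OF N w \<iota>_X[OF s]], simp_all add: A.closed \<psi>_closed b e a, intro ballI)
      fix t assume t: "t \<in> X"
      show "coefa (?e \<otimes>\<^bsub>A\<^esub> a) t (\<iota> s) = coefa (\<psi> b) t (\<iota> s)"
      proof (cases "t \<in> \<iota> ` Y")
        case True
        then obtain y where "y \<in> Y" "t = \<iota> y" by blast
        then show ?thesis
          using a b s by (simp add: coef_\<psi>_mult(2) \<iota>_X B.closed coef_\<psi> B.coefs B.sum_of_bool_left)
      next
        case False
        then show ?thesis using a b s t e by (simp add: A.coef_mult \<iota>_X coef_\<psi>_out B.closed)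
      qed
    qed
    finally show "v \<in> (\<lambda>b. act N (\<psi> b) w) ` carrier B" using b by blast
  qed
  moreover have "(\<lambda>b. act N (\<psi> b) w) ` carrier B \<subseteq> carrier ?M"
    using left_module.act_closed[OF lm _ wM] by (auto simp: M(5))
  ultimately show ?thesis
    unfolding B.of_type_def M(2,5) by (intro conjI bexI[of _ w] lm wM w ww equalityI)
qed

text \<open>Moving \<open>b\<close> across the tensor sign turns the pure tensor of \<open>a\<close>
  and \<open>b w\<close> into \<open>a \<psi> b\<close> applied to the tensor of 1 and
  \<open>w\<close>. So this vector generates and \<open>A.E (\<iota> s) (\<iota> s)\<close> fixes
  it; that it is nonzero requires a functional compatible with the balancing relations.\<close>

lemma induced_of_type:
  fixes M :: "('b, 'v) alg_module"
  assumes "B.of_type s M" and s: "s \<in> Y"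
  shows "A.of_type (\<iota> s) (induced_module A B \<psi> M)"
proof -
  obtain w \<phi> where w: "w \<in> carrier M" "w \<noteq> \<zero>\<^bsub>M\<^esub>" "act M (B.E s s) w = w"
    and cM: "carrier M = (\<lambda>a. act M a w) ` carrier B"
    and \<phi>: "\<And>t a. t \<in> Y \<Longrightarrow> a \<in> carrier B \<Longrightarrow> \<phi> t (act M a w) = coefb a t s"
      "\<And>t u v. t \<in> Y \<Longrightarrow> u \<in> carrier M \<Longrightarrow> v \<in> carrier M \<Longrightarrow> \<phi> t (u \<oplus>\<^bsub>M\<^esub> v) = \<phi> t u + \<phi> t v"
      "\<And>t c v. t \<in> Y \<Longrightarrow> v \<in> carrier M \<Longrightarrow> \<phi> t (c \<odot>\<^bsub>M\<^esub> v) = c * \<phi> t v"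
    by (rule B.of_type_coordinates[OF assms]) (rule that)
  have M: "left_module B M" using assms(1) by (simp add: B.of_type_def)
  interpret M: left_module B M by fact
  let ?N = "induced_module A B \<psi> M"
  define R where "R = balanced_rels A B \<psi> M"
  define V where "V = free_space (carrier A \<times> carrier M)"
  define L :: "'a \<Rightarrow> ('a \<times> 'v \<Rightarrow> complex) \<Rightarrow> ('a \<times> 'v \<Rightarrow> complex)"
    where "L a = fs.lsum (\<lambda>p. delta (a \<otimes>\<^bsub>A\<^esub> fst p, snd p))" for a
  have R: "fs.subspace R" unfolding R_def balanced_rels_def by (rule fs.subspace_span)
  have V: "fs.subspace V" unfolding V_def by (rule free_space_subspace)
  have R1: "delta (a \<oplus>\<^bsub>A\<^esub> a', v) - delta (a, v) - delta (a', v) \<in> R"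
    if "a \<in> carrier A" "a' \<in> carrier A" "v \<in> carrier M" for a a' v
    unfolding R_def balanced_rels_def by (rule fs.span_base) (use that in blast)
  have R2: "delta (a, v \<oplus>\<^bsub>M\<^esub> v') - delta (a, v) - delta (a, v') \<in> R"
    if "a \<in> carrier A" "v \<in> carrier M" "v' \<in> carrier M" for a v v'
    unfolding R_def balanced_rels_def by (rule fs.span_base) (use that in blast)
  have R3: "delta (c \<odot>\<^bsub>A\<^esub> a, v) - fscale c (delta (a, v)) \<in> R"
    if "a \<in> carrier A" "v \<in> carrier M" for a c v
    unfolding R_def balanced_rels_def by (rule fs.span_base) (use that in blast)
  have R4: "delta (a, c \<odot>\<^bsub>M\<^esub> v) - fscale c (delta (a, v)) \<in> R"
    if "a \<in> carrier A" "v \<in> carrier M" for a c v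
    unfolding R_def balanced_rels_def by (rule fs.span_base) (use that in blast)
  have R5: "delta (a \<otimes>\<^bsub>A\<^esub> \<psi> b, v) - delta (a, act M b v) \<in> R"
    if "a \<in> carrier A" "b \<in> carrier B" "v \<in> carrier M" for a b v
    unfolding R_def balanced_rels_def by (rule fs.span_base) (use that in blast)
  have minimal: "R \<subseteq> K" if K: "fs.subspace K"
    and 1: "\<And>a a' v. a \<in> carrier A \<Longrightarrow> a' \<in> carrier A \<Longrightarrow> v \<in> carrier M \<Longrightarrow>
      delta (a \<oplus>\<^bsub>A\<^esub> a', v) - delta (a, v) - delta (a', v) \<in> K"
    and 2: "\<And>a v v'. a \<in> carrier A \<Longrightarrow> v \<in> carrier M \<Longrightarrow> v' \<in> carrier M \<Longrightarrow>
      delta (a, v \<oplus>\<^bsub>M\<^esub> v') - delta (a, v) - delta (a, v') \<in> K"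
    and 3: "\<And>c a v. a \<in> carrier A \<Longrightarrow> v \<in> carrier M \<Longrightarrow>
      delta (c \<odot>\<^bsub>A\<^esub> a, v) - fscale c (delta (a, v)) \<in> K"
    and 4: "\<And>c a v. a \<in> carrier A \<Longrightarrow> v \<in> carrier M \<Longrightarrow>
      delta (a, c \<odot>\<^bsub>M\<^esub> v) - fscale c (delta (a, v)) \<in> K"
    and 5: "\<And>a b v. a \<in> carrier A \<Longrightarrow> b \<in> carrier B \<Longrightarrow> v \<in> carrier M \<Longrightarrow>
      delta (a \<otimes>\<^bsub>A\<^esub> \<psi> b, v) - delta (a, act M b v) \<in> K" for K
    unfolding R_def balanced_rels_def
    by (rule fs.span_minimal[OF _ K])
      (intro Un_least; rule subsetI; elim CollectE exE conjE; hypsubst; (rule 1 2 3 4 5; assumption))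
  note mem = fs.subspace_diff[OF V] fs.subspace_scale[OF V]
  have dV: "delta (a, v) \<in> V" if "a \<in> carrier A" "v \<in> carrier M" for a v
    using that by (simp add: V_def)
  have RV: "R \<subseteq> V"
    by (rule minimal[OF V]; intro mem dV; simp add: A.closed M.smult_closed' M.act_closed \<psi>_closed)
  have L_add: "L a (f + g) = L a f + L a g" "L a (f - g) = L a f - L a g"
    if "f \<in> V" "g \<in> V" for a f g
    using that unfolding L_def V_def by (simp_all only: fs_lsum_add[OF that[unfolded V_def]] fs_lsum_diff[OF that[unfolded V_def]])
  have L_scale: "L a (fscale c f) = fscale c (L a f)" for a c f
    unfolding L_def by (rule fs_lsum_fscale)
  have L_delta: "L a (delta (b, v)) = delta (a \<otimes>\<^bsub>A\<^esub> b, v)" for a b v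
    by (simp add: L_def)
  have LV: "L a f \<in> V" if "a \<in> carrier A" "f \<in> V" for a f
    unfolding L_def using that
    by (intro fs.lsum_in_subspace[OF V]) (auto simp: V_def A.closed dest: free_spaceD(2))
  \<comment> \<open>Left multiplication respects each of the five kinds of relations, so the action
    descends to the quotient.\<close>
  have LR: "L a r \<in> R" if a: "a \<in> carrier A" and r: "r \<in> R" for a r
  proof -
    have K: "fs.subspace {f \<in> V. L a f \<in> R}"
      by (rule fs.subspaceI) (simp_all add: fs.subspace_0[OF V] fs.subspace_0[OF R] L_add L_scale
          fs.subspace_add[OF V] fs.subspace_add[OF R] fs.subspace_scale[OF V] fs.subspace_scale[OF R]
          L_def[of a, THEN fun_cong, of 0])
    have "R \<subseteq> {f \<in> V. L a f \<in> R}"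
    proof (rule minimal[OF K]; intro CollectI conjI)
      fix b b' v assume b: "b \<in> carrier A" "b' \<in> carrier A" "v \<in> carrier M"
      note d = dV[OF A.add_closed[OF b(1,2)] b(3)] dV[OF b(1,3)] dV[OF b(2,3)]
      show "delta (b \<oplus>\<^bsub>A\<^esub> b', v) - delta (b, v) - delta (b', v) \<in> V" by (intro mem d)
      show "L a (delta (b \<oplus>\<^bsub>A\<^esub> b', v) - delta (b, v) - delta (b', v)) \<in> R"
        unfolding L_add(2)[OF mem(1)[OF d(1,2)] d(3)] L_add(2)[OF d(1,2)] L_delta
          A.algebra_laws(2)[OF b(1,2) a] by (rule R1) (use a b in \<open>simp_all add: A.closed\<close>)
    next
      fix b v v' assume b: "b \<in> carrier A" "v \<in> carrier M" "v' \<in> carrier M"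
      note d = dV[OF b(1) M.add.m_closed[OF b(2,3)]] dV[OF b(1,2)] dV[OF b(1,3)]
      show "delta (b, v \<oplus>\<^bsub>M\<^esub> v') - delta (b, v) - delta (b, v') \<in> V" by (intro mem d)
      show "L a (delta (b, v \<oplus>\<^bsub>M\<^esub> v') - delta (b, v) - delta (b, v')) \<in> R"
        unfolding L_add(2)[OF mem(1)[OF d(1,2)] d(3)] L_add(2)[OF d(1,2)] L_delta
        by (rule R2) (use a b in \<open>simp_all add: A.closed\<close>)
    next
      fix c b v assume b: "b \<in> carrier A" "v \<in> carrier M"
      note d = dV[OF A.smult_closed[OF b(1)] b(2), of c] mem(2)[OF dV[OF b], of c]
      show "delta (c \<odot>\<^bsub>A\<^esub> b, v) - fscale c (delta (b, v)) \<in> V" by (intro mem(1) d)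
      show "L a (delta (c \<odot>\<^bsub>A\<^esub> b, v) - fscale c (delta (b, v))) \<in> R"
        unfolding L_add(2)[OF d] L_delta L_scale A.algebra_laws(4)[OF a b(1) b(1)]
        by (rule R3) (use a b in \<open>simp_all add: A.closed\<close>)
      note d = dV[OF b(1) M.smult_closed'[OF b(2)], of c] mem(2)[OF dV[OF b], of c]
      show "delta (b, c \<odot>\<^bsub>M\<^esub> v) - fscale c (delta (b, v)) \<in> V" by (intro mem(1) d)
      show "L a (delta (b, c \<odot>\<^bsub>M\<^esub> v) - fscale c (delta (b, v))) \<in> R"
        unfolding L_add(2)[OF d] L_delta L_scale
        by (rule R4) (use a b in \<open>simp_all add: A.closed\<close>)
    next
      fix b c v assume b: "b \<in> carrier A" "c \<in> carrier B" "v \<in> carrier M"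
      note d = dV[OF A.mult_closed[OF b(1) \<psi>_closed[OF b(2)]] b(3)] dV[OF b(1) M.act_closed[OF b(2,3)]]
      show "delta (b \<otimes>\<^bsub>A\<^esub> \<psi> c, v) - delta (b, act M c v) \<in> V" by (intro mem(1) d)
      show "L a (delta (b \<otimes>\<^bsub>A\<^esub> \<psi> c, v) - delta (b, act M c v)) \<in> R"
        unfolding L_add(2)[OF d] L_delta A.mult_assoc[OF a b(1) \<psi>_closed[OF b(2)], symmetric]
        by (rule R5) (use a b in \<open>simp_all add: A.closed\<close>)
    qed
    then show ?thesis using r by blast
  qed
  have N: "carrier ?N = (\<lambda>f. f +o R) ` V" "zero ?N = R" "add ?N = (+)"
    "smult ?N c Z = fscale c ` Z + R" "act ?N a Z = L a ` Z + R" for a c Z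
    by (simp_all add: induced_module_def module.extend_def alg_module.fields_def quotient_space_def
        R_def V_def L_def lin_ext_eq case_prod_unfold)
  have act: "act ?N a (f +o R) = L a f +o R" if "a \<in> carrier A" "f \<in> V" for a f
    unfolding N(5)
  proof (rule linear_image_coset[OF R R])
    fix r assume r: "r \<in> R"
    have "L a (f + r) - L a f = L a r" using L_add(1)[OF that(2), of r a] r RV by auto
    then show "L a (f + r) - L a f \<in> R" using LR[OF that(1) r] by (simp only:)
  qed
  have plus: "(f +o R) \<oplus>\<^bsub>?N\<^esub> (g +o R) = (f + g) +o R" for f g
    by (simp only: N coset_plus[OF R])
  have smult: "c \<odot>\<^bsub>?N\<^esub> (f +o R) = fscale c f +o R" for f c
    by (simp only: N coset_scale[OF R])
  have vs: "vectorspace (class_ring :: complex ring) ?N"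
    by (rule quotient_vectorspace[OF V R N(1-4)])
  have lm: "left_module A ?N"
  proof (rule left_moduleI[OF vs])
    fix a v assume a: "a \<in> carrier A" and "v \<in> carrier ?N"
    then obtain f where v: "v = f +o R" and f: "f \<in> V" by (auto simp: N)
    have supp: "fst p \<in> carrier A" "snd p \<in> carrier M" if "f p \<noteq> 0" for p
    proof -
      have "p \<in> carrier A \<times> carrier M" by (rule free_spaceD(2)[OF f[unfolded V_def] that])
      then show "fst p \<in> carrier A" "snd p \<in> carrier M" by auto
    qed
    show "act ?N a v \<in> carrier ?N" unfolding v act[OF a f] N(1) using LV[OF a f] by blast
    fix c
    show "act ?N a (c \<odot>\<^bsub>?N\<^esub> v) = c \<odot>\<^bsub>?N\<^esub> act ?N a v"
      unfolding v smult act[OF a f] act[OF a mem(2)[OF f]] L_scale ..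
    have "L (c \<odot>\<^bsub>A\<^esub> a) f - fscale c (L a f) \<in> R"
      unfolding L_def fs.lsum_scale_fun[symmetric] fs.lsum_diff_fun[symmetric]
    proof (rule fs.lsum_in_subspace[OF R])
      fix p assume "f p \<noteq> 0"
      note p = supp[OF this]
      show "delta ((c \<odot>\<^bsub>A\<^esub> a) \<otimes>\<^bsub>A\<^esub> fst p, snd p) - fscale c (delta (a \<otimes>\<^bsub>A\<^esub> fst p, snd p)) \<in> R"
        unfolding A.algebra_laws(3)[OF a p(1) a] by (rule R3[OF A.mult_closed[OF a p(1)] p(2)])
    qed
    from coset_eqI[OF R this] show "act ?N (c \<odot>\<^bsub>A\<^esub> a) v = c \<odot>\<^bsub>?N\<^esub> act ?N a v"
      unfolding v act[OF a f] act[OF A.smult_closed[OF a] f] smult .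
    fix b assume b: "b \<in> carrier A"
    have "L (a \<oplus>\<^bsub>A\<^esub> b) f - (L a f + L b f) \<in> R"
      unfolding L_def fs.lsum_add_fun[symmetric] fs.lsum_diff_fun[symmetric]
    proof (rule fs.lsum_in_subspace[OF R])
      fix p assume "f p \<noteq> 0"
      note p = supp[OF this]
      show "delta ((a \<oplus>\<^bsub>A\<^esub> b) \<otimes>\<^bsub>A\<^esub> fst p, snd p) -
          (delta (a \<otimes>\<^bsub>A\<^esub> fst p, snd p) + delta (b \<otimes>\<^bsub>A\<^esub> fst p, snd p)) \<in> R"
        unfolding A.algebra_laws(1)[OF a b p(1)] diff_diff_eq[symmetric]
        by (rule R1[OF A.mult_closed[OF a p(1)] A.mult_closed[OF b p(1)] p(2)])
    qed
    from coset_eqI[OF R this] show "act ?N (a \<oplus>\<^bsub>A\<^esub> b) v = act ?N a v \<oplus>\<^bsub>?N\<^esub> act ?N b v"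
      unfolding v act[OF a f] act[OF b f] act[OF A.add_closed[OF a b] f] plus .
    have "L a (L b f) = fs.lsum (\<lambda>p. delta (a \<otimes>\<^bsub>A\<^esub> (b \<otimes>\<^bsub>A\<^esub> fst p), snd p)) f"
      unfolding L_def by (subst lsum_lsum) simp_all
    also have "\<dots> = L (a \<otimes>\<^bsub>A\<^esub> b) f"
      unfolding L_def by (rule fs.lsum_cong) (simp add: A.mult_assoc a b supp)
    finally show "act ?N (a \<otimes>\<^bsub>A\<^esub> b) v = act ?N a (act ?N b v)"
      unfolding v act[OF A.mult_closed[OF a b] f] act[OF b f] act[OF a LV[OF b f]] by simp
  next
    fix v assume "v \<in> carrier ?N"
    then obtain f where v: "v = f +o R" and f: "f \<in> V" by (auto simp: N)
    have "L \<one>\<^bsub>A\<^esub> f = fs.lsum delta f"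
      unfolding L_def
    proof (rule fs.lsum_cong)
      fix p assume "f p \<noteq> 0"
      then have "p \<in> carrier A \<times> carrier M" using f by (auto simp: V_def dest: free_spaceD(2))
      then show "delta (\<one>\<^bsub>A\<^esub> \<otimes>\<^bsub>A\<^esub> fst p, snd p) = delta p" by (auto simp: A.algebra_laws)
    qed
    also have "\<dots> = f" by (rule lsum_delta_self) (use f in \<open>auto simp: V_def dest: free_spaceD\<close>)
    finally show "act ?N \<one>\<^bsub>A\<^esub> v = v" unfolding v act[OF A.one_closed f] by simp
  next
    fix a v v' assume a: "a \<in> carrier A" and "v \<in> carrier ?N" "v' \<in> carrier ?N"
    then obtain f g where v: "v = f +o R" "v' = g +o R" and f: "f \<in> V" "g \<in> V" by (auto simp: N)
    show "act ?N a (v \<oplus>\<^bsub>?N\<^esub> v') = act ?N a v \<oplus>\<^bsub>?N\<^esub> act ?N a v'"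
      unfolding v plus act[OF a f(1)] act[OF a f(2)] act[OF a fs.subspace_add[OF V f]] L_add(1)[OF f] ..
  qed
  interpret N: left_module A ?N by (rule lm)
  let ?w = "delta (\<one>\<^bsub>A\<^esub>, w) +o R"
  have dw: "delta (\<one>\<^bsub>A\<^esub>, w) \<in> V" by (intro dV w A.one_closed)
  have w_in: "?w \<in> carrier ?N" unfolding N(1) using dw by blast
  have gen: "delta (a, act M b w) +o R = act ?N (a \<otimes>\<^bsub>A\<^esub> \<psi> b) ?w"
    if ab: "a \<in> carrier A" "b \<in> carrier B" for a b
  proof -
    note c = A.mult_closed[OF ab(1) \<psi>_closed[OF ab(2)]]
    have "act ?N (a \<otimes>\<^bsub>A\<^esub> \<psi> b) ?w = delta (a \<otimes>\<^bsub>A\<^esub> \<psi> b, w) +o R"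
      unfolding act[OF c dw] L_delta A.algebra_laws(6)[OF c c c] ..
    also have "\<dots> = delta (a, act M b w) +o R"
      by (rule coset_eqI[OF R R5]) (use ab w in auto)
    finally show ?thesis by simp
  qed
  have "act ?N (A.E (\<iota> s) (\<iota> s)) ?w = ?w"
  proof -
    note E = B.E_props(1)[OF s s refl]
    have "\<one>\<^bsub>A\<^esub> \<otimes>\<^bsub>A\<^esub> \<psi> (B.E s s) = A.E (\<iota> s) (\<iota> s)"
      using \<psi>_closed[OF E] by (simp add: A.algebra_laws \<psi>_E[OF s s])
    then show ?thesis using gen[OF A.one_closed E] w by simp
  qed
  moreover have "?w \<noteq> \<zero>\<^bsub>?N\<^esub>"
  proof
    \<comment> \<open>Multiplies row \<open>\<iota> s\<close> of \<open>a\<close> with the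
      coordinate vector of \<open>v\<close>, placed along \<open>\<iota>\<close>. It is balanced
      because \<open>\<psi>\<close> extends matrices by zero: the middle index in
      \<open>a \<psi> b\<close> runs over the image of \<open>Y\<close> only.\<close>
    define h where "h p = (\<Sum>t\<in>Y. coefa (fst p) (\<iota> s) (\<iota> t) * \<phi> t (snd p))" for p
    let ?K = "{f \<in> V. cs.lsum h f = 0}"
    have K: "fs.subspace ?K"
      by (rule fs.subspaceI) (auto simp: fs.subspace_0[OF V] fs.subspace_add[OF V] fs.subspace_scale[OF V]
        cs_lsum_add[of _ "carrier A \<times> carrier M", folded V_def] cs_lsum_fscale)
    have diff: "cs.lsum h (f - g) = cs.lsum h f - cs.lsum h g" if "f \<in> V" "g \<in> V" for f g
      using that unfolding V_def by (rule cs_lsum_diff)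
    note ex = \<iota>_X[OF s] \<iota>_X
    have "R \<subseteq> ?K"
    proof (rule minimal[OF K]; intro CollectI conjI)
      fix b b' v assume b: "b \<in> carrier A" "b' \<in> carrier A" "v \<in> carrier M"
      note d = dV[OF A.add_closed[OF b(1,2)] b(3)] dV[OF b(1,3)] dV[OF b(2,3)]
      show "delta (b \<oplus>\<^bsub>A\<^esub> b', v) - delta (b, v) - delta (b', v) \<in> V" by (intro mem d)
      show "cs.lsum h (delta (b \<oplus>\<^bsub>A\<^esub> b', v) - delta (b, v) - delta (b', v)) = 0"
        unfolding diff[OF mem(1)[OF d(1,2)] d(3)] diff[OF d(1,2)] cs_lsum_delta
        using b ex by (simp add: h_def A.coefs algebra_simps sum.distrib)
    next
      fix b v v' assume b: "b \<in> carrier A" "v \<in> carrier M" "v' \<in> carrier M"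
      note d = dV[OF b(1) M.add.m_closed[OF b(2,3)]] dV[OF b(1,2)] dV[OF b(1,3)]
      show "delta (b, v \<oplus>\<^bsub>M\<^esub> v') - delta (b, v) - delta (b, v') \<in> V" by (intro mem d)
      show "cs.lsum h (delta (b, v \<oplus>\<^bsub>M\<^esub> v') - delta (b, v) - delta (b, v')) = 0"
        unfolding diff[OF mem(1)[OF d(1,2)] d(3)] diff[OF d(1,2)] cs_lsum_delta
        using b by (simp add: h_def \<phi> algebra_simps sum.distrib)
    next
      fix c b v assume b: "b \<in> carrier A" "v \<in> carrier M"
      note d = dV[OF A.smult_closed[OF b(1)] b(2), of c] mem(2)[OF dV[OF b], of c]
      show "delta (c \<odot>\<^bsub>A\<^esub> b, v) - fscale c (delta (b, v)) \<in> V" by (intro mem(1) d)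
      show "cs.lsum h (delta (c \<odot>\<^bsub>A\<^esub> b, v) - fscale c (delta (b, v))) = 0"
        unfolding diff[OF d] cs_lsum_delta cs_lsum_fscale
        using b ex by (simp add: h_def A.coefs sum_distrib_left mult.assoc)
      note d = dV[OF b(1) M.smult_closed'[OF b(2)], of c] mem(2)[OF dV[OF b], of c]
      show "delta (b, c \<odot>\<^bsub>M\<^esub> v) - fscale c (delta (b, v)) \<in> V" by (intro mem(1) d)
      show "cs.lsum h (delta (b, c \<odot>\<^bsub>M\<^esub> v) - fscale c (delta (b, v))) = 0"
        unfolding diff[OF d] cs_lsum_delta cs_lsum_fscale
        using b by (simp add: h_def \<phi> sum_distrib_left mult.left_commute)
    next
      fix a b v assume b: "a \<in> carrier A" "b \<in> carrier B" "v \<in> carrier M"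
      note d = dV[OF A.mult_closed[OF b(1) \<psi>_closed[OF b(2)]] b(3)] dV[OF b(1) M.act_closed[OF b(2,3)]]
      show "delta (a \<otimes>\<^bsub>A\<^esub> \<psi> b, v) - delta (a, act M b v) \<in> V" by (intro mem(1) d)
      obtain c where c: "c \<in> carrier B" "v = act M c w" using b cM by auto
      have \<phi>bv: "\<phi> u (act M b v) = (\<Sum>t\<in>Y. coefb b u t * \<phi> t v)" if "u \<in> Y" for u
      proof -
        have "\<phi> u (act M b v) = coefb (b \<otimes>\<^bsub>B\<^esub> c) u s"
          using b c w that by (simp add: M.act_mult[symmetric] \<phi>(1) B.closed)
        then show ?thesis using b c s that by (simp add: B.coef_mult \<phi>(1))
      qed
      have "h (a \<otimes>\<^bsub>A\<^esub> \<psi> b, v) = (\<Sum>t\<in>Y. \<Sum>u\<in>Y. coefa a (\<iota> s) (\<iota> u) * (coefb b u t * \<phi> t v))"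
        using b ex by (simp add: h_def coef_\<psi>_mult sum_distrib_right mult.assoc)
      also have "\<dots> = (\<Sum>u\<in>Y. \<Sum>t\<in>Y. coefa a (\<iota> s) (\<iota> u) * (coefb b u t * \<phi> t v))"
        by (rule sum.swap)
      also have "\<dots> = h (a, act M b v)"
        by (simp add: h_def \<phi>bv sum_distrib_left)
      finally show "cs.lsum h (delta (a \<otimes>\<^bsub>A\<^esub> \<psi> b, v) - delta (a, act M b v)) = 0"
        unfolding diff[OF d] cs_lsum_delta by simp
    qed
    moreover assume "?w = \<zero>\<^bsub>?N\<^esub>"
    then have "?w = 0 +o R" by (simp only: N zero_coset)
    then have "delta (\<one>\<^bsub>A\<^esub>, w) - 0 \<in> R" by (simp only: coset_eq_iff[OF R])
    then have "delta (\<one>\<^bsub>A\<^esub>, w) \<in> R" by (simp only: diff_zero)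
    ultimately have "cs.lsum h (delta (\<one>\<^bsub>A\<^esub>, w)) = 0" by blast
    then have "(\<Sum>t\<in>Y. coefa \<one>\<^bsub>A\<^esub> (\<iota> s) (\<iota> t) * \<phi> t w) = 0" by (simp add: h_def)
    moreover have "(\<Sum>t\<in>Y. coefa \<one>\<^bsub>A\<^esub> (\<iota> s) (\<iota> t) * \<phi> t w) = (\<Sum>t\<in>Y. of_bool (s = t) * \<phi> t w)"
      by (rule sum.cong) (use s \<iota>_inj ex in \<open>auto simp: A.coef_one inj_on_eq_iff\<close>)
    moreover have "\<phi> s w = 1"
      using \<phi>(1)[OF s B.E_props(1)[OF s s refl]] s w by (simp add: B.coefs)
    ultimately show False using s by (simp add: B.sum_of_bool_left)
  qed
  moreover have "carrier ?N = (\<lambda>a. act ?N a ?w) ` carrier A"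
  proof
    show "(\<lambda>a. act ?N a ?w) ` carrier A \<subseteq> carrier ?N" using w_in N.act_closed by auto
    have "g +o R \<in> (\<lambda>a. act ?N a ?w) ` carrier A" if "g \<in> V" for g
      using that unfolding V_def
    proof (induction rule: free_induct)
      case zero
      have "act ?N (0 \<odot>\<^bsub>A\<^esub> \<one>\<^bsub>A\<^esub>) ?w = \<zero>\<^bsub>?N\<^esub>"
        using w_in by (simp add: N.act_smult_left A.closed N.smult_zero' N.act_one)
      also have "\<dots> = 0 +o R" by (simp only: N zero_coset)
      finally show ?case by (metis A.closed(3,4) image_eqI)
    next
      case (delta p)
      then obtain a b where ab: "a \<in> carrier A" "b \<in> carrier B" "p = (a, act M b w)"
        using cM by auto
      then show ?case using gen[OF ab(1,2)] A.mult_closed[OF ab(1) \<psi>_closed[OF ab(2)]] by blast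
    next
      case (add f g)
      then obtain a b where "a \<in> carrier A" "f +o R = act ?N a ?w"
        "b \<in> carrier A" "g +o R = act ?N b ?w" by blast
      then have "(f + g) +o R = act ?N (a \<oplus>\<^bsub>A\<^esub> b) ?w" "a \<oplus>\<^bsub>A\<^esub> b \<in> carrier A"
        using w_in by (simp_all add: N.act_add_left plus[symmetric] A.closed)
      then show ?case by blast
    next
      case (scale c f)
      then obtain a where "a \<in> carrier A" "f +o R = act ?N a ?w" by blast
      then have "fscale c f +o R = act ?N (c \<odot>\<^bsub>A\<^esub> a) ?w" "c \<odot>\<^bsub>A\<^esub> a \<in> carrier A"
        using w_in by (simp_all add: N.act_smult_left smult[symmetric] A.closed)
      then show ?case by blast
    qed
    then show "carrier ?N \<subseteq> (\<lambda>a. act ?N a ?w) ` carrier A" by (auto simp: N(1))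
  qed
  ultimately show ?thesis unfolding A.of_type_def using lm w_in by blast
qed

end

section \<open>Matrices as partial maps on tuples\<close>

lemma uel_inj [simp]: "uel i = uel j \<longleftrightarrow> i = j"
proof
  assume "uel i = uel j"
  then have "uel i i = uel j i" by simp
  then show "i = j" by (simp add: uel_def split: if_splits)
qed simp

lemma uel_nonzero [simp]: "uel i \<noteq> 0" "0 \<noteq> uel i"
proof -
  have "uel i i \<noteq> 0" by (simp add: uel_def)
  then show "uel i \<noteq> 0" "0 \<noteq> uel i" by (metis zero_fun_apply)+
qed

lemma uel_mult: "uel i * uel j = (if i = j then uel i else 0)"
  by (auto simp: uel_def fun_eq_iff)

text \<open>In the last fact condition (b) appears without its two zero entries: they are forced,
  since a row has at most one nonzero entry.\<close>

lemma PsetD: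
  assumes "d \<in> Pset n m"
  shows "dim_row d = m" "dim_col d = m" "d \<in> carrier_mat m m"
    and "r < m \<Longrightarrow> c < m \<Longrightarrow> d $$ (r, c) \<noteq> 0 \<Longrightarrow> \<exists>i\<in>{1..n}. d $$ (r, c) = uel i"
    and "r < m \<Longrightarrow> c < m \<Longrightarrow> c' < m \<Longrightarrow> d $$ (r, c) \<noteq> 0 \<Longrightarrow> d $$ (r, c') \<noteq> 0 \<Longrightarrow> c = c'"
    and "r < m \<Longrightarrow> r' < m \<Longrightarrow> c < m \<Longrightarrow> d $$ (r, c) \<noteq> 0 \<Longrightarrow> d $$ (r', c) \<noteq> 0 \<Longrightarrow> r = r'"
    and "r < r' \<Longrightarrow> r' < m \<Longrightarrow> c < c' \<Longrightarrow> c' < m \<Longrightarrow> d $$ (r, c') = uel i \<Longrightarrow> d $$ (r', c) = uel i \<Longrightarrow> False"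
proof -
  note d = assms[unfolded Pset_def mem_Collect_eq]
  note d1 = d[THEN conjunct1] and d2 = d[THEN conjunct2, THEN conjunct1]
    and d3 = d[THEN conjunct2, THEN conjunct2, THEN conjunct1]
    and d4 = d[THEN conjunct2, THEN conjunct2, THEN conjunct2, THEN conjunct1]
    and d5 = d[THEN conjunct2, THEN conjunct2, THEN conjunct2, THEN conjunct2]
  show "dim_row d = m" "dim_col d = m" "d \<in> carrier_mat m m" using d1 by auto
  show 1: "\<exists>i\<in>{1..n}. d $$ (r, c) = uel i" if "r < m" "c < m" "d $$ (r, c) \<noteq> 0" for r c
  proof -
    have "d $$ (r, c) \<in> insert 0 (uel ` {1..n})" by (rule d2[rule_format, OF that(1,2)])
    then show ?thesis using that by auto
  qed
  show 2: "c = c'" if "r < m" "c < m" "c' < m" "d $$ (r, c) \<noteq> 0" "d $$ (r, c') \<noteq> 0" for r c c'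
    using d3[rule_format, of r c c'] that by simp
  show 3: "r = r'" if "r < m" "r' < m" "c < m" "d $$ (r, c) \<noteq> 0" "d $$ (r', c) \<noteq> 0" for r r' c
    using d4[rule_format, of c r r'] that by simp
  show False if h: "r < r'" "r' < m" "c < c'" "c' < m" "d $$ (r, c') = uel i" "d $$ (r', c) = uel i" for r r' c c'
  proof -
    have "d $$ (r, c) = 0" using 2[of r c c'] h by fastforce
    moreover have "d $$ (r', c') = 0" using 2[of r' c c'] h by fastforce
    moreover have "i \<in> {1..n}" using 1[of r c'] h by auto
    ultimately show False using d5 h by blast
  qed
qed

lemma PsetI:
  assumes "d \<in> carrier_mat m m"
    and "\<And>r c. r < m \<Longrightarrow> c < m \<Longrightarrow> d $$ (r, c) \<noteq> 0 \<Longrightarrow> \<exists>i\<in>{1..n}. d $$ (r, c) = uel i"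
    and "\<And>r c c'. r < m \<Longrightarrow> c < m \<Longrightarrow> c' < m \<Longrightarrow> d $$ (r, c) \<noteq> 0 \<Longrightarrow> d $$ (r, c') \<noteq> 0 \<Longrightarrow> c = c'"
    and "\<And>r r' c. r < m \<Longrightarrow> r' < m \<Longrightarrow> c < m \<Longrightarrow> d $$ (r, c) \<noteq> 0 \<Longrightarrow> d $$ (r', c) \<noteq> 0 \<Longrightarrow> r = r'"
    and "\<And>r r' c c' i. r < r' \<Longrightarrow> r' < m \<Longrightarrow> c < c' \<Longrightarrow> c' < m \<Longrightarrow> d $$ (r, c') = uel i \<Longrightarrow>
      d $$ (r', c) = uel i \<Longrightarrow> False"
  shows "d \<in> Pset n m"
proof -
  have "d $$ (r, c) \<in> insert 0 (uel ` {1..n})" if "r < m" "c < m" for r c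
    using assms(2)[OF that] by blast
  moreover have "\<not> (\<exists>i\<in>{1..n}. \<exists>r r' c c'. r < r' \<and> r' < m \<and> c < c' \<and> c' < m \<and>
      d $$ (r, c) = 0 \<and> d $$ (r, c') = uel i \<and> d $$ (r', c) = uel i \<and> d $$ (r', c') = 0)"
    using assms(5) by blast
  moreover have "\<forall>r<m. \<forall>c<m. \<forall>c'<m. d $$ (r, c) \<noteq> 0 \<and> d $$ (r, c') \<noteq> 0 \<longrightarrow> c = c'"
    by (intro allI impI, elim conjE, rule assms(3))
  moreover have "\<forall>c<m. \<forall>r<m. \<forall>r'<m. d $$ (r, c) \<noteq> 0 \<and> d $$ (r', c) \<noteq> 0 \<longrightarrow> r = r'"
    by (intro allI impI, elim conjE, rule assms(4))
  ultimately show ?thesis unfolding Pset_def using assms(1) by simp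
qed

lemma finite_Pset: "finite (Pset n m)"
proof (rule finite_subset)
  let ?F = "({0..<m} \<times> {0..<m}) \<rightarrow>\<^sub>E insert 0 (uel ` {1..n})"
  show "finite (mat m m ` ?F)" by (intro finite_imageI finite_PiE) auto
  show "Pset n m \<subseteq> mat m m ` ?F"
  proof
    fix d assume d: "d \<in> Pset n m"
    have "d = mat m m (restrict (\<lambda>p. d $$ p) ({0..<m} \<times> {0..<m}))"
      using PsetD[OF d] by (intro eq_matI) auto
    moreover have "restrict (\<lambda>p. d $$ p) ({0..<m} \<times> {0..<m}) \<in> ?F"
      unfolding restrict_PiE_iff
    proof
      fix p assume "p \<in> {0..<m} \<times> {0..<m}"
      then show "d $$ p \<in> insert 0 (uel ` {1..n})" using PsetD(4)[OF d] by (cases p) auto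
    qed
    ultimately show "d \<in> mat m m ` ?F" by blast
  qed
qed

text \<open>A row of \<open>d\<close> has at most one nonzero entry, so at most one term of the
  scalar product survives. The \<open>uel i\<close> are orthogonal idempotents, so this term is
  nonzero only when both factors have the same colour.\<close>

lemma mult_nonzero_entry:
  assumes d: "d \<in> Pset n m" and d': "d' \<in> Pset n m" and rc: "r < m" "c < m"
  shows "(d * d') $$ (r, c) = uel i \<longleftrightarrow> (\<exists>k<m. d $$ (r, k) = uel i \<and> d' $$ (k, c) = uel i)"
    and "(d * d') $$ (r, c) \<noteq> 0 \<Longrightarrow> \<exists>k<m. \<exists>i\<in>{1..n}. d $$ (r, k) = uel i \<and> d' $$ (k, c) = uel i"
proof -
  note D = PsetD[OF d] and D' = PsetD[OF d']
  have eq: "(d * d') $$ (r, c) = (\<Sum>k\<in>{0..<m}. d $$ (r, k) * d' $$ (k, c))"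
    using rc D(1-3) D'(1-3) by (simp add: scalar_prod_def)
  have one: "(d * d') $$ (r, c) = d $$ (r, k) * d' $$ (k, c)" if "k < m" "d $$ (r, k) \<noteq> 0" for k
  proof -
    have "d $$ (r, j) = 0" if "j \<in> {0..<m} - {k}" for j
      using D(5)[of r j k] rc \<open>k < m\<close> \<open>d $$ (r, k) \<noteq> 0\<close> that by auto
    then have "(\<Sum>j\<in>{0..<m} - {k}. d $$ (r, j) * d' $$ (j, c)) = 0" by (intro sum.neutral) simp
    then show ?thesis unfolding eq using that by (subst sum.remove[of _ k]) auto
  qed
  have zero: "(d * d') $$ (r, c) = 0" if "\<And>k. k < m \<Longrightarrow> d $$ (r, k) = 0"
    unfolding eq using that by (intro sum.neutral) auto
  show *: "\<exists>k<m. \<exists>i\<in>{1..n}. d $$ (r, k) = uel i \<and> d' $$ (k, c) = uel i" if nz: "(d * d') $$ (r, c) \<noteq> 0"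
  proof -
    obtain k where k: "k < m" "d $$ (r, k) \<noteq> 0" using zero nz by blast
    then obtain i where i: "i \<in> {1..n}" "d $$ (r, k) = uel i" using D(4) rc by blast
    have "d' $$ (k, c) \<noteq> 0" using one[OF k] nz by auto
    then obtain j where j: "j \<in> {1..n}" "d' $$ (k, c) = uel j" using D'(4) k rc by blast
    have "i = j" using one[OF k] nz by (auto simp: i j uel_mult split: if_splits)
    then show ?thesis using i j k by blast
  qed
  show "(d * d') $$ (r, c) = uel i \<longleftrightarrow> (\<exists>k<m. d $$ (r, k) = uel i \<and> d' $$ (k, c) = uel i)"
  proof
    assume u: "(d * d') $$ (r, c) = uel i"
    then obtain k j where k: "k < m" "d $$ (r, k) = uel j" "d' $$ (k, c) = uel j" using * by auto
    then have "(d * d') $$ (r, c) = uel j" using one[of k] by (simp add: uel_mult)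
    then have "i = j" using u by simp
    then show "\<exists>k<m. d $$ (r, k) = uel i \<and> d' $$ (k, c) = uel i" using k by blast
  next
    assume "\<exists>k<m. d $$ (r, k) = uel i \<and> d' $$ (k, c) = uel i"
    then obtain k where "k < m" "d $$ (r, k) = uel i" "d' $$ (k, c) = uel i" by blast
    then show "(d * d') $$ (r, c) = uel i" using one[of k] by (simp add: uel_mult)
  qed
qed

text \<open>The crossing condition is the point: two paths of one colour that cross in the product
  either cross in one factor or pass through the same middle index, and each case is
  excluded.\<close>

lemma Pset_mult:
  assumes d: "d \<in> Pset n m" and d': "d' \<in> Pset n m"
  shows "d * d' \<in> Pset n m"
proof (rule PsetI)
  note D = PsetD[OF d] and D' = PsetD[OF d'] and nz = mult_nonzero_entry[OF d d']
  show "d * d' \<in> carrier_mat m m" using D(3) D'(3) by simp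
  fix r assume r: "r < m"
  {
    fix c assume "c < m" "(d * d') $$ (r, c) \<noteq> 0"
    then show "\<exists>i\<in>{1..n}. (d * d') $$ (r, c) = uel i" using nz r by metis
  next
    fix c c' assume c: "c < m" "c' < m" "(d * d') $$ (r, c) \<noteq> 0" "(d * d') $$ (r, c') \<noteq> 0"
    obtain k i where k: "k < m" "d $$ (r, k) = uel i" "d' $$ (k, c) = uel i"
      using nz(2)[OF r c(1,3)] by blast
    obtain k' i' where k': "k' < m" "d $$ (r, k') = uel i'" "d' $$ (k', c') = uel i'"
      using nz(2)[OF r c(2,4)] by blast
    have "k = k'" using D(5)[of r k k'] k k' r by simp
    then show "c = c'" using D'(5)[of k c c'] k k' c by simp
  next
    fix r' c assume r': "r' < m" and c: "c < m" "(d * d') $$ (r, c) \<noteq> 0" "(d * d') $$ (r', c) \<noteq> 0"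
    obtain k i where k: "k < m" "d $$ (r, k) = uel i" "d' $$ (k, c) = uel i"
      using nz(2)[OF r c(1,2)] by blast
    obtain k' i' where k': "k' < m" "d $$ (r', k') = uel i'" "d' $$ (k', c) = uel i'"
      using nz(2)[OF r' c(1,3)] by blast
    have "k = k'" using D'(6)[of k k' c] k k' c by simp
    then show "r = r'" using D(6)[of r r' k] k k' r r' by simp
  }
next
  fix r r' c c' i
  assume a: "r < r'" "r' < m" "c < c'" "c' < m" "(d * d') $$ (r, c') = uel i" "(d * d') $$ (r', c) = uel i"
  note D = PsetD[OF d] and D' = PsetD[OF d'] and nz = mult_nonzero_entry[OF d d']
  have r: "r < m" and c: "c < m" using a by auto
  obtain k where k: "k < m" "d $$ (r, k) = uel i" "d' $$ (k, c') = uel i"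
    using a nz(1)[OF r a(4), of i] by blast
  obtain k' where k': "k' < m" "d $$ (r', k') = uel i" "d' $$ (k', c) = uel i"
    using a nz(1)[OF a(2) c, of i] by blast
  consider "k < k'" | "k = k'" | "k' < k" by linarith
  then show False
  proof cases
    case 1 then show False using D'(7)[of k k' c c' i] a k k' by blast
  next
    case 2 then show False using D(6)[of r r' k] a r k k' by simp
  next
    case 3 then show False using D(7)[of r r' k' k i] a k k' by blast
  qed
qed

text \<open>The tuples \<open>T \<in> X\<^sub>m\<close> are encoded as lists \<open>s\<close> with \<open>s ! c = k\<close> iff \<open>c \<in> T\<^sub>k\<close>. A matrix \<open>d\<close> acts
  on them as a partial map: \<open>carries d t s\<close> means that \<open>d\<close> is defined at \<open>s\<close> with value \<open>t\<close>, i.e.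
  the element of \<open>P\<^sub>m\<close> with column tuple \<open>s\<close> and row tuple \<open>t\<close> is contained in \<open>d\<close>.\<close>

definition colorings :: "nat \<Rightarrow> nat \<Rightarrow> nat list set" where
  "colorings n m = {s. length s = m \<and> set s \<subseteq> {0..n}}"

definition shape :: "nat \<Rightarrow> nat list \<Rightarrow> nat list" where
  "shape n s = map (count_list s) [0..<n + 1]"

definition carries :: "pmat \<Rightarrow> nat list \<Rightarrow> nat list \<Rightarrow> bool" where
  "carries d t s \<longleftrightarrow>
    (\<forall>c<length s. s ! c \<noteq> 0 \<longrightarrow> (\<exists>r<length t. d $$ (r, c) = uel (s ! c) \<and> t ! r = s ! c)) \<and>
    (\<forall>r<length t. t ! r \<noteq> 0 \<longrightarrow> (\<exists>c<length s. d $$ (r, c) = uel (t ! r) \<and> s ! c = t ! r))"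

text \<open>Here \<open>t\<close> and \<open>s\<close> are the row tuple and the column tuple of
  \<open>d\<close> itself: no nonzero entry of \<open>d\<close> is left over.\<close>

definition full :: "pmat \<Rightarrow> nat list \<Rightarrow> nat list \<Rightarrow> bool" where
  "full d t s \<longleftrightarrow> carries d t s \<and>
    (\<forall>r<length t. \<forall>c<length s. d $$ (r, c) \<noteq> 0 \<longrightarrow> d $$ (r, c) = uel (s ! c) \<and> t ! r = s ! c \<and> s ! c \<noteq> 0)"

lemma coloringsD: "s \<in> colorings n m \<Longrightarrow> length s = m" "s \<in> colorings n m \<Longrightarrow> c < m \<Longrightarrow> s ! c \<le> n"
  unfolding colorings_def using nth_mem by fastforce+

lemma finite_colorings: "finite (colorings n m)"
  using finite_lists_length_eq[of "{0..n}" m] by (simp add: colorings_def conj_commute)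

text \<open>A column of \<open>d\<close> has at most one nonzero entry, so the row that receives its
  colour is forced; rows that receive none have colour 0.\<close>

lemma carries_functional:
  assumes d: "d \<in> Pset n m" and s: "length s = m" "length t = m" "length u = m"
    and "carries d t s" "carries d u s"
  shows "t = u"
proof -
  have *: "t ! r = u ! r" if h: "r < m" "t ! r \<noteq> 0" "carries d t s" "carries d u s" "length u = m" "length t = m" for t u r
  proof -
    obtain c where c: "c < m" "d $$ (r, c) = uel (t ! r)" "s ! c = t ! r"
      using h s(1) unfolding carries_def by metis
    then obtain r' where r': "r' < m" "d $$ (r', c) = uel (s ! c)" "u ! r' = s ! c"
      using h s(1) unfolding carries_def by metis
    have "r = r'" using PsetD(6)[OF d, of r r' c] c r' that by simp
    then show ?thesis using c r' by simp
  qed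
  have "t ! r = u ! r" if "r < m" for r
  proof (cases "t ! r = 0 \<and> u ! r = 0")
    case False
    then show ?thesis using *[of r t u] *[of r u t] assms that by metis
  qed simp
  then show ?thesis using s by (intro nth_equalityI) auto
qed

text \<open>Together with \<open>carries_functional\<close> this makes the matrix product a
  composition of partial maps.\<close>

lemma carries_mult:
  assumes d: "d \<in> Pset n m" and d': "d' \<in> Pset n m" and s: "s \<in> colorings n m" "t \<in> colorings n m"
  shows "carries (d * d') t s \<longleftrightarrow> (\<exists>u\<in>colorings n m. carries d t u \<and> carries d' u s)"
proof
  note ls = coloringsD(1)[OF s(1)] coloringsD(1)[OF s(2)]
  note nz = mult_nonzero_entry[OF d d']
  assume rel: "carries (d * d') t s"
  \<comment> \<open>The middle tuple is forced: position \<open>k\<close> gets the nonzero colour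
    \<open>i\<close> if \<open>d'\<close> moves some column of colour \<open>i\<close> in
    \<open>s\<close> to row \<open>k\<close>, and colour 0 if there is no such column.\<close>
  define P where "P k i \<longleftrightarrow> i \<noteq> 0 \<and> (\<exists>c<m. d' $$ (k, c) = uel i \<and> s ! c = i)" for k i
  have uniq: "i = j" if "P k i" "P k j" "k < m" for k i j
    using that PsetD(5)[OF d', of k] unfolding P_def by (metis uel_nonzero(1))
  define u where "u = map (\<lambda>k. if \<exists>i. P k i then THE i. P k i else 0) [0..<m]"
  have u1: "u ! k = i" if "k < m" "P k i" for k i
    using that uniq by (auto simp: u_def intro!: the_equality)
  have u2: "P k (u ! k)" if k: "k < m" "u ! k \<noteq> 0" for k
  proof -
    have "\<exists>i. P k i" using k by (auto simp: u_def split: if_splits)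
    then show ?thesis using u1 k by metis
  qed
  have lu: "length u = m" by (simp add: u_def)
  have "u ! k \<le> n" if k: "k < m" for k
    using u2[OF k] coloringsD(2)[OF s(1)] unfolding P_def by (metis le0)
  then have u: "u \<in> colorings n m" using lu by (auto simp: colorings_def in_set_conv_nth)
  have "carries d' u s" unfolding carries_def lu ls
  proof (intro conjI allI impI)
    fix c assume c: "c < m" "s ! c \<noteq> 0"
    then obtain r where r: "r < m" "(d * d') $$ (r, c) = uel (s ! c)" using rel ls unfolding carries_def by metis
    then obtain k where k: "k < m" "d' $$ (k, c) = uel (s ! c)" using nz(1)[OF r(1) c(1)] by blast
    then have "u ! k = s ! c" using c by (intro u1) (auto simp: P_def)
    then show "\<exists>k<m. d' $$ (k, c) = uel (s ! c) \<and> u ! k = s ! c" using k by blast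
  next
    fix k assume "k < m" "u ! k \<noteq> 0"
    then show "\<exists>c<m. d' $$ (k, c) = uel (u ! k) \<and> s ! c = u ! k" using u2 unfolding P_def by blast
  qed
  moreover have "carries d t u" unfolding carries_def lu ls
  proof (intro conjI allI impI)
    fix k assume k: "k < m" "u ! k \<noteq> 0"
    then obtain c where c: "c < m" "d' $$ (k, c) = uel (u ! k)" "s ! c = u ! k" using u2 unfolding P_def by blast
    then obtain r where r: "r < m" "(d * d') $$ (r, c) = uel (u ! k)" "t ! r = u ! k"
      using rel ls k unfolding carries_def by metis
    then obtain k' where k': "k' < m" "d $$ (r, k') = uel (u ! k)" "d' $$ (k', c) = uel (u ! k)"
      using nz(1)[OF r(1) c(1)] by blast
    have "k = k'" using PsetD(6)[OF d', of k k' c] k k' c by simp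
    then show "\<exists>r<m. d $$ (r, k) = uel (u ! k) \<and> t ! r = u ! k" using k' r by blast
  next
    fix r assume r: "r < m" "t ! r \<noteq> 0"
    then obtain c where c: "c < m" "(d * d') $$ (r, c) = uel (t ! r)" "s ! c = t ! r"
      using rel ls unfolding carries_def by metis
    then obtain k where k: "k < m" "d $$ (r, k) = uel (t ! r)" "d' $$ (k, c) = uel (t ! r)"
      using nz(1)[OF r(1) c(1)] by blast
    then have "u ! k = t ! r" using c r by (intro u1) (auto simp: P_def)
    then show "\<exists>k<m. d $$ (r, k) = uel (t ! r) \<and> u ! k = t ! r" using k by blast
  qed
  ultimately show "\<exists>u\<in>colorings n m. carries d t u \<and> carries d' u s" using u by blast
next
  note ls = coloringsD(1)[OF s(1)] coloringsD(1)[OF s(2)]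
  note nz = mult_nonzero_entry(1)[OF d d']
  assume "\<exists>u\<in>colorings n m. carries d t u \<and> carries d' u s"
  then obtain u where u: "length u = m" "carries d t u" "carries d' u s" by (auto dest: coloringsD)
  show "carries (d * d') t s" unfolding carries_def ls
  proof (intro conjI allI impI)
    fix c assume c: "c < m" "s ! c \<noteq> 0"
    then obtain k where k: "k < m" "d' $$ (k, c) = uel (s ! c)" "u ! k = s ! c"
      using u ls unfolding carries_def by metis
    then obtain r where r: "r < m" "d $$ (r, k) = uel (s ! c)" "t ! r = s ! c"
      using u ls c unfolding carries_def by metis
    then show "\<exists>r<m. (d * d') $$ (r, c) = uel (s ! c) \<and> t ! r = s ! c"
      using nz[OF r(1) c(1)] k by blast
  next
    fix r assume r: "r < m" "t ! r \<noteq> 0"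
    then obtain k where k: "k < m" "d $$ (r, k) = uel (t ! r)" "u ! k = t ! r"
      using u ls unfolding carries_def by metis
    then obtain c where c: "c < m" "d' $$ (k, c) = uel (t ! r)" "s ! c = t ! r"
      using u ls r unfolding carries_def by metis
    then show "\<exists>c<m. (d * d') $$ (r, c) = uel (t ! r) \<and> s ! c = t ! r"
      using nz[OF r(1) c(1)] k by blast
  qed
qed

text \<open>This is where the crossing condition enters. Suppose \<open>d\<close> and
  \<open>d'\<close> send column \<open>c\<close> to rows \<open>r < r'\<close>. Then
  \<open>d'\<close> must fill row \<open>r\<close> from some other column \<open>c'\<close>: left of
  \<open>c\<close>, the hypothesis on smaller columns puts a second entry into row \<open>r\<close>
  of \<open>d\<close>; right of \<open>c\<close>, two entries of \<open>d'\<close> cross.\<close>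

lemma carries_agree_less:
  assumes d: "d \<in> Pset n m" and d': "d' \<in> Pset n m" and ls: "length s = m" "length t = m"
    and rel: "carries d' t s" and c: "c < m" "s ! c = i" "i \<noteq> 0" and r: "r < m" "r' < m"
    and IH: "\<And>c' r. c' < c \<Longrightarrow> r < m \<Longrightarrow> s ! c' \<noteq> 0 \<Longrightarrow> d' $$ (r, c') = uel (s ! c') \<Longrightarrow> d $$ (r, c') = uel (s ! c')"
    and e: "d $$ (r, c) = uel i" "d' $$ (r', c) = uel i" "t ! r = i"
  shows "\<not> r < r'"
proof
  assume rr: "r < r'"
  obtain c' where c': "c' < m" "d' $$ (r, c') = uel i" "s ! c' = i"
    using rel ls r e(3) c(3) unfolding carries_def by metis
  consider "c' < c" | "c' = c" | "c < c'" by linarith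
  then show False
  proof cases
    case 1
    then have "d $$ (r, c') = uel i" using IH c' c r by metis
    then show False using PsetD(5)[OF d, of r c c'] e c c' r 1 by simp
  next
    case 2
    then show False using PsetD(6)[OF d', of r r' c] c' e c r rr by simp
  next
    case 3
    then show False using PsetD(7)[OF d' rr r(2) 3 c'(1) c'(2) e(2)] by blast
  qed
qed

text \<open>Without crossings the columns of one colour are matched with the rows of that colour in
  increasing order, so \<open>t\<close> and \<open>s\<close> determine the entries that are used.
  The induction goes through the columns from left to right.\<close>

lemma carries_agree:
  assumes d: "d \<in> Pset n m" and d': "d' \<in> Pset n m" and ls: "length s = m" "length t = m"
    and rel: "carries d t s" "carries d' t s" and "c < m" "r < m" "s ! c \<noteq> 0"
  shows "d $$ (r, c) = uel (s ! c) \<longleftrightarrow> d' $$ (r, c) = uel (s ! c)"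
  using assms(7-)
proof (induction c arbitrary: r rule: less_induct)
  case (less c)
  obtain r1 where r1: "r1 < m" "d $$ (r1, c) = uel (s ! c)" "t ! r1 = s ! c"
    using rel(1) ls less.prems unfolding carries_def by metis
  obtain r2 where r2: "r2 < m" "d' $$ (r2, c) = uel (s ! c)" "t ! r2 = s ! c"
    using rel(2) ls less.prems unfolding carries_def by metis
  have "\<not> r1 < r2"
    by (rule carries_agree_less[OF d d' ls rel(2) less.prems(1) refl less.prems(3) r1(1) r2(1) _ r1(2) r2(2) r1(3)])
      (use less in auto)
  moreover have "\<not> r2 < r1"
    by (rule carries_agree_less[OF d' d ls rel(1) less.prems(1) refl less.prems(3) r2(1) r1(1) _ r2(2) r1(2) r2(3)])
      (use less in auto)
  ultimately have "r1 = r2" by simp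
  then show ?case
    using PsetD(6)[OF d, of r r1 c] PsetD(6)[OF d', of r r2 c] r1 r2 less.prems by (metis uel_nonzero(1))
qed

lemma ex_full:
  assumes d: "d \<in> Pset n m"
  shows "\<exists>t\<in>colorings n m. \<exists>s\<in>colorings n m. full d t s"
proof -
  have "\<exists>i\<le>n. (\<exists>r<m. d $$ (r, c) = uel i \<and> i \<noteq> 0) \<or> (i = 0 \<and> (\<forall>r<m. d $$ (r, c) = 0))" if h: "c < m" for c
  proof (cases "\<forall>r<m. d $$ (r, c) = 0")
    case False
    then obtain r i where "r < m" "i \<in> {1..n}" "d $$ (r, c) = uel i" using PsetD(4)[OF d _ h] by blast
    then show ?thesis by (intro exI[of _ i]) auto
  qed (intro exI[of _ 0], simp)
  then obtain f where f: "\<And>c. c < m \<Longrightarrow> f c \<le> n \<and> ((\<exists>r<m. d $$ (r, c) = uel (f c) \<and> f c \<noteq> 0) \<or> (f c = 0 \<and> (\<forall>r<m. d $$ (r, c) = 0)))"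
    by metis
  have "\<exists>i\<le>n. (\<exists>c<m. d $$ (r, c) = uel i \<and> i \<noteq> 0) \<or> (i = 0 \<and> (\<forall>c<m. d $$ (r, c) = 0))" if h: "r < m" for r
  proof (cases "\<forall>c<m. d $$ (r, c) = 0")
    case False
    then obtain c i where "c < m" "i \<in> {1..n}" "d $$ (r, c) = uel i" using PsetD(4)[OF d h] by blast
    then show ?thesis by (intro exI[of _ i]) auto
  qed (intro exI[of _ 0], simp)
  then obtain g where g: "\<And>r. r < m \<Longrightarrow> g r \<le> n \<and> ((\<exists>c<m. d $$ (r, c) = uel (g r) \<and> g r \<noteq> 0) \<or> (g r = 0 \<and> (\<forall>c<m. d $$ (r, c) = 0)))"
    by metis
  define s t where "s = map f [0..<m]" and "t = map g [0..<m]"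
  have X: "s \<in> colorings n m" "t \<in> colorings n m"
    using f g by (auto simp: s_def t_def colorings_def)
  have entry: "d $$ (r, c) = uel (f c) \<and> g r = f c \<and> f c \<noteq> 0" if rc: "r < m" "c < m" "d $$ (r, c) \<noteq> 0" for r c
  proof -
    obtain r' where "r' < m" "d $$ (r', c) = uel (f c)" "f c \<noteq> 0" using f[OF rc(2)] rc by metis
    moreover obtain c' where "c' < m" "d $$ (r, c') = uel (g r)" using g[OF rc(1)] rc by metis
    ultimately show ?thesis using PsetD(5)[OF d, of r c c'] PsetD(6)[OF d, of r r' c] rc by (metis uel_inj uel_nonzero(1))
  qed
  have "carries d t s"
    unfolding carries_def
  proof (intro conjI allI impI)
    fix c assume "c < length s" "s ! c \<noteq> 0"
    then have c: "c < m" "f c \<noteq> 0" by (auto simp: s_def)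
    then obtain r where r: "r < m" "d $$ (r, c) = uel (f c)" using f by metis
    then have "g r = f c" using entry[OF r(1) c(1)] by simp
    then show "\<exists>r<length t. d $$ (r, c) = uel (s ! c) \<and> t ! r = s ! c"
      using c r by (intro exI[of _ r]) (simp add: s_def t_def)
  next
    fix r assume "r < length t" "t ! r \<noteq> 0"
    then have r: "r < m" "g r \<noteq> 0" by (auto simp: t_def)
    then obtain c where c: "c < m" "d $$ (r, c) = uel (g r)" using g by metis
    then have "f c = g r" using entry[OF r(1) c(1)] by simp
    then show "\<exists>c<length s. d $$ (r, c) = uel (t ! r) \<and> s ! c = t ! r"
      using c r by (intro exI[of _ c]) (simp add: s_def t_def)
  qed
  then have "full d t s"
    using entry by (auto simp: full_def s_def t_def)
  then show ?thesis using X by blast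
qed

section \<open>Multiplicities of colours as the invariant of the action\<close>

lemma count_list_card: "count_list s i = card {c. c < length s \<and> s ! c = i}"
  by (simp add: count_list_eq_length_filter length_filter_conv_card eq_commute)

lemma shape_eq_iff: "shape n t = shape n s \<longleftrightarrow> (\<forall>i\<le>n. count_list t i = count_list s i)"
  by (auto simp: shape_def less_Suc_eq_le simp del: upt_Suc)

text \<open>For a nonzero colour \<open>i\<close>, the entries \<open>uel i\<close> used by
  \<open>t\<close> and \<open>s\<close> match the columns of colour \<open>i\<close> bijectively
  with the rows of colour \<open>i\<close>. The multiplicity of colour 0 follows from the common
  length \<open>m\<close>.\<close>

lemma carries_shape:
  assumes d: "d \<in> Pset n m" and s: "s \<in> colorings n m" and t: "t \<in> colorings n m" and rel: "carries d t s"
  shows "shape n t = shape n s"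
proof -
  note ls = coloringsD(1)[OF s] coloringsD(1)[OF t]
  have pos: "count_list t i = count_list s i" if i: "i \<noteq> 0" for i
  proof -
    let ?Z = "{(r, c). r < m \<and> c < m \<and> d $$ (r, c) = uel i \<and> s ! c = i \<and> t ! r = i}"
    have "fst ` ?Z = {r. r < length t \<and> t ! r = i}"
    proof (intro equalityI subsetI)
      fix r assume "r \<in> {r. r < length t \<and> t ! r = i}"
      then obtain c where "(r, c) \<in> ?Z" using rel i unfolding carries_def ls by auto
      then show "r \<in> fst ` ?Z" by (rule image_eqI[rotated]) simp
    qed (use ls in auto)
    moreover have "snd ` ?Z = {c. c < length s \<and> s ! c = i}"
    proof (intro equalityI subsetI)
      fix c assume "c \<in> {c. c < length s \<and> s ! c = i}"
      then obtain r where "(r, c) \<in> ?Z" using rel i unfolding carries_def ls by auto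
      then show "c \<in> snd ` ?Z" by (rule image_eqI[rotated]) simp
    qed (use ls in auto)
    moreover have "inj_on fst ?Z"
    proof (rule inj_onI)
      fix p q assume "p \<in> ?Z" "q \<in> ?Z" "fst p = fst q"
      then show "p = q" using PsetD(5)[OF d, of "fst p" "snd p" "snd q"] by (cases p, cases q) simp
    qed
    moreover have "inj_on snd ?Z"
    proof (rule inj_onI)
      fix p q assume "p \<in> ?Z" "q \<in> ?Z" "snd p = snd q"
      then show "p = q" using PsetD(6)[OF d, of "fst p" "fst q" "snd p"] by (cases p, cases q) simp
    qed
    ultimately show ?thesis unfolding count_list_card using card_image[of fst ?Z] card_image[of snd ?Z] by simp
  qed
  have "sum (count_list u) {0..n} = count_list u 0 + sum (count_list u) {1..n}" for u
    by (simp add: sum.atLeast_Suc_atMost)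
  moreover have "sum (count_list s) {0..n} = sum (count_list t) {0..n}"
    using s t by (simp add: sum_count_set colorings_def)
  moreover have "sum (count_list s) {1..n} = sum (count_list t) {1..n}"
    by (rule sum.cong) (auto simp: pos)
  ultimately have "count_list s 0 = count_list t 0" by simp
  then show ?thesis unfolding shape_eq_iff using pos by metis
qed

text \<open>For each nonzero colour the positions in \<open>s\<close> and in \<open>t\<close> are
  enumerated increasingly and matched in this order; monotonicity excludes crossings.\<close>

lemma ex_full_of_shape:
  assumes s: "s \<in> colorings n m" and t: "t \<in> colorings n m" and sh: "shape n t = shape n s"
  shows "\<exists>d\<in>Pset n m. full d t s"
proof -
  note ls = coloringsD(1)[OF s] coloringsD(1)[OF t]
  define S where "S u i = {c. c < m \<and> u ! c = i}" for u and i :: nat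
  have fin: "finite (S u i)" for u i by (simp add: S_def)
  have card: "card (S t i) = card (S s i)" if "i \<le> n" for i
    using sh that by (simp add: shape_eq_iff count_list_card ls S_def)
  have "\<exists>h. bij_betw h {..<card (S u i)} (S u i) \<and> strict_mono_on {..<card (S u i)} h" for u i
    using ex_bij_betw_strict_mono_card[OF fin[of u i]] by metis
  then obtain h where h: "\<And>u i. bij_betw (h u i) {..<card (S u i)} (S u i)"
    "\<And>u i. strict_mono_on {..<card (S u i)} (h u i)" by metis
  define d where "d = mat m m (\<lambda>(r, c). if s ! c \<noteq> 0 \<and> t ! r = s ! c \<and>
      (\<exists>k<card (S s (s ! c)). r = h t (s ! c) k \<and> c = h s (s ! c) k) then uel (s ! c) else 0)"
  have entry: "d $$ (r, c) = uel i \<longleftrightarrow> i \<noteq> 0 \<and> s ! c = i \<and> t ! r = i \<and>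
      (\<exists>k<card (S s i). r = h t i k \<and> c = h s i k)" if "r < m" "c < m" for r c i
    using that by (auto simp: d_def)
  have nz: "\<exists>i\<in>{1..n}. d $$ (r, c) = uel i" if "r < m" "c < m" "d $$ (r, c) \<noteq> 0" for r c
  proof -
    have "d $$ (r, c) = uel (s ! c)" using that by (auto simp: d_def split: if_splits)
    moreover have "s ! c \<noteq> 0" using that by (auto simp: d_def split: if_splits)
    ultimately show ?thesis using coloringsD(2)[OF s that(2)] by (intro bexI[of _ "s ! c"]) auto
  qed
  have inj: "k = k'" if "k < card (S s i)" "k' < card (S s i)" "h s i k = h s i k' \<or> h t i k = h t i k'" "i \<le> n" for i k k'
    using that h(1)[of s i] h(1)[of t i] card[of i] unfolding bij_betw_def inj_on_def by auto
  have "d \<in> Pset n m"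
  proof (rule PsetI)
    show "d \<in> carrier_mat m m" by (simp add: d_def)
  next
    fix r c c' assume a: "r < m" "c < m" "c' < m" "d $$ (r, c) \<noteq> 0" "d $$ (r, c') \<noteq> 0"
    obtain i j where i: "i \<in> {1..n}" "d $$ (r, c) = uel i" "j \<in> {1..n}" "d $$ (r, c') = uel j"
      using nz a by metis
    then have "i = j" using entry a by metis
    then have j: "d $$ (r, c) = uel i" "d $$ (r, c') = uel i" using i by auto
    obtain k where k: "k < card (S s i)" "r = h t i k" "c = h s i k" using entry[OF a(1,2), of i] j by blast
    obtain k' where k': "k' < card (S s i)" "r = h t i k'" "c' = h s i k'" using entry[OF a(1,3), of i] j by blast
    have "h s i k = h s i k' \<or> h t i k = h t i k'" using k(2,3) k'(2,3) by simp
    then have "k = k'" using inj[OF k(1) k'(1)] i by simp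
    then show "c = c'" using k k' by simp
  next
    fix r r' c assume a: "r < m" "r' < m" "c < m" "d $$ (r, c) \<noteq> 0" "d $$ (r', c) \<noteq> 0"
    obtain i j where i: "i \<in> {1..n}" "d $$ (r, c) = uel i" "j \<in> {1..n}" "d $$ (r', c) = uel j"
      using nz a by metis
    then have "i = j" using entry a by metis
    then have j: "d $$ (r, c) = uel i" "d $$ (r', c) = uel i" using i by auto
    obtain k where k: "k < card (S s i)" "r = h t i k" "c = h s i k" using entry[OF a(1,3), of i] j by blast
    obtain k' where k': "k' < card (S s i)" "r' = h t i k'" "c = h s i k'" using entry[OF a(2,3), of i] j by blast
    have "h s i k = h s i k' \<or> h t i k = h t i k'" using k(2,3) k'(2,3) by simp
    then have "k = k'" using inj[OF k(1) k'(1)] i by simp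
    then show "r = r'" using k k' by simp
  next
    fix r r' c c' i assume a: "r < r'" "r' < m" "c < c'" "c' < m" "d $$ (r, c') = uel i" "d $$ (r', c) = uel i"
    have rc: "r < m" "c < m" using a by auto
    then have "i \<noteq> 0" "s ! c = i" using entry[of r' c i] a by auto
    then have i: "i \<le> n" using coloringsD(2)[OF s rc(2)] by simp
    obtain k where k: "k < card (S s i)" "r = h t i k" "c' = h s i k" using entry[of r c' i] a rc by auto
    obtain k' where k': "k' < card (S s i)" "r' = h t i k'" "c = h s i k'" using entry[of r' c i] a rc by auto
    have "k < k'"
      using strict_mono_on_less[OF h(2)[of t i], of k k'] k k' a card[OF i] by simp
    moreover have "k' < k"
      using strict_mono_on_less[OF h(2)[of s i], of k' k] k k' a by simp
    ultimately show False by simp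
  qed (rule nz)
  moreover have "carries d t s" unfolding carries_def ls
  proof (intro conjI allI impI)
    fix c assume c: "c < m" "s ! c \<noteq> 0"
    define i where "i = s ! c"
    have i: "i \<le> n" unfolding i_def by (rule coloringsD(2)[OF s c(1)])
    have "c \<in> S s i" using c by (simp add: S_def i_def)
    then obtain k where k: "k < card (S s i)" "c = h s i k"
      using h(1)[of s i] unfolding bij_betw_def by auto
    then have "h t i k \<in> S t i" using h(1)[of t i] card[OF i] unfolding bij_betw_def by auto
    then have "h t i k < m" "t ! h t i k = i" by (auto simp: S_def)
    then show "\<exists>r<m. d $$ (r, c) = uel (s ! c) \<and> t ! r = s ! c"
      using k c entry[of "h t i k" c i] unfolding i_def by blast
  next
    fix r assume r: "r < m" "t ! r \<noteq> 0"
    define i where "i = t ! r"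
    have i: "i \<le> n" unfolding i_def by (rule coloringsD(2)[OF t r(1)])
    have "r \<in> S t i" using r by (simp add: S_def i_def)
    then obtain k where k: "k < card (S s i)" "r = h t i k"
      using h(1)[of t i] card[OF i] unfolding bij_betw_def by auto
    then have "h s i k \<in> S s i" using h(1)[of s i] unfolding bij_betw_def by auto
    then have "h s i k < m" "s ! h s i k = i" by (auto simp: S_def)
    then show "\<exists>c<m. d $$ (r, c) = uel (t ! r) \<and> s ! c = t ! r"
      using k r entry[of r "h s i k" i] unfolding i_def by blast
  qed
  moreover have "\<forall>r<m. \<forall>c<m. d $$ (r, c) \<noteq> 0 \<longrightarrow> d $$ (r, c) = uel (s ! c) \<and> t ! r = s ! c \<and> s ! c \<noteq> 0"
    by (auto simp: d_def)
  ultimately show ?thesis unfolding full_def ls by blast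
qed

section \<open>Matrix units in the semigroup algebras\<close>

text \<open>The matrix of \<open>a\<close> in the linearised action of \<open>P\<^sub>m\<close> by partial maps. In these coordinates \<open>x\<^sub>d\<close> is a
  matrix unit (lemma \<open>coefP_xvec\<close>).\<close>

definition coefP :: "pvec \<Rightarrow> nat list \<Rightarrow> nat list \<Rightarrow> complex" where
  "coefP a t s = cs.lsum (\<lambda>d. of_bool (carries d t s)) a"

lemma coefP_linear:
  "a \<in> free_space S \<Longrightarrow> b \<in> free_space S \<Longrightarrow> coefP (a + b) t s = coefP a t s + coefP b t s"
  "a \<in> free_space S \<Longrightarrow> b \<in> free_space S \<Longrightarrow> coefP (a - b) t s = coefP a t s - coefP b t s"
  "coefP (fscale c a) t s = c * coefP a t s"
  "coefP (delta d) t s = of_bool (carries d t s)"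
  by (simp_all only: coefP_def cs_lsum_add cs_lsum_diff cs_lsum_fscale cs_lsum_delta)

text \<open>At most one middle tuple contributes to a product \<open>d * d'\<close>, by
  \<open>carries_functional\<close>, so the sum over middle tuples is again an indicator.\<close>

lemma coefP_mult:
  assumes a: "a \<in> free_space (Pset n m)" and b: "b \<in> free_space (Pset n m)"
    and ts: "t \<in> colorings n m" "s \<in> colorings n m"
  shows "coefP (bilin_ext (*) a b) t s = (\<Sum>u\<in>colorings n m. coefP a t u * coefP b u s)"
proof -
  have "coefP (bilin_ext (*) a b) t s =
      cs.lsum (\<lambda>d. cs.lsum (\<lambda>d'. of_bool (carries (d * d') t s)) b) a"
    unfolding coefP_def by (rule cs_lsum_bilin_ext[OF b])
  also have "\<dots> = cs.lsum (\<lambda>d. cs.lsum (\<lambda>d'.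
      \<Sum>u\<in>colorings n m. of_bool (carries d t u) * of_bool (carries d' u s)) b) a"
  proof (intro cs.lsum_cong)
    fix d d' assume "a d \<noteq> 0" "b d' \<noteq> 0"
    then have d: "d \<in> Pset n m" "d' \<in> Pset n m" using a b by (auto dest: free_spaceD)
    show "of_bool (carries (d * d') t s) =
      (\<Sum>u\<in>colorings n m. of_bool (carries d t u) * of_bool (carries d' u s) :: complex)"
    proof (cases "\<exists>u\<in>colorings n m. carries d t u \<and> carries d' u s")
      case True
      then obtain u where u: "u \<in> colorings n m" "carries d t u" "carries d' u s" by blast
      have "(\<Sum>v\<in>colorings n m. of_bool (carries d t v) * of_bool (carries d' v s) :: complex) =
          (\<Sum>v\<in>colorings n m. if v = u then 1 else 0)"
      proof (rule sum.cong)
        fix v assume v: "v \<in> colorings n m"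
        show "(of_bool (carries d t v) * of_bool (carries d' v s) :: complex) = (if v = u then 1 else 0)"
        proof (cases "carries d' v s")
          case True
          then have "v = u"
            by (rule carries_functional[OF d(2) coloringsD(1)[OF ts(2)] coloringsD(1)[OF v] coloringsD(1)[OF u(1)] _ u(3)])
          then show ?thesis using u by simp
        next
          case False
          then have "v \<noteq> u" using u by blast
          then show ?thesis using False by simp
        qed
      qed simp
      then show ?thesis
        using u carries_mult[OF d ts(2,1)] by (auto simp: sum.delta finite_colorings)
    next
      case False
      then show ?thesis using carries_mult[OF d ts(2,1)] by (auto intro!: sum.neutral[symmetric])
    qed
  qed
  also have "\<dots> = (\<Sum>u\<in>colorings n m. coefP a t u * coefP b u s)"
    unfolding cs.lsum_sum_fun coefP_def cs.lsum_scale_fun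
  proof (rule sum.cong)
    fix u
    show "cs.lsum (\<lambda>d. of_bool (carries d t u) * cs.lsum (\<lambda>d'. of_bool (carries d' u s)) b) a =
        cs.lsum (\<lambda>d. of_bool (carries d t u)) a * cs.lsum (\<lambda>d. of_bool (carries d u s)) b"
      using cs.lsum_scale_fun[of "cs.lsum (\<lambda>d. of_bool (carries d u s)) b" "\<lambda>d. of_bool (carries d t u)" a]
      by (simp add: mult.commute)
  qed simp
  finally show ?thesis .
qed

section \<open>Faithfulness of the representation and the elements \<open>xvec d\<close>\<close>

definition support :: "pmat \<Rightarrow> (nat \<times> nat) set" where
  "support d = {(r, c). r < dim_row d \<and> c < dim_col d \<and> d $$ (r, c) \<noteq> 0}"

lemma msize_support: "msize d = card (support d)"
  by (simp add: msize_def support_def)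

lemma finite_support: "finite (support d)"
  by (rule finite_subset[of _ "{..<dim_row d} \<times> {..<dim_col d}"]) (auto simp: support_def)

lemma sub_mat_support: "sub_mat d' d \<Longrightarrow> support d' \<subseteq> support d"
  unfolding sub_mat_def support_def by (auto, metis)

lemma sub_mat_eq:
  assumes "sub_mat d' d" "support d \<subseteq> support d'"
  shows "d' = d"
proof (rule eq_matI)
  show "dim_row d' = dim_row d" "dim_col d' = dim_col d" using assms by (simp_all add: sub_mat_def)
  fix r c assume rc: "r < dim_row d" "c < dim_col d"
  then have "d' $$ (r, c) = 0 \<or> d' $$ (r, c) = d $$ (r, c)" using assms(1) by (simp add: sub_mat_def)
  moreover have "d' $$ (r, c) \<noteq> 0" if "d $$ (r, c) \<noteq> 0"
    using assms rc that by (auto simp: support_def)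
  ultimately show "d' $$ (r, c) = d $$ (r, c)" by metis
qed

text \<open>A matrix \<open>d\<close> of maximal size among those occurring in \<open>a\<close> is
  seen in isolation: by \<open>carries_agree\<close>, any \<open>d'\<close> that carries the column
  tuple of \<open>d\<close> to its row tuple contains \<open>d\<close>, and maximality makes them
  equal. The coefficient at these tuples is then \<open>a d\<close>.\<close>

lemma coefP_inj:
  assumes a: "a \<in> free_space (Pset n m)"
    and z: "\<And>t s. t \<in> colorings n m \<Longrightarrow> s \<in> colorings n m \<Longrightarrow> coefP a t s = 0"
  shows "a = 0"
proof (rule ccontr)
  assume "a \<noteq> 0"
  then have ne: "{d. a d \<noteq> 0} \<noteq> {}" by (auto simp: fun_eq_iff)
  have fin: "finite {d. a d \<noteq> 0}" by (rule free_spaceD(1)[OF a])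
  obtain d where d: "a d \<noteq> 0" and max: "\<And>d'. a d' \<noteq> 0 \<Longrightarrow> msize d' \<le> msize d"
  proof -
    have "Max (msize ` {d. a d \<noteq> 0}) \<in> msize ` {d. a d \<noteq> 0}" using fin ne by (intro Max_in) auto
    then obtain d where "a d \<noteq> 0" "msize d = Max (msize ` {d. a d \<noteq> 0})" by auto
    then show ?thesis using fin by (intro that[of d]) (auto intro!: Max_ge)
  qed
  have dP: "d \<in> Pset n m" by (rule free_spaceD(2)[OF a d])
  obtain t s where X: "t \<in> colorings n m" "s \<in> colorings n m" and full: "full d t s"
    using ex_full[OF dP] by blast
  note ls = coloringsD(1)[OF X(2)] coloringsD(1)[OF X(1)]
  have "d' = d" if d': "a d' \<noteq> 0" "carries d' t s" for d'
  proof -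
    have d'P: "d' \<in> Pset n m" by (rule free_spaceD(2)[OF a d'(1)])
    have "d' $$ (r, c) = d $$ (r, c)" if rc: "r < m" "c < m" "d $$ (r, c) \<noteq> 0" for r c
    proof -
      have f: "carries d t s" "d $$ (r, c) = uel (s ! c)" "s ! c \<noteq> 0"
        using full rc unfolding full_def ls by blast+
      show ?thesis using carries_agree[OF dP d'P ls f(1) d'(2) rc(2,1) f(3)] f(2) by simp
    qed
    then have eq: "\<And>r c. r < m \<Longrightarrow> c < m \<Longrightarrow> d $$ (r, c) = 0 \<or> d $$ (r, c) = d' $$ (r, c)" by metis
    have sub: "sub_mat d d'"
      using eq PsetD(1,2)[OF dP] PsetD(1,2)[OF d'P] by (simp add: sub_mat_def)
    have "support d = support d'"
      using max[OF d'(1)] sub_mat_support[OF sub] finite_support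
      by (intro card_seteq) (auto simp: msize_support)
    then show ?thesis using sub_mat_eq[OF sub] by simp
  qed
  note unique = this
  have "coefP a t s = (\<Sum>d'\<in>{d. a d \<noteq> 0}. if d' = d then a d else 0)"
    unfolding coefP_def cs.lsum_def
  proof (rule sum.cong)
    fix d' assume "d' \<in> {d. a d \<noteq> 0}"
    then show "a d' * of_bool (carries d' t s) = (if d' = d then a d else 0)"
      using unique[of d'] full unfolding full_def by (cases "d' = d") auto
  qed simp
  also have "\<dots> = a d" using fin d by (simp add: sum.delta)
  finally show False using z[OF X] d by simp
qed

lemma carries_sub:
  assumes d: "d \<in> Pset n m" and sub: "sub_mat d' d" and ls: "length s = m" "length t = m"
    and rel: "carries d' t s"
  shows "carries d t s"
proof -
  have *: "d $$ (r, c) = uel i" if "r < m" "c < m" "d' $$ (r, c) = uel i" for r c i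
  proof -
    have "d' $$ (r, c) = 0 \<or> d' $$ (r, c) = d $$ (r, c)"
      using sub that(1,2) PsetD(1,2)[OF d] by (simp add: sub_mat_def)
    then show ?thesis using that(3) by (metis uel_nonzero(1))
  qed
  show ?thesis unfolding carries_def ls
  proof (intro conjI allI impI)
    fix c assume "c < m" "s ! c \<noteq> 0"
    then show "\<exists>r<m. d $$ (r, c) = uel (s ! c) \<and> t ! r = s ! c"
      using rel * unfolding carries_def ls by blast
  next
    fix r assume "r < m" "t ! r \<noteq> 0"
    then show "\<exists>c<m. d $$ (r, c) = uel (t ! r) \<and> s ! c = t ! r"
      using rel * unfolding carries_def ls by blast
  qed
qed

lemma sub_mat_Pset:
  assumes d: "d \<in> Pset n m" and sub: "sub_mat d' d"
  shows "d' \<in> Pset n m"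
proof (rule PsetI)
  note D = PsetD[OF d]
  have e: "d' $$ (r, c) = 0 \<or> d' $$ (r, c) = d $$ (r, c)" if "r < m" "c < m" for r c
    using sub that D(1,2) by (simp add: sub_mat_def)
  show "d' \<in> carrier_mat m m" using sub D(1,2) by (auto simp: sub_mat_def)
  show "\<exists>i\<in>{1..n}. d' $$ (r, c) = uel i" if "r < m" "c < m" "d' $$ (r, c) \<noteq> 0" for r c
    using e[of r c] that D(4)[of r c] by auto
  show "c = c'" if "r < m" "c < m" "c' < m" "d' $$ (r, c) \<noteq> 0" "d' $$ (r, c') \<noteq> 0" for r c c'
    using e[of r c] e[of r c'] that D(5)[of r c c'] by auto
  show "r = r'" if "r < m" "r' < m" "c < m" "d' $$ (r, c) \<noteq> 0" "d' $$ (r', c) \<noteq> 0" for r r' c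
    using e[of r c] e[of r' c] that D(6)[of r r' c] by auto
  show False if "r < r'" "r' < m" "c < c'" "c' < m" "d' $$ (r, c') = uel i" "d' $$ (r', c) = uel i" for r r' c c' i
    using e[of r c'] e[of r' c] that D(7)[of r r' c c' i] by auto
qed

lemma xvec_free:
  assumes "d \<in> Pset n m"
  shows "xvec d \<in> free_space (Pset n m)"
  unfolding xvec_def using sub_mat_Pset[OF assms] by (intro free_closed) auto

lemma coefP_xvec_sum:
  assumes d: "d \<in> Pset n m"
  shows "coefP (xvec d) t s =
    (\<Sum>d' | sub_mat d' d \<and> carries d' t s. (- 1) ^ (msize d - msize d'))"
proof -
  have fin: "finite {d'. sub_mat d' d}"
    by (rule finite_subset[OF _ finite_Pset[of n m]]) (use sub_mat_Pset[OF d] in auto)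
  have f1: "finite {x. fscale ((- 1) ^ (msize d - msize d')) (delta d') x \<noteq> 0}" for d'
    by (rule finite_subset[OF supp_fscale_subset]) (simp only: supp_delta finite.intros)
  have "coefP (xvec d) t s = (\<Sum>d' | sub_mat d' d. coefP (fscale ((- 1) ^ (msize d - msize d')) (delta d')) t s)"
    unfolding xvec_def coefP_def by (rule cs.lsum_sum) (rule f1)
  also have "\<dots> = (\<Sum>d' | sub_mat d' d. if carries d' t s then (- 1) ^ (msize d - msize d') else 0)"
    unfolding coefP_linear by (intro sum.cong) auto
  also have "\<dots> = (\<Sum>d'\<in>{d'\<in>{d'. sub_mat d' d}. carries d' t s}. (- 1) ^ (msize d - msize d'))"
    by (rule sum.inter_filter[OF fin, symmetric])
  finally show ?thesis by simp
qed

text \<open>If \<open>s \<noteq> s'\<close>, some nonzero column of \<open>d\<close> is not needed for \<open>carries d' t' s'\<close>; toggling it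
  is a sign reversing involution of the submatrices of \<open>d\<close> carrying \<open>s'\<close> to \<open>t'\<close>.\<close>

lemma coefP_xvec:
  assumes d: "d \<in> Pset n m" and full: "full d t s"
    and X: "t \<in> colorings n m" "s \<in> colorings n m" "t' \<in> colorings n m" "s' \<in> colorings n m"
  shows "coefP (xvec d) t' s' = of_bool (t' = t \<and> s' = s)"
proof -
  note ls = coloringsD(1)[OF X(1)] coloringsD(1)[OF X(2)] coloringsD(1)[OF X(3)] coloringsD(1)[OF X(4)]
  note D = PsetD[OF d]
  have rel: "carries d t s" and entry: "\<And>r c. r < m \<Longrightarrow> c < m \<Longrightarrow> d $$ (r, c) \<noteq> 0 \<Longrightarrow>
      d $$ (r, c) = uel (s ! c) \<and> t ! r = s ! c \<and> s ! c \<noteq> 0"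
    using full unfolding full_def ls by auto
  let ?Z = "{d'. sub_mat d' d \<and> carries d' t' s'}"
  have sub_refl: "sub_mat d d" by (simp add: sub_mat_def)
  consider (none) "\<not> carries d t' s'" | (same) "carries d t' s'" "s' = s" | (diff) "carries d t' s'" "s' \<noteq> s"
    by blast
  then show ?thesis
  proof cases
    case none
    then have Z: "?Z = {}" using carries_sub[OF d _ ls(4,3)] by blast
    have "coefP (xvec d) t' s' = 0" unfolding coefP_xvec_sum[OF d] Z by simp
    then show ?thesis using none rel by auto
  next
    case same
    then have t: "t' = t" using carries_functional[OF d ls(2,3,1)] rel by simp
    \<comment> \<open>Every column of nonzero colour in \<open>s\<close> needs its entry of
      \<open>d\<close>, so no proper submatrix carries \<open>s\<close> to \<open>t\<close>.\<close>
    have "d' = d" if d': "sub_mat d' d" "carries d' t s" for d'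
    proof (rule sub_mat_eq[OF d'(1)])
      show "support d \<subseteq> support d'"
      proof
        fix p assume "p \<in> support d"
        then obtain r c where p: "p = (r, c)" and rc: "r < m" "c < m" "d $$ (r, c) \<noteq> 0"
          using D(1,2) by (auto simp: support_def)
        then have sc: "s ! c \<noteq> 0" using entry by blast
        then obtain r' where r': "r' < m" "d' $$ (r', c) = uel (s ! c)"
          using d'(2) rc unfolding carries_def ls by blast
        then have "d $$ (r', c) = uel (s ! c)"
        proof -
          have "d' $$ (r', c) = 0 \<or> d' $$ (r', c) = d $$ (r', c)"
            using d'(1) rc(2) r'(1) D(1,2) by (simp add: sub_mat_def)
          then show ?thesis using r'(2) by (metis uel_nonzero(1))
        qed
        then have "r' = r" using D(6)[of r' r c] r' rc by simp
        then show "p \<in> support d'" using p r' rc d'(1) D(1,2) by (simp add: support_def sub_mat_def)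
      qed
    qed
    then have Z: "?Z = {d}" using same t sub_refl rel by auto
    have "coefP (xvec d) t' s' = 1" unfolding coefP_xvec_sum[OF d] Z by simp
    then show ?thesis using same t by simp
  next
    case diff
    have agree: "s ! c = s' ! c" if h: "c < m" "s' ! c \<noteq> 0" for c
    proof -
      obtain r where "r < m" "d $$ (r, c) = uel (s' ! c)"
        using diff(1) h unfolding carries_def ls by blast
      then show ?thesis using entry[of r c] h by auto
    qed
    \<comment> \<open>A column where the tuples differ has colour 0 in \<open>s'\<close> but not in
      \<open>s\<close>. So \<open>d\<close> has an entry there that can be removed or restored
      without affecting what is carried from \<open>s'\<close> to \<open>t'\<close>.\<close>
    obtain c0 where c0: "c0 < m" "s' ! c0 \<noteq> s ! c0"
      using diff(2) ls by (metis nth_equalityI)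
    then have "s' ! c0 = 0" using agree[of c0] by metis
    then have s0: "s' ! c0 = 0" "s ! c0 \<noteq> 0" using c0(2) by simp_all
    obtain r0 where r0: "r0 < m" "d $$ (r0, c0) = uel (s ! c0)"
      using rel c0 s0 unfolding carries_def ls by blast
    have t0: "t' ! r0 = 0"
    proof (rule ccontr)
      assume "t' ! r0 \<noteq> 0"
      then obtain c where c: "c < m" "d $$ (r0, c) = uel (t' ! r0)" "s' ! c = t' ! r0"
        using diff(1) r0 unfolding carries_def ls by blast
      then have "c = c0" using D(5)[of r0 c c0] r0 c0 by simp
      then show False using c s0 \<open>t' ! r0 \<noteq> 0\<close> by simp
    qed
    define tog where "tog d' = mat m m (\<lambda>p. if p = (r0, c0) then (if d' $$ p = 0 then d $$ p else 0) else d' $$ p)"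
      for d' :: pmat
    have tog_e: "tog d' $$ (r, c) = (if (r, c) = (r0, c0) then (if d' $$ (r, c) = 0 then d $$ (r, c) else 0)
        else d' $$ (r, c))" if "r < m" "c < m" for r c d'
      using that by (simp add: tog_def)
    have tog_dim: "dim_row (tog d') = m" "dim_col (tog d') = m" for d' by (simp_all add: tog_def)
    have dims: "dim_row d' = m" "dim_col d' = m" if "sub_mat d' d" for d'
      using that D(1,2) by (simp_all add: sub_mat_def)
    have tog_sub: "sub_mat (tog d') d" if "sub_mat d' d" for d'
      using that D(1,2) by (auto simp: sub_mat_def tog_dim tog_e)
    have tog_tog: "tog (tog d') = d'" if sub: "sub_mat d' d" for d'
    proof (rule eq_matI)
      fix r c assume "r < dim_row d'" "c < dim_col d'"
      then have rc: "r < m" "c < m" using dims[OF sub] by auto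
      then have "d' $$ (r, c) = 0 \<or> d' $$ (r, c) = d $$ (r, c)" using sub D(1,2) by (simp add: sub_mat_def)
      moreover have "d $$ (r0, c0) \<noteq> 0" using r0 by simp
      ultimately show "tog (tog d') $$ (r, c) = d' $$ (r, c)" using rc by (auto simp: tog_e)
    qed (use dims[OF sub] tog_dim in auto)
    have tog_carries: "carries (tog d') t' s'" if h: "carries d' t' s'" for d'
      unfolding carries_def ls
    proof (intro conjI allI impI)
      fix c assume c: "c < m" "s' ! c \<noteq> 0"
      then have "c \<noteq> c0" using s0 by auto
      moreover obtain r where "r < m" "d' $$ (r, c) = uel (s' ! c)" "t' ! r = s' ! c"
        using h c unfolding carries_def ls by blast
      ultimately show "\<exists>r<m. tog d' $$ (r, c) = uel (s' ! c) \<and> t' ! r = s' ! c"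
        using c by (intro exI[of _ r]) (simp add: tog_e)
    next
      fix r assume r: "r < m" "t' ! r \<noteq> 0"
      then have "r \<noteq> r0" using t0 by auto
      moreover obtain c where "c < m" "d' $$ (r, c) = uel (t' ! r)" "s' ! c = t' ! r"
        using h r unfolding carries_def ls by blast
      ultimately show "\<exists>c<m. tog d' $$ (r, c) = uel (t' ! r) \<and> s' ! c = t' ! r"
        using r by (intro exI[of _ c]) (simp add: tog_e)
    qed
    have size_Suc: "msize (tog d') = Suc (msize d')" if sub: "sub_mat d' d" and z: "d' $$ (r0, c0) = 0" for d'
    proof -
      have "support (tog d') = insert (r0, c0) (support d')"
        using z r0 c0 dims[OF sub] by (auto simp: support_def tog_dim tog_e split: if_splits)
      moreover have "(r0, c0) \<notin> support d'" using z by (simp add: support_def)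
      ultimately show ?thesis by (simp add: msize_support finite_support)
    qed
    have le: "msize d' \<le> msize d" if "sub_mat d' d" for d'
      unfolding msize_support by (rule card_mono[OF finite_support sub_mat_support[OF that]])
    have sign: "(- 1 :: complex) ^ (msize d - msize (tog d')) = - ((- 1) ^ (msize d - msize d'))"
      if sub: "sub_mat d' d" for d'
    proof -
      have step: "(- 1 :: complex) ^ (msize d - msize e) = - ((- 1) ^ (msize d - msize (tog e)))"
        if "sub_mat e d" "e $$ (r0, c0) = 0" for e
      proof -
        \<comment> \<open>This is natural subtraction: the bound \<open>le\<close> for the larger
          matrix keeps the exponents from being truncated.\<close>
        have "msize d - msize e = Suc (msize d - msize (tog e))"
          using size_Suc[OF that] le[OF tog_sub[OF that(1)]] by simp
        then show ?thesis by simp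
      qed
      show ?thesis
      proof (cases "d' $$ (r0, c0) = 0")
        case True
        then show ?thesis using step[OF sub] by simp
      next
        case False
        then have "tog d' $$ (r0, c0) = 0" using r0 c0 by (simp add: tog_e)
        from step[OF tog_sub[OF sub] this] show ?thesis by (simp add: tog_tog[OF sub])
      qed
    qed
    have "coefP (xvec d) t' s' = - coefP (xvec d) t' s'"
      unfolding coefP_xvec_sum[OF d] sum_negf[symmetric]
      by (rule sum.reindex_bij_witness[of _ tog tog])
        (auto simp: tog_tog tog_sub tog_carries sign)
    then show ?thesis using diff by simp
  qed
qed

section \<open>Block diagonal matrices and the identity element\<close>

lemma block_diag_entry:
  assumes "d1 \<in> carrier_mat m1 m1" "d2 \<in> carrier_mat m2 m2" "r < m1 + m2" "c < m1 + m2"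
  shows "block_diag d1 d2 $$ (r, c) = (if r < m1 \<and> c < m1 then d1 $$ (r, c)
    else if m1 \<le> r \<and> m1 \<le> c then d2 $$ (r - m1, c - m1) else 0)"
  using assms by (auto simp: block_diag_def)

lemma block_diag_Pset:
  assumes d1: "d1 \<in> Pset n m1" and d2: "d2 \<in> Pset n m2"
  shows "block_diag d1 d2 \<in> Pset n (m1 + m2)"
proof (rule PsetI)
  note D1 = PsetD[OF d1] and D2 = PsetD[OF d2]
  note e = block_diag_entry[OF D1(3) D2(3)]
  show "block_diag d1 d2 \<in> carrier_mat (m1 + m2) (m1 + m2)"
    using D1(3) D2(3) by (simp add: block_diag_def)
  fix r assume r: "r < m1 + m2"
  show "\<exists>i\<in>{1..n}. block_diag d1 d2 $$ (r, c) = uel i" if "c < m1 + m2" "block_diag d1 d2 $$ (r, c) \<noteq> 0" for c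
    using that r D1(4)[of r c] D2(4)[of "r - m1" "c - m1"] by (auto simp: e less_diff_conv2 add.commute eq_diff_iff split: if_splits)
  show "c = c'" if "c < m1 + m2" "c' < m1 + m2" "block_diag d1 d2 $$ (r, c) \<noteq> 0" "block_diag d1 d2 $$ (r, c') \<noteq> 0" for c c'
    using that r D1(5)[of r c c'] D2(5)[of "r - m1" "c - m1" "c' - m1"] by (auto simp: e less_diff_conv2 add.commute eq_diff_iff split: if_splits)
  show "r = r'" if "r' < m1 + m2" "c < m1 + m2" "block_diag d1 d2 $$ (r, c) \<noteq> 0" "block_diag d1 d2 $$ (r', c) \<noteq> 0" for r' c
    using that r D1(6)[of r r' c] D2(6)[of "r - m1" "r' - m1" "c - m1"] by (auto simp: e less_diff_conv2 add.commute eq_diff_iff split: if_splits)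
next
  note D1 = PsetD[OF d1] and D2 = PsetD[OF d2]
  note e = block_diag_entry[OF D1(3) D2(3)]
  fix r r' c c' i
  assume a: "r < r'" "r' < m1 + m2" "c < c'" "c' < m1 + m2"
    "block_diag d1 d2 $$ (r, c') = uel i" "block_diag d1 d2 $$ (r', c) = uel i"
  then show False
    using D1(7)[of r r' c c' i] D2(7)[of "r - m1" "r' - m1" "c - m1" "c' - m1" i]
    by (auto simp: e less_diff_conv2 add.commute eq_diff_iff split: if_splits)
qed

lemma carries_block_diag:
  assumes d1: "d1 \<in> Pset n m1" and d2: "d2 \<in> Pset n m2"
    and ls: "length t1 = m1" "length s1 = m1" "length t2 = m2" "length s2 = m2"
  shows "carries (block_diag d1 d2) (t1 @ t2) (s1 @ s2) \<longleftrightarrow> carries d1 t1 s1 \<and> carries d2 t2 s2"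
proof -
  note e = block_diag_entry[OF PsetD(3)[OF d1] PsetD(3)[OF d2]]
  have split: "(\<forall>x<m1 + m2. Q x) \<longleftrightarrow> (\<forall>x<m1. Q x) \<and> (\<forall>x<m2. Q (m1 + x))"
    "(\<exists>x<m1 + m2. Q x) \<longleftrightarrow> (\<exists>x<m1. Q x) \<or> (\<exists>x<m2. Q (m1 + x))" for Q
  proof -
    have "x < m1 \<or> (\<exists>y<m2. x = m1 + y)" if "x < m1 + m2" for x
      using that by (cases "x < m1") (auto intro!: exI[of _ "x - m1"])
    then show "(\<forall>x<m1 + m2. Q x) \<longleftrightarrow> (\<forall>x<m1. Q x) \<and> (\<forall>x<m2. Q (m1 + x))"
      "(\<exists>x<m1 + m2. Q x) \<longleftrightarrow> (\<exists>x<m1. Q x) \<or> (\<exists>x<m2. Q (m1 + x))"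
      by (metis add_strict_left_mono trans_less_add1)+
  qed
  have e': "r < m1 \<Longrightarrow> c < m1 \<Longrightarrow> block_diag d1 d2 $$ (r, c) = d1 $$ (r, c)"
    "r < m1 \<Longrightarrow> c < m2 \<Longrightarrow> block_diag d1 d2 $$ (r, m1 + c) = 0"
    "r < m2 \<Longrightarrow> c < m1 \<Longrightarrow> block_diag d1 d2 $$ (m1 + r, c) = 0"
    "r < m2 \<Longrightarrow> c < m2 \<Longrightarrow> block_diag d1 d2 $$ (m1 + r, m1 + c) = d2 $$ (r, c)" for r c
    by (simp_all add: e)
  show ?thesis
    unfolding carries_def length_append ls split
    by (simp add: e' nth_append ls cong: conj_cong) blast
qed

text \<open>Block diagonal matrices move each part of a tuple within itself, so under concatenation
  of tuples the tensor product becomes the Kronecker product.\<close>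

lemma coefP_ptensor:
  assumes a: "a \<in> free_space (Pset n m1)" and b: "b \<in> free_space (Pset n m2)"
    and ls: "length t1 = m1" "length s1 = m1" "length t2 = m2" "length s2 = m2"
  shows "coefP (ptensor a b) (t1 @ t2) (s1 @ s2) = coefP a t1 s1 * coefP b t2 s2"
proof -
  have "coefP (ptensor a b) (t1 @ t2) (s1 @ s2) =
      cs.lsum (\<lambda>d. cs.lsum (\<lambda>d'. of_bool (carries (block_diag d d') (t1 @ t2) (s1 @ s2))) b) a"
    unfolding coefP_def by (rule cs_lsum_bilin_ext[OF b])
  also have "\<dots> = cs.lsum (\<lambda>d. cs.lsum (\<lambda>d'. of_bool (carries d t1 s1) * of_bool (carries d' t2 s2)) b) a"
  proof (intro cs.lsum_cong)
    fix d d' assume "a d \<noteq> 0" "b d' \<noteq> 0"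
    then have d: "d \<in> Pset n m1" "d' \<in> Pset n m2"
      using free_spaceD(2)[OF a] free_spaceD(2)[OF b] by auto
    show "of_bool (carries (block_diag d d') (t1 @ t2) (s1 @ s2)) =
      (of_bool (carries d t1 s1) * of_bool (carries d' t2 s2) :: complex)"
      by (simp add: carries_block_diag[OF d ls] of_bool_conj)
  qed
  also have "\<dots> = coefP a t1 s1 * coefP b t2 s2"
    unfolding coefP_def cs.lsum_scale_fun
    using cs.lsum_scale_fun[of "cs.lsum (\<lambda>d. of_bool (carries d t2 s2)) b" "\<lambda>d. of_bool (carries d t1 s1)" a]
    by (simp add: mult.commute)
  finally show ?thesis .
qed

lemma ptensor_free:
  "a \<in> free_space (Pset n m1) \<Longrightarrow> b \<in> free_space (Pset n m2) \<Longrightarrow> ptensor a b \<in> free_space (Pset n (m1 + m2))"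
  by (rule bilin_ext_free) (auto intro: block_diag_Pset)

lemma Iel_free:
  assumes "i \<le> n"
  shows "Iel i \<in> free_space (Pset n 1)"
proof -
  have "mat 1 1 (\<lambda>_. if i = 0 then 0 else uel i) \<in> Pset n 1"
    by (rule PsetI) (use assms in \<open>auto intro!: bexI[of _ i]\<close>)
  then show ?thesis by (simp add: Iel_def)
qed

text \<open>Colour 0 imposes no condition on the entry, so \<open>Iel i\<close> fixes the colours 0
  and \<open>i\<close>. This is why \<open>psi\<close> uses \<open>Iel i - Iel 0\<close> for
  positive \<open>i\<close>: it is the projection onto colour \<open>i\<close>.\<close>

lemma coefP_Iel: "coefP (Iel i) [a] [b] = of_bool (a = b \<and> (b = 0 \<or> b = i))"
  unfolding Iel_def coefP_linear by (auto simp: carries_def)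

lemma e1_free: "e1 n \<in> free_space (Pset n 1)"
  unfolding e1_def
  by (intro free_closed(2) free_closed(3) free_closed(5) Iel_free) auto

text \<open>Colour 0 is counted by all \<open>n\<close> summands \<open>Iel i\<close> and any other
  colour by exactly one; subtracting \<open>Iel 0\<close> with factor \<open>n - 1\<close> leaves
  the identity matrix.\<close>

lemma coefP_e1:
  assumes "b \<le> n"
  shows "coefP (e1 n) [a] [b] = of_bool (a = b)"
proof -
  have f: "(\<Sum>i\<in>{1..n}. Iel i) \<in> free_space (Pset n 1)" "fscale (of_nat n - 1) (Iel 0) \<in> free_space (Pset n 1)"
    by (intro free_closed(3) free_closed(5) Iel_free; simp)+
  have "coefP (\<Sum>i\<in>{1..n}. Iel i) [a] [b] = (\<Sum>i\<in>{1..n}. coefP (Iel i) [a] [b])"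
    unfolding coefP_def by (rule cs.lsum_sum) (use Iel_free free_spaceD(1) in auto)
  also have "\<dots> = (\<Sum>i\<in>{1..n}. if a = b then of_bool (b = 0) + (if i = b then of_bool (b \<noteq> 0) else 0) else 0)"
    by (rule sum.cong) (auto simp: coefP_Iel)
  also have "\<dots> = of_bool (a = b) * (of_nat n * of_bool (b = 0) + of_bool (b \<noteq> 0))"
    using assms by (auto simp: sum.distrib sum.delta)
  finally show ?thesis
    unfolding e1_def coefP_linear(2)[OF f] coefP_linear(3) coefP_Iel by auto
qed

lemma eCP_Suc: "0 < m \<Longrightarrow> eCP n (Suc m) = ptensor (eCP n m) (e1 n)"
  by (cases m) (simp_all add: eCP_def)

lemma colorings_Suc:
  "s \<in> colorings n (Suc m) \<longleftrightarrow> (\<exists>s' b. s = s' @ [b] \<and> s' \<in> colorings n m \<and> b \<le> n)"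
proof
  assume s: "s \<in> colorings n (Suc m)"
  then have "s \<noteq> []" by (auto simp: colorings_def)
  then have "s = butlast s @ [last s]" by simp
  moreover have "butlast s \<in> colorings n m" "last s \<le> n"
    using s in_set_butlastD[of _ s] last_in_set[OF \<open>s \<noteq> []\<close>] by (auto simp: colorings_def)
  ultimately show "\<exists>s' b. s = s' @ [b] \<and> s' \<in> colorings n m \<and> b \<le> n" by blast
qed (auto simp: colorings_def)

lemma eCP_unit:
  assumes "0 < m"
  shows "eCP n m \<in> free_space (Pset n m) \<and>
    (\<forall>t\<in>colorings n m. \<forall>s\<in>colorings n m. coefP (eCP n m) t s = of_bool (t = s))"
  using assms
proof (induction m rule: nat_induct_non_zero)
  case 1
  have single: "\<exists>b\<le>n. s = [b]" if "s \<in> colorings n 1" for s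
    using that colorings_Suc[of s n 0] by (auto simp: colorings_def)
  have "coefP (e1 n) t s = of_bool (t = s)" if "t \<in> colorings n 1" "s \<in> colorings n 1" for t s
    using single[OF that(1)] single[OF that(2)] coefP_e1 by auto
  then show ?case using e1_free by (simp add: eCP_def)
next
  case (Suc m)
  have "coefP (eCP n (Suc m)) t s = of_bool (t = s)"
    if h: "t \<in> colorings n (Suc m)" "s \<in> colorings n (Suc m)" for t s
  proof -
    obtain t' a s' b where ts: "t = t' @ [a]" "s = s' @ [b]" "t' \<in> colorings n m" "s' \<in> colorings n m" "a \<le> n" "b \<le> n"
      using h unfolding colorings_Suc by blast
    then have "coefP (eCP n (Suc m)) t s = coefP (eCP n m) t' s' * coefP (e1 n) [a] [b]"
      unfolding eCP_Suc[OF Suc.hyps] ts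
      using Suc.IH e1_free by (intro coefP_ptensor) (auto dest: coloringsD)
    then show ?thesis using ts Suc.IH by (simp add: coefP_e1)
  qed
  moreover have "eCP n (Suc m) \<in> free_space (Pset n (Suc m))"
    using ptensor_free[of "eCP n m" n m "e1 n" 1] Suc e1_free by (simp add: eCP_Suc)
  ultimately show ?case by blast
qed

lemma CP_simps:
  "carrier (CP n m) = free_space (Pset n m)" "mult (CP n m) = bilin_ext (*)" "one (CP n m) = eCP n m"
  "zero (CP n m) = 0" "add (CP n m) = (+)" "smult (CP n m) = fscale"
  by (simp_all add: CP_def)

lemma CP_block:
  assumes "0 < m"
  shows "block_algebra (CP n m) (colorings n m) (shape n) coefP"
proof
  show "finite (colorings n m)" by (rule finite_colorings)
  have "replicate m 0 \<in> colorings n m" by (auto simp: colorings_def)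
  then show "colorings n m \<noteq> {}" by blast
next
  fix a b assume ab: "a \<in> carrier (CP n m)" "b \<in> carrier (CP n m)"
  then have f: "a \<in> free_space (Pset n m)" "b \<in> free_space (Pset n m)" by (simp_all add: CP_simps)
  show "a \<oplus>\<^bsub>CP n m\<^esub> b \<in> carrier (CP n m)" unfolding CP_simps by (rule free_closed(1)[OF f])
  show "a \<otimes>\<^bsub>CP n m\<^esub> b \<in> carrier (CP n m)" unfolding CP_simps
    by (rule bilin_ext_free[OF f]) (rule Pset_mult)
  show "c \<odot>\<^bsub>CP n m\<^esub> a \<in> carrier (CP n m)" for c unfolding CP_simps by (rule free_closed(3)[OF f(1)])
  fix t s assume ts: "t \<in> colorings n m" "s \<in> colorings n m"
  show "coefP (a \<oplus>\<^bsub>CP n m\<^esub> b) t s = coefP a t s + coefP b t s"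
    unfolding CP_simps by (rule coefP_linear(1)[OF f])
  show "coefP (c \<odot>\<^bsub>CP n m\<^esub> a) t s = c * coefP a t s" for c
    unfolding CP_simps by (rule coefP_linear(3))
  show "coefP (a \<otimes>\<^bsub>CP n m\<^esub> b) t s = (\<Sum>u\<in>colorings n m. coefP a t u * coefP b u s)"
    unfolding CP_simps by (rule coefP_mult[OF f ts])
  show "coefP a t s = 0" if ne: "shape n t \<noteq> shape n s"
    unfolding coefP_def cs.lsum_def
  proof (rule sum.neutral, intro ballI)
    fix d assume "d \<in> {d. a d \<noteq> 0}"
    then have "d \<in> Pset n m" using free_spaceD(2)[OF f(1)] by blast
    then have "\<not> carries d t s" using carries_shape[OF _ ts(2,1)] ne by blast
    then show "a d * of_bool (carries d t s) = 0" by simp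
  qed
next
  fix a b assume ab: "a \<in> carrier (CP n m)" "b \<in> carrier (CP n m)"
    and eq: "\<And>t s. t \<in> colorings n m \<Longrightarrow> s \<in> colorings n m \<Longrightarrow> coefP a t s = coefP b t s"
  then have f: "a \<in> free_space (Pset n m)" "b \<in> free_space (Pset n m)" by (simp_all add: CP_simps)
  have "a - b = 0"
    by (rule coefP_inj[OF free_closed(2)[OF f]]) (simp only: coefP_linear(2)[OF f] eq diff_self)
  then show "a = b" by (simp only: right_minus_eq)
next
  show "\<one>\<^bsub>CP n m\<^esub> \<in> carrier (CP n m)" using eCP_unit[OF assms] by (simp add: CP_simps)
  fix t s assume ts: "t \<in> colorings n m" "s \<in> colorings n m"
  then show "coefP \<one>\<^bsub>CP n m\<^esub> t s = of_bool (t = s)" using eCP_unit[OF assms] by (simp add: CP_simps)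
  assume "shape n t = shape n s"
  then obtain d where d: "d \<in> Pset n m" "full d t s" using ex_full_of_shape[OF ts(2,1)] by blast
  then show "\<exists>a\<in>carrier (CP n m). \<forall>t'\<in>colorings n m. \<forall>s'\<in>colorings n m.
      coefP a t' s' = of_bool (t' = t \<and> s' = s)"
    using coefP_xvec[OF d ts] xvec_free[OF d(1)] by (intro bexI[of _ "xvec d"]) (auto simp: CP_simps)
qed

section \<open>The irreducible modules and the functors\<close>

text \<open>The list \<open>row_word ms\<close> is both the one-row tableau with \<open>ms ! k\<close> entries \<open>k\<close> and the encoding of
  the tuple of consecutive intervals of sizes \<open>ms\<close>.\<close>

fun row_from :: "nat \<Rightarrow> nat list \<Rightarrow> nat list" where
  "row_from k [] = []"
| "row_from k (a # ms) = replicate a k @ row_from (Suc k) ms"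

abbreviation row_word :: "nat list \<Rightarrow> nat list" where
  "row_word \<equiv> row_from 0"

lemma length_row_from: "length (row_from k ms) = sum_list ms"
  by (induction ms arbitrary: k) auto

lemma set_row_from: "set (row_from k ms) \<subseteq> {k..<k + length ms}"
  by (induction ms arbitrary: k) fastforce+

lemma count_row_from: "i < length ms \<Longrightarrow> count_list (row_from k ms) (k + i) = ms ! i"
proof (induction ms arbitrary: k i)
  case (Cons a ms)
  have rep: "count_list (replicate a k) j = (if j = k then a else 0)" for j
    by (induction a) auto
  show ?case
  proof (cases i)
    case 0
    have "k \<notin> set (row_from (Suc k) ms)" using set_row_from[of "Suc k" ms] by auto
    then show ?thesis using 0 by (simp add: rep)
  next
    case (Suc j)
    then show ?thesis using Cons.IH[of j "Suc k"] Cons.prems by (simp add: rep)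
  qed
qed simp

lemma row_coloring: "length ms = n + 1 \<Longrightarrow> row_word ms \<in> colorings n (sum_list ms)"
  using set_row_from[of 0 ms] by (auto simp: colorings_def length_row_from)

lemma shape_row: "length ms = n + 1 \<Longrightarrow> shape n (row_word ms) = ms"
  by (intro nth_equalityI) (use count_row_from[of _ ms 0] in \<open>auto simp: shape_def simp del: upt_Suc\<close>)

lemma row_from_interval:
  "c < sum_list ms \<Longrightarrow> i < length ms \<Longrightarrow>
    row_from k ms ! c = k + i \<longleftrightarrow> sum_list (take i ms) \<le> c \<and> c < sum_list (take (Suc i) ms)"
proof (induction ms arbitrary: k c i)
  case (Cons a ms)
  show ?case
  proof (cases "c < a")
    case True
    then show ?thesis by (cases i) (simp_all add: nth_append)
  next
    case False
    then have c: "c - a < sum_list ms" using Cons.prems by simp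
    have eq: "row_from k (a # ms) ! c = row_from (Suc k) ms ! (c - a)" using False by (simp add: nth_append)
    show ?thesis
    proof (cases i)
      case 0
      have "row_from (Suc k) ms ! (c - a) \<in> set (row_from (Suc k) ms)"
        using c by (intro nth_mem) (simp add: length_row_from)
      then show ?thesis using 0 False set_row_from[of "Suc k" ms] eq by auto
    next
      case (Suc j)
      then show ?thesis using Cons.IH[OF c, of j "Suc k"] Cons.prems eq False by auto
    qed
  qed
qed simp

lemma sum_list_take_le: "sum_list (take i ms) \<le> sum_list (ms :: nat list)"
  by (metis append_take_drop_id le_add1 sum_list_append)

lemma intervals_row:
  assumes "length ms = n + 1"
  shows "intervals ms = map (\<lambda>k. {c. c < sum_list ms \<and> row_word ms ! c = k}) [0..<n + 1]"
  unfolding intervals_def assms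
proof (intro map_cong refl)
  fix k assume "k \<in> set [0..<n + 1]"
  then have k: "k < length ms" using assms by (simp del: upt_Suc)
  show "{sum_list (take k ms)..<sum_list (take (Suc k) ms)} = {c. c < sum_list ms \<and> row_word ms ! c = k}"
    using row_from_interval[OF _ k, of _ 0] sum_list_take_le[of "Suc k" ms] by fastforce
qed

lemma beta_full:
  assumes d: "d \<in> Pset n m" and X: "t \<in> colorings n m" "s \<in> colorings n m" and full: "full d t s"
  shows "beta n d = map (\<lambda>k. {c. c < m \<and> s ! c = k}) [0..<n + 1]"
  unfolding beta_def PsetD(1,2)[OF d]
proof (intro map_cong refl Collect_cong)
  note ls = coloringsD(1)[OF X(1)] coloringsD(1)[OF X(2)]
  fix k c
  have "(if k = 0 then \<forall>r<m. d $$ (r, c) = 0 else \<exists>r<m. d $$ (r, c) = uel k) \<longleftrightarrow> s ! c = k" if c: "c < m"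
  proof (cases "s ! c = 0")
    case True
    then have z: "d $$ (r, c) = 0" if "r < m" for r using full c that unfolding full_def ls by blast
    then show ?thesis using True by auto
  next
    case False
    then obtain r where r: "r < m" "d $$ (r, c) = uel (s ! c)"
      using full c unfolding full_def carries_def ls by blast
    have "k = s ! c" if k: "r' < m" "d $$ (r', c) = uel k" for r'
    proof -
      have "d $$ (r', c) \<noteq> 0" using k(2) by simp
      then have "d $$ (r', c) = uel (s ! c)" using full k(1) c unfolding full_def ls by blast
      then show ?thesis using k(2) by simp
    qed
    then show ?thesis using r False by (cases "k = 0") auto
  qed
  then show "(c < m \<and> (if k = 0 then \<forall>r<m. d $$ (r, c) = 0 else \<exists>r<m. d $$ (r, c) = uel k)) \<longleftrightarrow>
      (c < m \<and> s ! c = k)" by blast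
qed

lemma fibers_inj:
  assumes "s \<in> colorings n m" "s' \<in> colorings n m"
    and eq: "map (\<lambda>k. {c. c < m \<and> s ! c = k}) [0..<n + 1] = map (\<lambda>k. {c. c < m \<and> s' ! c = k}) [0..<n + 1]"
  shows "s = s'"
proof (rule nth_equalityI)
  show "length s = length s'" using assms by (simp add: coloringsD)
  fix c assume "c < length s"
  then have c: "c < m" using assms by (simp add: coloringsD)
  have "s ! c \<in> set [0..<n + 1]" using coloringsD(2)[OF assms(1) c] by (simp del: upt_Suc)
  then have eq': "{c'. c' < m \<and> s ! c' = s ! c} = {c'. c' < m \<and> s' ! c' = s ! c}"
    by (rule bspec[OF eq[unfolded map_eq_conv]])
  have "c \<in> {c'. c' < m \<and> s' ! c' = s ! c}" unfolding eq'[symmetric] using c by simp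
  then show "s ! c = s' ! c" by simp
qed

lemma coefP_zero: "coefP 0 t s = 0"
  by (simp add: coefP_def)

text \<open>The elements \<open>xvec d\<close> with \<open>beta n d = intervals ms\<close> are the
  matrix units whose column index is \<open>row_word ms\<close>. So the module is the left ideal of
  one minimal idempotent, with this idempotent as generator.\<close>

lemma Wmod_of_type:
  assumes ms: "length ms = n + 1" "sum_list ms = m" "0 < m"
  shows "block_algebra.of_type (CP n m) (colorings n m) coefP (row_word ms) (Wmod n ms)"
proof -
  interpret C: block_algebra "CP n m" "colorings n m" "shape n" coefP by (rule CP_block[OF ms(3)])
  let ?s = "row_word ms"
  have s: "?s \<in> colorings n m" using row_coloring[OF ms(1)] ms(2) by simp
  define S where "S = {xvec d | d. d \<in> Pset n m \<and> beta n d = intervals ms}"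
  have E: "C.E t u = xvec d" if "d \<in> Pset n m" "full d t u" "t \<in> colorings n m" "u \<in> colorings n m" for d t u
  proof (rule C.E_eqI[symmetric])
    show "shape n t = shape n u" using that carries_shape unfolding full_def by blast
    show "xvec d \<in> carrier (CP n m)" using xvec_free[OF that(1)] by (simp add: CP_simps)
  qed (use that coefP_xvec in auto)
  have S: "S = {C.E t ?s | t. t \<in> colorings n m \<and> shape n t = shape n ?s}"
  proof (intro equalityI subsetI)
    fix x assume "x \<in> S"
    then obtain d where d: "d \<in> Pset n m" "beta n d = intervals ms" "x = xvec d" by (auto simp: S_def)
    obtain t u where tu: "t \<in> colorings n m" "u \<in> colorings n m" "full d t u" using ex_full[OF d(1)] by blast
    have "u = ?s"
      using beta_full[OF d(1) tu] d(2) unfolding intervals_row[OF ms(1)] ms(2)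
      by (intro fibers_inj[OF tu(2) s]) simp
    moreover have "shape n t = shape n u" using carries_shape[OF d(1) tu(2,1)] tu(3) unfolding full_def by blast
    ultimately show "x \<in> {C.E t ?s | t. t \<in> colorings n m \<and> shape n t = shape n ?s}"
      using E[OF d(1) tu(3,1,2)] d(3) tu(1) by (intro CollectI exI[of _ t]) simp
  next
    fix x assume "x \<in> {C.E t ?s | t. t \<in> colorings n m \<and> shape n t = shape n ?s}"
    then obtain t where t: "t \<in> colorings n m" "shape n t = shape n ?s" "x = C.E t ?s" by blast
    obtain d where d: "d \<in> Pset n m" "full d t ?s" using ex_full_of_shape[OF s t(1,2)] by blast
    have "beta n d = intervals ms"
      using beta_full[OF d(1) t(1) s d(2)] unfolding intervals_row[OF ms(1)] ms(2) .
    then show "x \<in> S" using E[OF d t(1) s] t(3) d(1) by (auto simp: S_def)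
  qed
  let ?W = "Wmod n ms" and ?V = "fspan S"
  have W: "carrier ?W = ?V" "zero ?W = 0" "add ?W = (+)" "smult ?W = fscale" "act ?W = mult (CP n m)"
    by (simp_all add: Wmod_def WT_def S_def ms(2) CP_simps)
  note V = fs.subspace_span[of S] and C = CP_simps
  have VA: "?V \<subseteq> carrier (CP n m)" unfolding C(1)
    by (rule fs.span_minimal[OF _ free_space_subspace]) (use S C.E_props(1) s C(1) in auto)
  \<comment> \<open>A linear condition cuts out a subspace, so a property of the whole span can be
    checked on the spanning matrix units.\<close>
  have sub_mem: "fs.subspace {v \<in> carrier (CP n m). L v \<in> K}"
    if "fs.subspace K" "\<And>u v. u \<in> carrier (CP n m) \<Longrightarrow> v \<in> carrier (CP n m) \<Longrightarrow> L (u + v) = L u + L v"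
      "\<And>c v. L (fscale c v) = fscale c (L v)" for L K
  proof (rule fs.subspaceI)
    have "L 0 = 0" using that(3)[of 0 0] by (simp only: fs.scale_zero_left)
    then show "0 \<in> {v \<in> carrier (CP n m). L v \<in> K}"
      using fs.subspace_0[OF that(1)] by (simp add: C(1) free_closed(4))
  qed (use fs.subspace_add[OF that(1)] fs.subspace_scale[OF that(1)] that(2,3) free_closed(1,3) C(1) in auto)
  have EE: "C.E p q \<otimes>\<^bsub>CP n m\<^esub> C.E t ?s \<in> ?V"
    if pq: "p \<in> colorings n m" "q \<in> colorings n m" "shape n p = shape n q"
      "t \<in> colorings n m" "shape n t = shape n ?s" for p q t
  proof (cases "q = t")
    case True
    then have "C.E p q \<otimes>\<^bsub>CP n m\<^esub> C.E t ?s = C.E p ?s"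
      using pq s by (intro C.coef_inj) (auto simp: C.coefs C.closed C.sum_of_bool_left)
    moreover have "C.E p ?s \<in> S" using pq True unfolding S by auto
    ultimately show ?thesis using fs.span_base by metis
  next
    case False
    have 0: "(0 :: pvec) \<in> carrier (CP n m)" by (simp add: C(1) free_closed(4))
    have "C.E p q \<otimes>\<^bsub>CP n m\<^esub> C.E t ?s = 0"
      using pq s False 0 by (intro C.coef_inj) (auto simp: C.coefs C.closed C.sum_of_bool_left coefP_zero)
    then show ?thesis using fs.span_zero by metis
  qed
  have closed: "a \<otimes>\<^bsub>CP n m\<^esub> v \<in> ?V" if a: "a \<in> carrier (CP n m)" and v: "v \<in> ?V" for a v
  proof -
    have "?V \<subseteq> {v \<in> carrier (CP n m). a \<otimes>\<^bsub>CP n m\<^esub> v \<in> ?V}"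
    proof (rule fs.span_minimal)
      show "fs.subspace {v \<in> carrier (CP n m). a \<otimes>\<^bsub>CP n m\<^esub> v \<in> ?V}"
        by (rule sub_mem[OF V]) (simp_all only: C bilin_ext_right bilin_ext_fscale)
      show "S \<subseteq> {v \<in> carrier (CP n m). a \<otimes>\<^bsub>CP n m\<^esub> v \<in> ?V}"
      proof
        fix v assume "v \<in> S"
        then obtain t where t: "v = C.E t ?s" "t \<in> colorings n m" "shape n t = shape n ?s" unfolding S by blast
        have vA: "v \<in> carrier (CP n m)" using t s by (simp add: C.closed)
        have "a \<otimes>\<^bsub>CP n m\<^esub> v \<in> ?V"
          using a
        proof (induction rule: C.block_induct)
          case (E p q)
          then show ?case unfolding t(1) by (rule EE) (use t in auto)
        next
          case (add a b)
          show ?case unfolding C.algebra_laws(1)[OF add(1,2) vA] unfolding C(5) by (rule fs.subspace_add[OF V add(3,4)])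
        next
          case (smult c a)
          show ?case unfolding C.algebra_laws(3)[OF smult(1) vA vA] unfolding C(6) by (rule fs.subspace_scale[OF V smult(2)])
        qed
        then show "v \<in> {v \<in> carrier (CP n m). a \<otimes>\<^bsub>CP n m\<^esub> v \<in> ?V}" using vA by simp
      qed
    qed
    then show ?thesis using v by blast
  qed
  let ?w = "C.E ?s ?s"
  have wA: "?w \<in> carrier (CP n m)" using s by (simp add: C.closed)
  have wV: "?w \<in> ?V" by (rule fs.span_base) (use s in \<open>auto simp: S\<close>)
  \<comment> \<open>Right multiplication by the idempotent fixes the matrix units of its column,
    hence their span. So every \<open>v\<close> is obtained by letting \<open>v\<close> itself act
    on the generator.\<close>
  have vw: "v \<otimes>\<^bsub>CP n m\<^esub> ?w = v" if v: "v \<in> ?V" for v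
  proof -
    have "?V \<subseteq> {v \<in> carrier (CP n m). v \<otimes>\<^bsub>CP n m\<^esub> ?w - v \<in> {0}}"
    proof (rule fs.span_minimal)
      show "fs.subspace {v \<in> carrier (CP n m). v \<otimes>\<^bsub>CP n m\<^esub> ?w - v \<in> {0}}"
      proof (rule sub_mem)
        fix u v assume "u \<in> carrier (CP n m)" "v \<in> carrier (CP n m)"
        then have "(u + v) \<otimes>\<^bsub>CP n m\<^esub> ?w = u \<otimes>\<^bsub>CP n m\<^esub> ?w + v \<otimes>\<^bsub>CP n m\<^esub> ?w"
          by (simp only: C bilin_ext_left)
        then show "(u + v) \<otimes>\<^bsub>CP n m\<^esub> ?w - (u + v) = (u \<otimes>\<^bsub>CP n m\<^esub> ?w - u) + (v \<otimes>\<^bsub>CP n m\<^esub> ?w - v)"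
          by (simp only: add_diff_add)
      next
        fix c v
        show "fscale c v \<otimes>\<^bsub>CP n m\<^esub> ?w - fscale c v = fscale c (v \<otimes>\<^bsub>CP n m\<^esub> ?w - v)"
          by (simp only: C bilin_ext_fscale fs.scale_right_diff_distrib)
      qed (rule fs.subspace_single_0)
      show "S \<subseteq> {v \<in> carrier (CP n m). v \<otimes>\<^bsub>CP n m\<^esub> ?w - v \<in> {0}}"
      proof
        fix v assume "v \<in> S"
        then obtain t where t: "v = C.E t ?s" "t \<in> colorings n m" "shape n t = shape n ?s" unfolding S by blast
        have "v \<otimes>\<^bsub>CP n m\<^esub> ?w = v"
          unfolding t(1) using t s by (intro C.coef_inj) (auto simp: C.coefs C.closed C.sum_of_bool_left)
        then show "v \<in> {v \<in> carrier (CP n m). v \<otimes>\<^bsub>CP n m\<^esub> ?w - v \<in> {0}}"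
          using t s by (simp only: diff_self mem_Collect_eq singleton_iff C.closed simp_thms)
      qed
    qed
    then have "v \<otimes>\<^bsub>CP n m\<^esub> ?w - v = 0" using v by blast
    then show ?thesis by (simp only: right_minus_eq)
  qed
  have vs: "vectorspace (class_ring :: complex ring) ?W"
  proof (rule vectorspace_complexI, unfold W)
    show "v + fscale (- 1) v = 0" for v :: pvec by (simp only: fscale_minus_one right_minus)
  qed (simp_all only: fs.subspace_0[OF V] fs.subspace_add[OF V] fs.subspace_scale[OF V] fs.scale_scale
      fs.scale_one fs.scale_left_distrib fs.scale_right_distrib add_0_right add_ac)
  have lm: "left_module (CP n m) ?W"
  proof (rule left_moduleI[OF vs], unfold W)
    fix a b v c assume a: "a \<in> carrier (CP n m)" and v: "v \<in> ?V"
    have vA: "v \<in> carrier (CP n m)" using v VA by blast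
    show "a \<otimes>\<^bsub>CP n m\<^esub> v \<in> ?V" by (rule closed[OF a v])
    show "(c \<odot>\<^bsub>CP n m\<^esub> a) \<otimes>\<^bsub>CP n m\<^esub> v = fscale c (a \<otimes>\<^bsub>CP n m\<^esub> v)"
      "a \<otimes>\<^bsub>CP n m\<^esub> fscale c v = fscale c (a \<otimes>\<^bsub>CP n m\<^esub> v)"
      by (simp_all only: C bilin_ext_fscale)
    assume b: "b \<in> carrier (CP n m)"
    show "(a \<oplus>\<^bsub>CP n m\<^esub> b) \<otimes>\<^bsub>CP n m\<^esub> v = a \<otimes>\<^bsub>CP n m\<^esub> v + b \<otimes>\<^bsub>CP n m\<^esub> v"
      using C.algebra_laws(1)[OF a b vA] unfolding C(5) .
    show "a \<otimes>\<^bsub>CP n m\<^esub> b \<otimes>\<^bsub>CP n m\<^esub> v = a \<otimes>\<^bsub>CP n m\<^esub> (b \<otimes>\<^bsub>CP n m\<^esub> v)"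
      by (rule C.mult_assoc[OF a b vA])
  next
    fix a v u assume a: "a \<in> carrier (CP n m)" and v: "v \<in> ?V" "u \<in> ?V"
    then show "a \<otimes>\<^bsub>CP n m\<^esub> (v + u) = a \<otimes>\<^bsub>CP n m\<^esub> v + a \<otimes>\<^bsub>CP n m\<^esub> u"
      using C.algebra_laws(2)[of v u a] VA unfolding C(5) by blast
  next
    fix v assume "v \<in> ?V"
    then have "v \<in> carrier (CP n m)" using VA by blast
    then show "\<one>\<^bsub>CP n m\<^esub> \<otimes>\<^bsub>CP n m\<^esub> v = v" using C.algebra_laws(5) by blast
  qed
  have "?w \<noteq> 0"
  proof
    assume "?w = 0"
    then have "coefP ?w ?s ?s = 0" by (simp add: coefP_def)
    then show False using s by (simp add: C.coefs)
  qed
  moreover have "?V \<subseteq> (\<lambda>a. a \<otimes>\<^bsub>CP n m\<^esub> ?w) ` carrier (CP n m)"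
    using vw VA by (metis (no_types, lifting) image_eqI subsetD subsetI)
  moreover have "(\<lambda>a. a \<otimes>\<^bsub>CP n m\<^esub> ?w) ` carrier (CP n m) \<subseteq> ?V" using closed wV by blast
  ultimately show ?thesis
    unfolding C.of_type_def W by (intro conjI bexI[of _ ?w] lm wV vw[OF wV] equalityI)
qed

section \<open>The effect of the functors on multiplicities of colours\<close>

lemma shape_snoc: "i \<le> n \<Longrightarrow> shape n (s @ [i]) = (shape n s)[i := Suc (shape n s ! i)]"
  by (intro nth_equalityI) (auto simp: shape_def nth_list_update simp del: upt_Suc)

lemma shape_snoc_eq_iff: "shape n (y @ [i]) = shape n (z @ [i]) \<longleftrightarrow> shape n y = shape n z"
  by (simp add: shape_eq_iff)

text \<open>The second tensor factor is the projection onto colour \<open>i\<close>, so the image of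
  an element lives on the tuples ending in \<open>i\<close> and is zero elsewhere.\<close>

lemma psi_embedding:
  assumes m: "0 < m" and i: "i \<le> n"
  shows "block_embedding (CP n (Suc m)) (colorings n (Suc m)) (shape n) coefP
    (CP n m) (colorings n m) (shape n) coefP (psi i) (\<lambda>s. s @ [i])"
proof -
  interpret A: block_algebra "CP n (Suc m)" "colorings n (Suc m)" "shape n" coefP by (rule CP_block) simp
  interpret B: block_algebra "CP n m" "colorings n m" "shape n" coefP by (rule CP_block[OF m])
  let ?x = "if i = 0 then Iel 0 else Iel i - Iel 0"
  have x: "?x \<in> free_space (Pset n 1)"
    using free_closed(2)[OF Iel_free Iel_free] Iel_free i by auto
  have cx: "coefP ?x [a] [b] = of_bool (a = i \<and> b = i)" for a b
    using coefP_linear(2)[OF Iel_free[OF i] Iel_free[of 0 n]] by (auto simp: coefP_Iel)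
  have coef: "coefP (psi i b) (y @ [a]) (z @ [c]) = coefP b y z * of_bool (a = i \<and> c = i)"
    if "b \<in> carrier (CP n m)" "y \<in> colorings n m" "z \<in> colorings n m" for b y z a c
    unfolding psi_def cx[symmetric]
    using that x by (intro coefP_ptensor) (auto simp: CP_simps dest: coloringsD)
  show ?thesis
  proof
    fix y z assume "y \<in> colorings n m"
    then show "y @ [i] \<in> colorings n (Suc m)" using i by (auto simp: colorings_Suc)
  next
    fix b assume b: "b \<in> carrier (CP n m)"
    show "psi i b \<in> carrier (CP n (Suc m))"
      using ptensor_free[OF b[unfolded CP_simps] x] by (simp add: CP_simps psi_def)
    show "coefP (psi i b) (y @ [i]) (z @ [i]) = coefP b y z" if "y \<in> colorings n m" "z \<in> colorings n m" for y z
      using coef[OF b that] by simp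
    fix t s assume ts: "t \<in> colorings n (Suc m)" "s \<in> colorings n (Suc m)"
      "t \<notin> (\<lambda>s. s @ [i]) ` colorings n m \<or> s \<notin> (\<lambda>s. s @ [i]) ` colorings n m"
    obtain y a z c where "t = y @ [a]" "s = z @ [c]" "y \<in> colorings n m" "z \<in> colorings n m"
      using ts(1,2) unfolding colorings_Suc by blast
    then show "coefP (psi i b) t s = 0" using ts(3) coef[OF b] by auto
  qed (auto simp: shape_snoc_eq_iff inj_on_def)
qed

text \<open>The multiplicities after appending an entry of colour \<open>p\<close> and deleting one
  of colour \<open>q\<close>. The natural subtraction has this meaning when \<open>ms ! q\<close> is
  positive.\<close>

definition move :: "nat \<Rightarrow> nat \<Rightarrow> nat list \<Rightarrow> nat list" where
  "move p q ms = ms[p := Suc (ms ! p), q := ms ! q - 1]"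

lemma move_update:
  assumes "p \<noteq> q" "q < length ms" "0 < ms ! q"
  shows "(move p q ms)[q := Suc (move p q ms ! q)] = ms[p := Suc (ms ! p)]"
  using assms by (auto simp: move_def list_eq_iff_nth_eq nth_list_update)

lemma length_move [simp]: "length (move p q ms) = length ms"
  by (simp add: move_def)

lemma sum_list_Suc_update: "q < length ms \<Longrightarrow> sum_list (ms[q := Suc (ms ! q)]) = Suc (sum_list ms)"
  by (induction ms arbitrary: q) (auto split: nat.splits)

lemma sum_list_move:
  assumes "p \<noteq> q" "p < length ms" "q < length ms" "0 < ms ! q"
  shows "sum_list (move p q ms) = sum_list ms"
  using sum_list_Suc_update[of q "move p q ms"] sum_list_Suc_update[of p ms] move_update[OF assms(1,3,4)] assms
  by simp

text \<open>Induction leads to the type \<open>row_word ms @ [p]\<close>. This tuple has the same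
  shape as \<open>row_word (move p q ms) @ [q]\<close>, so \<open>of_type_sh\<close> exchanges them,
  and restriction then strips the final \<open>q\<close>. Positivity of \<open>ms ! q\<close> makes
  the exchange possible.\<close>

lemma Res_Ind_of_type:
  assumes ms: "length ms = n + 1" "sum_list ms = m" "0 < m"
    and pq: "p \<le> n" "q \<le> n" "p \<noteq> q" "0 < ms ! q"
  shows "block_algebra.of_type (CP n m) (colorings n m) coefP (row_word (move p q ms))
    (Res n q (m + 1) (Ind n p (m + 1) (Wmod n ms)))"
proof -
  interpret P: block_embedding "CP n (Suc m)" "colorings n (Suc m)" "shape n" coefP
    "CP n m" "colorings n m" "shape n" coefP "psi p" "\<lambda>s. s @ [p]" by (rule psi_embedding[OF ms(3) pq(1)])
  interpret Q: block_embedding "CP n (Suc m)" "colorings n (Suc m)" "shape n" coefP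
    "CP n m" "colorings n m" "shape n" coefP "psi q" "\<lambda>s. s @ [q]" by (rule psi_embedding[OF ms(3) pq(2)])
  have lt: "p < length ms" "q < length ms" using ms pq by auto
  have s: "row_word ms \<in> colorings n m" using row_coloring[OF ms(1)] ms(2) by simp
  have u: "row_word (move p q ms) \<in> colorings n m"
    using row_coloring[of "move p q ms" n] ms sum_list_move[OF pq(3) lt pq(4)] by simp
  have "shape n (row_word ms @ [p]) = shape n (row_word (move p q ms) @ [q])"
    using ms pq lt by (simp add: shape_snoc shape_row move_update)
  then have "P.A.of_type (row_word (move p q ms) @ [q]) (induced_module (CP n (Suc m)) (CP n m) (psi p) (Wmod n ms))"
    using P.A.of_type_sh[OF P.induced_of_type[OF Wmod_of_type[OF ms] s] P.\<iota>_X[OF s] Q.\<iota>_X[OF u]] by blast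
  then have "P.B.of_type (row_word (move p q ms))
      (restricted_module (CP n m) (psi q) (induced_module (CP n (Suc m)) (CP n m) (psi p) (Wmod n ms)))"
    by (rule Q.restricted_of_type[OF _ u])
  then show ?thesis by (simp add: Res_def Ind_def)
qed

section \<open>Tensor products of crystals\<close>

definition nval :: "int extended \<Rightarrow> nat" where
  "nval x = (case x of Fin k \<Rightarrow> nat k | _ \<Rightarrow> 0)"

lemma nval_Fin [simp]: "nval (Fin (int k)) = k" "nval (Fin 0) = 0" "nval (Fin 1) = 1"
  by (simp_all add: nval_def)

text \<open>The axioms make \<open>eps\<close> and \<open>phi\<close> the lengths of the strings
  along \<open>ecr\<close> and \<open>fcr\<close>. Tensor products preserve this, and it is what
  connects them with the iteration counts on the class side.\<close>

locale seminormal = gl_crystal n B for n :: nat and B :: "'b crystal" +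
  assumes eps_nval: "i \<in> {1..n} \<Longrightarrow> b \<in> elts B \<Longrightarrow> eps B i b = Fin (int (nval (eps B i b)))"
    and phi_nval: "i \<in> {1..n} \<Longrightarrow> b \<in> elts B \<Longrightarrow> phi B i b = Fin (int (nval (phi B i b)))"
    and e_None: "i \<in> {1..n} \<Longrightarrow> b \<in> elts B \<Longrightarrow> ecr B i b = None \<longleftrightarrow> nval (eps B i b) = 0"
    and f_None: "i \<in> {1..n} \<Longrightarrow> b \<in> elts B \<Longrightarrow> fcr B i b = None \<longleftrightarrow> nval (phi B i b) = 0"
    and eps_e: "i \<in> {1..n} \<Longrightarrow> b \<in> elts B \<Longrightarrow> ecr B i b = Some b' \<Longrightarrow>
      nval (eps B i b) = Suc (nval (eps B i b'))"

lemma coroot_val_plus: "coroot_val i (\<mu> + \<nu>) = coroot_val i \<mu> + coroot_val i \<nu>"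
  by (simp add: coroot_val_def)

lemma seminormalI:
  fixes p q :: "nat \<Rightarrow> 'b \<Rightarrow> nat"
  assumes wt: "\<And>b. b \<in> elts B \<Longrightarrow> wt B b \<in> weight_lattice n"
    and p: "\<And>i b. i \<in> {1..n} \<Longrightarrow> b \<in> elts B \<Longrightarrow> eps B i b = Fin (int (p i b))"
    and q: "\<And>i b. i \<in> {1..n} \<Longrightarrow> b \<in> elts B \<Longrightarrow> phi B i b = Fin (int (q i b))"
    and pq: "\<And>i b. i \<in> {1..n} \<Longrightarrow> b \<in> elts B \<Longrightarrow> int (q i b) = int (p i b) + coroot_val i (wt B b)"
    and e_in: "\<And>i b b'. i \<in> {1..n} \<Longrightarrow> b \<in> elts B \<Longrightarrow> ecr B i b = Some b' \<Longrightarrow>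
      b' \<in> elts B \<and> wt B b' = wt B b + epsilon i - epsilon (i + 1) \<and> p i b = Suc (p i b')"
    and f_in: "\<And>i b b'. i \<in> {1..n} \<Longrightarrow> b \<in> elts B \<Longrightarrow> fcr B i b = Some b' \<Longrightarrow> b' \<in> elts B"
    and fe: "\<And>i b b'. i \<in> {1..n} \<Longrightarrow> b \<in> elts B \<Longrightarrow> b' \<in> elts B \<Longrightarrow>
      fcr B i b' = Some b \<longleftrightarrow> ecr B i b = Some b'"
    and e0: "\<And>i b. i \<in> {1..n} \<Longrightarrow> b \<in> elts B \<Longrightarrow> ecr B i b = None \<longleftrightarrow> p i b = 0"
    and f0: "\<And>i b. i \<in> {1..n} \<Longrightarrow> b \<in> elts B \<Longrightarrow> fcr B i b = None \<longleftrightarrow> q i b = 0"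
  shows "seminormal n B"
proof
  fix i b assume i: "i \<in> {1..n}" and b: "b \<in> elts B"
  note [simp] = p[OF i] q[OF i] i b
  show "eps B i b \<noteq> Pinf" "phi B i b \<noteq> Pinf" "eps B i b = Fin (int (nval (eps B i b)))"
    "phi B i b = Fin (int (nval (phi B i b)))" by simp_all
  show "set_option (ecr B i b) \<subseteq> elts B" using e_in[OF i b] by auto
  show "set_option (fcr B i b) \<subseteq> elts B" using f_in[OF i b] by auto
  show "phi B i b = eps B i b + Fin (coroot_val i (wt B b))" using pq[OF i b] by simp
  show "ecr B i b = None \<longleftrightarrow> nval (eps B i b) = 0" "fcr B i b = None \<longleftrightarrow> nval (phi B i b) = 0"
    using e0[OF i b] f0[OF i b] by simp_all
  show "ecr B i b = None \<and> fcr B i b = None" if "eps B i b = Minf" using that by simp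
  fix b' :: 'b
  show "wt B b' = wt B b + epsilon i - epsilon (i + 1)" if "ecr B i b = Some b'" using e_in[OF i b that] by simp
  show "nval (eps B i b) = Suc (nval (eps B i b'))" if "ecr B i b = Some b'"
    using e_in[OF i b that] p[OF i b] p[OF i, of b'] by (simp only: nval_Fin)
  show "wt B b' = wt B b - epsilon i + epsilon (i + 1)" if f: "fcr B i b = Some b'"
  proof -
    have b': "b' \<in> elts B" by (rule f_in[OF i b f])
    have "ecr B i b' = Some b" using fe[OF i b' b] f by simp
    from e_in[OF i b' this] show ?thesis by simp
  qed
  show "fcr B i b' = Some b \<longleftrightarrow> ecr B i b = Some b'" if "b' \<in> elts B" using fe[OF i b that] .
qed (rule wt)

context seminormal
begin

lemma e_in: "i \<in> {1..n} \<Longrightarrow> b \<in> elts B \<Longrightarrow> ecr B i b = Some b' \<Longrightarrow> b' \<in> elts B"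
  and f_in: "i \<in> {1..n} \<Longrightarrow> b \<in> elts B \<Longrightarrow> fcr B i b = Some b' \<Longrightarrow> b' \<in> elts B"
  using e_range f_range by fastforce+

lemma coroot_nval: "i \<in> {1..n} \<Longrightarrow> b \<in> elts B \<Longrightarrow>
    coroot_val i (wt B b) = int (nval (phi B i b)) - int (nval (eps B i b))"
  using phi_eq[of i b] eps_nval[of i b] phi_nval[of i b] by (metis add_diff_cancel_left' extended.inject(1) plus_extended.simps(1))

lemma phi_e:
  assumes i: "i \<in> {1..n}" and b: "b \<in> elts B" and e: "ecr B i b = Some b'"
  shows "nval (phi B i b') = Suc (nval (phi B i b))"
proof -
  \<comment> \<open>A simple root takes the value 2 on its coroot; one unit is the drop of
    \<open>eps\<close>, the other the rise of \<open>phi\<close>.\<close>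
  have "coroot_val i (wt B b') = coroot_val i (wt B b) + 2"
    unfolding wt_e[OF i b e] by (simp add: coroot_val_def epsilon_def)
  then show ?thesis
    using coroot_nval[OF i b] coroot_nval[OF i e_in[OF i b e]] eps_e[OF i b e] by simp
qed

lemma f_step:
  assumes i: "i \<in> {1..n}" and b: "b \<in> elts B" and f: "fcr B i b = Some b'"
  shows "nval (phi B i b) = Suc (nval (phi B i b'))" "nval (eps B i b') = Suc (nval (eps B i b))"
    "ecr B i b' = Some b"
proof -
  note b' = f_in[OF i b f]
  show e: "ecr B i b' = Some b" using f_iff_e[OF i b' b] f by simp
  show "nval (phi B i b) = Suc (nval (phi B i b'))" by (rule phi_e[OF i b' e])
  show "nval (eps B i b') = Suc (nval (eps B i b))" by (rule eps_e[OF i b' e])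
qed

end

lemma seminormal_box: "seminormal n (box_crystal n)"
  by (rule seminormalI[where p = "\<lambda>i j. if i = j then 1 else 0" and q = "\<lambda>i j. if i = j + 1 then 1 else 0"])
    (auto simp: box_crystal_def weight_lattice_def epsilon_def coroot_val_def fun_eq_iff split: if_splits)

text \<open>The coroot value of a weight is \<open>phi - eps\<close>, so the maxima in the
  definition become truncated differences, that is, numbers of signs left after cancelling
  \<open>+\<close> of the left factor against \<open>-\<close> of the right one.\<close>

lemma crystal_tensor_values:
  assumes "seminormal n B" "seminormal n C" and i: "i \<in> {1..n}" and bc: "b \<in> elts B" "c \<in> elts C"
  shows "eps (crystal_tensor B C) i (b, c) =
      Fin (int (nval (eps B i b) + (nval (eps C i c) - nval (phi B i b))))"
    and "phi (crystal_tensor B C) i (b, c) =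
      Fin (int (nval (phi C i c) + (nval (phi B i b) - nval (eps C i c))))"
    and "ecr (crystal_tensor B C) i (b, c) = (if nval (eps C i c) \<le> nval (phi B i b)
      then map_option (\<lambda>b'. (b', c)) (ecr B i b) else map_option (\<lambda>c'. (b, c')) (ecr C i c))"
    and "fcr (crystal_tensor B C) i (b, c) = (if nval (eps C i c) < nval (phi B i b)
      then map_option (\<lambda>b'. (b', c)) (fcr B i b) else map_option (\<lambda>c'. (b, c')) (fcr C i c))"
proof -
  interpret B: seminormal n B by fact
  interpret C: seminormal n C by fact
  obtain p q where p: "eps B i b = Fin (int p)" and q: "phi B i b = Fin (int q)"
    using B.eps_nval[OF i bc(1)] B.phi_nval[OF i bc(1)] by blast
  obtain p' q' where p': "eps C i c = Fin (int p')" and q': "phi C i c = Fin (int q')"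
    using C.eps_nval[OF i bc(2)] C.phi_nval[OF i bc(2)] by blast
  have r: "coroot_val i (wt B b) = int q - int p" "coroot_val i (wt C c) = int q' - int p'"
    using B.coroot_nval[OF i bc(1)] C.coroot_nval[OF i bc(2)] by (simp_all add: p q p' q')
  show "eps (crystal_tensor B C) i (b, c) =
      Fin (int (nval (eps B i b) + (nval (eps C i c) - nval (phi B i b))))"
    "phi (crystal_tensor B C) i (b, c) =
      Fin (int (nval (phi C i c) + (nval (phi B i b) - nval (eps C i c))))"
    "ecr (crystal_tensor B C) i (b, c) = (if nval (eps C i c) \<le> nval (phi B i b)
      then map_option (\<lambda>b'. (b', c)) (ecr B i b) else map_option (\<lambda>c'. (b, c')) (ecr C i c))"
    "fcr (crystal_tensor B C) i (b, c) = (if nval (eps C i c) < nval (phi B i b)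
      then map_option (\<lambda>b'. (b', c)) (fcr B i b) else map_option (\<lambda>c'. (b, c')) (fcr C i c))"
    by (auto simp: crystal_tensor_def p q p' q' r max_def)
qed

lemma seminormal_tensor:
  assumes B: "seminormal n B" and C: "seminormal n C"
  shows "seminormal n (crystal_tensor B C)"
proof -
  interpret B: seminormal n B by fact
  interpret C: seminormal n C by fact
  note val = crystal_tensor_values[OF B C]
  let ?T = "crystal_tensor B C"
  have elts: "elts ?T = elts B \<times> elts C" by (simp add: crystal_tensor_def)
  have wt: "wt ?T (b, c) = wt B b + wt C c" for b c by (simp add: crystal_tensor_def)
  show ?thesis
  proof (rule seminormalI[where p = "\<lambda>i x. nval (eps B i (fst x)) + (nval (eps C i (snd x)) - nval (phi B i (fst x)))"
        and q = "\<lambda>i x. nval (phi C i (snd x)) + (nval (phi B i (fst x)) - nval (eps C i (snd x)))"])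
    fix x assume "x \<in> elts ?T"
    then show "wt ?T x \<in> weight_lattice n"
      using B.wt_lattice C.wt_lattice by (auto simp: elts wt weight_lattice_def)
  next
    fix i x assume i: "i \<in> {1..n}" and "x \<in> elts ?T"
    then obtain b c where x: "x = (b, c)" and b: "b \<in> elts B" and c: "c \<in> elts C" by (auto simp: elts)
    note v = val[OF i b c]
    show "eps ?T i x = Fin (int (nval (eps B i (fst x)) + (nval (eps C i (snd x)) - nval (phi B i (fst x)))))"
      "phi ?T i x = Fin (int (nval (phi C i (snd x)) + (nval (phi B i (fst x)) - nval (eps C i (snd x)))))"
      using v by (simp_all add: x)
    show "int (nval (phi C i (snd x)) + (nval (phi B i (fst x)) - nval (eps C i (snd x)))) =
        int (nval (eps B i (fst x)) + (nval (eps C i (snd x)) - nval (phi B i (fst x)))) + coroot_val i (wt ?T x)"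
      using B.coroot_nval[OF i b] C.coroot_nval[OF i c] by (simp add: x wt coroot_val_plus)
    show "ecr ?T i x = None \<longleftrightarrow> nval (eps B i (fst x)) + (nval (eps C i (snd x)) - nval (phi B i (fst x))) = 0"
      using v(3) B.e_None[OF i b] C.e_None[OF i c] by (auto simp: x)
    show "fcr ?T i x = None \<longleftrightarrow> nval (phi C i (snd x)) + (nval (phi B i (fst x)) - nval (eps C i (snd x))) = 0"
      using v(4) B.f_None[OF i b] C.f_None[OF i c] by (auto simp: x)
    fix y
    show "y \<in> elts ?T" if "fcr ?T i x = Some y"
      using that v(4) B.f_in[OF i b] C.f_in[OF i c] b c by (auto simp: x elts split: if_splits)
    show "y \<in> elts ?T \<and> wt ?T y = wt ?T x + epsilon i - epsilon (i + 1) \<and>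
        nval (eps B i (fst x)) + (nval (eps C i (snd x)) - nval (phi B i (fst x))) =
        Suc (nval (eps B i (fst y)) + (nval (eps C i (snd y)) - nval (phi B i (fst y))))"
      if e: "ecr ?T i x = Some y"
    proof (cases "nval (eps C i c) \<le> nval (phi B i b)")
      case True
      then obtain b' where y: "y = (b', c)" and b': "ecr B i b = Some b'" using e v(3) by (auto simp: x)
      then show ?thesis
        using B.e_in[OF i b b'] c B.wt_e[OF i b b'] B.eps_e[OF i b b'] B.phi_e[OF i b b'] True
        by (simp add: elts wt x)
    next
      case False
      then obtain c' where y: "y = (b, c')" and c': "ecr C i c = Some c'" using e v(3) by (auto simp: x)
      then show ?thesis
        using C.e_in[OF i c c'] b C.wt_e[OF i c c'] C.eps_e[OF i c c'] False
        by (simp add: elts wt x)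
    qed
    show "fcr ?T i y = Some x \<longleftrightarrow> ecr ?T i x = Some y" if yT: "y \<in> elts ?T"
    proof -
      obtain b' c' where y: "y = (b', c')" and b': "b' \<in> elts B" and c': "c' \<in> elts C"
        using yT by (auto simp: elts)
      note v' = val[OF i b' c']
      have feB: "fcr B i b' = Some b \<longleftrightarrow> ecr B i b = Some b'" by (rule B.f_iff_e[OF i b b'])
      have feC: "fcr C i c' = Some c \<longleftrightarrow> ecr C i c = Some c'" by (rule C.f_iff_e[OF i c c'])
      \<comment> \<open>Applying \<open>ecr\<close> on the left raises \<open>phi\<close> there, so
        the weak inequality becomes the strict one tested by \<open>fcr\<close>. Applying it on the
        right lowers \<open>eps\<close> there by one, and the strict inequality weakens just enough
        for \<open>fcr\<close> to stay on the right.\<close>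
      have 1: "nval (phi B i b') = Suc (nval (phi B i b))" if "ecr B i b = Some b'"
        by (rule B.phi_e[OF i b that])
      have 2: "nval (eps C i c) = Suc (nval (eps C i c'))" if "ecr C i c = Some c'"
        by (rule C.eps_e[OF i c that])
      show ?thesis
        unfolding x y v(3) v'(4) using feB feC 1 2 by (auto split: if_splits)
    qed
  qed
qed

lemma induced_values:
  "elts (induced_crystal S g B) = S" "wt (induced_crystal S g B) = wt B \<circ> g"
  "eps (induced_crystal S g B) i s = eps B i (g s)" "phi (induced_crystal S g B) i s = phi B i (g s)"
  "ecr (induced_crystal S g B) i s = map_option (the_inv_into S g) (ecr B i (g s))"
  "fcr (induced_crystal S g B) i s = map_option (the_inv_into S g) (fcr B i (g s))"
  by (simp_all add: induced_crystal_def)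

lemma seminormal_induced:
  assumes B: "seminormal n B" and inj: "inj_on g S" and sub: "g ` S \<subseteq> elts B"
    and e: "\<And>i s b. i \<in> {1..n} \<Longrightarrow> s \<in> S \<Longrightarrow> ecr B i (g s) = Some b \<Longrightarrow> b \<in> g ` S"
    and f: "\<And>i s b. i \<in> {1..n} \<Longrightarrow> s \<in> S \<Longrightarrow> fcr B i (g s) = Some b \<Longrightarrow> b \<in> g ` S"
  shows "seminormal n (induced_crystal S g B)"
proof -
  interpret B: seminormal n B by fact
  let ?T = "induced_crystal S g B"
  have inv: "the_inv_into S g (g s) = s" if "s \<in> S" for s by (rule the_inv_into_f_f[OF inj that])
  have gB: "g s \<in> elts B" if "s \<in> S" for s using that sub by blast
  have eT: "ecr ?T i s = Some s' \<longleftrightarrow> s' \<in> S \<and> ecr B i (g s) = Some (g s')" if "i \<in> {1..n}" "s \<in> S" for i s s'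
    using e[OF that] inv by (auto simp: induced_values)
  have fT: "fcr ?T i s = Some s' \<longleftrightarrow> s' \<in> S \<and> fcr B i (g s) = Some (g s')" if "i \<in> {1..n}" "s \<in> S" for i s s'
    using f[OF that] inv by (auto simp: induced_values)
  show ?thesis
  proof (rule seminormalI[where p = "\<lambda>i s. nval (eps B i (g s))" and q = "\<lambda>i s. nval (phi B i (g s))"],
      unfold induced_values(1))
    fix s assume "s \<in> S"
    then show "wt ?T s \<in> weight_lattice n" using gB B.wt_lattice by (simp add: induced_values)
  next
    fix i s assume i: "i \<in> {1..n}" and s: "s \<in> S"
    note g = gB[OF s]
    show "eps ?T i s = Fin (int (nval (eps B i (g s))))" "phi ?T i s = Fin (int (nval (phi B i (g s))))"
      using B.eps_nval[OF i g] B.phi_nval[OF i g] by (simp_all add: induced_values)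
    show "int (nval (phi B i (g s))) = int (nval (eps B i (g s))) + coroot_val i (wt ?T s)"
      using B.coroot_nval[OF i g] by (simp add: induced_values)
    show "ecr ?T i s = None \<longleftrightarrow> nval (eps B i (g s)) = 0" "fcr ?T i s = None \<longleftrightarrow> nval (phi B i (g s)) = 0"
      using B.e_None[OF i g] B.f_None[OF i g] by (simp_all add: induced_values)
    fix s'
    show "s' \<in> S" if "fcr ?T i s = Some s'" using that fT[OF i s] by blast
    show "s' \<in> S \<and> wt ?T s' = wt ?T s + epsilon i - epsilon (i + 1) \<and>
        nval (eps B i (g s)) = Suc (nval (eps B i (g s')))" if "ecr ?T i s = Some s'"
      using that eT[OF i s] B.wt_e[OF i g] B.eps_e[OF i g] by (simp add: induced_values)
    show "fcr ?T i s' = Some s \<longleftrightarrow> ecr ?T i s = Some s'" if "s' \<in> S"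
      using that s eT[OF i s] fT[OF i that] B.f_iff_e[OF i g gB[OF that]] by simp
  qed
qed

text \<open>For factors with \<open>\<epsilon>\<^sub>i = p\<^sub>j\<close> and \<open>\<phi>\<^sub>i = q\<^sub>j\<close>, given as a list of pairs, \<open>leps\<close> and \<open>lphi\<close> are
  the numbers of signs \<open>-\<close> and \<open>+\<close> that remain after cancellation, and \<open>epos\<close> and \<open>fpos\<close> are the
  factors on which \<open>e\<^sub>i\<close> and \<open>f\<^sub>i\<close> act.\<close>

fun leps :: "(nat \<times> nat) list \<Rightarrow> nat" where
  "leps [] = 0"
| "leps ((p, q) # \<sigma>) = p + (leps \<sigma> - q)"

fun lphi :: "(nat \<times> nat) list \<Rightarrow> nat" where
  "lphi [] = 0"
| "lphi ((p, q) # \<sigma>) = lphi \<sigma> + (q - leps \<sigma>)"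

fun epos :: "(nat \<times> nat) list \<Rightarrow> nat option" where
  "epos [] = None"
| "epos ((p, q) # \<sigma>) = (if leps \<sigma> \<le> q then if p = 0 then None else Some 0 else map_option Suc (epos \<sigma>))"

fun fpos :: "(nat \<times> nat) list \<Rightarrow> nat option" where
  "fpos [] = None"
| "fpos ((p, q) # \<sigma>) = (if leps \<sigma> < q then Some 0 else map_option Suc (fpos \<sigma>))"

lemma epos_less: "epos \<sigma> = Some j \<Longrightarrow> j < length \<sigma> \<and> 0 < fst (\<sigma> ! j)"
  by (induction \<sigma> arbitrary: j rule: epos.induct) (auto split: if_splits)

lemma fpos_less: "fpos \<sigma> = Some j \<Longrightarrow> j < length \<sigma> \<and> 0 < snd (\<sigma> ! j)"
  by (induction \<sigma> arbitrary: j rule: fpos.induct) (auto split: if_splits)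

definition sig :: "nat \<Rightarrow> 'b crystal \<Rightarrow> 'b \<Rightarrow> nat \<times> nat" where
  "sig i B b = (nval (eps B i b), nval (phi B i b))"

text \<open>Unfolds the nested tensor product into arithmetic on the list of pairs
  (\<open>eps\<close>, \<open>phi\<close>). Seminormality belongs to the same induction, since the
  binary rule is applied to the tensor product of the tail.\<close>

lemma crystal_tensor_list:
  assumes "Bs \<noteq> []" "\<forall>B\<in>set Bs. seminormal n B"
  shows "seminormal n (crystal_tensor_list Bs)"
    and "elts (crystal_tensor_list Bs) = listset (map elts Bs)"
    and "bs \<in> listset (map elts Bs) \<Longrightarrow> wt (crystal_tensor_list Bs) bs = sum_list (map2 wt Bs bs)"
    and "bs \<in> listset (map elts Bs) \<Longrightarrow> i \<in> {1..n} \<Longrightarrow>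
      eps (crystal_tensor_list Bs) i bs = Fin (int (leps (map2 (sig i) Bs bs))) \<and>
      phi (crystal_tensor_list Bs) i bs = Fin (int (lphi (map2 (sig i) Bs bs))) \<and>
      ecr (crystal_tensor_list Bs) i bs =
        map_option (\<lambda>j. bs[j := the (ecr (Bs ! j) i (bs ! j))]) (epos (map2 (sig i) Bs bs)) \<and>
      fcr (crystal_tensor_list Bs) i bs =
        map_option (\<lambda>j. bs[j := the (fcr (Bs ! j) i (bs ! j))]) (fpos (map2 (sig i) Bs bs))"
  using assms
proof (induction Bs arbitrary: bs rule: crystal_tensor_list.induct)
  case (2 B)
  {
    case 1
    interpret B: seminormal n B using 1 by simp
    have im: "hd ` {[b] |b. b \<in> elts B} = elts B" by force
    show ?case
      unfolding crystal_tensor_list.simps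
    proof (rule seminormal_induced[OF B.seminormal_axioms])
      show "inj_on hd {[b] |b. b \<in> elts B}" by (auto simp: inj_on_def)
      fix i s b assume i: "i \<in> {1..n}" and s: "s \<in> {[b] |b. b \<in> elts B}"
      then have "hd s \<in> elts B" by auto
      then show "ecr B i (hd s) = Some b \<Longrightarrow> b \<in> hd ` {[b] |b. b \<in> elts B}"
          "fcr B i (hd s) = Some b \<Longrightarrow> b \<in> hd ` {[b] |b. b \<in> elts B}"
        using B.e_in[OF i] B.f_in[OF i] unfolding im by blast+
    qed (simp only: im order_refl)
  next
    case 2
    show ?case by (auto simp: induced_values set_Cons_def)
  next
    case 3
    then show ?case by (auto simp: induced_values set_Cons_def)
  next
    case 4
    interpret B: seminormal n B using 4 by simp
    obtain b where bs: "bs = [b]" and b: "b \<in> elts B" using 4 by (auto simp: set_Cons_def)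
    let ?S = "{[b] |b. b \<in> elts B}"
    have inv: "the_inv_into ?S hd b' = [b']" if "b' \<in> elts B" for b'
    proof -
      have "inj_on hd ?S" by (auto simp: inj_on_def)
      from the_inv_into_f_f[OF this, of "[b']"] that show ?thesis by simp
    qed
    show ?case
      using B.eps_nval[OF 4(2) b] B.phi_nval[OF 4(2) b] B.e_None[OF 4(2) b] B.f_None[OF 4(2) b]
        B.e_in[OF 4(2) b] B.f_in[OF 4(2) b] inv
      by (auto simp: bs induced_values sig_def map_option_case split: option.splits)
  }
next
  case (3 B C Bs)
  let ?T = "crystal_tensor_list (C # Bs)"
  {
    case 1
    interpret B: seminormal n B using 1 by simp
    interpret T: seminormal n ?T by (rule "3.IH"(1)) (use 1 in auto)
    interpret X: seminormal n "crystal_tensor B ?T" by (rule seminormal_tensor) unfold_locales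
    have im: "(\<lambda>bs. (hd bs, tl bs)) ` {b # bs |b bs. b \<in> elts B \<and> bs \<in> elts ?T} = elts (crystal_tensor B ?T)"
      by (force simp: crystal_tensor_def)
    show ?case
      unfolding crystal_tensor_list.simps
    proof (rule seminormal_induced[OF X.seminormal_axioms])
      show "inj_on (\<lambda>bs. (hd bs, tl bs)) {b # bs |b bs. b \<in> elts B \<and> bs \<in> elts ?T}"
        by (auto simp: inj_on_def)
      fix i s b assume i: "i \<in> {1..n}" and s: "s \<in> {b # bs |b bs. b \<in> elts B \<and> bs \<in> elts ?T}"
      then have "(hd s, tl s) \<in> elts (crystal_tensor B ?T)" unfolding im[symmetric] by (rule_tac imageI)
      then show "ecr (crystal_tensor B ?T) i (hd s, tl s) = Some b \<Longrightarrow>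
            b \<in> (\<lambda>bs. (hd bs, tl bs)) ` {b # bs |b bs. b \<in> elts B \<and> bs \<in> elts ?T}"
          "fcr (crystal_tensor B ?T) i (hd s, tl s) = Some b \<Longrightarrow>
            b \<in> (\<lambda>bs. (hd bs, tl bs)) ` {b # bs |b bs. b \<in> elts B \<and> bs \<in> elts ?T}"
        using X.e_in[OF i] X.f_in[OF i] unfolding im by blast+
    qed (simp only: im order_refl)
  next
    case 2
    have "elts ?T = listset (map elts (C # Bs))" by (rule "3.IH"(2)) (use 2 in auto)
    then show ?case by (simp add: induced_values) (auto simp: set_Cons_def)
  next
    case 3
    obtain b bs' where bs: "bs = b # bs'" and b: "b \<in> elts B" and bs': "bs' \<in> listset (map elts (C # Bs))"
      using 3 by (auto simp: set_Cons_def)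
    have "wt ?T bs' = sum_list (map2 wt (C # Bs) bs')" by (rule "3.IH"(3)) (use 3 bs' in auto)
    then show ?case by (simp add: bs induced_values crystal_tensor_def)
  next
    case 4
    obtain b bs' where bs: "bs = b # bs'" and b: "b \<in> elts B" and bs': "bs' \<in> listset (map elts (C # Bs))"
      using 4 by (auto simp: set_Cons_def)
    interpret B: seminormal n B using 4 by simp
    interpret T: seminormal n ?T by (rule "3.IH"(1)) (use 4 in auto)
    have el: "elts ?T = listset (map elts (C # Bs))" by (rule "3.IH"(2)) (use 4 in auto)
    have bT: "bs' \<in> elts ?T" using bs' el by simp
    let ?\<sigma> = "map2 (sig i) (C # Bs) bs'"
    have IH: "eps ?T i bs' = Fin (int (leps ?\<sigma>))" "phi ?T i bs' = Fin (int (lphi ?\<sigma>))"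
      "ecr ?T i bs' = map_option (\<lambda>j. bs'[j := the (ecr ((C # Bs) ! j) i (bs' ! j))]) (epos ?\<sigma>)"
      "fcr ?T i bs' = map_option (\<lambda>j. bs'[j := the (fcr ((C # Bs) ! j) i (bs' ! j))]) (fpos ?\<sigma>)"
      using "3.IH"(4)[OF bs' 4(2)] 4 by auto
    note v = crystal_tensor_values[OF B.seminormal_axioms T.seminormal_axioms 4(2) b bT]
    let ?S = "{b # bs |b bs. b \<in> elts B \<and> bs \<in> elts ?T}"
    let ?g = "\<lambda>bs. (hd bs, tl bs)"
    have inv: "the_inv_into ?S ?g (b', c) = b' # c" if "b' \<in> elts B" "c \<in> elts ?T" for b' c
    proof -
      have "inj_on ?g ?S" by (auto simp: inj_on_def)
      from the_inv_into_f_f[OF this, of "b' # c"] that show ?thesis by auto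
    qed
    have sg: "map2 (sig i) (B # C # Bs) bs = (nval (eps B i b), nval (phi B i b)) # ?\<sigma>"
      by (simp add: bs sig_def)
    have "ecr (crystal_tensor_list (B # C # Bs)) i bs =
        map_option (the_inv_into ?S ?g) (ecr (crystal_tensor B ?T) i (b, bs'))"
      by (simp add: induced_values bs)
    also have "\<dots> = map_option (\<lambda>j. bs[j := the (ecr ((B # C # Bs) ! j) i (bs ! j))]) (epos (map2 (sig i) (B # C # Bs) bs))"
    proof (cases "leps ?\<sigma> \<le> nval (phi B i b)")
      case True
      then show ?thesis
        using B.e_None[OF 4(2) b] B.e_in[OF 4(2) b] inv bT
        unfolding v(3) sg IH(1) by (auto simp: bs split: option.splits)
    next
      case False
      have "c \<in> elts ?T" if "ecr ?T i bs' = Some c" for c using T.e_in[OF 4(2) bT that] .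
      then show ?thesis
        using False inv b unfolding v(3) sg IH(1)
        by (auto simp: bs IH(3) option.map_comp o_def intro!: option.map_cong0 split: option.splits)
    qed
    finally have e: "ecr (crystal_tensor_list (B # C # Bs)) i bs = \<dots>" .
    have "fcr (crystal_tensor_list (B # C # Bs)) i bs =
        map_option (the_inv_into ?S ?g) (fcr (crystal_tensor B ?T) i (b, bs'))"
      by (simp add: induced_values bs)
    also have "\<dots> = map_option (\<lambda>j. bs[j := the (fcr ((B # C # Bs) ! j) i (bs ! j))]) (fpos (map2 (sig i) (B # C # Bs) bs))"
    proof (cases "leps ?\<sigma> < nval (phi B i b)")
      case True
      then show ?thesis
        using B.f_None[OF 4(2) b] B.f_in[OF 4(2) b] inv bT
        unfolding v(4) sg IH(1) by (auto simp: bs split: option.splits)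
    next
      case False
      have "c \<in> elts ?T" if "fcr ?T i bs' = Some c" for c using T.f_in[OF 4(2) bT that] .
      then show ?thesis
        using False inv b unfolding v(4) sg IH(1)
        by (auto simp: bs IH(4) option.map_comp o_def intro!: option.map_cong0 split: option.splits)
    qed
    finally have f: "fcr (crystal_tensor_list (B # C # Bs)) i bs = \<dots>" .
    have "eps (crystal_tensor_list (B # C # Bs)) i bs = Fin (int (leps (map2 (sig i) (B # C # Bs) bs)))"
      "phi (crystal_tensor_list (B # C # Bs)) i bs = Fin (int (lphi (map2 (sig i) (B # C # Bs) bs)))"
      unfolding sg using v(1,2) by (simp_all add: induced_values bs IH)
    then show ?case using e f by blast
  }
qed simp_all

text \<open>\<open>N\<close> drops by one with each application of \<open>h\<close> and is 0 exactly
  where \<open>h\<close> is undefined, so the iterates are defined precisely up to exponent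
  \<open>N x\<close>.\<close>

lemma max_iter_eq:
  assumes step: "\<And>x. x \<in> S \<Longrightarrow> h x = None \<longleftrightarrow> N x = 0"
    "\<And>x y. x \<in> S \<Longrightarrow> h x = Some y \<Longrightarrow> y \<in> S \<and> N x = Suc (N y)"
    and x: "x \<in> S"
  shows "max_iter h x = Fin (int (N x))"
proof -
  let ?it = "\<lambda>j. ((\<lambda>x. Option.bind x h) ^^ j) (Some x)"
  have le: "\<exists>y\<in>S. ?it j = Some y \<and> N y + j = N x" if "j \<le> N x" for j
    using that
  proof (induction j)
    case (Suc j)
    then obtain y where y: "y \<in> S" "?it j = Some y" "N y + j = N x" by auto
    then obtain z where "h y = Some z" using Suc.prems step(1)[of y] by (cases "h y") auto
    then show ?case using y step(2)[of y z] by auto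
  qed (use x in auto)
  have gt: "?it (Suc (N x) + k) = None" for k
  proof (induction k)
    case 0
    obtain y where "y \<in> S" "?it (N x) = Some y" "N y + N x = N x" using le[of "N x"] by auto
    then show ?case using step(1)[of y] by simp
  qed simp
  have "{j. ?it j \<noteq> None} = {..N x}"
  proof (intro equalityI subsetI)
    fix j assume j: "j \<in> {j. ?it j \<noteq> None}"
    show "j \<in> {..N x}"
    proof (rule ccontr)
      assume "j \<notin> {..N x}"
      then have "?it j = None" using gt[of "j - Suc (N x)"] by simp
      then show False using j by simp
    qed
  qed (use le in fastforce)
  moreover have "Max {..N x} = N x" by (intro Max_eqI) auto
  ultimately show ?thesis unfolding max_iter_def by (simp only:)
qed

section \<open>Row tableaux and sign sequences\<close>

lemma epos_None_iff: "epos \<sigma> = None \<longleftrightarrow> leps \<sigma> = 0"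
  by (induction \<sigma> rule: epos.induct) auto

lemma map_option_plus:
  "map_option ((+) 0) x = (x :: nat option)"
  "map_option ((+) (Suc k)) x = map_option Suc (map_option ((+) k) x)"
  by (cases x; simp)+

text \<open>Boxes with entries other than \<open>i\<close> and \<open>i - 1\<close> are invisible to
  the signature for \<open>i\<close>; they merely shift positions.\<close>

lemma sig_zeros:
  assumes "\<forall>x\<in>set \<tau>. x = (0, 0)"
  shows "leps (\<tau> @ \<sigma>) = leps \<sigma>" "lphi (\<tau> @ \<sigma>) = lphi \<sigma>"
    "epos (\<tau> @ \<sigma>) = map_option ((+) (length \<tau>)) (epos \<sigma>)"
    "fpos (\<tau> @ \<sigma>) = map_option ((+) (length \<tau>)) (fpos \<sigma>)"
  using assms
  by (induction \<tau>) (auto simp: epos_None_iff[symmetric] map_option_plus simp del: option.map_comp)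

lemma sig_plus:
  assumes "leps \<sigma> = 0"
  shows "leps (replicate b (0, Suc 0) @ \<sigma>) = 0" "lphi (replicate b (0, Suc 0) @ \<sigma>) = b + lphi \<sigma>"
    "fpos (replicate b (0, Suc 0) @ \<sigma>) = (if b = 0 then fpos \<sigma> else Some 0)"
proof -
  show 1: "leps (replicate b (0, Suc 0) @ \<sigma>) = 0" for b using assms by (induction b) auto
  show "lphi (replicate b (0, Suc 0) @ \<sigma>) = b + lphi \<sigma>" by (induction b) (auto simp: 1)
  show "fpos (replicate b (0, Suc 0) @ \<sigma>) = (if b = 0 then fpos \<sigma> else Some 0)" by (cases b) (auto simp: 1)
qed

lemma sig_minus:
  assumes "leps \<sigma> = 0"
  shows "leps (replicate a (Suc 0, 0) @ \<sigma>) = a" "lphi (replicate a (Suc 0, 0) @ \<sigma>) = lphi \<sigma>"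
    "epos (replicate a (Suc 0, 0) @ \<sigma>) = (if a = 0 then None else Some (a - 1))"
    "fpos (replicate a (Suc 0, 0) @ \<sigma>) = map_option ((+) a) (fpos \<sigma>)"
proof -
  show 1: "leps (replicate a (Suc 0, 0) @ \<sigma>) = a" for a using assms by (induction a) auto
  show "lphi (replicate a (Suc 0, 0) @ \<sigma>) = lphi \<sigma>" by (induction a) auto
  show "epos (replicate a (Suc 0, 0) @ \<sigma>) = (if a = 0 then None else Some (a - 1))"
  proof (induction a)
    case (Suc a)
    then show ?case by (cases a) (auto simp: 1 assms)
  qed (use assms epos_None_iff[of \<sigma>] in simp)
  show "fpos (replicate a (Suc 0, 0) @ \<sigma>) = map_option ((+) a) (fpos \<sigma>)"
    by (induction a) (cases "fpos \<sigma>"; simp)+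
qed

definition box_sig :: "nat \<Rightarrow> nat \<Rightarrow> nat \<times> nat" where
  "box_sig i x = (if i = x then 1 else 0, if i = x + 1 then 1 else 0)"

lemma sig_box: "sig i (box_crystal n) = box_sig i"
  by (auto simp: sig_def box_sig_def box_crystal_def)

text \<open>Read from right to left, a row shows its entries \<open>i\<close> before its entries
  \<open>i - 1\<close>, hence all \<open>-\<close> before all \<open>+\<close>, and nothing cancels.
  So \<open>e_i\<close> acts on the last \<open>i\<close> of the word, at position
  \<open>length hi + a - 1\<close>, and \<open>f_i\<close> on the \<open>i - 1\<close> directly
  after it.\<close>

lemma word_sig:
  fixes hi lo :: "nat list" and i a b :: nat
  assumes hi: "\<forall>x\<in>set hi. x \<noteq> i \<and> x + 1 \<noteq> i" and lo: "\<forall>x\<in>set lo. x \<noteq> i \<and> x + 1 \<noteq> i" and i: "0 < i"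
  defines "\<sigma> \<equiv> map (box_sig i) (hi @ replicate a i @ replicate b (i - 1) @ lo)"
  shows "leps \<sigma> = a" "lphi \<sigma> = b" "epos \<sigma> = (if a = 0 then None else Some (length hi + a - 1))"
    "fpos \<sigma> = (if b = 0 then None else Some (length hi + a))"
proof -
  have z: "\<forall>x\<in>set (map (box_sig i) hi). x = (0, 0)" "\<forall>x\<in>set (map (box_sig i) lo). x = (0, 0)"
    using hi lo by (auto simp: box_sig_def)
  have eq: "\<sigma> = map (box_sig i) hi @ replicate a (Suc 0, 0) @ replicate b (0, Suc 0) @ map (box_sig i) lo @ []"
    using i by (simp add: \<sigma>_def box_sig_def)
  note rest = sig_zeros[OF z(2), of "[]", simplified]
  show "leps \<sigma> = a" "lphi \<sigma> = b" "epos \<sigma> = (if a = 0 then None else Some (length hi + a - 1))"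
    "fpos \<sigma> = (if b = 0 then None else Some (length hi + a))"
    unfolding eq by (simp_all add: sig_zeros[OF z(1)] sig_minus sig_plus rest)
qed

section \<open>The crystal of row tableaux\<close>

lemma row_from_append: "row_from k (xs @ ys) = row_from k xs @ row_from (k + length xs) ys"
  by (induction xs arbitrary: k) auto

lemma sorted_row_from: "sorted (row_from k ms)"
proof (induction ms arbitrary: k)
  case (Cons a ms)
  then show ?case using set_row_from[of "Suc k" ms] by (fastforce simp: sorted_append)
qed simp

lemma sum_list_row_from:
  fixes f :: "nat \<Rightarrow> int"
  shows "sum_list (map f (row_from k ms)) = (\<Sum>i<length ms. int (ms ! i) * f (k + i))"
  by (induction ms arbitrary: k)
    (simp_all add: sum_list_replicate sum.lessThan_Suc_shift del: sum.lessThan_Suc)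

definition arrays :: "nat \<Rightarrow> nat \<Rightarrow> nat list set" where
  "arrays n m = {ms. length ms = n + 1 \<and> sum_list ms = m}"

lemma arraysD: "ms \<in> arrays n m \<Longrightarrow> length ms = n + 1" "ms \<in> arrays n m \<Longrightarrow> sum_list ms = m"
  by (simp_all add: arrays_def)

lemma shape_arrays: "s \<in> colorings n m \<Longrightarrow> shape n s \<in> arrays n m"
proof -
  assume s: "s \<in> colorings n m"
  have "sum_list (shape n s) = sum (count_list s) {0..<n + 1}"
    unfolding shape_def by (rule sum_list_distinct_conv_sum_set[THEN trans]) (simp_all del: upt_Suc)
  also have "\<dots> = length s" using s by (intro sum_count_set) (auto simp: colorings_def)
  finally show ?thesis using s by (simp add: arrays_def shape_def colorings_def)
qed

lemma sorted_eq_row_word: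
  assumes "sorted t" "set t \<subseteq> {0..n}"
  shows "t = row_word (shape n t)"
proof -
  let ?r = "row_word (shape n t)"
  have len: "length (shape n t) = n + 1" by (simp add: shape_def)
  have "count_list ?r x = count_list t x" for x
  proof (cases "x \<le> n")
    case True
    then show ?thesis using count_row_from[of x "shape n t" 0] by (simp add: len) (simp add: shape_def del: upt_Suc)
  next
    case False
    then have "x \<notin> set t" "x \<notin> set ?r" using assms(2) set_row_from[of 0 "shape n t"] len by auto
    then show ?thesis by simp
  qed
  then have "mset ?r = mset t" by (intro multiset_eqI) (simp add: count_mset)
  then have "sort t = ?r" by (rule properties_for_sort) (rule sorted_row_from)
  then show ?thesis using assms(1) by (simp add: sort_key_id_if_sorted)
qed

lemma row_split:
  assumes "ms \<in> arrays n m" "i \<in> {1..n}"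
  obtains xs ys where "ms = xs @ ms ! (i - 1) # ms ! i # ys" "length xs = i - 1"
proof
  have l: "length ms = n + 1" using assms by (simp add: arrays_def)
  show "ms = take (i - 1) ms @ ms ! (i - 1) # ms ! i # drop (Suc i) ms"
    using assms(2) l id_take_nth_drop[of "i - 1" ms] Cons_nth_drop_Suc[of i ms] by auto
  show "length (take (i - 1) ms) = i - 1" using assms(2) l by auto
qed

lemma move_arrays:
  "ms \<in> arrays n m \<Longrightarrow> p \<le> n \<Longrightarrow> q \<le> n \<Longrightarrow> p \<noteq> q \<Longrightarrow> 0 < ms ! q \<Longrightarrow> move p q ms \<in> arrays n m"
  by (simp add: arrays_def sum_list_move)

text \<open>In the reversed row the box changed by \<open>e_i\<close> or \<open>f_i\<close> lies at
  the border between the run of \<open>i\<close> and the run of \<open>i - 1\<close>. The operators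
  only shift this border, so row tableaux stay row tableaux and two multiplicities change by
  one.\<close>

lemma row_crystal:
  assumes m: "0 < m"
  shows "seminormal n (row_crystal n m)"
    and "elts (row_crystal n m) = row_word ` arrays n m"
    and "ms \<in> arrays n m \<Longrightarrow> wt (row_crystal n m) (row_word ms) = (\<lambda>p. \<Sum>i\<le>n. int (ms ! i) * epsilon (i + 1) p)"
    and "ms \<in> arrays n m \<Longrightarrow> i \<in> {1..n} \<Longrightarrow> sig i (row_crystal n m) (row_word ms) = (ms ! i, ms ! (i - 1))"
    and "ms \<in> arrays n m \<Longrightarrow> i \<in> {1..n} \<Longrightarrow> ecr (row_crystal n m) i (row_word ms) =
      (if ms ! i = 0 then None else Some (row_word (move (i - 1) i ms)))"
    and "ms \<in> arrays n m \<Longrightarrow> i \<in> {1..n} \<Longrightarrow> fcr (row_crystal n m) i (row_word ms) =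
      (if ms ! (i - 1) = 0 then None else Some (row_word (move i (i - 1) ms)))"
proof -
  let ?Bs = "replicate m (box_crystal n)"
  let ?W = "crystal_tensor_list ?Bs"
  let ?S = "{t. length t = m \<and> sorted t \<and> set t \<subseteq> {0..n}}"
  have Bs: "?Bs \<noteq> []" "\<forall>B\<in>set ?Bs. seminormal n B" using m seminormal_box by auto
  note W = crystal_tensor_list[OF Bs]
  interpret W: seminormal n ?W by (rule W(1))
  have map2: "map2 g ?Bs w = map (g (box_crystal n)) w" if "length w = m" for g :: "nat crystal \<Rightarrow> nat \<Rightarrow> 'z" and w
    using that by (simp add: zip_replicate1 o_def)
  have W2: "elts ?W = listset (map elts ?Bs)" by (rule crystal_tensor_list(2)[OF Bs])
  have elb: "elts (box_crystal n) = {0..n}" by (simp add: box_crystal_def)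
  have elW: "w \<in> elts ?W \<longleftrightarrow> length w = m \<and> set w \<subseteq> {0..n}" for w
  proof -
    have "w \<in> elts ?W \<longleftrightarrow> length w = m \<and> (\<forall>j<m. w ! j \<in> {0..n})"
      unfolding W2 by (simp add: in_listset_iff elb cong: conj_cong)
    then show ?thesis by (auto simp: set_conv_nth)
  qed
  have S: "?S = row_word ` arrays n m"
  proof (intro equalityI subsetI)
    fix t assume t: "t \<in> ?S"
    then have "t = row_word (shape n t)" by (intro sorted_eq_row_word) auto
    moreover have "shape n t \<in> arrays n m" using t by (intro shape_arrays) (auto simp: colorings_def)
    ultimately show "t \<in> row_word ` arrays n m" by blast
  next
    fix t assume "t \<in> row_word ` arrays n m"
    then obtain ms where "length ms = n + 1" "sum_list ms = m" "t = row_word ms" by (auto simp: arrays_def)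
    then show "t \<in> ?S" using row_coloring[of ms n] sorted_row_from[of 0 ms] by (auto simp: colorings_def)
  qed
  have inS: "row_word ms \<in> ?S" if "ms \<in> arrays n m" for ms using that S by blast
  have revW: "rev (row_word ms) \<in> elts ?W" if "ms \<in> arrays n m" for ms
    using inS[OF that] unfolding elW by simp
  have inj: "inj_on rev ?S" by (auto simp: inj_on_def)
  have inv: "the_inv_into ?S rev (rev (row_word ms)) = row_word ms" if "ms \<in> arrays n m" for ms
    by (rule the_inv_into_f_f[OF inj inS[OF that]])
  have vals: "eps ?W i (rev (row_word ms)) = Fin (int (ms ! i)) \<and>
      phi ?W i (rev (row_word ms)) = Fin (int (ms ! (i - 1))) \<and>
      ecr ?W i (rev (row_word ms)) = (if ms ! i = 0 then None else Some (rev (row_word (move (i - 1) i ms)))) \<and>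
      fcr ?W i (rev (row_word ms)) = (if ms ! (i - 1) = 0 then None else Some (rev (row_word (move i (i - 1) ms))))"
    if ms: "ms \<in> arrays n m" and i: "i \<in> {1..n}" for ms i
  proof -
    obtain xs ys where eq: "ms = xs @ ms ! (i - 1) # ms ! i # ys" and lx: "length xs = i - 1"
      by (rule row_split[OF ms i])
    define a b where "a = ms ! i" and "b = ms ! (i - 1)"
    have i0: "0 < i" "Suc (i - 1) = i" using i by auto
    let ?hi = "rev (row_from (Suc i) ys)" and ?lo = "rev (row_word xs)"
    have word: "rev (row_word (xs @ b' # a' # ys)) = ?hi @ replicate a' i @ replicate b' (i - 1) @ ?lo" for a' b'
      using i0 by (simp add: row_from_append lx)
    let ?w = "rev (row_word ms)"
    have w: "?w = ?hi @ replicate a i @ replicate b (i - 1) @ ?lo"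
      using word[of b a] eq by (simp add: a_def b_def)
    have hi: "\<forall>x\<in>set ?hi. x \<noteq> i \<and> x + 1 \<noteq> i" using set_row_from[of "Suc i" ys] by auto
    have lo: "\<forall>x\<in>set ?lo. x \<noteq> i \<and> x + 1 \<noteq> i" using set_row_from[of 0 xs] lx i by fastforce
    note sg = word_sig[OF hi lo i0(1), of a b, folded w]
    have lw: "length ?w = m" using revW[OF ms] elW by blast
    note val = W(4)[OF revW[OF ms, unfolded W(2)] i, unfolded map2[OF lw] sig_box sg]
    have mv: "move (i - 1) i ms = xs @ Suc b # (a - 1) # ys" "move i (i - 1) ms = xs @ (b - 1) # Suc a # ys"
      by (subst eq, use lx i0 in \<open>simp add: move_def list_update_append nth_append a_def b_def\<close>)+
    have e: "?w[length ?hi + a - 1 := the (ecr (?Bs ! (length ?hi + a - 1)) i (?w ! (length ?hi + a - 1)))] =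
        rev (row_word (move (i - 1) i ms))" if a: "a \<noteq> 0"
    proof -
      obtain a' where a': "a = Suc a'" using a by (cases a) auto
      have rep: "replicate (Suc a') i = replicate a' i @ [i]" by (simp add: replicate_append_same)
      have j: "length ?hi + a - 1 < m" using lw[unfolded w] a' by simp
      have nth: "?w ! (length ?hi + a - 1) = i" unfolding w a' rep by (simp add: nth_append)
      have "the (ecr (?Bs ! (length ?hi + a - 1)) i i) = i - 1" using j by (simp add: box_crystal_def)
      then show ?thesis
        unfolding nth mv word unfolding w a' rep by (simp add: list_update_append)
    qed
    have f: "?w[length ?hi + a := the (fcr (?Bs ! (length ?hi + a)) i (?w ! (length ?hi + a)))] =
        rev (row_word (move i (i - 1) ms))" if b: "b \<noteq> 0"
    proof -
      obtain b' where b': "b = Suc b'" using b by (cases b) auto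
      have rep: "replicate (Suc a) i = replicate a i @ [i]" by (simp add: replicate_append_same)
      have j: "length ?hi + a < m" using lw[unfolded w] b' by simp
      have nth: "?w ! (length ?hi + a) = i - 1" unfolding w b' by (simp add: nth_append)
      have "the (fcr (?Bs ! (length ?hi + a)) i (i - 1)) = i" using j by (simp add: box_crystal_def)
      then show ?thesis
        unfolding nth mv word rep unfolding w b' by (simp add: list_update_append)
    qed
    show ?thesis using val e f by (simp add: a_def b_def)
  qed
  have R: "row_crystal n m = induced_crystal ?S rev ?W" by (simp add: row_crystal_def)
  have mv_in: "move (i - 1) i ms \<in> arrays n m" if "ms \<in> arrays n m" "i \<in> {1..n}" "ms ! i \<noteq> 0" for ms i
    using that by (intro move_arrays) auto
  have mv_in': "move i (i - 1) ms \<in> arrays n m" if "ms \<in> arrays n m" "i \<in> {1..n}" "ms ! (i - 1) \<noteq> 0" for ms i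
    using that by (intro move_arrays) auto
  show sem: "seminormal n (row_crystal n m)"
    unfolding R
  proof (rule seminormal_induced[OF W.seminormal_axioms inj])
    show "rev ` ?S \<subseteq> elts ?W" using elW by auto
    fix i s b assume i: "i \<in> {1..n}" and "s \<in> ?S"
    then obtain ms where ms: "ms \<in> arrays n m" "s = row_word ms" unfolding S by blast
    show "b \<in> rev ` ?S" if "ecr ?W i (rev s) = Some b"
      using that vals[OF ms(1) i] inS[OF mv_in[OF ms(1) i]] ms by (auto split: if_splits)
    show "b \<in> rev ` ?S" if "fcr ?W i (rev s) = Some b"
      using that vals[OF ms(1) i] inS[OF mv_in'[OF ms(1) i]] ms by (auto split: if_splits)
  qed
  show "elts (row_crystal n m) = row_word ` arrays n m" unfolding R induced_values S ..
  assume ms: "ms \<in> arrays n m"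
  let ?w = "rev (row_word ms)"
  have lw: "length ?w = m" using revW[OF ms] elW by blast
  have "wt (row_crystal n m) (row_word ms) = sum_list (map (\<lambda>j. epsilon (j + 1)) ?w)"
    using W(3)[OF revW[OF ms, unfolded W(2)]] unfolding map2[OF lw] by (simp add: R induced_values box_crystal_def)
  also have "\<dots> = (\<lambda>p. \<Sum>i\<le>n. int (ms ! i) * epsilon (i + 1) p)"
  proof
    fix p
    have "(sum_list (map (\<lambda>j. epsilon (j + 1)) w)) p = sum_list (map (\<lambda>j. epsilon (j + 1) p) w)" for w
      by (induction w) auto
    then have "(sum_list (map (\<lambda>j. epsilon (j + 1)) ?w)) p = sum_list (map (\<lambda>j. epsilon (j + 1) p) (row_word ms))"
      by (simp add: rev_map[symmetric])
    also have "\<dots> = (\<Sum>i<length ms. int (ms ! i) * epsilon (i + 1) p)"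
      unfolding sum_list_row_from by simp
    finally show "(sum_list (map (\<lambda>j. epsilon (j + 1)) ?w)) p = (\<Sum>i\<le>n. int (ms ! i) * epsilon (i + 1) p)"
      using ms by (simp add: arrays_def lessThan_Suc_atMost)
  qed
  finally show "wt (row_crystal n m) (row_word ms) = (\<lambda>p. \<Sum>i\<le>n. int (ms ! i) * epsilon (i + 1) p)" .
  assume i: "i \<in> {1..n}"
  note v = vals[OF ms i]
  show "sig i (row_crystal n m) (row_word ms) = (ms ! i, ms ! (i - 1))"
    using v by (simp add: sig_def R induced_values)
  show "ecr (row_crystal n m) i (row_word ms) = (if ms ! i = 0 then None else Some (row_word (move (i - 1) i ms)))"
    using v inv[OF mv_in[OF ms i]] by (simp add: R induced_values)
  show "fcr (row_crystal n m) i (row_word ms) = (if ms ! (i - 1) = 0 then None else Some (row_word (move i (i - 1) ms)))"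
    using v inv[OF mv_in'[OF ms i]] by (simp add: R induced_values)
qed

section \<open>Cancellation of signs\<close>

fun red :: "(sign \<times> nat) list \<Rightarrow> (sign \<times> nat) list" where
  "red [] = []"
| "red ((Minus, a) # xs) = (Minus, a) # red xs"
| "red ((Plus, a) # xs) = (case red xs of (Minus, b) # ys \<Rightarrow> ys | ys \<Rightarrow> (Plus, a) # ys)"

definition normal :: "(sign \<times> nat) list \<Rightarrow> bool" where
  "normal r \<longleftrightarrow> (\<exists>xs ys. r = xs @ ys \<and> (\<forall>x\<in>set xs. fst x = Minus) \<and> (\<forall>y\<in>set ys. fst y = Plus))"

lemma normal_simps:
  "normal []" "normal ((Minus, a) # r) \<longleftrightarrow> normal r" "normal ((Plus, a) # r) \<longleftrightarrow> (\<forall>y\<in>set r. fst y = Plus)"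
proof -
  show "normal []" by (auto simp: normal_def)
  show "normal ((Minus, a) # r) \<longleftrightarrow> normal r"
  proof
    assume "normal ((Minus, a) # r)"
    then obtain xs ys where h: "(Minus, a) # r = xs @ ys" "\<forall>x\<in>set xs. fst x = Minus" "\<forall>y\<in>set ys. fst y = Plus"
      by (auto simp: normal_def)
    then obtain xs' where "xs = (Minus, a) # xs'" by (cases xs) auto
    then show "normal r" using h unfolding normal_def by auto
  next
    assume "normal r"
    then obtain xs ys where "r = xs @ ys" "\<forall>x\<in>set xs. fst x = Minus" "\<forall>y\<in>set ys. fst y = Plus"
      by (auto simp: normal_def)
    then show "normal ((Minus, a) # r)" unfolding normal_def by (intro exI[of _ "(Minus, a) # xs"] exI[of _ ys]) auto
  qed
  show "normal ((Plus, a) # r) \<longleftrightarrow> (\<forall>y\<in>set r. fst y = Plus)"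
  proof
    assume "normal ((Plus, a) # r)"
    then obtain xs ys where h: "(Plus, a) # r = xs @ ys" "\<forall>x\<in>set xs. fst x = Minus" "\<forall>y\<in>set ys. fst y = Plus"
      by (auto simp: normal_def)
    then have "xs = []" by (cases xs) auto
    then show "\<forall>y\<in>set r. fst y = Plus" using h by auto
  next
    assume "\<forall>y\<in>set r. fst y = Plus"
    then show "normal ((Plus, a) # r)" unfolding normal_def
      by (intro exI[of _ "[]"] exI[of _ "(Plus, a) # r"]) auto
  qed
qed

lemma normal_red: "normal (red s)"
  by (induction s rule: red.induct)
    (fastforce simp: normal_simps split: list.splits prod.splits sign.splits)+

lemma red_normal: "normal r \<Longrightarrow> red r = r"
proof (induction r rule: red.induct)
  case (3 a xs)
  then have p: "\<forall>y\<in>set xs. fst y = Plus" by (simp add: normal_simps)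
  then have "normal xs" unfolding normal_def by (intro exI[of _ "[]", OF exI[of _ xs]]) simp
  then have r: "red xs = xs" by (rule 3)
  show ?case
  proof (cases xs)
    case (Cons y ys)
    then obtain b where "y = (Plus, b)" using p by (cases y) auto
    then show ?thesis using r Cons by simp
  qed simp
qed (auto simp: normal_simps)

lemma red_append_cong: "red ys = red zs \<Longrightarrow> red (xs @ ys) = red (xs @ zs)"
  by (induction xs rule: red.induct) auto

text \<open>Invariance of \<open>red\<close> under a single deletion takes the place of a confluence
  argument: the order of deletions cannot influence the final sequence.\<close>

lemma red_delete: "delete_pair s r \<Longrightarrow> red s = red r"
proof (induction rule: delete_pair.induct)
  case (1 xs a b ys)
  show ?case by (rule red_append_cong) simp
qed

lemma delete_pair_Cons: "delete_pair s r \<Longrightarrow> delete_pair (x # s) (x # r)"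
proof (induction rule: delete_pair.induct)
  case (1 xs a b ys)
  show ?case using delete_pair.intros[of "x # xs" a b ys] by simp
qed

lemma delete_pairs_Cons: "delete_pair\<^sup>*\<^sup>* s r \<Longrightarrow> delete_pair\<^sup>*\<^sup>* (x # s) (x # r)"
  by (induction rule: rtranclp_induct) (auto intro: rtranclp.rtrancl_into_rtrancl delete_pair_Cons)

lemma delete_pairs_red: "delete_pair\<^sup>*\<^sup>* s (red s)"
proof (induction s rule: red.induct)
  case (2 a xs)
  then show ?case by (simp add: delete_pairs_Cons)
next
  case (3 a xs)
  show ?case
  proof (cases "\<exists>b ys. red xs = (Minus, b) # ys")
    case True
    then obtain b ys where r: "red xs = (Minus, b) # ys" by blast
    have "delete_pair\<^sup>*\<^sup>* ((Plus, a) # xs) ((Plus, a) # (Minus, b) # ys)"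
      using delete_pairs_Cons[OF 3, of "(Plus, a)"] r by simp
    moreover have "delete_pair ((Plus, a) # (Minus, b) # ys) ys"
      using delete_pair.intros[of "[]" a b ys] by simp
    ultimately show ?thesis using r by (simp add: rtranclp.rtrancl_into_rtrancl)
  next
    case False
    then have "red ((Plus, a) # xs) = (Plus, a) # red xs"
      by (auto split: list.splits prod.splits sign.splits)
    then show ?thesis using delete_pairs_Cons[OF 3, of "(Plus, a)"] by simp
  qed
qed simp

text \<open>Deletions lead from \<open>s\<close> to \<open>red s\<close>, which has the required
  form. Any other sequence of that form reached by deletions has the same value of
  \<open>red\<close> and is fixed by \<open>red\<close>, so the description in
  \<open>reduced_seq\<close> is unique.\<close>

lemma reduced_seq_eq: "reduced_seq s = red s"
  unfolding reduced_seq_def normal_def[symmetric]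
proof (rule the_equality)
  show "delete_pair\<^sup>*\<^sup>* s (red s) \<and> normal (red s)" using delete_pairs_red normal_red by blast
  fix r assume r: "delete_pair\<^sup>*\<^sup>* s r \<and> normal r"
  then have "delete_pair\<^sup>*\<^sup>* s r" by blast
  then have "red s = red r" by (induction rule: rtranclp_induct) (auto simp: red_delete)
  then show "r = red s" using red_normal r by simp
qed

text \<open>A recursive form of \<open>sign_seq\<close> with the component counter as an argument,
  so that it follows the recursion of \<open>leps\<close>, \<open>epos\<close> and
  \<open>fpos\<close>.\<close>

fun labelled :: "nat \<Rightarrow> (nat \<times> nat) list \<Rightarrow> (sign \<times> nat) list" where
  "labelled k [] = []"
| "labelled k ((p, q) # \<sigma>) = replicate p (Minus, k) @ replicate q (Plus, k) @ labelled (Suc k) \<sigma>"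

lemma sign_seq_labelled: "sign_seq i L = labelled 0 (map (\<lambda>ms. (ms ! i, ms ! (i - 1))) L)"
proof -
  have "concat (map (\<lambda>j. replicate (L ! (j - k) ! i) (Minus, j) @ replicate (L ! (j - k) ! (i - 1)) (Plus, j)) [k..<k + length L]) =
      labelled k (map (\<lambda>ms. (ms ! i, ms ! (i - 1))) L)" for k
  proof (induction L arbitrary: k)
    case (Cons ms L)
    have u: "[k..<k + length (ms # L)] = k # [Suc k..<Suc k + length L]" by (simp add: upt_conv_Cons del: upt_Suc)
    have m: "map (\<lambda>j. replicate ((ms # L) ! (j - k) ! i) (Minus, j) @ replicate ((ms # L) ! (j - k) ! (i - 1)) (Plus, j)) [Suc k..<Suc k + length L] =
        map (\<lambda>j. replicate (L ! (j - Suc k) ! i) (Minus, j) @ replicate (L ! (j - Suc k) ! (i - 1)) (Plus, j)) [Suc k..<Suc k + length L]"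
      by (rule map_cong) (auto simp: nth_Cons')
    show ?case unfolding u list.map(2) m concat.simps Cons.IH[of "Suc k"] by simp
  qed simp
  from this[of 0] show ?thesis by (simp add: sign_seq_def)
qed

text \<open>Plus signs put in front consume the minus signs of the reduced tail from the left, so
  the rightmost \<open>-\<close> survives as long as any does. Surplus plus signs stay and supply
  the new leftmost \<open>+\<close>.\<close>

lemma red_plus:
  assumes "red xs = ms @ ps" "\<forall>x\<in>set ms. fst x = Minus" "\<forall>x\<in>set ps. fst x = Plus"
  shows "red (replicate q (Plus, k) @ xs) = drop q ms @ replicate (q - length ms) (Plus, k) @ ps"
proof (induction q)
  case (Suc q)
  show ?case
  proof (cases "q < length ms")
    case True
    then have d: "drop q ms = ms ! q # drop (Suc q) ms" by (simp add: Cons_nth_drop_Suc)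
    have "fst (ms ! q) = Minus" using assms True by auto
    then obtain b where "ms ! q = (Minus, b)" by (cases "ms ! q") auto
    then show ?thesis using Suc True d by simp
  next
    case False
    have "replicate (q - length ms) (Plus, k) @ ps = [] \<or>
        (\<exists>b ys. replicate (q - length ms) (Plus, k) @ ps = (Plus, b) # ys)"
    proof (cases "replicate (q - length ms) (Plus, k) @ ps")
      case (Cons x ys)
      have "x \<in> set (replicate (q - length ms) (Plus, k) @ ps)" unfolding Cons by simp
      then have "fst x = Plus" using assms(3) by auto
      then show ?thesis using Cons by (cases x) auto
    qed simp
    then show ?thesis using Suc False by (auto simp: Suc_diff_le)
  qed
qed (simp add: assms)

text \<open>Adding a component in front changes the remaining signs by the same recursion that
  defines \<open>leps\<close>, \<open>epos\<close> and \<open>fpos\<close>. This is the agreement of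
  the signature rule with the tensor product rule.\<close>

lemma red_labelled:
  "\<exists>ms ps. red (labelled k \<sigma>) = ms @ ps \<and> (\<forall>x\<in>set ms. fst x = Minus) \<and> (\<forall>x\<in>set ps. fst x = Plus) \<and>
    length ms = leps \<sigma> \<and>
    map_option ((+) k) (epos \<sigma>) = (if ms = [] then None else Some (snd (last ms))) \<and>
    map_option ((+) k) (fpos \<sigma>) = (if ps = [] then None else Some (snd (hd ps)))"
proof (induction k \<sigma> rule: labelled.induct)
  case (2 k p q \<sigma>)
  then obtain ms ps where IH: "red (labelled (Suc k) \<sigma>) = ms @ ps" "\<forall>x\<in>set ms. fst x = Minus"
    "\<forall>x\<in>set ps. fst x = Plus" "length ms = leps \<sigma>"
    "map_option ((+) (Suc k)) (epos \<sigma>) = (if ms = [] then None else Some (snd (last ms)))"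
    "map_option ((+) (Suc k)) (fpos \<sigma>) = (if ps = [] then None else Some (snd (hd ps)))" by blast
  have rm: "red (replicate p (Minus, k) @ xs) = replicate p (Minus, k) @ red xs" for xs by (induction p) auto
  have shift: "map_option ((+) k) (map_option Suc x) = map_option ((+) (Suc k)) x" for x
    by (cases x) auto
  have "red (labelled k ((p, q) # \<sigma>)) =
      (replicate p (Minus, k) @ drop q ms) @ (replicate (q - length ms) (Plus, k) @ ps)"
    by (simp add: rm red_plus[OF IH(1-3)])
  moreover have "\<forall>x\<in>set (replicate p (Minus, k) @ drop q ms). fst x = Minus"
    using IH(2) by (auto dest: in_set_dropD)
  moreover have "\<forall>x\<in>set (replicate (q - length ms) (Plus, k) @ ps). fst x = Plus" using IH(3) by auto
  moreover have "length (replicate p (Minus, k) @ drop q ms) = leps ((p, q) # \<sigma>)" using IH(4) by simp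
  moreover have "map_option ((+) k) (epos ((p, q) # \<sigma>)) = (if replicate p (Minus, k) @ drop q ms = [] then None
      else Some (snd (last (replicate p (Minus, k) @ drop q ms))))"
  proof (cases "leps \<sigma> \<le> q")
    case True
    then show ?thesis using IH(4) by (auto simp: last_replicate)
  next
    case False
    then have "drop q ms \<noteq> []" "last (drop q ms) = last ms" "ms \<noteq> []" using IH(4) by auto
    then show ?thesis using False IH(5) by (simp add: shift)
  qed
  moreover have "map_option ((+) k) (fpos ((p, q) # \<sigma>)) = (if replicate (q - length ms) (Plus, k) @ ps = [] then None
      else Some (snd (hd (replicate (q - length ms) (Plus, k) @ ps))))"
  proof (cases "leps \<sigma> < q")
    case True
    then show ?thesis using IH(4) by (auto simp: hd_append)
  next
    case False
    then show ?thesis using IH(4,6) by (simp add: shift)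
  qed
  ultimately show ?case by blast
qed simp

lemma reduced_sign_seq:
  fixes i L
  defines "\<sigma> \<equiv> map (\<lambda>ms. (ms ! i, ms ! (i - 1))) L"
    and "Ms \<equiv> filter (\<lambda>x. fst x = Minus) (reduced_seq (sign_seq i L))"
    and "Ps \<equiv> filter (\<lambda>x. fst x = Plus) (reduced_seq (sign_seq i L))"
  shows "epos \<sigma> = (if Ms = [] then None else Some (snd (last Ms)))"
    and "fpos \<sigma> = (if Ps = [] then None else Some (snd (hd Ps)))"
proof -
  obtain ms ps where r: "red (labelled 0 \<sigma>) = ms @ ps" "\<forall>x\<in>set ms. fst x = Minus"
    "\<forall>x\<in>set ps. fst x = Plus"
    "map_option ((+) 0) (epos \<sigma>) = (if ms = [] then None else Some (snd (last ms)))"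
    "map_option ((+) 0) (fpos \<sigma>) = (if ps = [] then None else Some (snd (hd ps)))"
    using red_labelled[of 0 \<sigma>] by blast
  have "filter (\<lambda>x. fst x = Minus) ms = ms" "filter (\<lambda>x. fst x = Plus) ps = ps"
    using r(2,3) by simp_all
  moreover have "filter (\<lambda>x. fst x = Plus) ms = []" "filter (\<lambda>x. fst x = Minus) ps = []"
    using r(2,3) by (auto simp: filter_empty_conv)
  ultimately have "Ms = ms" "Ps = ps"
    unfolding Ms_def Ps_def reduced_seq_eq sign_seq_labelled \<sigma>_def[symmetric] r(1) by simp_all
  then show "epos \<sigma> = (if Ms = [] then None else Some (snd (last Ms)))"
    "fpos \<sigma> = (if Ps = [] then None else Some (snd (hd Ps)))"
    using r(4,5) by (simp_all add: map_option_plus)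
qed

section \<open>The crystal of isomorphism classes\<close>

text \<open>\<open>crystal_iso\<close> sees the operators of \<open>B\<close> only through
  \<open>h\<close>, which is injective only on \<open>elts B\<close>. Closure of
  \<open>elts B\<close> under the operators is therefore a hypothesis of its own.\<close>

lemma gl_crystal_transfer:
  assumes C: "gl_crystal n C" and iso: "crystal_iso n B C h"
    and e_in: "\<And>i b. i \<in> {1..n} \<Longrightarrow> b \<in> elts B \<Longrightarrow> set_option (ecr B i b) \<subseteq> elts B"
    and f_in: "\<And>i b. i \<in> {1..n} \<Longrightarrow> b \<in> elts B \<Longrightarrow> set_option (fcr B i b) \<subseteq> elts B"
  shows "gl_crystal n B"
proof -
  interpret C: gl_crystal n C by fact
  have inj: "h b = h b' \<longleftrightarrow> b = b'" if "b \<in> elts B" "b' \<in> elts B" for b b'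
    using iso that by (auto simp: crystal_iso_def bij_betw_def inj_on_eq_iff)
  have hC: "h b \<in> elts C" if "b \<in> elts B" for b
    using iso that by (auto simp: crystal_iso_def bij_betw_def)
  have wt: "wt C (h b) = wt B b" if "b \<in> elts B" for b
    using iso that by (simp add: crystal_iso_def)
  have v: "eps C i (h b) = eps B i b" "phi C i (h b) = phi B i b"
    "ecr C i (h b) = map_option h (ecr B i b)" "fcr C i (h b) = map_option h (fcr B i b)"
    if "i \<in> {1..n}" "b \<in> elts B" for i b
    using iso that unfolding crystal_iso_def by blast+
  show ?thesis
  proof
    fix b assume "b \<in> elts B"
    then show "wt B b \<in> weight_lattice n" using C.wt_lattice[OF hC] wt by metis
  next
    fix i b assume i: "i \<in> {1..n}" and b: "b \<in> elts B"
    note V = v[OF i b] and W = wt[OF b] and H = hC[OF b]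
    show "eps B i b \<noteq> Pinf" "phi B i b \<noteq> Pinf" using C.eps_range[OF i H] C.phi_range[OF i H] V by auto
    show "set_option (ecr B i b) \<subseteq> elts B" "set_option (fcr B i b) \<subseteq> elts B"
      using e_in[OF i b] f_in[OF i b] .
    show "phi B i b = eps B i b + Fin (coroot_val i (wt B b))" using C.phi_eq[OF i H] V W by simp
    show "ecr B i b = None \<and> fcr B i b = None" if "eps B i b = Minf"
      using C.eps_Minf[OF i H] that V by simp
    fix b'
    show "wt B b' = wt B b + epsilon i - epsilon (i + 1)" if e: "ecr B i b = Some b'"
    proof -
      have "b' \<in> elts B" using e_in[OF i b] e by simp
      then show ?thesis using C.wt_e[OF i H, of "h b'"] V e W wt[of b'] by simp
    qed
    show "wt B b' = wt B b - epsilon i + epsilon (i + 1)" if f: "fcr B i b = Some b'"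
    proof -
      have "b' \<in> elts B" using f_in[OF i b] f by simp
      then show ?thesis using C.wt_f[OF i H, of "h b'"] V f W wt[of b'] by simp
    qed
  next
    fix i b1 b2 assume i: "i \<in> {1..n}" and b: "b1 \<in> elts B" "b2 \<in> elts B"
    have "fcr B i b2 = Some b1 \<longleftrightarrow> fcr C i (h b2) = Some (h b1)"
      unfolding v(4)[OF i b(2)] using f_in[OF i b(2)] inj b by (cases "fcr B i b2") auto
    also have "\<dots> \<longleftrightarrow> ecr C i (h b1) = Some (h b2)" by (rule C.f_iff_e[OF i hC[OF b(1)] hC[OF b(2)]])
    also have "\<dots> \<longleftrightarrow> ecr B i b1 = Some b2"
      unfolding v(3)[OF i b(1)] using e_in[OF i b(1)] inj b by (cases "ecr B i b1") auto
    finally show "fcr B i b2 = Some b1 \<longleftrightarrow> ecr B i b1 = Some b2" .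
  qed
qed

locale composition =
  fixes n :: nat and lam :: "nat list"
  assumes lam_ne: "lam \<noteq> []" and lam_pos: "\<forall>a\<in>set lam. a > 0"
begin

lemma pos: "j < length lam \<Longrightarrow> 0 < lam ! j"
  using lam_pos by simp

sublocale I: block_algebras "map (CP n) lam" "map (colorings n) lam" "shape n" coefP
  by (rule block_algebras.intro) (simp_all add: CP_block pos)

definition parameters :: "nat list list set" where
  "parameters = {L. length L = length lam \<and> (\<forall>j<length lam. L ! j \<in> arrays n (lam ! j))}"

definition cls :: "nat list list \<Rightarrow> mod_class" where
  "cls L = {N. I.T.of_type (map row_word L) N}"

lemma parametersD: "L \<in> parameters \<Longrightarrow> length L = length lam" "L \<in> parameters \<Longrightarrow> j < length lam \<Longrightarrow> L ! j \<in> arrays n (lam ! j)"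
  by (auto simp: parameters_def)

lemma row_word_in: "ms \<in> arrays n m \<Longrightarrow> row_word ms \<in> colorings n m"
  using row_coloring by (auto simp: arrays_def)

lemma row_words: "L \<in> parameters \<Longrightarrow> map row_word L \<in> I.XX"
  unfolding I.XX_iff using parametersD row_word_in by auto

lemma shape_row_words: "L \<in> parameters \<Longrightarrow> map (shape n) (map row_word L) = L"
  by (rule nth_equalityI) (use parametersD in \<open>auto simp: shape_row arrays_def\<close>)

text \<open>The class of an outer tensor product depends only on the types of its factors, so the
  modules \<open>Wmod\<close>, their copies and the images under the functors may be mixed
  freely.\<close>

lemma iso_class_outer:
  assumes L: "L \<in> parameters" and len: "length Ms = length lam"
    and ty: "\<And>j. j < length lam \<Longrightarrow>
      block_algebra.of_type (CP n (lam ! j)) (colorings n (lam ! j)) coefP (row_word (L ! j)) (Ms ! j)"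
  shows "iso_class (CP_comp n lam) (outer_tensor Ms) = cls L"
proof -
  have "I.T.of_type (map row_word L) (outer_tensor Ms)"
    by (rule I.outer_tensor_of_type) (use len row_words[OF L] ty parametersD(1)[OF L] in simp_all)
  from I.T.iso_class_of_type[OF this row_words[OF L]] show ?thesis
    by (simp add: cls_def CP_comp_def)
qed

lemma Wmod_type:
  assumes "L \<in> parameters" "j < length lam"
  shows "block_algebra.of_type (CP n (lam ! j)) (colorings n (lam ! j)) coefP (row_word (L ! j)) (Wmod n (L ! j))"
  using parametersD(2)[OF assms] pos[OF assms(2)] by (intro Wmod_of_type) (auto simp: arrays_def)

lemma iso_class_Wmod: "L \<in> parameters \<Longrightarrow> iso_class (CP_comp n lam) (outer_tensor (map (Wmod n) L)) = cls L"
  by (rule iso_class_outer) (use parametersD Wmod_type in auto)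

text \<open>By \<open>of_type_copy\<close> the class is inhabited within its vector type. A member
  of both classes has both types, and the shapes of these recover \<open>L\<close> and
  \<open>L'\<close>.\<close>

lemma cls_inj:
  assumes "L \<in> parameters" "L' \<in> parameters" "cls L = cls L'"
  shows "L = L'"
proof -
  have "I.T.of_type (map row_word L) (outer_tensor (map (Wmod n) L))"
    by (rule I.outer_tensor_of_type) (use row_words Wmod_type parametersD assms in auto)
  then obtain N :: "((pvec list \<Rightarrow> complex) set, nat \<Rightarrow> complex) alg_module" where "I.T.of_type (map row_word L) N"
    using I.T.of_type_copy row_words assms by blast
  moreover from this have "I.T.of_type (map row_word L') N" using assms(3) by (auto simp: cls_def)
  ultimately have "map (shape n) (map row_word L) = map (shape n) (map row_word L')"
    using I.T.of_type_unique row_words assms by blast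
  then show ?thesis unfolding shape_row_words[OF assms(1)] shape_row_words[OF assms(2)] .
qed

text \<open>An irreducible module has some type \<open>ss\<close>, and each entry of
  \<open>ss\<close> may be replaced by the sorted tuple of the same shape, the
  \<open>row_word\<close> of its multiplicities.\<close>

lemma irr_classes_eq: "irr_classes (CP_comp n lam) = cls ` parameters"
proof (intro equalityI subsetI)
  fix X assume "X \<in> irr_classes (CP_comp n lam)"
  then obtain M :: "((pvec list \<Rightarrow> complex) set, nat \<Rightarrow> complex) alg_module" where
    M: "irreducible_module I.T M" "X = iso_class I.T M"
    by (auto simp: irr_classes_def CP_comp_def)
  obtain ss where ss: "ss \<in> I.XX" "I.T.of_type ss M" using I.T.irreducible_of_type[OF M(1)] by blast
  have L: "map (shape n) ss \<in> parameters"
    using ss(1) shape_arrays by (auto simp: parameters_def I.XX_iff)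
  have "I.T.of_type (map row_word (map (shape n) ss)) M"
    by (rule I.T.of_type_sh[OF ss(2,1) row_words[OF L]]) (simp only: shape_row_words[OF L])
  then have "X = cls (map (shape n) ss)"
    unfolding M(2) cls_def by (rule I.T.iso_class_of_type[OF _ row_words[OF L]])
  then show "X \<in> cls ` parameters" using L by blast
next
  fix X assume "X \<in> cls ` parameters"
  then obtain L where L: "L \<in> parameters" "X = cls L" by blast
  have "I.T.of_type (map row_word L) (outer_tensor (map (Wmod n) L))"
    by (rule I.outer_tensor_of_type) (use row_words Wmod_type parametersD L in auto)
  then obtain N :: "((pvec list \<Rightarrow> complex) set, nat \<Rightarrow> complex) alg_module" where
    N: "I.T.of_type (map row_word L) N"
    using I.T.of_type_copy row_words L by blast
  have "X = iso_class I.T N"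
    using I.T.iso_class_of_type[OF N row_words[OF L(1)]] L(2) by (simp add: cls_def)
  then show "X \<in> irr_classes (CP_comp n lam)"
    using I.T.of_type_irreducible[OF N row_words[OF L(1)]] I.T.of_type_fin_dim[OF N row_words[OF L(1)]]
    by (auto simp: irr_classes_def CP_comp_def)
qed

text \<open>Injectivity of \<open>cls\<close> makes the array described in \<open>params\<close>
  unique.\<close>

lemma params_cls:
  assumes L: "L \<in> parameters"
  shows "params n lam (cls L) = L"
proof -
  have mem: "length L' = length lam \<and>
     (\<forall>j<length lam. length (L' ! j) = n + 1 \<and> sum_list (L' ! j) = lam ! j) \<longleftrightarrow> L' \<in> parameters" for L'
    by (auto simp: parameters_def arrays_def)
  have "(length L' = length lam \<and>
     (\<forall>j<length lam. length (L' ! j) = n + 1 \<and> sum_list (L' ! j) = lam ! j) \<and>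
     cls L = iso_class (CP_comp n lam) (outer_tensor (map (Wmod n) L'))) \<longleftrightarrow> L' = L" for L'
    using mem[of L'] mem[of L] L iso_class_Wmod cls_inj by metis
  then show ?thesis unfolding params_def by simp
qed

text \<open>Passing to copies with a common vector type preserves types, so
  \<open>iso_class_outer\<close> applies to any \<open>N\<close> of the given type.\<close>

lemma replace_factor_cls:
  assumes L: "L \<in> parameters" and s: "s < length lam" and ms: "ms \<in> arrays n (lam ! s)"
    and ty: "block_algebra.of_type (CP n (lam ! s)) (colorings n (lam ! s)) coefP (row_word ms) N"
  shows "replace_factor n lam L s N = cls (L[s := ms])" "L[s := ms] \<in> parameters"
proof -
  show L': "L[s := ms] \<in> parameters" using L s ms by (auto simp: parameters_def nth_list_update)
  have std: "block_algebra.of_type (CP n (lam ! j)) (colorings n (lam ! j)) coefP (row_word ms')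
      (std_copy (CP n (lam ! j)) M)"
    if "j < length lam" "ms' \<in> arrays n (lam ! j)"
      "block_algebra.of_type (CP n (lam ! j)) (colorings n (lam ! j)) coefP (row_word ms') M" for j ms' M
    using block_algebra.std_copy_of_type[OF CP_block[OF pos[OF that(1)]] that(3) row_word_in[OF that(2)]] .
  have std': "block_algebra.of_type (CP n (lam ! s)) (colorings n (lam ! s)) coefP (row_word ms)
      (std_copy (CP n (lam ! s)) N)"
    using block_algebra.std_copy_of_type[OF CP_block[OF pos[OF s]] ty row_word_in[OF ms]] .
  show "replace_factor n lam L s N = cls (L[s := ms])"
    unfolding replace_factor_def
  proof (rule iso_class_outer[OF L'])
    fix j assume j: "j < length lam"
    show "block_algebra.of_type (CP n (lam ! j)) (colorings n (lam ! j)) coefP (row_word (L[s := ms] ! j))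
      ((map2 (\<lambda>m ms. std_copy (CP n m) (Wmod n ms)) lam L)[s := std_copy (CP n (lam ! s)) N] ! j)"
    proof (cases "j = s")
      case True
      then show ?thesis using std' s parametersD(1)[OF L] by simp
    next
      case False
      then show ?thesis using std[OF j parametersD(2)[OF L j] Wmod_type[OF L j]] j parametersD(1)[OF L] by simp
    qed
  qed (use parametersD(1)[OF L] in simp)
qed

text \<open>\<open>epos\<close> selects a component with a remaining \<open>-\<close>, so the
  multiplicity of \<open>i\<close> there is positive. This is what \<open>Res_Ind_of_type\<close>
  requires of the colour that is removed.\<close>

lemma e_class_cls:
  assumes L: "L \<in> parameters" and i: "i \<in> {1..n}"
  shows "e_class n lam i (cls L) = map_option (\<lambda>s. cls (L[s := move (i - 1) i (L ! s)]))
    (epos (map (\<lambda>ms. (ms ! i, ms ! (i - 1))) L))"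
    and "\<And>s. epos (map (\<lambda>ms. (ms ! i, ms ! (i - 1))) L) = Some s \<Longrightarrow>
      s < length lam \<and> 0 < L ! s ! i \<and> L[s := move (i - 1) i (L ! s)] \<in> parameters"
proof -
  let ?\<sigma> = "map (\<lambda>ms. (ms ! i, ms ! (i - 1))) L"
  have step: "s < length lam \<and> 0 < L ! s ! i \<and> L[s := move (i - 1) i (L ! s)] \<in> parameters \<and>
      replace_factor n lam L s (Efun n i (lam ! s) (Wmod n (L ! s))) = cls (L[s := move (i - 1) i (L ! s)])"
    if "epos ?\<sigma> = Some s" for s
  proof -
    have s: "s < length lam" and p: "0 < L ! s ! i" using epos_less[OF that] parametersD(1)[OF L] by auto
    note a = parametersD(2)[OF L s]
    have mv: "move (i - 1) i (L ! s) \<in> arrays n (lam ! s)" using i p by (intro move_arrays[OF a]) auto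
    have "block_algebra.of_type (CP n (lam ! s)) (colorings n (lam ! s)) coefP (row_word (move (i - 1) i (L ! s)))
      (Efun n i (lam ! s) (Wmod n (L ! s)))"
      unfolding Efun_def o_apply
      by (rule Res_Ind_of_type) (use arraysD[OF a] pos[OF s] i p in auto)
    from replace_factor_cls[OF L s mv this] show ?thesis using s p by simp
  qed
  show "s < length lam \<and> 0 < L ! s ! i \<and> L[s := move (i - 1) i (L ! s)] \<in> parameters" if "epos ?\<sigma> = Some s" for s
    using step[OF that] by blast
  show "e_class n lam i (cls L) = map_option (\<lambda>s. cls (L[s := move (i - 1) i (L ! s)])) (epos ?\<sigma>)"
    unfolding e_class_def params_cls[OF L] Let_def
    using reduced_sign_seq(1)[of i L] step by auto
qed

lemma f_class_cls:
  assumes L: "L \<in> parameters" and i: "i \<in> {1..n}"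
  shows "f_class n lam i (cls L) = map_option (\<lambda>s. cls (L[s := move i (i - 1) (L ! s)]))
    (fpos (map (\<lambda>ms. (ms ! i, ms ! (i - 1))) L))"
    and "\<And>s. fpos (map (\<lambda>ms. (ms ! i, ms ! (i - 1))) L) = Some s \<Longrightarrow>
      s < length lam \<and> 0 < L ! s ! (i - 1) \<and> L[s := move i (i - 1) (L ! s)] \<in> parameters"
proof -
  let ?\<sigma> = "map (\<lambda>ms. (ms ! i, ms ! (i - 1))) L"
  have step: "s < length lam \<and> 0 < L ! s ! (i - 1) \<and> L[s := move i (i - 1) (L ! s)] \<in> parameters \<and>
      replace_factor n lam L s (Ffun n i (lam ! s) (Wmod n (L ! s))) = cls (L[s := move i (i - 1) (L ! s)])"
    if "fpos ?\<sigma> = Some s" for s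
  proof -
    have s: "s < length lam" and p: "0 < L ! s ! (i - 1)" using fpos_less[OF that] parametersD(1)[OF L] by auto
    note a = parametersD(2)[OF L s]
    have mv: "move i (i - 1) (L ! s) \<in> arrays n (lam ! s)" using i p by (intro move_arrays[OF a]) auto
    have "block_algebra.of_type (CP n (lam ! s)) (colorings n (lam ! s)) coefP (row_word (move i (i - 1) (L ! s)))
      (Ffun n i (lam ! s) (Wmod n (L ! s)))"
      unfolding Ffun_def o_apply
      by (rule Res_Ind_of_type) (use arraysD[OF a] pos[OF s] i p in auto)
    from replace_factor_cls[OF L s mv this] show ?thesis using s p by simp
  qed
  show "s < length lam \<and> 0 < L ! s ! (i - 1) \<and> L[s := move i (i - 1) (L ! s)] \<in> parameters" if "fpos ?\<sigma> = Some s" for s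
    using step[OF that] by blast
  show "f_class n lam i (cls L) = map_option (\<lambda>s. cls (L[s := move i (i - 1) (L ! s)])) (fpos ?\<sigma>)"
    unfolding f_class_def params_cls[OF L] Let_def
    using reduced_sign_seq(2)[of i L] step by auto
qed

abbreviation "tableau_crystal \<equiv> crystal_tensor_list (map (row_crystal n) lam)"

section \<open>Comparison with tensor products of row tableaux\<close>

lemma tableau_crystal_values:
  shows "seminormal n tableau_crystal" and "elts tableau_crystal = map row_word ` parameters"
    and "L \<in> parameters \<Longrightarrow> wt tableau_crystal (map row_word L) =
      (\<Sum>j<length lam. \<Sum>i\<le>n. (\<lambda>p. int (L ! j ! i) * epsilon (i + 1) p))"
    and "L \<in> parameters \<Longrightarrow> i \<in> {1..n} \<Longrightarrow>
      eps tableau_crystal i (map row_word L) = Fin (int (leps (map (\<lambda>ms. (ms ! i, ms ! (i - 1))) L))) \<and>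
      phi tableau_crystal i (map row_word L) = Fin (int (lphi (map (\<lambda>ms. (ms ! i, ms ! (i - 1))) L))) \<and>
      ecr tableau_crystal i (map row_word L) = map_option (\<lambda>s. map row_word (L[s := move (i - 1) i (L ! s)]))
        (epos (map (\<lambda>ms. (ms ! i, ms ! (i - 1))) L)) \<and>
      fcr tableau_crystal i (map row_word L) = map_option (\<lambda>s. map row_word (L[s := move i (i - 1) (L ! s)]))
        (fpos (map (\<lambda>ms. (ms ! i, ms ! (i - 1))) L))"
proof -
  let ?Bs = "map (row_crystal n) lam"
  have "?Bs \<noteq> []" "\<forall>B\<in>set ?Bs. seminormal n B" using lam_ne lam_pos row_crystal(1) by auto
  note T = crystal_tensor_list[OF this]
  show "seminormal n tableau_crystal" by (rule T(1))
  have mem: "map row_word L \<in> listset (map elts ?Bs)" if "L \<in> parameters" for L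
    unfolding in_listset_iff using parametersD[OF that] row_crystal(2)[OF pos] by auto
  show el: "elts tableau_crystal = map row_word ` parameters"
  proof (intro equalityI subsetI)
    fix bs assume "bs \<in> elts tableau_crystal"
    then have bs: "length bs = length lam" "\<And>j. j < length lam \<Longrightarrow> bs ! j \<in> row_word ` arrays n (lam ! j)"
      unfolding T(2) in_listset_iff using row_crystal(2)[OF pos] by auto
    have sh: "shape n (bs ! j) \<in> arrays n (lam ! j) \<and> row_word (shape n (bs ! j)) = bs ! j"
      if "j < length lam" for j
      using bs(2)[OF that] by (auto simp: shape_row arrays_def)
    have "bs = map row_word (map (shape n) bs)"
      using sh bs(1) by (intro nth_equalityI) auto
    moreover have "map (shape n) bs \<in> parameters" using sh bs(1) by (auto simp: parameters_def)
    ultimately show "bs \<in> map row_word ` parameters" by blast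
  qed (use mem T(2) in auto)
  assume L: "L \<in> parameters"
  note len = parametersD(1)[OF L]
  have "wt tableau_crystal (map row_word L) = (\<Sum>j<length lam. wt (row_crystal n (lam ! j)) (row_word (L ! j)))"
    unfolding T(3)[OF mem[OF L]] by (simp add: sum_list_sum_nth len atLeast0LessThan)
  also have "\<dots> = (\<Sum>j<length lam. \<Sum>i\<le>n. (\<lambda>p. int (L ! j ! i) * epsilon (i + 1) p))"
    by (rule sum.cong) (simp_all add: row_crystal(3)[OF pos parametersD(2)[OF L]] fun_eq_iff sum_fun_apply)
  finally show "wt tableau_crystal (map row_word L) =
      (\<Sum>j<length lam. \<Sum>i\<le>n. (\<lambda>p. int (L ! j ! i) * epsilon (i + 1) p))" .
  assume i: "i \<in> {1..n}"
  let ?\<sigma> = "map (\<lambda>ms. (ms ! i, ms ! (i - 1))) L"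
  have \<sigma>: "map2 (sig i) ?Bs (map row_word L) = ?\<sigma>"
    by (rule nth_equalityI) (simp_all add: len row_crystal(4)[OF pos parametersD(2)[OF L] i])
  note t = T(4)[OF mem[OF L] i, unfolded \<sigma>]
  have "map_option (\<lambda>j. (map row_word L)[j := the (ecr (?Bs ! j) i (map row_word L ! j))]) (epos ?\<sigma>) =
      map_option (\<lambda>s. map row_word (L[s := move (i - 1) i (L ! s)])) (epos ?\<sigma>)"
  proof (rule option.map_cong0)
    fix s assume "s \<in> set_option (epos ?\<sigma>)"
    then have "s < length lam" "0 < L ! s ! i" using e_class_cls(2)[OF L i, of s] by auto
    then show "(map row_word L)[s := the (ecr (?Bs ! s) i (map row_word L ! s))] =
        map row_word (L[s := move (i - 1) i (L ! s)])"
      by (simp add: len row_crystal(5)[OF pos parametersD(2)[OF L] i] map_update)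
  qed
  moreover have "map_option (\<lambda>j. (map row_word L)[j := the (fcr (?Bs ! j) i (map row_word L ! j))]) (fpos ?\<sigma>) =
      map_option (\<lambda>s. map row_word (L[s := move i (i - 1) (L ! s)])) (fpos ?\<sigma>)"
  proof (rule option.map_cong0)
    fix s assume "s \<in> set_option (fpos ?\<sigma>)"
    then have "s < length lam" "0 < L ! s ! (i - 1)" using f_class_cls(2)[OF L i, of s] by auto
    then show "(map row_word L)[s := the (fcr (?Bs ! s) i (map row_word L ! s))] =
        map row_word (L[s := move i (i - 1) (L ! s)])"
      by (simp add: len row_crystal(6)[OF pos parametersD(2)[OF L] i] map_update)
  qed
  ultimately show "eps tableau_crystal i (map row_word L) = Fin (int (leps ?\<sigma>)) \<and>
      phi tableau_crystal i (map row_word L) = Fin (int (lphi ?\<sigma>)) \<and>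
      ecr tableau_crystal i (map row_word L) = map_option (\<lambda>s. map row_word (L[s := move (i - 1) i (L ! s)])) (epos ?\<sigma>) \<and>
      fcr tableau_crystal i (map row_word L) = map_option (\<lambda>s. map row_word (L[s := move i (i - 1) (L ! s)])) (fpos ?\<sigma>)"
    using t by (simp only:)
qed

definition tableaux :: "mod_class \<Rightarrow> nat list list" where
  "tableaux X = map row_word (params n lam X)"

lemma tableaux_cls: "L \<in> parameters \<Longrightarrow> tableaux (cls L) = map row_word L"
  by (simp add: tableaux_def params_cls)

lemma class_maps:
  assumes L: "L \<in> parameters" and i: "i \<in> {1..n}"
  shows "ecr tableau_crystal i (map row_word L) = map_option tableaux (e_class n lam i (cls L))"
    and "fcr tableau_crystal i (map row_word L) = map_option tableaux (f_class n lam i (cls L))"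
    and "set_option (e_class n lam i (cls L)) \<subseteq> cls ` parameters"
    and "set_option (f_class n lam i (cls L)) \<subseteq> cls ` parameters"
proof -
  note e = e_class_cls[OF L i] and f = f_class_cls[OF L i]
  show "ecr tableau_crystal i (map row_word L) = map_option tableaux (e_class n lam i (cls L))"
    unfolding e(1) option.map_comp tableau_crystal_values(4)[OF L i, THEN conjunct2, THEN conjunct2, THEN conjunct1]
    by (rule option.map_cong0) (use e(2) tableaux_cls in auto)
  show "fcr tableau_crystal i (map row_word L) = map_option tableaux (f_class n lam i (cls L))"
    unfolding f(1) option.map_comp tableau_crystal_values(4)[OF L i, THEN conjunct2, THEN conjunct2, THEN conjunct2]
    by (rule option.map_cong0) (use f(2) tableaux_cls in auto)
  show "set_option (e_class n lam i (cls L)) \<subseteq> cls ` parameters" unfolding e(1) using e(2) by (auto simp: option.set_map)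
  show "set_option (f_class n lam i (cls L)) \<subseteq> cls ` parameters" unfolding f(1) using f(2) by (auto simp: option.set_map)
qed

lemma class_crystal_iso: "crystal_iso n (class_crystal n lam) tableau_crystal tableaux"
proof -
  interpret R: seminormal n tableau_crystal by (rule tableau_crystal_values(1))
  have el: "elts (class_crystal n lam) = cls ` parameters" by (simp add: class_crystal_def irr_classes_eq)
  have in_rows: "map row_word L \<in> elts tableau_crystal" if "L \<in> parameters" for L using that tableau_crystal_values(2) by blast
  have row_inj: "L = L'" if "L \<in> parameters" "L' \<in> parameters" "map row_word L = map row_word L'" for L L'
    using shape_row_words[OF that(1)] shape_row_words[OF that(2)] that(3) by metis
  have bij: "bij_betw tableaux (cls ` parameters) (elts tableau_crystal)"
    unfolding tableau_crystal_values(2) bij_betw_def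
  proof
    show "inj_on tableaux (cls ` parameters)" using tableaux_cls row_inj by (auto simp: inj_on_def)
    show "tableaux ` cls ` parameters = map row_word ` parameters" unfolding image_image by (intro image_cong) (auto simp: tableaux_cls)
  qed
  have eps: "max_iter (e_class n lam i) (cls L) = eps tableau_crystal i (map row_word L)"
    and phi: "max_iter (f_class n lam i) (cls L) = phi tableau_crystal i (map row_word L)"
    if L: "L \<in> parameters" and i: "i \<in> {1..n}" for L i
  proof -
    \<comment> \<open>On the class side \<open>eps\<close> and \<open>phi\<close> come from
      iterating the operators. Pulled back along \<open>tableaux\<close>, the string lengths of the
      seminormal tableau crystal decrease by one in each step and vanish where the operator does, so
      \<open>max_iter_eq\<close> identifies the two.\<close>
    have step_e: "(e_class n lam i X = None \<longleftrightarrow> nval (eps tableau_crystal i (tableaux X)) = 0) \<and>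
        (\<forall>Y. e_class n lam i X = Some Y \<longrightarrow> Y \<in> cls ` parameters \<and>
          nval (eps tableau_crystal i (tableaux X)) = Suc (nval (eps tableau_crystal i (tableaux Y))))"
      if X: "X \<in> cls ` parameters" for X
    proof -
      obtain L where L: "L \<in> parameters" "X = cls L" using X by blast
      note c = class_maps[OF L(1) i] and t = tableaux_cls[OF L(1)]
      show ?thesis
        using R.e_None[OF i in_rows[OF L(1)]] R.eps_e[OF i in_rows[OF L(1)]] c(1,3)
        by (auto simp: L(2) t)
    qed
    have step_f: "(f_class n lam i X = None \<longleftrightarrow> nval (phi tableau_crystal i (tableaux X)) = 0) \<and>
        (\<forall>Y. f_class n lam i X = Some Y \<longrightarrow> Y \<in> cls ` parameters \<and>
          nval (phi tableau_crystal i (tableaux X)) = Suc (nval (phi tableau_crystal i (tableaux Y))))"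
      if X: "X \<in> cls ` parameters" for X
    proof -
      obtain L where L: "L \<in> parameters" "X = cls L" using X by blast
      note c = class_maps[OF L(1) i] and t = tableaux_cls[OF L(1)]
      show ?thesis
        using R.f_None[OF i in_rows[OF L(1)]] R.f_step(1)[OF i in_rows[OF L(1)]] c(2,4)
        by (auto simp: L(2) t)
    qed
    have X: "cls L \<in> cls ` parameters" using L by blast
    have "max_iter (e_class n lam i) (cls L) = Fin (int (nval (eps tableau_crystal i (tableaux (cls L)))))"
      by (rule max_iter_eq[OF _ _ X, where N = "\<lambda>X. nval (eps tableau_crystal i (tableaux X))"])
        (fact step_e[THEN conjunct1], fact step_e[THEN conjunct2, rule_format])
    then show "max_iter (e_class n lam i) (cls L) = eps tableau_crystal i (map row_word L)"
      unfolding tableaux_cls[OF L] using R.eps_nval[OF i in_rows[OF L]] by simp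
    have "max_iter (f_class n lam i) (cls L) = Fin (int (nval (phi tableau_crystal i (tableaux (cls L)))))"
      by (rule max_iter_eq[OF _ _ X, where N = "\<lambda>X. nval (phi tableau_crystal i (tableaux X))"])
        (fact step_f[THEN conjunct1], fact step_f[THEN conjunct2, rule_format])
    then show "max_iter (f_class n lam i) (cls L) = phi tableau_crystal i (map row_word L)"
      unfolding tableaux_cls[OF L] using R.phi_nval[OF i in_rows[OF L]] by simp
  qed
  show ?thesis unfolding crystal_iso_def el
  proof (intro conjI bij ballI)
    fix X assume "X \<in> cls ` parameters"
    then obtain L where L: "L \<in> parameters" "X = cls L" by blast
    show "wt tableau_crystal (tableaux X) = wt (class_crystal n lam) X"
      unfolding L(2) tableaux_cls[OF L(1)] tableau_crystal_values(3)[OF L(1)] by (simp add: class_crystal_def params_cls[OF L(1)])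
    fix i assume i: "i \<in> {1..n}"
    show "eps tableau_crystal i (tableaux X) = eps (class_crystal n lam) i X"
      "phi tableau_crystal i (tableaux X) = phi (class_crystal n lam) i X"
      "ecr tableau_crystal i (tableaux X) = map_option tableaux (ecr (class_crystal n lam) i X)"
      "fcr tableau_crystal i (tableaux X) = map_option tableaux (fcr (class_crystal n lam) i X)"
      unfolding L(2) tableaux_cls[OF L(1)] class_maps[OF L(1) i]
      by (simp_all add: class_crystal_def eps[OF L(1) i] phi[OF L(1) i])
  qed
qed

lemma class_crystal_isomorphic: "crystal_isomorphic n (class_crystal n lam) tableau_crystal"
  unfolding crystal_isomorphic_def
proof (intro conjI exI)
  show R: "gl_crystal n tableau_crystal" using tableau_crystal_values(1) by (simp add: seminormal_def)
  show iso: "crystal_iso n (class_crystal n lam) tableau_crystal tableaux" by (rule class_crystal_iso)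
  show "gl_crystal n (class_crystal n lam)"
  proof (rule gl_crystal_transfer[OF R iso])
    fix i b assume i: "i \<in> {1..n}" and "b \<in> elts (class_crystal n lam)"
    then obtain L where L: "L \<in> parameters" "b = cls L" by (auto simp: class_crystal_def irr_classes_eq)
    show "set_option (ecr (class_crystal n lam) i b) \<subseteq> elts (class_crystal n lam)"
      "set_option (fcr (class_crystal n lam) i b) \<subseteq> elts (class_crystal n lam)"
      using class_maps(3,4)[OF L(1) i] by (simp_all add: class_crystal_def irr_classes_eq L(2))
  qed
qed

end

theorem theorem4p5:
  fixes n l :: nat and lam :: "nat list"
  assumes "n \<ge> 1"
    and "l > 0"
    and "\<forall>a\<in>set lam. a > 0"
    and "sum_list lam = l"
  shows "crystal_isomorphic n (class_crystal n lam) (crystal_tensor_list (map (row_crystal n) lam))"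
proof -
  interpret composition n lam
    by unfold_locales (use assms in auto)
  show ?thesis by (rule class_crystal_isomorphic)
qed

end
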